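(* Let $(u,C)$ be the weak solution obtained in the existence theorem with $C_0\in W^{1/2,4/3}_{\mathbf n}(\Omega)$, and assume $C\in L^s(0,T;L^r(\Omega))$ for some $(s,r)$ with $\frac2s+\frac3r\le1$, $2<s<\infty$, $3<r<\infty$. Then for almost all $\tau\in(0,T]$, $$\int_\Omega\tfrac12|C(\tau)|^2dx+\int_0^\tau\!\!\int_\Omega\varepsilon|\nabla C|^2+|\operatorname{tr}C|^2|C|^2+a|\operatorname{tr}C||C|^2\,dx\,dt=\int_\Omega\tfrac12|C_0|^2dx+\int_0^\tau\!\!\int_\Omega|\operatorname{tr}C|^2+a\operatorname{tr}C\,dx\,dt+\int_0^\tau\!\!\int_\Omega[(\nabla u)C+C(\nabla u)^\top]:C\,dx\,dt.$$
   Context: Standing setting: $\Omega\subset\mathbb R^3$ bounded $C^{2,\beta}$ domain, $\beta\in(0,1)$, $T>0$, $\Omega_T=\Omega\times(0,T)$; $\eta,\varepsilon>0$, $a\ge0$, $\Phi(s)=s+a$, $\chi(s)=s^2+a|s|$. Peterlin system: $\partial_tu+(u\cdot\nabla)u=\operatorname{div}(\eta Du)-\nabla p+\operatorname{div}(\operatorname{tr}(C)C)$, $\operatorname{div}u=0$, $\partial_tC+(u\cdot\nabla)C=(\nabla u)C+C(\nabla u)^\top+\Phi(\operatorname{tr}C)I-\chi(\operatorname{tr}C)C+\varepsilon\Delta C$, $u=0$ and $\partial_nC=0$ on $\partial\Omega$, $u(0)=u_0\in H$, $C(0)=C_0$ ($L^2$, SPD a.e.). $(\nabla u)_{ij}=\partial_ju_i$,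 $Du=\frac12(\nabla u+\nabla u^\top)$, $A:B=\sum A_{ij}B_{ij}$, $|A|^2=A:A$. The existence theorem's weak solution satisfies $u\in C_w([0,T];L^2)\cap L^2(0,T;H^1_0)$, $\operatorname{div}u=0$, $C\in C_w([0,T];L^2)\cap L^2(0,T;H^1)\cap L^4(\Omega_T)$, $\chi(\operatorname{tr}C)C\in L^{4/3}(\Omega_T)$, and solves both equations in the weak (distributional) sense. $W^{1/2,4/3}_{\mathbf n}(\Omega)$ is the completion of $\{v\in C^\infty(\overline\Omega):\partial_{\mathbf n}v=0\text{ on }\partial\Omega\}$ in the norm of $W^{1/2,4/3}(\Omega)$. *)

theory Defs
  imports "HOL-Analysis.Analysis"
begin

type_synonym vec3 = "real^3"
type_synonym mat3 = "real^3^3"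

primrec Ck :: "nat \<Rightarrow> 'a::euclidean_space set \<Rightarrow> ('a \<Rightarrow> real) \<Rightarrow> bool" where
  "Ck 0 U f = continuous_on U f"
| "Ck (Suc k) U f = (continuous_on U f \<and>
      (\<forall>b\<in>Basis. \<exists>g. (\<forall>x\<in>U. ((\<lambda>s. f (x + s *\<^sub>R b)) has_real_derivative g x) (at 0)) \<and> Ck k U g))"

definition Cinf_on :: "'a::euclidean_space set \<Rightarrow> ('a \<Rightarrow> 'b::euclidean_space) \<Rightarrow> bool" where
  "Cinf_on U f \<longleftrightarrow> open U \<and> (\<forall>b\<in>Basis. \<forall>k. Ck k U (\<lambda>x. f x \<bullet> b))"

definition pdx :: "3 \<Rightarrow> (vec3 \<Rightarrow> 'b::real_normed_vector) \<Rightarrow> vec3 \<Rightarrow> 'b" where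
  "pdx j f x = vector_derivative (\<lambda>s. f (x + s *\<^sub>R axis j 1)) (at 0)"

definition grads :: "(vec3 \<Rightarrow> real) \<Rightarrow> vec3 \<Rightarrow> vec3" where
  "grads f x = (\<chi> j. pdx j f x)"

definition gradv :: "(vec3 \<Rightarrow> vec3) \<Rightarrow> vec3 \<Rightarrow> mat3" where
  "gradv f x = (\<chi> i j. pdx j f x $ i)"

definition gradm :: "(vec3 \<Rightarrow> mat3) \<Rightarrow> vec3 \<Rightarrow> mat3^3" where
  "gradm f x = (\<chi> k. pdx k f x)"

definition dt :: "(real \<Rightarrow> vec3 \<Rightarrow> 'b::real_normed_vector) \<Rightarrow> real \<Rightarrow> vec3 \<Rightarrow> 'b" where
  "dt f t x = vector_derivative (\<lambda>s. f s x) (at t)"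

definition symD :: "mat3 \<Rightarrow> mat3" where
  "symD G = (1/2) *\<^sub>R (G + transpose G)"

definition Phi :: "real \<Rightarrow> real \<Rightarrow> real" where "Phi a s = s + a"
definition chi :: "real \<Rightarrow> real \<Rightarrow> real" where "chi a s = s\<^sup>2 + a * \<bar>s\<bar>"

definition SPD :: "mat3 \<Rightarrow> bool" where
  "SPD A \<longleftrightarrow> transpose A = A \<and> (\<forall>v. v \<noteq> 0 \<longrightarrow> v \<bullet> (A *v v) > 0)"

definition C1_defining :: "vec3 set \<Rightarrow> (vec3 \<Rightarrow> real) \<Rightarrow> (vec3 \<Rightarrow> vec3) \<Rightarrow> bool" where
  "C1_defining \<Omega> \<rho> \<rho>' \<longleftrightarrow> (\<forall>x. (\<rho> has_derivative (\<lambda>h. \<rho>' x \<bullet> h)) (at x)) \<and> continuous_on UNIV \<rho>'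
     \<and> \<Omega> = {x. \<rho> x < 0} \<and> (\<forall>x\<in>frontier \<Omega>. \<rho>' x \<noteq> 0)"

definition C2beta_domain :: "real \<Rightarrow> vec3 set \<Rightarrow> bool" where
  "C2beta_domain \<beta> \<Omega> \<longleftrightarrow> open \<Omega> \<and> connected \<Omega> \<and> bounded \<Omega> \<and> \<Omega> \<noteq> {} \<and>
     (\<exists>\<rho> \<rho>' H K. C1_defining \<Omega> \<rho> \<rho>' \<and>
        (\<forall>x. (\<rho>' has_derivative (\<lambda>h. H x *v h)) (at x)) \<and> continuous_on UNIV H \<and>
        (\<forall>x\<in>closure \<Omega>. \<forall>y\<in>closure \<Omega>. norm (H x - H y) \<le> K * dist x y powr \<beta>))"

definition Lp_on :: "'a::euclidean_space set \<Rightarrow> real \<Rightarrow> ('a \<Rightarrow> 'b::euclidean_space) \<Rightarrow> bool" where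
  "Lp_on S p f \<longleftrightarrow> f \<in> borel_measurable (lebesgue_on S) \<and>
     integrable (lebesgue_on S) (\<lambda>x. norm (f x) powr p)"

definition OmT :: "vec3 set \<Rightarrow> real \<Rightarrow> (real \<times> vec3) set" where
  "OmT \<Omega> T = {0<..<T} \<times> \<Omega>"

definition Cc_inf :: "'a::euclidean_space set \<Rightarrow> ('a \<Rightarrow> 'b::euclidean_space) \<Rightarrow> bool" where
  "Cc_inf U f \<longleftrightarrow> Cinf_on UNIV f \<and> (\<exists>K. compact K \<and> K \<subseteq> U \<and> (\<forall>x. x \<notin> K \<longrightarrow> f x = 0))"

definition testfn :: "(real \<times> vec3) set \<Rightarrow> (real \<Rightarrow> vec3 \<Rightarrow> 'b::euclidean_space) \<Rightarrow> bool" where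
  "testfn U \<phi> \<longleftrightarrow> Cc_inf U (\<lambda>(t,x). \<phi> t x)"

definition H_space :: "vec3 set \<Rightarrow> (vec3 \<Rightarrow> vec3) set" where
  "H_space \<Omega> = {f. f \<in> borel_measurable (lebesgue_on \<Omega>) \<and>
     (\<exists>\<phi>. (\<forall>n. Cc_inf \<Omega> (\<phi> n) \<and> (\<forall>x. trace (gradv (\<phi> n) x) = 0)) \<and>
        (\<lambda>n. \<integral>\<^sup>+ x. ennreal ((norm (\<phi> n x - f x))\<^sup>2) \<partial>lebesgue_on \<Omega>) \<longlonglongrightarrow> 0)}"

definition H10 :: "vec3 set \<Rightarrow> (vec3 \<Rightarrow> vec3) \<Rightarrow> (vec3 \<Rightarrow> mat3) \<Rightarrow> bool" where
  "H10 \<Omega> f G \<longleftrightarrow> f \<in> borel_measurable (lebesgue_on \<Omega>) \<and> G \<in> borel_measurable (lebesgue_on \<Omega>) \<and>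
     (\<exists>\<phi>. (\<forall>n. Cc_inf \<Omega> (\<phi> n)) \<and>
        (\<lambda>n. \<integral>\<^sup>+ x. ennreal ((norm (\<phi> n x - f x))\<^sup>2 + (norm (gradv (\<phi> n) x - G x))\<^sup>2)
               \<partial>lebesgue_on \<Omega>) \<longlonglongrightarrow> 0)"

definition Cw_L2 :: "vec3 set \<Rightarrow> real \<Rightarrow> (real \<Rightarrow> vec3 \<Rightarrow> 'b::euclidean_space) \<Rightarrow> bool" where
  "Cw_L2 \<Omega> T f \<longleftrightarrow> (\<forall>t\<in>{0..T}. Lp_on \<Omega> 2 (f t)) \<and>
     (\<forall>g. Lp_on \<Omega> 2 g \<longrightarrow> continuous_on {0..T} (\<lambda>t. LINT x:\<Omega>|lebesgue. f t x \<bullet> g x))"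

definition weak_dx :: "vec3 set \<Rightarrow> real \<Rightarrow> (real \<Rightarrow> vec3 \<Rightarrow> real) \<Rightarrow> (real \<Rightarrow> vec3 \<Rightarrow> real) \<Rightarrow> 3 \<Rightarrow> bool" where
  "weak_dx \<Omega> T f g k \<longleftrightarrow>
     set_integrable lebesgue (OmT \<Omega> T) (\<lambda>(t,x). f t x) \<and>
     set_integrable lebesgue (OmT \<Omega> T) (\<lambda>(t,x). g t x) \<and>
     (\<forall>\<theta>. testfn (OmT \<Omega> T) \<theta> \<longrightarrow>
        (LINT z:OmT \<Omega> T|lebesgue. (case z of (t,x) \<Rightarrow> f t x * pdx k (\<theta> t) x))
          = - (LINT z:OmT \<Omega> T|lebesgue. (case z of (t,x) \<Rightarrow> g t x * \<theta> t x)))"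

text \<open>Sobolev--Slobodeckij W^{1/2,4/3}(\<Omega>) distance (to the power 4/3), s p = 2/3, n + s p = 11/3.\<close>
definition W_half_43 :: "vec3 set \<Rightarrow> (vec3 \<Rightarrow> real) \<Rightarrow> ennreal" where
  "W_half_43 \<Omega> g = (\<integral>\<^sup>+ x. ennreal (\<bar>g x\<bar> powr (4/3)) \<partial>lebesgue_on \<Omega>) +
     (\<integral>\<^sup>+ z. ennreal (\<bar>g (fst z) - g (snd z)\<bar> powr (4/3) / dist (fst z) (snd z) powr (11/3))
        \<partial>lebesgue_on (\<Omega> \<times> \<Omega>))"

text \<open>Smooth up to the boundary with vanishing normal derivative; the normal direction
  is that of the gradient of any C^1 defining function of \<Omega>.\<close>
definition neumann_smooth :: "vec3 set \<Rightarrow> (vec3 \<Rightarrow> real) \<Rightarrow> bool" where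
  "neumann_smooth \<Omega> v \<longleftrightarrow> (\<exists>U. closure \<Omega> \<subseteq> U \<and> Cinf_on U v) \<and>
     (\<forall>\<rho> \<rho>'. C1_defining \<Omega> \<rho> \<rho>' \<longrightarrow> (\<forall>x\<in>frontier \<Omega>. grads v x \<bullet> \<rho>' x = 0))"

definition W_half_43_n :: "vec3 set \<Rightarrow> (vec3 \<Rightarrow> real) set" where
  "W_half_43_n \<Omega> = {f. f \<in> borel_measurable (lebesgue_on \<Omega>) \<and>
     (\<exists>v. (\<forall>n. neumann_smooth \<Omega> (v n)) \<and> (\<lambda>n. W_half_43 \<Omega> (\<lambda>x. v n x - f x)) \<longlonglongrightarrow> 0)}"

definition LsLr :: "vec3 set \<Rightarrow> real \<Rightarrow> real \<Rightarrow> real \<Rightarrow> (real \<Rightarrow> vec3 \<Rightarrow> 'b::euclidean_space) \<Rightarrow> bool" where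
  "LsLr \<Omega> T s r f \<longleftrightarrow> (\<lambda>(t,x). f t x) \<in> borel_measurable (lebesgue_on (OmT \<Omega> T)) \<and>
     (AE t in lebesgue_on {0<..<T}. integrable (lebesgue_on \<Omega>) (\<lambda>x. norm (f t x) powr r)) \<and>
     integrable (lebesgue_on {0<..<T}) (\<lambda>t. (LINT x:\<Omega>|lebesgue. norm (f t x) powr r) powr (s / r))"

text \<open>(u,C) weak solution with data (u0,C0); Gu and GC are the (weak) spatial gradients:
  Gu t x $ i $ j = d_j u_i, GC t x $ k = d_k C. The pressure is eliminated by divergence-free
  test functions.\<close>
definition peterlin_weak_solution ::
  "vec3 set \<Rightarrow> real \<Rightarrow> real \<Rightarrow> real \<Rightarrow> real \<Rightarrow> (vec3 \<Rightarrow> vec3) \<Rightarrow> (vec3 \<Rightarrow> mat3) \<Rightarrow>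
   (real \<Rightarrow> vec3 \<Rightarrow> vec3) \<Rightarrow> (real \<Rightarrow> vec3 \<Rightarrow> mat3) \<Rightarrow>
   (real \<Rightarrow> vec3 \<Rightarrow> mat3) \<Rightarrow> (real \<Rightarrow> vec3 \<Rightarrow> mat3^3) \<Rightarrow> bool" where
  "peterlin_weak_solution \<Omega> T \<eta> \<epsilon> a u0 C0 u C Gu GC \<longleftrightarrow>
     \<comment> \<open>data\<close>
     u0 \<in> H_space \<Omega> \<and> Lp_on \<Omega> 2 C0 \<and> (AE x in lebesgue_on \<Omega>. SPD (C0 x)) \<and>
     \<comment> \<open>u in C_w([0,T];L^2) and L^2(0,T;H^1_0), div u = 0\<close>
     Cw_L2 \<Omega> T u \<and>
     Lp_on (OmT \<Omega> T) 2 (\<lambda>(t,x). u t x) \<and> Lp_on (OmT \<Omega> T) 2 (\<lambda>(t,x). Gu t x) \<and>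
     (\<forall>i j. weak_dx \<Omega> T (\<lambda>t x. u t x $ i) (\<lambda>t x. Gu t x $ i $ j) j) \<and>
     (AE t in lebesgue_on {0<..<T}. H10 \<Omega> (u t) (Gu t)) \<and>
     (AE z in lebesgue_on (OmT \<Omega> T). trace (Gu (fst z) (snd z)) = 0) \<and>
     \<comment> \<open>C in C_w([0,T];L^2), L^2(0,T;H^1), L^4(\<Omega>_T), chi(tr C) C in L^{4/3}\<close>
     Cw_L2 \<Omega> T C \<and>
     Lp_on (OmT \<Omega> T) 2 (\<lambda>(t,x). C t x) \<and> Lp_on (OmT \<Omega> T) 2 (\<lambda>(t,x). GC t x) \<and>
     (\<forall>i j k. weak_dx \<Omega> T (\<lambda>t x. C t x $ i $ j) (\<lambda>t x. GC t x $ k $ i $ j) k) \<and>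
     Lp_on (OmT \<Omega> T) 4 (\<lambda>(t,x). C t x) \<and>
     Lp_on (OmT \<Omega> T) (4/3) (\<lambda>(t,x). chi a (trace (C t x)) *\<^sub>R C t x) \<and>
     \<comment> \<open>initial data\<close>
     (AE x in lebesgue_on \<Omega>. u 0 x = u0 x) \<and> (AE x in lebesgue_on \<Omega>. C 0 x = C0 x) \<and>
     \<comment> \<open>weak momentum equation\<close>
     (\<forall>\<phi>::real \<Rightarrow> vec3 \<Rightarrow> vec3. testfn ({..<T} \<times> \<Omega>) \<phi> \<and> (\<forall>t x. trace (gradv (\<phi> t) x) = 0) \<longrightarrow>
        (LINT z:OmT \<Omega> T|lebesgue. (case z of (t,x) \<Rightarrow>
            - (u t x \<bullet> dt \<phi> t x) + ((Gu t x *v u t x) \<bullet> \<phi> t x)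
            + \<eta> * (symD (Gu t x) \<bullet> gradv (\<phi> t) x)
            + trace (C t x) * (C t x \<bullet> gradv (\<phi> t) x)))
        = (LINT x:\<Omega>|lebesgue. u0 x \<bullet> \<phi> 0 x)) \<and>
     \<comment> \<open>weak equation for C (homogeneous Neumann condition is natural)\<close>
     (\<forall>\<psi>::real \<Rightarrow> vec3 \<Rightarrow> mat3. testfn ({..<T} \<times> UNIV) \<psi> \<longrightarrow>
        (LINT z:OmT \<Omega> T|lebesgue. (case z of (t,x) \<Rightarrow>
            - (C t x \<bullet> dt \<psi> t x)
            + ((\<Sum>k\<in>UNIV. u t x $ k *\<^sub>R GC t x $ k) \<bullet> \<psi> t x)
            - ((Gu t x ** C t x + C t x ** transpose (Gu t x)
                + Phi a (trace (C t x)) *\<^sub>R mat 1 - chi a (trace (C t x)) *\<^sub>R C t x) \<bullet> \<psi> t x)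
            + \<epsilon> * (GC t x \<bullet> gradm (\<psi> t) x)))
        = (LINT x:\<Omega>|lebesgue. C0 x \<bullet> \<psi> 0 x))"

end

(* Proof idea: for almost every s the slice C(s) is itself an admissible test function of the
   equation integrated over a time interval, since it is a limit of smooth functions in H^1, L^4
   and L^r.  This makes B(t,s) = (C(t), C(s)) absolutely continuous in t for almost every s, with
   an explicit density K(t,s).  Averaging the symmetric function B over short time steps and using
   continuity of translations of K gives |C(t)|^2 = |C(0)|^2 + 2 int_0^t K(s,s) ds for a.e. t.
   The Serrin condition is used only for the transport term: by the Sobolev inequality for u(t) and
   interpolation, |u(t)| |grad C(t)| pairs with L^r with a constant in L^{s'}(0,T).  The transport
   term drops out of K(s,s) because div u = 0 and u(t) is in H^1_0. *)
theory Submission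
  imports Defs
begin

text \<open>The slice identity holds for almost every s only, and the diagonal t = s is a null set
  for it; this is why increments are averaged over thin strips around the diagonal. Symmetry of B
  turns the increment of |C|^2 over a step h into two increments in the first argument, the origin
  of the factor 2. What remains has L^1 norm o(h), and a function whose translates differ by o(h) is
  constant; weak continuity at time 0 fixes the constant. Neumann conditions are natural, so test
  functions must reach the boundary. Mollification alone would use values outside \<Omega>; a slice
  is therefore composed with x - d V(x), V the gradient of the defining function, which moves
  \<Omega> into itself by a margin comparable to d. This map is only C^1, hence the extension of the
  equation to C^1 test functions. The dual norm of the transport term is of order |grad C|_2
  |u|_2^(1-3/r) |grad u|_2^(3/r), where |u(t)|_2 is bounded in t by weak continuity and uniform
  boundedness. Its power s' is integrable when (1/2 + 3/(2r)) s' <= 1, that is 2/s + 3/r <=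
  1.\<close>

abbreviation nnl :: "('a::euclidean_space \<Rightarrow> ennreal) \<Rightarrow> ennreal" (binder "NNL " 10) where
  "nnl f \<equiv> nn_integral lborel f"
abbreviation ael :: "('a::euclidean_space \<Rightarrow> bool) \<Rightarrow> bool" (binder "AL " 10) where
  "ael P \<equiv> almost_everywhere lborel P"
abbreviation "IL \<equiv> integrable lborel"
abbreviation nsq :: "'a::real_normed_vector \<Rightarrow> ennreal" where
  "nsq v \<equiv> ennreal ((norm v)\<^sup>2)"
abbreviation "BM \<equiv> borel_measurable borel"
abbreviation "BM2 \<equiv> borel_measurable (borel \<Otimes>\<^sub>M borel)"
notation LIMSEQ ("((_)/ ~> (_))" [60, 60] 60)
abbreviation "CU \<equiv> continuous_on UNIV"
notation inner (infix "<.>" 70)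
notation scaleR (infixr "*R" 75)
lemmas LB_cong = Bochner_Integration.integral_cong and LB_bound = Bochner_Integration.integrable_bound
  and LB_iadd = Bochner_Integration.integrable_add and LB_add = Bochner_Integration.integral_add
  and LB_isum = Bochner_Integration.integrable_sum and LB_sum = Bochner_Integration.integral_sum

section \<open>Smooth functions and mollifiers\<close>

text \<open>The form with difference quotients is the one to which dominated convergence applies
  along a sequence of steps.\<close>

lemma has_vector_derivative_at_0_iff:
 fixes f :: "real => 'b::real_normed_vector"
 shows "(f has_vector_derivative D) (at 0) \<longleftrightarrow> ((%h. (f h - f 0) /\<^sub>R h) \<longlongrightarrow> D) (at 0)"
proof -
 have "(f has_vector_derivative D) (at 0) \<longleftrightarrow>
   ((%h. norm (f (0 + h) - f 0 - h *R D) / norm h) \<longlongrightarrow> 0) (at 0)"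
  unfolding has_vector_derivative_def has_derivative_at
  by (auto intro: bounded_linear_scaleR_left)
 also have "\<dots> \<longleftrightarrow> ((%h. norm ((f h - f 0) /\<^sub>R h - D)) \<longlongrightarrow> 0) (at 0)"
 proof (rule filterlim_cong[OF refl refl])
  show "\<forall>\<^sub>F h in at 0. norm (f (0 + h) - f 0 - h *R D) / norm h = norm ((f h - f 0) /\<^sub>R h - D)"
  proof (rule eventually_at_topological[THEN iffD2], intro exI[of _ UNIV] conjI ballI impI)
   fix h :: real assume "h ~= 0"
   then have "(f h - f 0) /\<^sub>R h - D = (f h - f 0 - h *R D) /\<^sub>R h"
    by (simp add: scaleR_diff_right)
   then show "norm (f (0 + h) - f 0 - h *R D) / norm h = norm ((f h - f 0) /\<^sub>R h - D)"
    by (simp add: divide_inverse mult.commute)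
  qed auto
 qed
 also have "\<dots> \<longleftrightarrow> ((%h. (f h - f 0) /\<^sub>R h) \<longlongrightarrow> D) (at 0)"
  using tendsto_norm_zero_iff[of "%h. (f h - f 0) /\<^sub>R h - D"] LIM_zero_iff by auto
 finally show ?thesis .
qed

text \<open>Differentiation under the integral sign. By the mean value inequality the difference
  quotients with steps in [-1,1] are dominated by \<open>h\<close>, so dominated convergence applies
  along every sequence of steps tending to 0.\<close>

lemma has_vector_derivative_integral:
 fixes F :: "real => 'a => 'b::euclidean_space"
 assumes F: "!!s. integrable M (F s)"
  and G: "!!s x. ((%s. F s x) has_vector_derivative G s x) (at s)"
  and h: "!!s x. \<bar>s\<bar> <= 1 ==> norm (G s x) <= h x" and ih: "integrable M h"
  and G0: "G 0 \<in> borel_measurable M"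
 shows "((%s. \<integral>x. F s x \<partial>M) has_vector_derivative (\<integral>x. G 0 x \<partial>M)) (at 0)"
 unfolding has_vector_derivative_at_0_iff tendsto_at_iff_sequentially
proof (intro allI impI)
 fix X :: "nat => real" assume X0: "\<forall>i. X i \<in> UNIV - {0}" and Xl: "X ~> 0"
 obtain N where N: "!!n. n >= N ==> \<bar>X n\<bar> <= 1"
  using Xl unfolding LIMSEQ_iff by (metis diff_zero less_imp_le real_norm_def zero_less_one)
 define Y where "Y n = X (n + N)" for n
 have Y0: "Y n ~= 0" and Y1: "\<bar>Y n\<bar> <= 1" for n using X0 N by (auto simp: Y_def)
 have Yl: "Y ~> 0" unfolding Y_def using Xl by (rule LIMSEQ_ignore_initial_segment)
 have bd: "norm ((F (Y n) x - F 0 x) /\<^sub>R Y n) <= h x" for n x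
 proof -
  have "norm (F (Y n) x - F 0 x) <= h x * norm (Y n - 0)"
  proof (rule differentiable_bound[where S="{-1..1}" and f'="%s t. t *R G s x"])
   show "onorm (%t. t *R G s x) <= h x" if "s \<in> {-1..1}" for s
   proof (rule onorm_bound)
    have *: "norm (G s x) <= h x" using h[of s x] that by auto
    then show "0 <= h x" using norm_ge_zero[of "G s x"] by linarith
    show "norm (t *R G s x) <= h x * norm t" for t
     using * by (simp add: mult.commute mult_left_mono)
   qed
   show "((%s. F s x) has_derivative (%t. t *R G s x)) (at s within {-1..1})" for s
    using G[of x s] unfolding has_vector_derivative_def by (rule has_derivative_at_withinI)
  qed (use Y1[of n] in auto)
  then have "norm (F (Y n) x - F 0 x) / \<bar>Y n\<bar> <= h x" using Y0[of n] by (simp add: pos_divide_le_eq)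
  then show ?thesis by (simp add: divide_inverse mult.commute)
 qed
 have "(%n. \<integral>x. (F (Y n) x - F 0 x) /\<^sub>R Y n \<partial>M) ~> (\<integral>x. G 0 x \<partial>M)"
 proof (rule integral_dominated_convergence[where w=h])
  show "AE x in M. (%n. (F (Y n) x - F 0 x) /\<^sub>R Y n) ~> G 0 x"
  proof (rule AE_I2)
   fix x
   have "((%h. (F h x - F 0 x) /\<^sub>R h) \<longlongrightarrow> G 0 x) (at 0)"
    using G[of x 0] unfolding has_vector_derivative_at_0_iff .
   then show "(%n. (F (Y n) x - F 0 x) /\<^sub>R Y n) ~> G 0 x"
    unfolding tendsto_at_iff_sequentially using Y0 Yl by (auto simp: o_def)
  qed
 qed (use F G0 ih bd in auto)
 moreover have "(\<integral>x. (F (Y n) x - F 0 x) /\<^sub>R Y n \<partial>M) = ((\<integral>x. F (Y n) x \<partial>M) - (\<integral>x. F 0 x \<partial>M)) /\<^sub>R Y n" for n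
  using F by (simp only: integral_scaleR_right Bochner_Integration.integral_diff)
 ultimately have "(%n. ((\<integral>x. F (X (n + N)) x \<partial>M) - (\<integral>x. F 0 x \<partial>M)) /\<^sub>R X (n + N)) ~> (\<integral>x. G 0 x \<partial>M)"
  by (simp only: Y_def)
 then show "((%h. ((\<integral>x. F h x \<partial>M) - (\<integral>x. F 0 x \<partial>M)) /\<^sub>R h) \<circ> X) ~> (\<integral>x. G 0 x \<partial>M)"
  unfolding o_def by (rule LIMSEQ_offset)
qed

text \<open>Matches the shape in which \<open>Ck\<close> asks for partial derivatives: the curve s
  -> f (x + s b) at s = 0, for every base point x. \<open>dirderivD\<close> moves the statement
  along the line.\<close>

definition dirderiv :: "'a::real_normed_vector => ('a => 'b::real_normed_vector) => ('a => 'b) => bool" where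
 "dirderiv b f g \<longleftrightarrow> (\<forall>x. ((%s. f (x + s *R b)) has_vector_derivative g x) (at 0))"

lemma dirderivD:
 assumes "dirderiv b f g"
 shows "((%s. f (x + s *R b)) has_vector_derivative g (x + t *R b)) (at t)"
proof -
 have "((%s. f ((x + t *R b) + s *R b)) has_vector_derivative g (x + t *R b)) (at (t + (-t)))"
  using assms by (auto simp: dirderiv_def)
 then have "((%s. f ((x + t *R b) + s *R b)) \<circ> (%s. s + (-t)) has_vector_derivative 1 *R g (x + t *R b)) (at t)"
  by (intro vector_diff_chain_at) (auto intro!: derivative_eq_intros)
 then show ?thesis by (simp add: o_def algebra_simps)
qed

lemma dirderiv_pdx: "dirderiv (axis j 1) f g ==> pdx j f x = g x"
 unfolding pdx_def dirderiv_def by (auto intro: vector_derivative_at)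

lemma Ck_continuous: "Ck k U f ==> continuous_on U f"
 by (cases k) auto

lemma Ck_SucD: "Ck (Suc k) U f ==> Ck k U f"
proof (induction k arbitrary: f)
 case (Suc k)
 have c: "continuous_on U f" using Suc.prems by simp
 have "\<exists>g. (\<forall>x\<in>U. ((%s. f (x + s *R b)) has_real_derivative g x) (at 0)) & Ck k U g"
  if "b \<in> Basis" for b
 proof -
  have "\<forall>b\<in>Basis. \<exists>g. (\<forall>x\<in>U. ((%s. f (x + s *R b)) has_real_derivative g x) (at 0)) & Ck (Suc k) U g"
   using Suc.prems unfolding Ck.simps(2)[of "Suc k"] by (rule conjunct2)
  from bspec[OF this that] obtain g where g: "\<forall>x\<in>U. ((%s. f (x + s *R b)) has_real_derivative g x) (at 0)" "Ck (Suc k) U g"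
   by (elim exE conjE)
  show ?thesis by (intro exI[of _ g] conjI g(1) Suc.IH[OF g(2)])
 qed
 then show ?case using c unfolding Ck.simps by (intro conjI ballI)
qed simp

lemma Ck_SucI:
 assumes "CU f" "!!b. b \<in> Basis ==> dirderiv b f (g b)" "!!b. b \<in> Basis ==> Ck k UNIV (g b)"
 shows "Ck (Suc k) UNIV f"
 unfolding Ck.simps
proof (intro conjI ballI assms(1))
 fix b :: 'a assume b: "b \<in> Basis"
 show "\<exists>g. (\<forall>x\<in>UNIV. ((%s. f (x + s *R b)) has_real_derivative g x) (at 0)) & Ck k UNIV g"
  using assms(2,3)[OF b] unfolding dirderiv_def has_real_derivative_iff_has_vector_derivative
  by (intro exI[of _ "g b"]) blast
qed

lemma Ck_SucE:
 assumes "Ck (Suc k) UNIV f"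
 obtains g where "CU f" "!!b. b \<in> Basis ==> dirderiv b f (g b)" "!!b. b \<in> Basis ==> Ck k UNIV (g b)"
proof -
 have "\<forall>b\<in>Basis. \<exists>g. dirderiv b f g & Ck k UNIV g"
  using assms unfolding Ck.simps dirderiv_def has_real_derivative_iff_has_vector_derivative by simp
 then obtain g where "\<forall>b\<in>Basis. dirderiv b f (g b) & Ck k UNIV (g b)" by metis
 then show ?thesis using that Ck_continuous[OF assms] by blast
qed

lemma Ck_const: "Ck k UNIV (%x. c)"
proof (induction k arbitrary: c)
 case (Suc k)
 show ?case by (rule Ck_SucI[where g="%_ _. 0"]) (auto simp: dirderiv_def Suc)
qed simp

lemma Ck_add: "Ck k UNIV f ==> Ck k UNIV g ==> Ck k UNIV (%x. f x + g x)"
proof (induction k arbitrary: f g)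
 case (Suc k)
 from Ck_SucE[OF Suc.prems(1)] obtain f' where f: "CU f" "!!b. b \<in> Basis ==> dirderiv b f (f' b)" "!!b. b \<in> Basis ==> Ck k UNIV (f' b)" by metis
 from Ck_SucE[OF Suc.prems(2)] obtain g' where g: "CU g" "!!b. b \<in> Basis ==> dirderiv b g (g' b)" "!!b. b \<in> Basis ==> Ck k UNIV (g' b)" by metis
 show ?case
  by (rule Ck_SucI[where g="%b x. f' b x + g' b x"])
   (use f g Suc.IH in \<open>auto simp: dirderiv_def intro!: continuous_intros has_vector_derivative_add\<close>)
qed (auto intro: continuous_intros)

lemma Ck_mult: "Ck k UNIV f ==> Ck k UNIV g ==> Ck k UNIV (%x. f x * g x)"
proof (induction k arbitrary: f g)
 case (Suc k)
 from Ck_SucE[OF Suc.prems(1)] obtain f' where f: "CU f" "!!b. b \<in> Basis ==> dirderiv b f (f' b)" "!!b. b \<in> Basis ==> Ck k UNIV (f' b)" by metis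
 from Ck_SucE[OF Suc.prems(2)] obtain g' where g: "CU g" "!!b. b \<in> Basis ==> dirderiv b g (g' b)" "!!b. b \<in> Basis ==> Ck k UNIV (g' b)" by metis
 show ?case
 proof (rule Ck_SucI[where g="%b x. f x * g' b x + f' b x * g x"])
  fix b :: 'a assume b: "b \<in> Basis"
  show "dirderiv b (%x. f x * g x) (%x. f x * g' b x + f' b x * g x)"
   unfolding dirderiv_def
  proof
   fix x
   show "((%s. f (x + s *R b) * g (x + s *R b)) has_vector_derivative f x * g' b x + f' b x * g x) (at 0)"
    using has_vector_derivative_mult[of "%s. f (x + s *R b)" "f' b x" 0 UNIV "%s. g (x + s *R b)" "g' b x"]
     f(2)[OF b] g(2)[OF b] by (auto simp: dirderiv_def)
  qed
  show "Ck k UNIV (%x. f x * g' b x + f' b x * g x)"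
   using f(3)[OF b] g(3)[OF b] Suc.prems Suc.IH by (intro Ck_add) (auto dest: Ck_SucD simp del: Ck.simps)
 qed (use f g in \<open>auto intro: continuous_intros\<close>)
qed (auto intro: continuous_intros)

lemma Ck_cmult: "Ck k UNIV f ==> Ck k UNIV (%x. c * f x)"
 using Ck_mult[OF Ck_const] .

lemma Ck_prod: "finite I ==> (!!i. i \<in> I ==> Ck k UNIV (f i)) ==> Ck k UNIV (%x. \<Prod>i\<in>I. f i x)"
 by (induction I rule: finite_induct) (auto intro: Ck_const Ck_mult)

lemma Ck_inner:
 fixes f :: "real => real" and v :: "'a::euclidean_space"
 shows "Ck k UNIV f ==> Ck k UNIV (%x. f (c + x <.> v))"
proof (induction k arbitrary: f)
 case (Suc k)
 from Ck_SucE[OF Suc.prems] obtain g where f: "CU f" "!!b. b \<in> Basis ==> dirderiv b f (g b)" "!!b. b \<in> Basis ==> Ck k UNIV (g b)" by metis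
 show ?case
 proof (rule Ck_SucI[where g="%b x. (b <.> v) * g 1 (c + x <.> v)"])
  fix b :: 'a assume "b \<in> Basis"
  show "dirderiv b (%x. f (c + x <.> v)) (%x. (b <.> v) * g 1 (c + x <.> v))"
   unfolding dirderiv_def
  proof
   fix x
   have "((%s. f ((c + x <.> v) + s *R 1)) \<circ> (%s. s * (b <.> v)) has_vector_derivative (b <.> v) *R g 1 (c + x <.> v)) (at 0)"
    using f(2)[of 1]
    by (intro vector_diff_chain_at) (auto simp: dirderiv_def intro!: derivative_eq_intros)
   then show "((%s. f (c + (x + s *R b) <.> v)) has_vector_derivative (b <.> v) * g 1 (c + x <.> v)) (at 0)"
    by (simp add: o_def algebra_simps inner_simps)
  qed
 next
  fix b :: 'a
  show "Ck k UNIV (%x. (b <.> v) * g 1 (c + x <.> v))"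
   using f(3)[of 1] Suc.IH by (intro Ck_cmult) auto
 next
  show "CU (%x. f (c + x <.> v))"
   by (rule continuous_on_compose2[OF f(1)]) (auto intro!: continuous_intros)
 qed
next
 case 0
 then have "CU f" by simp
 then show ?case unfolding Ck.simps by (rule continuous_on_compose2) (auto intro!: continuous_intros)
qed

lemma Ck_affine:
 fixes f :: "'a::euclidean_space => real"
 shows "Ck k UNIV f ==> Ck k UNIV (%x. f (d + c *R x))"
proof (induction k arbitrary: f)
 case (Suc k)
 from Ck_SucE[OF Suc.prems] obtain g where f: "CU f" "!!b. b \<in> Basis ==> dirderiv b f (g b)" "!!b. b \<in> Basis ==> Ck k UNIV (g b)" by metis
 show ?case
 proof (rule Ck_SucI[where g="%b x. c * g b (d + c *R x)"])
  fix b :: 'a assume b: "b \<in> Basis"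
  show "dirderiv b (%x. f (d + c *R x)) (%x. c * g b (d + c *R x))"
   unfolding dirderiv_def
  proof
   fix x
   have "((%s. f ((d + c *R x) + s *R b)) \<circ> (%s. s * c) has_vector_derivative c *R g b (d + c *R x)) (at 0)"
    using f(2)[OF b]
    by (intro vector_diff_chain_at) (auto simp: dirderiv_def intro!: derivative_eq_intros)
   then show "((%s. f (d + c *R (x + s *R b))) has_vector_derivative c * g b (d + c *R x)) (at 0)"
    by (simp add: o_def algebra_simps)
  qed
  show "Ck k UNIV (%x. c * g b (d + c *R x))"
   using f(3)[OF b] Suc.IH by (intro Ck_cmult) auto
 next
  show "CU (%x. f (d + c *R x))"
   by (rule continuous_on_compose2[OF f(1)]) (auto intro!: continuous_intros)
 qed
next
 case 0
 then have "CU f" by simp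
 then show ?case unfolding Ck.simps by (rule continuous_on_compose2) (auto intro!: continuous_intros)
qed

text \<open>Serves the products th(t) w(x), the space-time test functions. In a direction whose
  first component is 0 the function is constant along the line, hence the case split in the
  derivative.\<close>

lemma Ck_fst:
 fixes f :: "'a::euclidean_space => real"
 shows "Ck k UNIV f ==> Ck k UNIV (%z::'a \<times> 'b::euclidean_space. f (fst z))"
proof (induction k arbitrary: f)
 case (Suc k)
 from Ck_SucE[OF Suc.prems] obtain g where f: "CU f" "!!b. b \<in> Basis ==> dirderiv b f (g b)" "!!b. b \<in> Basis ==> Ck k UNIV (g b)" by metis
 show ?case
 proof (rule Ck_SucI[where g="%b x. if fst b = 0 then 0 else g (fst b) (fst x)"])
  fix b :: "'a \<times> 'b" assume b: "b \<in> Basis"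
  then have *: "fst b ~= 0 ==> fst b \<in> Basis" by (auto simp: Basis_prod_def)
  show "dirderiv b (%z. f (fst z)) (%x. if fst b = 0 then 0 else g (fst b) (fst x))"
   using f(2)[OF *] by (auto simp: dirderiv_def)
  show "Ck k UNIV (%x::'a \<times> 'b. if fst b = 0 then 0 else g (fst b) (fst x))"
  proof (cases "fst b = 0")
   case False
   show ?thesis unfolding if_not_P[OF False] by (rule Suc.IH[OF f(3)[OF *[OF False]]])
  qed (simp add: Ck_const)
 qed (use f(1) in \<open>auto intro!: continuous_intros continuous_on_compose2[OF f(1)]\<close>)
next
 case 0
 then show ?case by (auto intro!: continuous_intros intro: continuous_on_compose2)
qed

lemma Ck_snd:
 fixes f :: "'a::euclidean_space => real"
 shows "Ck k UNIV f ==> Ck k UNIV (%z::'b::euclidean_space \<times> 'a. f (snd z))"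
proof (induction k arbitrary: f)
 case (Suc k)
 from Ck_SucE[OF Suc.prems] obtain g where f: "CU f" "!!b. b \<in> Basis ==> dirderiv b f (g b)" "!!b. b \<in> Basis ==> Ck k UNIV (g b)" by metis
 show ?case
 proof (rule Ck_SucI[where g="%b x. if snd b = 0 then 0 else g (snd b) (snd x)"])
  fix b :: "'b \<times> 'a" assume b: "b \<in> Basis"
  then have *: "snd b ~= 0 ==> snd b \<in> Basis" by (auto simp: Basis_prod_def)
  show "dirderiv b (%z. f (snd z)) (%x. if snd b = 0 then 0 else g (snd b) (snd x))"
   using f(2)[OF *] by (auto simp: dirderiv_def)
  show "Ck k UNIV (%x::'b \<times> 'a. if snd b = 0 then 0 else g (snd b) (snd x))"
  proof (cases "snd b = 0")
   case False
   show ?thesis unfolding if_not_P[OF False] by (rule Suc.IH[OF f(3)[OF *[OF False]]])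
  qed (simp add: Ck_const)
 qed (use f(1) in \<open>auto intro!: continuous_intros continuous_on_compose2[OF f(1)]\<close>)
next
 case 0
 then show ?case by (auto intro!: continuous_intros intro: continuous_on_compose2)
qed

section \<open>Smooth bump functions\<close>

definition flat :: "nat => real => real" where
 "flat n x = (if x > 0 then (1/x) ^ n * exp (- (1/x)) else 0)"

lemma flat_tendsto_0: "(flat n \<longlongrightarrow> 0) (at 0)"
proof -
 have "((%x. x ^ n / exp x) \<longlongrightarrow> (0::real)) at_top" by (rule tendsto_power_div_exp_0)
 then have "((%x. inverse x ^ n / exp (inverse x)) \<longlongrightarrow> (0::real)) (at_right 0)"
  by (rule filterlim_compose[OF _ filterlim_inverse_at_top_right])
 then have r: "(flat n \<longlongrightarrow> 0) (at_right 0)"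
  by (rule Lim_transform_eventually)
   (auto simp: eventually_at_filter flat_def exp_minus divide_inverse)
 have l: "(flat n \<longlongrightarrow> 0) (at_left 0)"
  by (rule tendsto_eventually) (auto simp: eventually_at_filter flat_def)
 show ?thesis using l r by (simp add: filterlim_at_split)
qed

text \<open>The functions x^(-n) exp(-1/x), continued by 0, are closed under differentiation up to
  linear combinations. One induction over the whole family therefore shows that all of them are
  smooth.\<close>

lemma flat_deriv: "(flat n has_real_derivative flat (n + 2) x - real n * flat (n + 1) x) (at x)"
proof (cases x "0::real" rule: linorder_cases)
 case less
 have "((%x::real. 0::real) has_real_derivative 0) (at x)" by simp
 then have "(flat n has_real_derivative 0) (at x)"
  by (rule has_field_derivative_transform_within_open[where S="{..<0}"]) (use less in \<open>auto simp: flat_def\<close>)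
 then show ?thesis using less by (simp add: flat_def)
next
 case equal
 \<comment> \<open>At 0 the difference quotient of \<open>flat n\<close> is itself
   \<open>flat (n + 1)\<close>, whose limit is known.\<close>
 have "((%h. (flat n h - flat n 0) / h) \<longlongrightarrow> 0) (at 0)"
  by (rule Lim_transform_eventually[OF flat_tendsto_0[of "n + 1"]])
   (auto simp: eventually_at_filter flat_def)
 then show ?thesis using equal by (simp add: has_field_derivative_iff flat_def)
next
 case greater
 have "((%x. (1/x) ^ n * exp (- (1/x))) has_real_derivative flat (n + 2) x - real n * flat (n + 1) x) (at x)"
 proof (cases n)
  case 0
  then show ?thesis using greater
   by (auto intro!: derivative_eq_intros simp: flat_def power2_eq_square)
 next
  case (Suc m)
  show ?thesis using greater unfolding Suc
   by (auto intro!: derivative_eq_intros simp: flat_def power2_eq_square) (cases m; simp add: divide_simps algebra_simps)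
 qed
 then show ?thesis
  by (rule has_field_derivative_transform_within_open[where S="{0<..}"]) (use greater in \<open>auto simp: flat_def\<close>)
qed

lemma Ck_flat: "Ck k UNIV (flat n)"
proof (induction k arbitrary: n)
 case 0
 show ?case using flat_deriv by (auto intro!: DERIV_continuous continuous_at_imp_continuous_on)
next
 case (Suc k)
 show ?case
 proof (rule Ck_SucI[where g="%b x. flat (n + 2) x + (- real n) * flat (n + 1) x"])
  show "CU (flat n)"
   using flat_deriv by (auto intro!: DERIV_continuous continuous_at_imp_continuous_on)
  fix b :: real assume "b \<in> Basis"
  then have [simp]: "b = 1" by simp
  show "dirderiv b (flat n) (%x. flat (n + 2) x + (- real n) * flat (n + 1) x)"
   unfolding dirderiv_def
  proof
   fix x
   have "(flat n has_real_derivative flat (n + 2) x - real n * flat (n + 1) x) (at (x + 0))"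
    using flat_deriv by simp
   then show "((%s. flat n (x + s *R b)) has_vector_derivative flat (n + 2) x + (- real n) * flat (n + 1) x) (at 0)"
    unfolding has_real_derivative_iff_has_vector_derivative[symmetric]
    using DERIV_shift[of "flat n" "flat (n + 2) x - real n * flat (n + 1) x" 0 x] by (simp add: add.commute)
  qed
  show "Ck k UNIV (%x. flat (n + 2) x + (- real n) * flat (n + 1) x)"
   using Suc by (intro Ck_add Ck_cmult)
 qed
qed

definition bump1 :: "real => real" where
 "bump1 x = flat 0 (1 - x) * flat 0 (1 + x)"

lemma bump1_pos: "\<bar>x\<bar> < 1 ==> bump1 x > 0" and bump1_eq_0: "\<not> \<bar>x\<bar> < 1 ==> bump1 x = 0"
 by (auto simp: bump1_def flat_def abs_less_iff)

lemma bump1_nonneg: "bump1 x >= 0"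
 by (auto simp: bump1_def flat_def)

lemma Ck_bump1: "Ck k UNIV bump1"
proof -
 have "Ck k UNIV (%x. flat 0 (1 + (-1) *R x) * flat 0 (1 + 1 *R x))"
  by (intro Ck_mult Ck_affine Ck_flat)
 then show ?thesis by (simp add: bump1_def[abs_def])
qed

text \<open>The factor \<open>DIM('a)\<close> confines each coordinate of the support to modulus
  below 1/\<open>DIM('a)\<close>; the sum of the coordinates, and with it the norm, then stays below
  1.\<close>

definition bump :: "'a::euclidean_space => real" where
 "bump x = (\<Prod>b\<in>Basis. bump1 (DIM('a) * (x <.> b)))"

lemma Ck_bump: "Ck k UNIV (bump :: 'a::euclidean_space => real)"
proof -
 have "Ck k UNIV (%x::'a. \<Prod>b\<in>Basis. bump1 (0 + x <.> (real DIM('a) *R b)))"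
  by (intro Ck_prod Ck_inner Ck_bump1) auto
 then show ?thesis by (simp add: bump_def[abs_def])
qed

lemma bump_nonneg: "bump x >= 0"
 by (simp add: bump_def prod_nonneg bump1_nonneg)

lemma bump_support:
 fixes x :: "'a::euclidean_space"
 assumes "bump x ~= 0" shows "norm x < 1"
proof -
 have "\<bar>real DIM('a) * (x <.> b)\<bar> < 1" if "b \<in> Basis" for b
  using assms that bump1_eq_0[of "real DIM('a) * (x <.> b)"] by (auto simp: bump_def)
 then have *: "\<bar>x <.> b\<bar> < 1 / DIM('a)" if "b \<in> Basis" for b
  using that by (simp add: abs_mult field_simps)
 have "norm x <= (\<Sum>b\<in>Basis. \<bar>x <.> b\<bar>)" by (rule norm_le_l1)
 also have "\<dots> < (\<Sum>b\<in>(Basis::'a set). 1 / DIM('a))" by (rule sum_strict_mono) (use * in auto)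
 finally show ?thesis by simp
qed

lemma continuous_bump: "CU bump"
 using Ck_bump[of 0] by simp

lemma continuous_compact_support_integrable:
 fixes f :: "'a::euclidean_space => 'b::euclidean_space"
 assumes c: "CU f" and s: "!!x. norm x > R ==> f x = 0"
 shows "IL f"
proof -
 have "IL (%x. indicator (cball 0 R) x *R f x)"
  by (intro borel_integrable_compact continuous_on_subset[OF c]) auto
 moreover have "(%x. indicator (cball 0 R) x *R f x) = f"
  using s by (auto simp: indicator_def fun_eq_iff not_le)
 ultimately show ?thesis by simp
qed

lemma continuous_compact_support_bounded:
 fixes f :: "'a::euclidean_space => 'b::euclidean_space"
 assumes c: "CU f" and s: "!!x. norm x > R ==> f x = 0"
 obtains M where "M > 0" "!!x. norm (f x) <= M"
proof -
 have "compact (f ` cball 0 R)" by (intro compact_continuous_image continuous_on_subset[OF c]) auto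
 then obtain M where M: "M > 0" "!!y. y \<in> f ` cball 0 R ==> norm y <= M"
  by (meson bounded_pos compact_imp_bounded)
 have "norm (f x) <= M" for x
  using M s[of x] by (cases "norm x <= R") auto
 then show ?thesis using that M by blast
qed

definition eta :: "'a::euclidean_space => real" where
 "eta x = bump x / (LBINT y. bump (y::'a))"

lemma integrable_bump: "IL (bump :: 'a::euclidean_space => real)"
 by (rule continuous_compact_support_integrable[OF continuous_bump, where R=1]) (use bump_support in fastforce)

text \<open>A vanishing integral would make \<open>bump\<close> zero almost everywhere, hence
  everywhere because its zero set is closed; but it is positive at the origin.\<close>

lemma bump_integral_pos: "(LBINT y. bump (y::'a::euclidean_space)) > 0"
proof -
 have "(LBINT y. bump (y::'a)) ~= 0"
 proof
  assume "(LBINT y. bump (y::'a)) = 0"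
  then have "AL x. bump (x::'a) = 0"
   using integral_nonneg_eq_0_iff_AE[OF integrable_bump] bump_nonneg by auto
  then have "AE x in lebesgue. (x::'a) \<in> {x. bump x = 0}" by (auto intro: AE_completion)
  moreover have "closed {x::'a. bump x = 0}"
   using continuous_closed_preimage_constant[OF continuous_bump] by simp
  ultimately have "(0::'a) \<in> {x. bump x = 0}" using mem_closed_if_AE_lebesgue by blast
  then show False using bump1_pos[of 0] by (simp add: bump_def)
 qed
 moreover have "(LBINT y. bump (y::'a)) >= 0" using bump_nonneg by (intro integral_nonneg_AE) auto
 ultimately show ?thesis by simp
qed

lemma eta_nonneg: "eta x >= 0"
 using bump_nonneg bump_integral_pos by (auto simp: eta_def intro!: divide_nonneg_pos)

lemma eta_support: "eta x ~= 0 ==> norm x < 1"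
 using bump_support by (auto simp: eta_def)

lemma Ck_eta: "Ck k UNIV (eta :: 'a::euclidean_space => real)"
 using Ck_cmult[OF Ck_bump, where c="1 / (LBINT y. bump (y::'a))"] by (simp add: eta_def[abs_def])

lemma integrable_eta: "IL eta"
 unfolding eta_def[abs_def] using integrable_bump by (rule Bochner_Integration.integrable_divide_zero)

lemma integral_eta: "(LBINT x. eta (x::'a::euclidean_space)) = 1"
 using bump_integral_pos[where 'a='a] by (simp add: eta_def[abs_def])

lemma measurable_eta[measurable]: "eta \<in> BM"
 using borel_measurable_integrable[OF integrable_eta] by simp

section \<open>Mollification\<close>

definition ker :: "real => 'a::euclidean_space => real" where
 "ker k x = eta (x /\<^sub>R k) / k ^ DIM('a)"

text \<open>This is the convolution with \<open>ker k\<close> after the substitution x = y - k z.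
  The weight no longer depends on k, which suits Jensen's inequality and dominated convergence;
  \<open>moll_eq\<close> returns to the kernel form, which suits differentiation.\<close>

definition moll :: "real => ('a::euclidean_space => 'b::euclidean_space) => 'a => 'b" where
 "moll k w y = (LBINT z. eta z *R w (y - k *R z))"

lemma Ck_ker: "Ck m UNIV (ker k :: 'a::euclidean_space => real)"
proof -
 have "Ck m UNIV (%x::'a. (1 / k ^ DIM('a)) * eta (0 + (inverse k) *R x))"
  by (intro Ck_cmult Ck_affine Ck_eta)
 then show ?thesis by (simp add: ker_def[abs_def])
qed

lemma ker_support: "k > 0 ==> ker k x ~= 0 ==> norm x < k"
 using eta_support[of "x /\<^sub>R k"] by (auto simp: ker_def field_simps)

lemma measurable_ker[measurable]: "ker k \<in> BM"
 unfolding ker_def[abs_def] by measurable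

lemma continuous_ker: "CU (ker k)"
 using Ck_ker[of 0] by simp

lemma moll_eq:
 fixes w :: "'a::euclidean_space => 'b::euclidean_space"
 assumes k: "k > 0" and [measurable]: "w \<in> BM"
 shows "moll k w y = (LBINT x. ker k (y - x) *R w x)"
proof -
 have "(LBINT x. ker k (y - x) *R w x) =
  (\<integral>x. ker k (y - x) *R w x \<partial>(density (distr lborel borel (%x. y + (- k) *R x)) (%_. \<bar>- k\<bar>^DIM('a))))"
  using lborel_affine[of "- k" y] k by simp
 also have "\<dots> = (LBINT x. (k ^ DIM('a)) *R (ker k (y - (y + (- k) *R x)) *R w (y + (- k) *R x)))"
  using k by (subst integral_density) (auto simp: integral_distr)
 also have "\<dots> = moll k w y" unfolding moll_def using k
  by (intro LB_cong) (auto simp: ker_def)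
 finally show ?thesis ..
qed

lemma dirderiv_support:
 assumes d: "dirderiv b f g" and s: "!!x. norm x > R ==> f x = 0" and x: "norm x > R"
 shows "g x = 0"
proof -
 have "((%s. f (x + s *R b)) has_vector_derivative g x) (at 0)" using d by (auto simp: dirderiv_def)
 moreover have "((%s. f (x + s *R b)) has_vector_derivative 0) (at 0)"
 proof (rule has_vector_derivative_transform_within_open[where S="{s. norm (x + s *R b) > R}" and f="%_. 0"])
  show "open {s. norm (x + s *R b) > R}"
   by (intro open_Collect_less continuous_intros)
 qed (use s x in auto)
 ultimately show ?thesis by (rule vector_derivative_unique_at)
qed

text \<open>All regularity comes from the kernel: the derivative falls on \<open>ph\<close>, and f
  enters only through the integrable majorant M' |f|.\<close>

lemma dirderiv_conv:
 fixes ph :: "'a::euclidean_space => real" and f :: "'a => 'b::euclidean_space"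
 assumes f: "IL f" and c: "CU ph" and d: "dirderiv b ph g"
  and cg: "CU g" and s: "!!x. norm x > R ==> ph x = 0"
 shows "dirderiv b (%y. LBINT x. ph (y - x) *R f x) (%y. LBINT x. g (y - x) *R f x)"
 unfolding dirderiv_def
proof
 fix y
 have [measurable]: "f \<in> BM" "ph \<in> BM" "g \<in> BM"
  using f c cg by (auto intro: borel_measurable_continuous_onI)
 obtain M where M: "!!x. norm (ph x) <= M" using continuous_compact_support_bounded[OF c s] by metis
 obtain M' where M': "!!x. norm (g x) <= M'"
  using continuous_compact_support_bounded[OF cg, of R] dirderiv_support[OF d s] by metis
 have "((%s. LBINT x. ph (y + s *R b - x) *R f x) has_vector_derivative (LBINT x. g (y + 0 *R b - x) *R f x)) (at 0)"
 proof (rule has_vector_derivative_integral[where h="%x. M' * norm (f x)"])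
  fix s x
  show "((%s. ph (y + s *R b - x) *R f x) has_vector_derivative g (y + s *R b - x) *R f x) (at s)"
   using has_vector_derivative_scaleR[of "%s. ph (y + s *R b - x)" "g (y + s *R b - x)" s UNIV "%_. f x" 0]
    dirderivD[OF d, of "y - x" s]
   by (auto simp: algebra_simps has_real_derivative_iff_has_vector_derivative)
  show "norm (g (y + s *R b - x) *R f x) <= M' * norm (f x)"
   using M'[of "y + s *R b - x"] by (auto intro: mult_right_mono)
  show "IL (%x. ph (y + s *R b - x) *R f x)"
  proof (rule LB_bound[where f="%x. M * norm (f x)"])
   show "AL x. norm (ph (y + s *R b - x) *R f x) <= norm (M * norm (f x))"
   proof (rule AE_I2)
    fix x
    have "norm (ph (y + s *R b - x)) * norm (f x) <= M * norm (f x)"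
     by (rule mult_right_mono[OF M]) auto
    then show "norm (ph (y + s *R b - x) *R f x) <= norm (M * norm (f x))" by auto
   qed
  qed (use f in auto)
 qed (use f in auto)
 then show "((%s. LBINT x. ph (y + s *R b - x) *R f x) has_vector_derivative (LBINT x. g (y - x) *R f x)) (at 0)"
  by simp
qed

lemma continuous_conv:
 fixes ph :: "'a::euclidean_space => real" and f :: "'a => 'b::euclidean_space"
 assumes f: "IL f" and c: "CU ph" and s: "!!x. norm x > R ==> ph x = 0"
 shows "CU (%y. LBINT x. ph (y - x) *R f x)"
 unfolding continuous_on_sequentially
proof (intro allI ballI impI)
 fix X :: "nat => 'a" and y assume X: "(\<forall>n. X n \<in> UNIV) & X ~> y"
 have [measurable]: "f \<in> BM" "ph \<in> BM"
  using f c by (auto intro: borel_measurable_continuous_onI)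
 obtain M where M: "!!x. norm (ph x) <= M" using continuous_compact_support_bounded[OF c s] by metis
 have "(%n. LBINT x. ph (X n - x) *R f x) ~> (LBINT x. ph (y - x) *R f x)"
 proof (rule integral_dominated_convergence[where w="%x. M * norm (f x)"])
  show "AL x. (%n. ph (X n - x) *R f x) ~> ph (y - x) *R f x"
  proof (rule AE_I2)
   fix x
   have "(%n. X n - x) ~> y - x" using X by (intro tendsto_intros) auto
   then have "(%n. ph (X n - x)) ~> ph (y - x)"
    using continuous_on_tendsto_compose[OF c] by auto
   then show "(%n. ph (X n - x) *R f x) ~> ph (y - x) *R f x" by (intro tendsto_intros)
  qed
  show "AL x. norm (ph (X n - x) *R f x) <= M * norm (f x)" for n
   using M by (auto intro!: mult_right_mono)
 qed (use f in auto)
 then show "((%y. LBINT x. ph (y - x) *R f x) \<circ> X) ~> (LBINT x. ph (y - x) *R f x)"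
  by (simp add: o_def)
qed

lemma Ck_conv:
 fixes ph :: "'a::euclidean_space => real" and f :: "'a => real"
 assumes f: "IL f"
 shows "Ck k UNIV ph ==> (!!x. norm x > R ==> ph x = 0) ==> Ck k UNIV (%y. LBINT x. ph (y - x) * f x)"
proof (induction k arbitrary: ph)
 case 0
 then show ?case using continuous_conv[OF f, of ph R] by auto
next
 case (Suc k)
 from Ck_SucE[OF Suc.prems(1)] obtain g where g: "CU ph" "!!b. b \<in> Basis ==> dirderiv b ph (g b)" "!!b. b \<in> Basis ==> Ck k UNIV (g b)" by metis
 show ?case
 proof (rule Ck_SucI[where g="%b y. LBINT x. g b (y - x) * f x"])
  show "CU (%y. LBINT x. ph (y - x) * f x)"
   using continuous_conv[OF f g(1), of R] Suc.prems(2) by auto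
  fix b :: 'a assume b: "b \<in> Basis"
  show "dirderiv b (%y. LBINT x. ph (y - x) * f x) (%y. LBINT x. g b (y - x) * f x)"
   using dirderiv_conv[OF f g(1) g(2)[OF b] Ck_continuous[OF g(3)[OF b]], of R] Suc.prems(2) by auto
  show "Ck k UNIV (%y. LBINT x. g b (y - x) * f x)"
   by (rule Suc.IH[OF g(3)[OF b]]) (rule dirderiv_support[OF g(2)[OF b] Suc.prems(2)])
 qed
qed

lemma Cinf_moll:
 fixes w :: "'a::euclidean_space => 'b::euclidean_space"
 assumes k: "k > 0" and w: "IL w"
 shows "Cinf_on UNIV (moll k w)"
 unfolding Cinf_on_def
proof (intro conjI ballI allI)
 fix b :: 'b and m
 have [measurable]: "w \<in> BM" using w by auto
 obtain M where M: "!!x::'a. norm (ker k x) <= M"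
  by (rule continuous_compact_support_bounded[OF continuous_ker, of k k]) (use ker_support[OF k] in force)+
 have i: "IL (%x. ker k (y - x) *R w x)" for y
 proof (rule LB_bound[where f="%x. M * norm (w x)"])
  show "AL x. norm (ker k (y - x) *R w x) <= norm (M * norm (w x))"
  proof (rule AE_I2)
   fix x
   have "norm (ker k (y - x)) * norm (w x) <= M * norm (w x)"
    by (rule mult_right_mono[OF M]) auto
   then show "norm (ker k (y - x) *R w x) <= norm (M * norm (w x))" by auto
  qed
 qed (use w in auto)
 have "(%y. moll k w y <.> b) = (%y. LBINT x. ker k (y - x) * (w x <.> b))"
  using i by (auto simp: moll_eq[OF k] fun_eq_iff simp flip: integral_inner_left)
 moreover have "Ck m UNIV (%y. LBINT x. ker k (y - x) * (w x <.> b))"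
  by (rule Ck_conv[OF _ Ck_ker, of _ k k]) (use w ker_support[OF k] in force)+
 ultimately show "Ck m UNIV (%y. moll k w y <.> b)" by simp
qed simp

lemma moll_support:
 assumes k: "k > 0" and s: "!!x. norm x > R ==> w x = 0" and x: "norm x > R + k"
 shows "moll k w x = 0"
proof -
 have "eta z *R w (x - k *R z) = 0" for z
 proof (cases "eta z = 0")
  case False
  then have "norm (k *R z) <= k" using eta_support[of z] k by (auto simp: mult_le_cancel_left1)
  then have "norm (x - k *R z) > R" using x norm_triangle_ineq2[of x "k *R z"] by linarith
  then show ?thesis using s by simp
 qed auto
 then show ?thesis unfolding moll_def by (simp only: integral_zero)
qed

lemma Cc_inf_moll:
 fixes w :: "'a::euclidean_space => 'b::euclidean_space"
 assumes k: "k > 0" and w: "IL w" and s: "!!x. norm x > R ==> w x = 0"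
 shows "Cc_inf UNIV (moll k w)"
 unfolding Cc_inf_def
proof (intro conjI exI[of _ "cball 0 (R + k)"])
 show "\<forall>x. x \<notin> cball 0 (R + k) --> moll k w x = 0" using moll_support[OF k s] by (auto simp: not_le)
qed (use Cinf_moll[OF k w] in auto)

text \<open>The integral of x -> f (x + s b) is constant in s by translation invariance, and
  differentiating it under the integral sign at s = 0 gives the integral of g.\<close>

lemma integral_dirderiv_eq_0:
 fixes f :: "'a::euclidean_space => 'b::euclidean_space"
 assumes c: "CU f" and d: "dirderiv b f g"
  and cg: "CU g" and s: "!!x. norm x > R ==> f x = 0"
 shows "(LBINT x. g x) = 0"
proof -
 have [measurable]: "f \<in> BM" "g \<in> BM"
  using c cg by (auto intro: borel_measurable_continuous_onI)
 obtain M where M: "M > 0" "!!x. norm (g x) <= M"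
  using continuous_compact_support_bounded[OF cg, of R] dirderiv_support[OF d s] by metis
 have g0: "norm x > R ==> g x = 0" for x by (rule dirderiv_support[OF d s])
 have fi: "IL f" by (rule continuous_compact_support_integrable[OF c s])
 have tr: "IL (%x. f (x + v)) & (LBINT x. f (x + v)) = (LBINT x. f x)" for v
  using fi lborel_distr_plus[of v] integrable_distr_eq[of "(+) v" lborel borel f] integral_distr[of "(+) v" lborel borel f]
  by (auto simp: add.commute)
 have "((%s. LBINT x. f (x + s *R b)) has_vector_derivative (LBINT x. g (x + 0 *R b))) (at 0)"
 proof (rule has_vector_derivative_integral[where h="%x. indicator (cball 0 (R + norm b)) x *R M"])
  fix s x
  show "IL (%x. f (x + s *R b))" using tr by auto
  show "((%s. f (x + s *R b)) has_vector_derivative g (x + s *R b)) (at s)" by (rule dirderivD[OF d])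
  show "norm (g (x + s *R b)) <= indicat_real (cball 0 (R + norm b)) x *R M" if "\<bar>s\<bar> <= 1"
  proof (cases "norm x <= R + norm b")
   case False
   have "norm (s *R b) <= norm b" using that by (simp add: mult_left_le_one_le)
   then have "norm (x + s *R b) > R" using False norm_triangle_ineq4[of "x + s *R b" "s *R b"] by simp
   then show ?thesis using g0 M by simp
  qed (use M in auto)
 next
  show "IL (%x. indicat_real (cball 0 (R + norm b)) x *R M)"
   by (rule borel_integrable_compact) auto
 qed auto
 moreover have "((%s. LBINT x. f (x + s *R b)) has_vector_derivative 0) (at 0)"
  using tr by simp
 ultimately show ?thesis using vector_derivative_unique_at by fastforce
qed

section \<open>Approximation in Lebesgue spaces\<close>

lemma norm_add3_powr_le:
 fixes x y z :: "'b::real_normed_vector"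
 assumes "p > 0"
 shows "norm (x + y + z) powr p <= 3 powr p * (norm x powr p + norm y powr p + norm z powr p)"
proof -
 define m where "m = max (norm x) (max (norm y) (norm z))"
 have "norm (x + y + z) <= norm x + norm y + norm z"
  by (meson add_right_mono norm_triangle_ineq norm_triangle_le order_trans)
 also have "\<dots> <= 3 * m" by (simp add: m_def)
 finally have "norm (x + y + z) powr p <= (3 * m) powr p" using assms by (intro powr_mono2) auto
 also have "\<dots> = 3 powr p * m powr p" by (intro powr_mult)
 also have "m powr p <= norm x powr p + norm y powr p + norm z powr p"
  by (auto simp: m_def max_def)
 finally show ?thesis by simp
qed

lemma norm_add3_powr_le_ennreal:
 fixes x y z :: "'b::real_normed_vector"
 assumes "p > 0"
 shows "ennreal (norm (x + y + z) powr p) <= ennreal (3 powr p) * (ennreal (norm x powr p) + ennreal (norm y powr p) + ennreal (norm z powr p))"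
 using norm_add3_powr_le[OF assms, of x y z] by (simp flip: ennreal_plus ennreal_mult)

text \<open>The notion \<open>measurable_on\<close> supplies continuous functions that converge to w
  almost everywhere. Projecting their values radially to the ball of radius k and cutting them off
  outside radius k + 1 gives a common bound, so the convergence also holds in L^p.\<close>

lemma Lp_dense_bounded_support:
 fixes w :: "'a::euclidean_space => 'b::euclidean_space"
 assumes p: "p > 0" and w[measurable]: "w \<in> BM"
  and k: "k > 0" and wk: "!!x. norm (w x) <= k" "!!x. norm x > k ==> w x = 0" and e: "e > 0"
 shows "\<exists>ph. CU ph & (\<forall>x. norm x > k + 1 --> ph x = 0) &
  (NNL x. ennreal (norm (w x - ph x) powr p)) <= ennreal e"
proof -
 have "w \<in> borel_measurable (lebesgue_on UNIV)"
  unfolding lebesgue_on_UNIV_eq by (rule measurable_completion) simp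
 then have "w measurable_on UNIV"
  using measurable_on_iff_borel_measurable[of UNIV w] by simp
 then obtain N g where N: "negligible N" and g: "!!n. CU (g n)"
  and gl: "!!x. x \<notin> N ==> (%n. g n x) ~> w x"
  unfolding measurable_on_def by auto
 define cl where "cl v = (k / max k (norm v)) *R v" for v :: 'b
 have ccl: "CU cl" unfolding cl_def using k by (auto intro!: continuous_intros)
 have ncl: "norm (cl v) <= k" for v
  using k by (auto simp: cl_def max_def field_simps)
 have icl: "norm v <= k ==> cl v = v" for v using k by (auto simp: cl_def max_def)
 define ch where "ch x = max 0 (min 1 (k + 1 - norm x))" for x :: 'a
 have cch: "CU ch" unfolding ch_def by (intro continuous_intros)
 have ch01: "0 <= ch x" "ch x <= 1" for x by (auto simp: ch_def)
 define G where "G n x = ch x *R cl (g n x)" for n x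
 have cG: "CU (G n)" for n
  unfolding G_def using cch continuous_on_compose2[OF ccl g] by (auto intro!: continuous_intros)
 have [measurable]: "G n \<in> BM" for n using cG by (rule borel_measurable_continuous_onI)
 have G0: "norm x > k + 1 ==> G n x = 0" for n x by (simp add: G_def ch_def)
 have nG: "norm (G n x) <= k" for n x
  using ncl[of "g n x"] ch01[of x] by (simp add: G_def) (smt (verit) mult_left_le_one_le norm_ge_zero)
 have Gl: "(%n. G n x) ~> w x" if "x \<notin> N" for x
 proof -
  have "(%n. cl (g n x)) ~> cl (w x)"
   using continuous_on_tendsto_compose[OF ccl gl[OF that]] by simp
  then have "(%n. G n x) ~> ch x *R cl (w x)" unfolding G_def by (intro tendsto_intros)
  moreover have "ch x *R cl (w x) = w x"
   using wk[of x] icl[of "w x"] by (cases "norm x > k") (auto simp: ch_def)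
  ultimately show ?thesis by simp
 qed
 have "(%n. NNL x. ennreal (norm (w x - G n x) powr p)) ~> (NNL (x::'a). 0)"
 proof (rule nn_integral_dominated_convergence[where w="%x. ennreal ((2 * k) powr p) * indicator (cball 0 (k + 1)) x"])
  show "AL x. ennreal (norm (w x - G n x) powr p) <= ennreal ((2 * k) powr p) * indicator (cball 0 (k + 1)) x" for n
  proof (rule AE_I2)
   fix x
   show "ennreal (norm (w x - G n x) powr p) <= ennreal ((2 * k) powr p) * indicator (cball 0 (k + 1)) x"
   proof (cases "norm x > k + 1")
    case True
    then show ?thesis using G0[of x n] wk(2)[of x] by simp
   next
    case False
    have "norm (w x - G n x) <= 2 * k" using norm_triangle_ineq4[of "w x" "G n x"] wk(1)[of x] nG[of n x] by linarith
    then show ?thesis using False p by (simp add: powr_mono2)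
   qed
  qed
  show "AL x. (%i. ennreal (norm (w x - G i x) powr p)) ~> 0"
  proof -
   have "AE x in lebesgue. x \<notin> N" using N by (simp add: negligible_iff_null_sets AE_not_in)
   then have "AL x. x \<notin> N" by (simp add: AE_completion_iff)
   then show ?thesis
   proof (rule AE_mp, intro AE_I2 impI)
    fix x assume "x \<notin> N"
    have "(%i. norm (w x - G i x)) ~> norm (w x - w x)" by (intro tendsto_intros Gl \<open>x \<notin> N\<close>)
    then have "(%i. norm (w x - G i x) powr p) ~> 0"
     using p tendsto_zero_powrI[of "%i. norm (w x - G i x)" sequentially "%_. p" p] by simp
    then show "(%i. ennreal (norm (w x - G i x) powr p)) ~> 0"
     by (metis ennreal_0 tendsto_ennrealI)
   qed
  qed
  show "(NNL  (x::'a). ennreal ((2 * k) powr p) * indicator (cball 0 (k + 1)) x) < \<infinity>"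
   using emeasure_lborel_cball_finite[of "0::'a" "k + 1"] by (subst nn_integral_cmult_indicator) (auto simp: ennreal_mult_less_top)
  show "(%x. ennreal (norm (w x - G n x) powr p)) \<in> borel_measurable lborel" for n
   by measurable
  show "(%x::'a. ennreal ((2 * k) powr p) * indicator (cball 0 (k + 1)) x) \<in> borel_measurable lborel"
   by (intro borel_measurable_times_ennreal borel_measurable_const borel_measurable_indicator) simp
 qed (rule borel_measurable_const)
 then have "(%n. NNL x. ennreal (norm (w x - G n x) powr p)) ~> 0" by simp
 then have "\<forall>\<^sub>F n in sequentially. (NNL x. ennreal (norm (w x - G n x) powr p)) < ennreal e"
  using e by (intro order_tendstoD) auto
 then obtain n where "(NNL x. ennreal (norm (w x - G n x) powr p)) < ennreal e"
  by (auto simp: eventually_sequentially)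
 then show ?thesis using cG[of n] G0[of _ n] by (intro exI[of _ "G n"]) auto
qed

lemma Lp_truncation:
 fixes w :: "'a::euclidean_space => 'b::euclidean_space"
 assumes p: "p > 0" and w[measurable]: "w \<in> BM"
  and fin: "(NNL x. ennreal (norm (w x) powr p)) < \<infinity>"
 shows "(%n. NNL x. ennreal (norm (w x - (if norm x <= real n & norm (w x) <= real n then w x else 0)) powr p)) ~> 0"
proof -
 have "(%n. NNL x. ennreal (norm (w x - (if norm x <= real n & norm (w x) <= real n then w x else 0)) powr p))
   ~> (NNL (x::'a). 0)"
 proof (rule nn_integral_dominated_convergence[OF _ _ _ _ fin])
  show "AL x. (%n. ennreal (norm (w x - (if norm x <= real n & norm (w x) <= real n then w x else 0)) powr p)) ~> 0"
  proof (rule AE_I2)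
   fix x
   obtain n0 :: nat where "max (norm x) (norm (w x)) <= real n0" by (meson real_arch_simple)
   then have "\<forall>n\<ge>n0. ennreal (norm (w x - (if norm x <= real n & norm (w x) <= real n then w x else 0)) powr p) = 0"
    by auto
   then have "\<forall>\<^sub>F n in sequentially. ennreal (norm (w x - (if norm x <= real n & norm (w x) <= real n then w x else 0)) powr p) = 0"
    unfolding eventually_sequentially by blast
   then show "(%n. ennreal (norm (w x - (if norm x <= real n & norm (w x) <= real n then w x else 0)) powr p)) ~> 0"
    by (rule tendsto_eventually)
  qed
 qed auto
 then show ?thesis by simp
qed

lemma Lp_dense:
 fixes w :: "'a::euclidean_space => 'b::euclidean_space"
 assumes p: "p > 0" and w[measurable]: "w \<in> BM"
  and fin: "(NNL x. ennreal (norm (w x) powr p)) < \<infinity>" and e: "e > 0"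
 obtains ph R where "CU ph" "!!x. norm x > R ==> ph x = 0" "R > 0"
  "(NNL x. ennreal (norm (w x - ph x) powr p)) <= ennreal e"
proof -
 define e' where "e' = e / (3 powr p * 2)"
 have e': "e' > 0" using e by (simp add: e'_def)
 define W where "W n x = (if norm x <= real n & norm (w x) <= real n then w x else 0)" for n x
 have [measurable]: "W n \<in> BM" for n unfolding W_def by measurable
 have "\<forall>\<^sub>F n in sequentially. (NNL x. ennreal (norm (w x - W n x) powr p)) < ennreal e'"
  using Lp_truncation[OF p w fin] e' unfolding W_def by (intro order_tendstoD) auto
 then obtain n0 where n0: "!!n. n >= n0 ==> (NNL x. ennreal (norm (w x - W n x) powr p)) < ennreal e'"
  by (auto simp: eventually_sequentially)
 define n where "n = Suc n0"
 have n: "(NNL x. ennreal (norm (w x - W n x) powr p)) < ennreal e'" using n0[of n] by (simp add: n_def)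
 obtain ph where ph: "CU ph" "\<forall>x. norm x > real n + 1 --> ph x = 0"
  "(NNL x. ennreal (norm (W n x - ph x) powr p)) <= ennreal e'"
 proof -
  have "norm (W n x) <= real n" "norm x > real n ==> W n x = 0" for x by (auto simp: W_def)
  then show ?thesis using that Lp_dense_bounded_support[OF p, of "W n" "real n" e'] e' by (auto simp: n_def)
 qed
 have [measurable]: "ph \<in> BM" using ph(1) by (rule borel_measurable_continuous_onI)
 have "(NNL x. ennreal (norm (w x - ph x) powr p)) <=
  (NNL x. ennreal (3 powr p) * (ennreal (norm (w x - W n x) powr p) + ennreal (norm (W n x - ph x) powr p)))"
 proof (rule nn_integral_mono)
  fix x
  show "ennreal (norm (w x - ph x) powr p) <= ennreal (3 powr p) * (ennreal (norm (w x - W n x) powr p) + ennreal (norm (W n x - ph x) powr p))"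
   using norm_add3_powr_le_ennreal[OF p, of "w x - W n x" "W n x - ph x" 0] p by simp
 qed
 also have "\<dots> = ennreal (3 powr p) * ((NNL x. ennreal (norm (w x - W n x) powr p)) + (NNL x. ennreal (norm (W n x - ph x) powr p)))"
  by (simp add: nn_integral_cmult nn_integral_add)
 also have "\<dots> <= ennreal (3 powr p) * (ennreal e' + ennreal e')"
  using n ph(3) by (intro mult_left_mono add_mono) auto
 also have "\<dots> = ennreal e" using e' by (simp add: e'_def flip: ennreal_plus ennreal_mult)
 finally show ?thesis using that[of ph "real n + 1"] ph by auto
qed

text \<open>Exactly what makes composition with S bounded from L^p to L^p(A), with constant K on the
  integral of the p-th power. It covers translations (K = 1) and the inward map of the domain (K =
  2) at once.\<close>

definition quasi_pres :: "real => 'a::euclidean_space set => ('a => 'a) => bool" where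
 "quasi_pres K A S \<longleftrightarrow> S \<in> BM &
  (\<forall>B\<in>sets borel. emeasure lborel {x\<in>A. S x \<in> B} <= ennreal K * emeasure lborel B)"

lemma quasi_pres_nn_integral:
 assumes q: "quasi_pres K A S" and A[measurable]: "A \<in> sets borel" and f[measurable]: "f \<in> BM"
 shows "(NNL x. indicator A x * f (S x)) <= ennreal K * (NNL x. f x)"
proof -
 have [measurable]: "S \<in> BM" using q by (auto simp: quasi_pres_def)
 let ?M = "distr (density lborel (indicator A)) borel S"
 have "(NNL x. indicator A x * f (S x)) = (\<integral>\<^sup>+x. f x \<partial>?M)"
  by (simp add: nn_integral_distr nn_integral_density)
 also have "\<dots> <= (\<integral>\<^sup>+x. f x \<partial>scale_measure (ennreal K) lborel)"
 proof (rule nn_integral_mono_measure)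
  show "?M <= scale_measure (ennreal K) lborel"
  proof (rule le_measure[THEN iffD2], simp, intro ballI)
   fix B :: "'a set" assume "B \<in> sets ?M"
   then have [measurable]: "B \<in> sets borel" by simp
   have "emeasure ?M B = (NNL x. indicator A x * indicator (S -` B) x)"
    using measurable_sets_borel[of S borel B] by (simp add: emeasure_distr emeasure_density)
   also have "\<dots> = (NNL x. indicator {x\<in>A. S x \<in> B} x)"
    by (intro nn_integral_cong) (auto simp: indicator_def)
   also have "\<dots> = emeasure lborel {x\<in>A. S x \<in> B}" by (subst nn_integral_indicator) auto
   also have "\<dots> <= ennreal K * emeasure lborel B" using q by (auto simp: quasi_pres_def)
   finally show "emeasure ?M B <= emeasure (scale_measure (ennreal K) lborel) B" by simp
  qed
 qed simp
 also have "\<dots> = ennreal K * (NNL x. f x)" by (simp add: nn_integral_scale_measure)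
 finally show ?thesis .
qed

lemma emeasure_lborel_translation:
 fixes B :: "'a::euclidean_space set"
 assumes [measurable]: "B \<in> sets borel"
 shows "emeasure lborel {y. y - v \<in> B} = emeasure lborel B"
proof -
 have "emeasure lborel B = emeasure (distr lborel borel ((+) (- v))) B" by (simp add: lborel_distr_plus)
 also have "\<dots> = emeasure lborel {y. y - v \<in> B}"
  by (subst emeasure_distr) (auto intro!: arg_cong[where f="emeasure lborel"])
 finally show ?thesis ..
qed

lemma quasi_pres_shift:
 assumes "quasi_pres K A S"
 shows "quasi_pres K A (%x. S x - v)"
 unfolding quasi_pres_def
proof (intro conjI ballI)
 show "(%x. S x - v) \<in> BM" using assms by (auto simp: quasi_pres_def)
 fix B :: "'a set" assume [measurable]: "B \<in> sets borel"
 have "emeasure lborel {x \<in> A. S x \<in> {y. y - v \<in> B}} <= ennreal K * emeasure lborel {y. y - v \<in> B}"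
  using assms unfolding quasi_pres_def by (elim conjE) (erule bspec, measurable)
 then show "emeasure lborel {x \<in> A. S x - v \<in> B} <= ennreal K * emeasure lborel B"
  using emeasure_lborel_translation[of B v] by simp
qed

lemma quasi_pres_id: "A \<in> sets borel ==> quasi_pres 1 A (%x. x)"
 unfolding quasi_pres_def
 by (auto intro!: emeasure_mono)

text \<open>Replace w by a continuous function \<open>ph\<close> of compact support. The error of
  the replacement survives composition with S up to the factor K, and \<open>ph\<close> itself is
  uniformly continuous. The point is that d depends on K and w but not on the individual S.\<close>

lemma Lp_compose:
 fixes w :: "'a::euclidean_space => 'b::euclidean_space"
 assumes p: "p > 0" and w[measurable]: "w \<in> BM"
  and fin: "(NNL x. ennreal (norm (w x) powr p)) < \<infinity>"
  and A[measurable]: "A \<in> sets borel" and bA: "bounded A" and K: "K >= 0" and e: "e > 0"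
 obtains d where "d > 0"
  "!!S. quasi_pres K A S ==> (!!x. x \<in> A ==> dist (S x) x <= d) ==>
   (NNL x. indicator A x * ennreal (norm (w (S x) - w x) powr p)) <= ennreal e"
proof -
 \<comment> \<open>The denominator counts the three errors: K e1 for the replacement after S, e1 for
   the replacement itself, and e1 for the oscillation of \<open>ph\<close>.\<close>
 define e1 where "e1 = e / (3 powr p * (K + 2))"
 have e1: "e1 > 0" using e K by (simp add: e1_def)
 obtain ph R where ph: "CU ph" "!!x. norm x > R ==> ph x = 0" "R > 0"
  "(NNL x. ennreal (norm (w x - ph x) powr p)) <= ennreal e1"
  using Lp_dense[OF p w fin e1] by metis
 have [measurable]: "ph \<in> BM" using ph(1) by (rule borel_measurable_continuous_onI)
 obtain b where b0: "b > 0" "\<forall>x\<in>A. norm x <= b" using bA unfolding bounded_pos by blast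
 then have b: "b > 0" "A \<subseteq> cball 0 b" by auto
 define V where "V = measure lborel (cball (0::'a) b) + 1"
 have V: "V > 0" by (simp add: V_def add_nonneg_pos)
 have eA: "emeasure lborel A <= ennreal V"
 proof -
  have "emeasure lborel A <= emeasure lborel (cball (0::'a) b)" using b by (intro emeasure_mono) auto
  also have "\<dots> = ennreal (measure lborel (cball (0::'a) b))"
   using emeasure_lborel_cball_finite[of "0::'a" b] by (intro emeasure_eq_ennreal_measure) auto
  also have "\<dots> <= ennreal V" by (auto simp: V_def intro!: ennreal_leI)
  finally show ?thesis .
 qed
 \<comment> \<open>Chosen so that m^p V = e1, where V bounds the measure of A.\<close>
 define m where "m = (e1 / V) powr (1 / p)"
 have m: "m > 0" using e1 V by (simp add: m_def)
 have mp: "m powr p = e1 / V" using e1 V p by (simp add: m_def powr_powr)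
 have "uniformly_continuous_on (cball 0 (b + 1)) ph"
  by (intro compact_uniformly_continuous continuous_on_subset[OF ph(1)]) auto
 then obtain d where d: "d > 0" "!!x y. x \<in> cball 0 (b+1) ==> y \<in> cball 0 (b+1) ==> dist x y < d ==> dist (ph x) (ph y) < m"
  using m unfolding uniformly_continuous_on_def by metis
 \<comment> \<open>The bound 1 keeps S x in the ball of radius b + 1 on which \<open>ph\<close> is
   uniformly continuous; the half makes the distance strictly smaller than d.\<close>
 define d' where "d' = min 1 (d / 2)"
 show ?thesis
 proof (rule that[of d'])
  show "d' > 0" using d by (simp add: d'_def)
  fix S assume q: "quasi_pres K A S" and S: "!!x. x \<in> A ==> dist (S x) x <= d'"
  have [measurable]: "S \<in> BM" using q by (auto simp: quasi_pres_def)
  have pm: "norm (ph (S x) - ph x) powr p <= m powr p" if "x \<in> A" for x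
  proof -
   have "norm x <= b" "norm (S x - x) <= 1" "dist (S x) x < d"
    using that b S[OF that] d by (auto simp: d'_def dist_norm)
   moreover have "norm (S x) <= norm x + norm (S x - x)" using norm_triangle_ineq[of x "S x - x"] by simp
   ultimately have "dist (ph (S x)) (ph x) < m" by (intro d) auto
   then show ?thesis using p by (intro powr_mono2) (auto simp: dist_norm)
  qed
  have "(NNL x. indicator A x * ennreal (norm (w (S x) - w x) powr p)) <=
   (NNL x. ennreal (3 powr p) * (indicator A x * ennreal (norm (w (S x) - ph (S x)) powr p)
     + ennreal (m powr p) * indicator A x + ennreal (norm (w x - ph x) powr p)))"
  proof (rule nn_integral_mono)
   fix x
   show "indicator A x * ennreal (norm (w (S x) - w x) powr p) <= ennreal (3 powr p) * (indicator A x * ennreal (norm (w (S x) - ph (S x)) powr p)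
     + ennreal (m powr p) * indicator A x + ennreal (norm (w x - ph x) powr p))"
   proof (cases "x \<in> A")
    case True
    have "ennreal (norm (w (S x) - w x) powr p) <= ennreal (3 powr p) * (ennreal (norm (w (S x) - ph (S x)) powr p)
     + ennreal (norm (ph (S x) - ph x) powr p) + ennreal (norm (ph x - w x) powr p))"
     using norm_add3_powr_le_ennreal[OF p, of "w (S x) - ph (S x)" "ph (S x) - ph x" "ph x - w x"] by simp
    also have "\<dots> <= ennreal (3 powr p) * (ennreal (norm (w (S x) - ph (S x)) powr p)
     + ennreal (m powr p) + ennreal (norm (w x - ph x) powr p))"
     using pm[OF True] by (intro mult_left_mono add_mono ennreal_leI) (auto simp: norm_minus_commute)
    finally show ?thesis using True by simp
   qed simp
  qed
  also have "\<dots> = ennreal (3 powr p) * ((NNL x. indicator A x * ennreal (norm (w (S x) - ph (S x)) powr p))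
     + ennreal (m powr p) * emeasure lborel A + (NNL x. ennreal (norm (w x - ph x) powr p)))"
   by (simp add: nn_integral_cmult nn_integral_add)
  also have "\<dots> <= ennreal (3 powr p) * (ennreal K * (NNL x. ennreal (norm (w x - ph x) powr p))
     + ennreal (m powr p) * ennreal V + (NNL x. ennreal (norm (w x - ph x) powr p)))"
   using quasi_pres_nn_integral[OF q A, of "%x. ennreal (norm (w x - ph x) powr p)"] eA
   by (intro mult_left_mono add_mono) auto
  also have "\<dots> <= ennreal (3 powr p) * (ennreal K * ennreal e1
     + ennreal (m powr p) * ennreal V + ennreal e1)"
   using ph(4) by (intro mult_left_mono add_mono) auto
  also have "\<dots> = ennreal (3 powr p * (K * e1 + m powr p * V + e1))"
   using K e1 V by (simp flip: ennreal_plus ennreal_mult)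
  also have "3 powr p * (K * e1 + m powr p * V + e1) = 3 powr p * (e1 * (K + 2))"
   using V by (simp add: mp field_simps)
  also have "\<dots> = e" using K by (simp add: e1_def)
  finally show "(NNL x. indicator A x * ennreal (norm (w (S x) - w x) powr p)) <= ennreal e" .
 qed
qed

text \<open>The convex function v^p lies above its tangent at a. The inequality is Young's
  inequality for v and a^(p-1), rearranged.\<close>

lemma powr_tangent:
 fixes a v p :: real
 assumes p: "p >= 1" and a: "a > 0" and v: "v >= 0"
 shows "p * a powr (p - 1) * v - (p - 1) * a powr p <= v powr p"
proof (cases "p = 1")
 case True
 then show ?thesis using a v by simp
next
 case False
 then have p1: "p > 1" using p by simp
 define q where "q = p / (p - 1)"
 have q: "q > 1" "1 / p + 1 / q = 1" using p1 by (auto simp: q_def field_simps)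
 have "v * a powr (p - 1) <= v powr p / p + (a powr (p - 1)) powr q / q"
  using Youngs_inequality[OF p1 q, of v "a powr (p - 1)"] v by simp
 also have "(a powr (p - 1)) powr q = a powr p" using p1 by (simp add: powr_powr q_def)
 finally have "p * (v * a powr (p - 1)) <= p * (v powr p / p + a powr p / q)"
  using p1 by (intro mult_left_mono) auto
 also have "\<dots> = v powr p + (p - 1) * a powr p"
  using p1 by (simp add: q_def field_simps)
 finally show ?thesis by (simp add: algebra_simps)
qed

text \<open>Integrate the tangent inequality at the mean value a of |f| against \<open>eta\<close>,
  which has mass one.\<close>

lemma Jensen_eta:
 fixes f :: "'a::euclidean_space => 'b::euclidean_space"
 assumes p: "p >= 1" and [measurable]: "f \<in> BM"
  and fin: "(NNL z. ennreal (eta z * norm (f z) powr p)) < \<infinity>"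
 shows "IL (%z. eta z *R f z)"
  and "ennreal (norm (LBINT z. eta z *R f z) powr p) <= (NNL z. ennreal (eta z * norm (f z) powr p))"
proof -
 have ip: "IL (%z. eta z * norm (f z) powr p)"
  by (rule integrableI_nonneg) (use fin in \<open>auto simp: eta_nonneg\<close>)
 have le1: "v <= 1 + v powr p" if "v >= 0" for v :: real
 proof (cases "v <= 1")
  case False
  then have "v powr 1 <= v powr p" using p by (intro powr_mono) auto
  then show ?thesis using False by simp
 qed (simp add: add_increasing2)
 have iv: "IL (%z. eta z * norm (f z))"
 proof (rule LB_bound[OF LB_iadd[OF integrable_eta ip]])
  show "AL z. norm (eta z * norm (f z)) <= norm (eta z + eta z * norm (f z) powr p)"
  proof (rule AE_I2)
   fix z
   have "eta z * norm (f z) <= eta z * (1 + norm (f z) powr p)"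
    using le1[of "norm (f z)"] eta_nonneg[of z] by (intro mult_left_mono) auto
   then show "norm (eta z * norm (f z)) <= norm (eta z + eta z * norm (f z) powr p)"
    using eta_nonneg[of z] by (simp add: algebra_simps)
  qed
 qed simp
 show i: "IL (%z. eta z *R f z)"
  by (rule LB_bound[OF iv]) (auto simp: eta_nonneg)
 define a where "a = (LBINT z. eta z * norm (f z))"
 have na: "norm (LBINT z. eta z *R f z) <= a"
  using integral_norm_bound[of lborel "%z. eta z *R f z"] by (simp add: a_def eta_nonneg)
 have a0: "a >= 0" unfolding a_def by (intro integral_nonneg_AE AE_I2) (simp add: eta_nonneg)
 have "a powr p <= (LBINT z. eta z * norm (f z) powr p)"
 proof (cases "a = 0")
  case True
  then show ?thesis using p by (auto intro!: integral_nonneg_AE AE_I2 simp: eta_nonneg)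
 next
  case False
  then have a: "a > 0" using a0 by simp
  have "a powr p = p * a powr (p - 1) * a - (p - 1) * a powr p"
   using a by (simp add: powr_diff algebra_simps)
  also have "\<dots> = p * a powr (p - 1) * (LBINT z. eta z * norm (f z)) - (p - 1) * a powr p * (LBINT z. eta (z::'a))"
   by (simp add: integral_eta a_def)
  also have "\<dots> = (LBINT z. p * a powr (p - 1) * (eta z * norm (f z)) - (p - 1) * a powr p * eta z)"
   using iv integrable_eta by (subst Bochner_Integration.integral_diff) (auto intro!: integrable_mult_right)
  also have "\<dots> <= (LBINT z. eta z * norm (f z) powr p)"
  proof (rule integral_mono)
   fix z
   have "eta z * (p * a powr (p - 1) * norm (f z) - (p - 1) * a powr p) <= eta z * norm (f z) powr p"
    using powr_tangent[OF p a, of "norm (f z)"] eta_nonneg by (intro mult_left_mono) auto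
   then show "p * a powr (p - 1) * (eta z * norm (f z)) - (p - 1) * a powr p * eta z <= eta z * norm (f z) powr p"
    by (simp add: algebra_simps)
  qed (use iv ip integrable_eta in \<open>auto intro!: integrable_mult_right Bochner_Integration.integrable_diff\<close>)
  finally show ?thesis .
 qed
 then have "norm (LBINT z. eta z *R f z) powr p <= (LBINT z. eta z * norm (f z) powr p)"
  using powr_mono2[OF _ _ na, of p] p by simp
 then show "ennreal (norm (LBINT z. eta z *R f z) powr p) <= (NNL z. ennreal (eta z * norm (f z) powr p))"
  using ip by (subst nn_integral_eq_integral) (auto simp: eta_nonneg intro!: ennreal_leI)
qed

text \<open>Since \<open>eta\<close> has mass one, the constant v can be moved inside the average.
  When the right-hand side is infinite there is nothing to show, which spares an integrability
  assumption on w.\<close>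

lemma moll_diff_powr:
 fixes w :: "'a::euclidean_space => 'b::euclidean_space"
 assumes p: "p >= 1" and [measurable]: "w \<in> BM"
 shows "ennreal (norm (moll k w y - v) powr p) <= (NNL z. ennreal (eta z * norm (w (y - k *R z) - v) powr p))"
proof (cases "(NNL z. ennreal (eta z * norm (w (y - k *R z) - v) powr p)) < \<infinity>")
 case True
 have i: "IL (%z. eta z *R (w (y - k *R z) - v))"
  by (rule Jensen_eta(1)[OF p _ True]) simp
 have "moll k w y = (LBINT z. eta z *R (w (y - k *R z) - v) + eta z *R v)"
  unfolding moll_def by (simp add: algebra_simps)
 also have "\<dots> = (LBINT z. eta z *R (w (y - k *R z) - v)) + v"
  using i integrable_eta by (subst LB_add) (auto simp: integral_eta)
 finally have "moll k w y - v = (LBINT z. eta z *R (w (y - k *R z) - v))" by simp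
 then show ?thesis using Jensen_eta(2)[OF p _ True] by simp
next
 case False
 then show ?thesis by (simp add: not_less top_unique)
qed

lemma measurable_moll[measurable]:
 fixes w :: "'a::euclidean_space => 'b::euclidean_space"
 assumes [measurable]: "w \<in> BM"
 shows "moll k w \<in> BM"
 unfolding moll_def[abs_def] by measurable

text \<open>Jensen and Fubini leave only the maps x -> T x - k z with |z| < 1. They are again
  \<open>quasi_pres\<close> with the same constant, so \<open>Lp_compose\<close> bounds all of them
  uniformly in z. Half of d is spent on T, the other half on the radius k.\<close>

lemma moll_Lp:
 fixes w :: "'a::euclidean_space => 'b::euclidean_space"
 assumes p: "p >= 1" and w[measurable]: "w \<in> BM"
  and fin: "(NNL x. ennreal (norm (w x) powr p)) < \<infinity>"
  and A[measurable]: "A \<in> sets borel" and bA: "bounded A" and K: "K >= 0" and e: "e > 0"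
 obtains d where "d > 0"
  "!!T k. quasi_pres K A T ==> (!!x. x \<in> A ==> dist (T x) x <= d) ==> 0 < k ==> k <= d ==>
   (NNL x. indicator A x * ennreal (norm (moll k w (T x) - w x) powr p)) <= ennreal e"
proof -
 have p0: "p > 0" using p by simp
 obtain d where d: "d > 0"
  "!!S. quasi_pres K A S ==> (!!x. x \<in> A ==> dist (S x) x <= d) ==>
   (NNL x. indicator A x * ennreal (norm (w (S x) - w x) powr p)) <= ennreal e"
  by (rule Lp_compose[OF p0 w fin A bA K e]) (rule that, assumption, blast)
 show ?thesis
 proof (rule that[of "d / 2"])
  show "d / 2 > 0" using d by simp
  fix T k assume q: "quasi_pres K A T" and T: "!!x. x \<in> A ==> dist (T x) x <= d / 2" and k: "0 < k" "k <= d / 2"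
  have [measurable]: "T \<in> BM" using q by (auto simp: quasi_pres_def)
  have "(NNL x. indicator A x * ennreal (norm (moll k w (T x) - w x) powr p)) <=
   (NNL x. (NNL z. ennreal (eta z) * (indicator A x * ennreal (norm (w (T x - k *R z) - w x) powr p))))"
  proof (rule nn_integral_mono)
   fix x
   show "indicator A x * ennreal (norm (moll k w (T x) - w x) powr p) <=
    (NNL z. ennreal (eta z) * (indicator A x * ennreal (norm (w (T x - k *R z) - w x) powr p)))"
    using moll_diff_powr[OF p w, of k "T x" "w x"]
    by (cases "x \<in> A") (auto simp: ennreal_mult eta_nonneg)
  qed
  also have "\<dots> = (NNL z. (NNL x. ennreal (eta z) * (indicator A x * ennreal (norm (w (T x - k *R z) - w x) powr p))))"
   by (rule lborel_pair.Fubini'[symmetric]) measurable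
  also have "\<dots> <= (NNL (z::'a). ennreal (eta z) * ennreal e)"
  proof (rule nn_integral_mono)
   fix z :: 'a
   show "(NNL x. ennreal (eta z) * (indicator A x * ennreal (norm (w (T x - k *R z) - w x) powr p))) <= ennreal (eta z) * ennreal e"
   proof (cases "eta z = 0")
    case False
    then have "k * norm z <= k * 1" using eta_support[of z] k by (intro mult_left_mono) auto
    then have "k * norm z <= d / 2" using k by linarith
    then have "norm (k *R z) <= d / 2" using k by simp
    then have "dist (T x - k *R z) x <= d" if "x \<in> A" for x
     using T[OF that] norm_triangle_ineq4[of "T x - x" "k *R z"] by (simp add: dist_norm algebra_simps)
    then have "(NNL x. indicator A x * ennreal (norm (w (T x - k *R z) - w x) powr p)) <= ennreal e"
     by (intro d quasi_pres_shift q)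
    then show ?thesis by (subst nn_integral_cmult) (auto intro!: mult_left_mono)
   qed simp
  qed
  also have "\<dots> = ennreal e"
   using nn_integral_eq_integral[OF integrable_eta[where 'a='a]] by (simp add: nn_integral_multc eta_nonneg integral_eta)
  finally show "(NNL x. indicator A x * ennreal (norm (moll k w (T x) - w x) powr p)) <= ennreal e" .
 qed
qed

lemma Cc_inf_ker:
 assumes k: "k > 0" and U: "cball y k \<subseteq> U"
 shows "Cc_inf U (%x. ker k (y - x))"
 unfolding Cc_inf_def Cinf_on_def
proof (intro conjI ballI allI exI[of _ "cball y k"] impI)
 fix m and b :: real assume "b \<in> Basis"
 have "Ck m UNIV (%x. ker k (y + (- 1) *R x))" by (intro Ck_affine Ck_ker)
 then show "Ck m UNIV (%x. ker k (y - x) <.> b)" using \<open>b \<in> Basis\<close> by simp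
next
 show "x \<notin> cball y k ==> ker k (y - x) = 0" for x
  using ker_support[OF k, of "y - x"] by (auto simp: dist_norm)
qed (use U in auto)

text \<open>On [1/(n+1), T - 1/(n+1)] the mollification of v at a small scale vanishes identically,
  because the reflected kernel is an admissible test function. As the mollifications tend to v in
  L^1, v vanishes there, and these intervals exhaust (0,T).\<close>

lemma fundamental_lemma_variations:
 fixes v :: "real => real"
 assumes v: "IL v" and vt: "!!th. Cc_inf {0<..<T} th ==> (LBINT t. th t * v t) = 0"
 shows "AL t. t \<in> {0<..<T} --> v t = 0"
proof -
 have [measurable]: "v \<in> BM" using v by auto
 have fin: "(NNL x. ennreal (norm (v x) powr 1)) < \<infinity>"
  using v by (simp add: integrable_iff_bounded)
 have "AL t. t \<in> {1 / real (Suc n)..T - 1 / real (Suc n)} --> v t = 0" for n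
 proof -
  define h where "h = 1 / real (Suc n)"
  define A where "A = {h..T - h}"
  have h: "h > 0" by (simp add: h_def)
  have [measurable]: "A \<in> sets borel" by (simp add: A_def)
  have "(NNL x. indicator A x * ennreal (norm (v x))) <= 0"
  proof (rule ennreal_le_epsilon)
   fix e :: real assume e: "e > 0"
   obtain d where d: "d > 0" "!!T k. quasi_pres 1 A T ==> (!!x. x \<in> A ==> dist (T x) x <= d) ==> 0 < k ==> k <= d ==>
    (NNL x. indicator A x * ennreal (norm (moll k v (T x) - v x) powr 1)) <= ennreal e"
    using moll_Lp[OF _ _ fin, of A 1 e] e by (auto simp: A_def)
   define k where "k = min d (h / 2)"
   have k: "0 < k" "k <= d" "k < h" using d h by (auto simp: k_def)
   have m0: "moll k v y = 0" if "y \<in> A" for y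
   proof -
    have "cball y k \<subseteq> {0<..<T}" using that k by (auto simp: A_def dist_real_def)
    from vt[OF Cc_inf_ker[OF k(1) this]] show ?thesis by (simp add: moll_eq[OF k(1)])
   qed
   have "(NNL x. indicator A x * ennreal (norm (v x))) = (NNL x. indicator A x * ennreal (norm (moll k v x - v x) powr 1))"
    by (intro nn_integral_cong) (auto simp: indicator_def m0)
   also have "\<dots> <= ennreal e" using d(2)[of "%x. x" k] k d(1) by (simp add: quasi_pres_id)
   finally show "(NNL x. indicator A x * ennreal (norm (v x))) <= 0 + ennreal e" by simp
  qed
  then have "AL x. indicator A x * ennreal (norm (v x)) = 0"
   using nn_integral_0_iff_AE[of "%x. indicator A x * ennreal (norm (v x))" lborel] by simp
  then show ?thesis unfolding h_def[symmetric] A_def[symmetric]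
   by (rule AE_mp) (auto intro!: AE_I2 simp: indicator_def)
 qed
 then have "AL t. \<forall>n. t \<in> {1 / real (Suc n)..T - 1 / real (Suc n)} --> v t = 0"
  unfolding AE_all_countable by blast
 then show ?thesis
 proof (rule AE_mp, intro AE_I2 impI)
  fix t assume *: "\<forall>n. t \<in> {1 / real (Suc n)..T - 1 / real (Suc n)} --> v t = 0" and t: "t \<in> {0<..<T}"
  obtain n where "1 / real (Suc n) < min t (T - t)" using t nat_approx_posE[of "min t (T - t)"] by auto
  then have "t \<in> {1 / real (Suc n)..T - 1 / real (Suc n)}" by auto
  then show "v t = 0" using * by blast
 qed
qed

section \<open>The Sobolev inequality in three dimensions\<close>

lemma measurable_vec_nth[measurable]:
 fixes f :: "'a => ('b::euclidean_space)^'n"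
 assumes "f \<in> borel_measurable M"
 shows "(%x. f x $ i) \<in> borel_measurable M"
proof -
 have "(%v::'b^'n. v $ i) \<in> BM"
  by (intro borel_measurable_continuous_onI continuous_intros)
 from measurable_compose[OF assms this] show ?thesis .
qed

text \<open>Identifies nested pairs with vectors, so that Lebesgue measure on \<open>vec3\<close>
  becomes a product measure and Fubini applies coordinate by coordinate.\<close>

definition vec3of :: "real \<times> real \<times> real => vec3" where
 "vec3of z = (\<chi> i. if i = 1 then fst z else if i = 2 then fst (snd z) else snd (snd z))"

lemma vec3of_nth[simp]: "vec3of (x, y, z) $ 1 = x" "vec3of (x, y, z) $ 2 = y" "vec3of (x, y, z) $ 3 = z"
 by (simp_all add: vec3of_def)

lemma continuous_vec3of: "CU vec3of"
 unfolding vec3of_def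
proof (rule continuous_on_vec_lambda)
 fix i :: 3
 show "CU (%z. if i = 1 then fst z else if i = 2 then fst (snd z) else snd (snd z))"
  by (cases "i = 1"; cases "i = 2") (auto intro!: continuous_intros)
qed

lemma measurable_vec3of[measurable]: "vec3of \<in> BM"
 by (rule borel_measurable_continuous_onI[OF continuous_vec3of])

lemma measurable_vec3of'[measurable]: "vec3of \<in> borel_measurable (borel \<Otimes>\<^sub>M borel \<Otimes>\<^sub>M borel)"
 using measurable_vec3of by (simp add: borel_prod)

lemma measurable_vec3of''[measurable]: "vec3of \<in> BM2"
 using measurable_vec3of by (simp add: borel_prod)

lemma prod_Basis_vec3: "(\<Prod>b\<in>Basis. (v::vec3) <.> b) = v $ 1 * v $ 2 * v $ 3"
proof -
 have B: "(Basis :: vec3 set) = {axis 1 1, axis 2 1, axis 3 1}"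
  by (auto simp: Basis_vec_def) (metis exhaust_3)
 show ?thesis unfolding B by (simp add: axis_eq_axis inner_axis mult.assoc)
qed

lemma lborel_vec3: "(lborel :: vec3 measure) = distr lborel borel vec3of"
proof (rule lborel_eqI)
 fix l u :: vec3 assume *: "!!b. b \<in> Basis ==> l <.> b <= u <.> b"
 have le: "l $ i <= u $ i" for i using *[of "axis i 1"] by (simp add: inner_axis axis_in_Basis_iff)
 have "vec3of -` box l u = {l$1<..<u$1} \<times> {l$2<..<u$2} \<times> {l$3<..<u$3}"
  by (auto simp: mem_box_cart forall_3)
 then have "emeasure (distr lborel borel vec3of) (box l u) = emeasure (lborel \<Otimes>\<^sub>M (lborel :: (real \<times> real) measure)) ({l$1<..<u$1} \<times> ({l$2<..<u$2} \<times> {l$3<..<u$3}))"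
  by (simp add: emeasure_distr lborel_prod)
 also have "\<dots> = emeasure lborel {l$1<..<u$1} * emeasure (lborel :: (real \<times> real) measure) ({l$2<..<u$2} \<times> {l$3<..<u$3})"
  by (rule lborel.emeasure_pair_measure_Times) (auto intro: borel_Times)
 also have "emeasure (lborel :: (real \<times> real) measure) ({l$2<..<u$2} \<times> {l$3<..<u$3}) = emeasure (lborel \<Otimes>\<^sub>M lborel) ({l$2<..<u$2} \<times> {l$3<..<u$3})"
  by (simp add: lborel_prod)
 also have "\<dots> = emeasure lborel {l$2<..<u$2} * emeasure lborel {l$3<..<u$3}"
  by (rule lborel.emeasure_pair_measure_Times) auto
 also have "emeasure lborel {l$1<..<u$1} * (emeasure lborel {l$2<..<u$2} * emeasure lborel {l$3<..<u$3}) = ennreal (\<Prod>b\<in>Basis. (u - l) <.> b)"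
  unfolding prod_Basis_vec3 using le by (simp add: ennreal_mult mult.assoc)
 finally show "emeasure (distr lborel borel vec3of) (box l u) = ennreal (\<Prod>b\<in>Basis. (u - l) <.> b)" .
qed simp

lemma nn_integral_vec3:
 fixes f :: "vec3 => ennreal"
 assumes [measurable]: "f \<in> BM"
 shows "(NNL v. f v) = (NNL x. NNL y. NNL z. f (vec3of (x, y, z)))"
proof -
 have "(NNL v. f v) = (NNL p. f (vec3of p))"
  by (subst lborel_vec3) (simp add: nn_integral_distr)
 also have "\<dots> = (NNL x. NNL q. f (vec3of (x, q)))"
  by (subst lborel_prod[symmetric], subst lborel.nn_integral_fst[symmetric]) auto
 also have "\<dots> = (NNL x. NNL y. NNL z. f (vec3of (x, y, z)))"
  by (intro nn_integral_cong, subst lborel_prod[symmetric], subst lborel.nn_integral_fst[symmetric]) auto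
 finally show ?thesis .
qed

text \<open>Integrate x first: Cauchy-Schwarz in x separates \<open>f2\<close> and \<open>f3\<close>
  into a function of z and a function of y. A second Cauchy-Schwarz inequality in (y, z) against
  \<open>f1\<close> then finishes.\<close>

lemma Loomis_Whitney:
 fixes f1 f2 f3 :: "real \<times> real => ennreal"
 assumes m: "f1 \<in> BM" "f2 \<in> BM" "f3 \<in> BM"
 shows "(NNL x. NNL y. NNL z. f1 (y, z) * f2 (x, z) * f3 (x, y))^2
  <= (NNL y. NNL z. (f1 (y, z))^2) * ((NNL x. NNL z. (f2 (x, z))^2) * (NNL x. NNL y. (f3 (x, y))^2))"
proof -
 have [measurable]: "f1 \<in> BM2" "f2 \<in> BM2" "f3 \<in> BM2"
  using m by (auto simp: borel_prod)
 define I where "I y z = (NNL x. f2 (x, z) * f3 (x, y))" for y z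
 define P where "P z = (NNL x. (f2 (x, z))^2)" for z
 define Q where "Q y = (NNL x. (f3 (x, y))^2)" for y
 have [measurable]: "(%p. I (fst p) (snd p)) \<in> BM2" "P \<in> BM" "Q \<in> BM"
  unfolding I_def P_def Q_def by measurable
 have IPQ: "(I y z)^2 <= P z * Q y" for y z
  unfolding I_def P_def Q_def by (rule Cauchy_Schwarz_nn_integral) measurable
 have "(NNL x. NNL y. NNL z. f1 (y, z) * f2 (x, z) * f3 (x, y))
  = (NNL y. NNL x. NNL z. f1 (y, z) * f2 (x, z) * f3 (x, y))"
  by (rule lborel_pair.Fubini') measurable
 also have "\<dots> = (NNL y. NNL z. NNL x. f1 (y, z) * f2 (x, z) * f3 (x, y))"
  by (intro nn_integral_cong lborel_pair.Fubini') measurable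
 also have "\<dots> = (NNL y. NNL z. f1 (y, z) * I y z)"
  unfolding I_def by (intro nn_integral_cong, subst nn_integral_cmult[symmetric]) (auto simp: mult.assoc)
 also have "\<dots> = (\<integral>\<^sup>+p. f1 p * I (fst p) (snd p) \<partial>(lborel \<Otimes>\<^sub>M lborel))"
  by (subst lborel.nn_integral_fst[symmetric]) auto
 finally have "(NNL x. NNL y. NNL z. f1 (y, z) * f2 (x, z) * f3 (x, y))^2
  = (\<integral>\<^sup>+p. f1 p * I (fst p) (snd p) \<partial>(lborel \<Otimes>\<^sub>M lborel))^2" by simp
 also have "\<dots> <= (\<integral>\<^sup>+p. (f1 p)^2 \<partial>(lborel \<Otimes>\<^sub>M lborel)) * (\<integral>\<^sup>+p. (I (fst p) (snd p))^2 \<partial>(lborel \<Otimes>\<^sub>M lborel))"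
  by (rule Cauchy_Schwarz_nn_integral) auto
 also have "(\<integral>\<^sup>+p. (f1 p)^2 \<partial>(lborel \<Otimes>\<^sub>M lborel)) = (NNL y. NNL z. (f1 (y, z))^2)"
  by (subst lborel.nn_integral_fst[symmetric]) auto
 also have "(\<integral>\<^sup>+p. (I (fst p) (snd p))^2 \<partial>(lborel \<Otimes>\<^sub>M lborel)) = (NNL y. NNL z. (I y z)^2)"
  by (subst lborel.nn_integral_fst[symmetric]) auto
 also have "\<dots> <= (NNL y. NNL z. P z * Q y)"
  by (intro nn_integral_mono IPQ)
 also have "\<dots> = (NNL z. P z) * (NNL y. Q y)"
  by (simp add: nn_integral_multc nn_integral_cmult)
 also have "(NNL z. P z) = (NNL x. NNL z. (f2 (x, z))^2)"
  unfolding P_def by (rule lborel_pair.Fubini') measurable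
 also have "(NNL y. Q y) = (NNL x. NNL y. (f3 (x, y))^2)"
  unfolding Q_def by (rule lborel_pair.Fubini') measurable
 finally show ?thesis by (simp add: mult_left_mono)
qed

lemma abs_le_integral_derivative:
 fixes h h' :: "real => real"
 assumes d: "!!s. (h has_vector_derivative h' s) (at s)" and c: "CU h'" and z: "!!s. s < - R ==> h s = 0"
 shows "ennreal \<bar>h t\<bar> <= (NNL s. ennreal \<bar>h' s\<bar>)"
proof -
 define a where "a = min t (- R - 1)"
 have a: "a <= t" "h a = 0" using z[of a] by (auto simp: a_def)
 have [measurable]: "h' \<in> BM" using c by (rule borel_measurable_continuous_onI)
 have "(LBINT x. indicator {a..t} x *R h' x) = h t - h a"
  by (rule integral_FTC_Icc[OF a(1)]) (use d c in \<open>auto intro: has_vector_derivative_at_within continuous_on_subset\<close>)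
 moreover have "IL (%x. indicator {a..t} x *R h' x)"
  by (rule borel_integrable_compact) (auto intro: continuous_on_subset[OF c])
 ultimately have "ennreal \<bar>h t\<bar> <= (NNL x. ennreal (norm (indicator {a..t} x *R h' x)))"
  using integral_norm_bound_ennreal[of lborel "%x. indicator {a..t} x *R h' x"] a by simp
 also have "\<dots> <= (NNL s. ennreal \<bar>h' s\<bar>)"
  by (rule nn_integral_mono) (auto simp: indicator_def)
 finally show ?thesis .
qed

lemma ennreal_sqrt_square: "A ~= top ==> (ennreal (sqrt (enn2real A)))^2 = A"
 by (cases A) (simp_all add: ennreal_power)

text \<open>The Gagliardo-Nirenberg argument for f^4. Along each axis f^4 is at most the line
  integral of 4 |f|^3 |g j|; Loomis-Whitney combines the three lines, and Cauchy-Schwarz splits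
  |f|^3 from the derivative, which brings the integral of |f|^6 back on the right, where it is
  cancelled. The constant is 4096 = (4^2)^3.\<close>

lemma Sobolev_aux:
 fixes f :: "vec3 => real" and g :: "3 => vec3 => real"
 assumes c: "CU f" and d: "!!j. dirderiv (axis j 1) f (g j)"
  and cg: "!!j. CU (g j)" and s: "!!x. norm x > R ==> f x = 0"
 shows "(NNL x. ennreal (\<bar>f x\<bar> ^ 6)) <=
  4096 * ((NNL x. ennreal ((g 1 x)^2)) * ((NNL x. ennreal ((g 2 x)^2)) * (NNL x. ennreal ((g 3 x)^2))))"
proof -
 have [measurable]: "f \<in> BM" "!!j. g j \<in> BM"
  using c cg by (auto intro: borel_measurable_continuous_onI)
 have g0: "norm x > R ==> g j x = 0" for j x by (rule dirderiv_support[OF d s])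
 define G where "G j x = 4 * (\<bar>f x\<bar> ^ 3 * \<bar>g j x\<bar>)" for j x
 have [measurable]: "G j \<in> BM" for j unfolding G_def by measurable
 have iG: "IL (G j)" for j
  unfolding G_def by (rule continuous_compact_support_integrable[where R=R]) (use c cg s in \<open>auto intro!: continuous_intros\<close>)
 have line: "((%s. f (x + s *R axis j 1) ^ 4) has_vector_derivative 4 * f (x + s *R axis j 1) ^ 3 * g j (x + s *R axis j 1)) (at s)" for x s j
  using dirderivD[OF d, of x j s] unfolding has_real_derivative_iff_has_vector_derivative[symmetric]
  by (auto intro!: derivative_eq_intros)
 have lc: "CU (%s. 4 * f (x + s *R axis j 1) ^ 3 * g j (x + s *R axis j 1))" for x j
  by (intro continuous_intros continuous_on_compose2[OF c] continuous_on_compose2[OF cg]) auto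
 have key: "ennreal (f x ^ 4) <= (NNL s. ennreal (G j (x + s *R axis j 1)))" for x j
 proof -
  have "ennreal \<bar>f (x + 0 *R axis j 1) ^ 4\<bar> <= (NNL s. ennreal \<bar>4 * f (x + s *R axis j 1) ^ 3 * g j (x + s *R axis j 1)\<bar>)"
  proof (rule abs_le_integral_derivative[OF line lc])
   fix s assume s': "s < - (\<bar>R\<bar> + norm x)"
   have "norm (s *R (axis j 1 :: vec3)) = \<bar>s\<bar>" by simp
   then have "norm (x + s *R axis j 1) > R"
    using s' norm_triangle_ineq2[of "s *R (axis j 1 :: vec3)" "- x"] by (simp add: add.commute)
   then show "f (x + s *R axis j 1) ^ 4 = 0" using s by simp
  qed
  then show ?thesis by (simp add: G_def abs_mult power_abs mult.assoc)
 qed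
 define A1 where "A1 p = (NNL x. ennreal (G 1 (vec3of (x, fst p, snd p))))" for p
 define A2 where "A2 p = (NNL y. ennreal (G 2 (vec3of (fst p, y, snd p))))" for p
 define A3 where "A3 p = (NNL z. ennreal (G 3 (vec3of (fst p, snd p, z))))" for p
 have mA[measurable]: "A1 \<in> BM" "A2 \<in> BM" "A3 \<in> BM"
  unfolding A1_def A2_def A3_def borel_prod[symmetric] by measurable
 have shift: "(NNL s. h (a + s)) = (NNL s. h s)" if [measurable]: "h \<in> BM" for h :: "real => ennreal" and a
  using nn_integral_real_affine[of h 1 a] by simp
 have v1: "vec3of (x, y, z) + s *R axis 1 1 = vec3of (x + s, y, z)"
  and v2: "vec3of (x, y, z) + s *R axis 2 1 = vec3of (x, y + s, z)"
  and v3: "vec3of (x, y, z) + s *R axis 3 1 = vec3of (x, y, z + s)" for x y z s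
  by (simp_all add: vec_eq_iff forall_3 axis_def)
 have k1: "ennreal (f (vec3of (x, y, z)) ^ 4) <= A1 (y, z)" for x y z
  using key[of "vec3of (x, y, z)" 1] shift[of "%s. ennreal (G 1 (vec3of (s, y, z)))" x] by (simp add: v1 A1_def)
 have k2: "ennreal (f (vec3of (x, y, z)) ^ 4) <= A2 (x, z)" for x y z
  using key[of "vec3of (x, y, z)" 2] shift[of "%s. ennreal (G 2 (vec3of (x, s, z)))" y] by (simp add: v2 A2_def)
 have k3: "ennreal (f (vec3of (x, y, z)) ^ 4) <= A3 (x, y)" for x y z
  using key[of "vec3of (x, y, z)" 3] shift[of "%s. ennreal (G 3 (vec3of (x, y, s)))" z] by (simp add: v3 A3_def)
 \<comment> \<open>Every line integral is finite, so passing to real numbers for the square roots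
   below loses nothing.\<close>
 have fin1: "(NNL s. ennreal (G j (v + s *R axis j 1))) ~= top" for j v
 proof -
  have "IL (%s. G j (v + s *R axis j 1))"
  proof (rule continuous_compact_support_integrable[where R="\<bar>R\<bar> + norm v"])
   show "CU (%s. G j (v + s *R axis j 1))"
    unfolding G_def by (intro continuous_intros continuous_on_compose2[OF c] continuous_on_compose2[OF cg]) auto
   fix s :: real assume s': "\<bar>R\<bar> + norm v < norm s"
   have "norm (s *R (axis j 1 :: vec3)) = \<bar>s\<bar>" by simp
   then have "norm (v + s *R axis j 1) > R"
    using s' norm_triangle_ineq2[of "s *R (axis j 1 :: vec3)" "- v"] by (simp add: add.commute)
   then show "G j (v + s *R axis j 1) = 0" using s by (simp add: G_def)
  qed
  then show ?thesis unfolding integrable_iff_bounded by (auto simp: G_def)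
 qed
 have fA: "A1 p ~= top" "A2 p ~= top" "A3 p ~= top" for p
  using fin1[of 1 "vec3of (0, fst p, snd p)"] fin1[of 2 "vec3of (fst p, 0, snd p)"] fin1[of 3 "vec3of (fst p, snd p, 0)"]
  by (cases p; simp add: A1_def A2_def A3_def v1 v2 v3)+
 \<comment> \<open>|f|^6 is the product of three copies of (f^4)^(1/2), one for each axis, so the
   factors fed into Loomis-Whitney are the square roots of the line integrals.\<close>
 define S where "S A p = ennreal (sqrt (enn2real (A p)))" for A :: "real \<times> real => ennreal" and p
 have sq: "ennreal (v^2) <= S A p" if "ennreal (v ^ 4) <= A p" "A p ~= top" for v A p
 proof -
  have "v ^ 4 <= enn2real (A p)" using that by (cases "A p") (auto simp: ennreal_le_iff2)
  then have "sqrt (v ^ 4) <= sqrt (enn2real (A p))" by simp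
  moreover have "sqrt (v ^ 4) = v^2" by (rule real_sqrt_unique) (auto simp flip: power_mult)
  ultimately show ?thesis by (auto simp: S_def intro: ennreal_leI)
 qed
 define X where "X = (NNL x. ennreal (\<bar>f x\<bar> ^ 6))"
 define Q where "Q j = (NNL x. ennreal (G j x))" for j
 define P where "P j = (NNL x. ennreal ((g j x)^2))" for j
 have X: "X = (NNL x. NNL y. NNL z. ennreal (\<bar>f (vec3of (x, y, z))\<bar> ^ 6))"
  unfolding X_def by (rule nn_integral_vec3) measurable
 also have "\<dots> <= (NNL x. NNL y. NNL z. S A1 (y, z) * S A2 (x, z) * S A3 (x, y))"
 proof (intro nn_integral_mono)
  fix x y z
  let ?v = "f (vec3of (x, y, z))"
  have "ennreal (\<bar>?v\<bar> ^ 6) = ennreal (?v^2) * ennreal (?v^2) * ennreal (?v^2)"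
  proof -
   have "\<bar>?v\<bar> ^ 6 = ?v^2 * ?v^2 * ?v^2" by (simp add: power_even_abs flip: power_add)
   then show ?thesis by (simp only: ennreal_mult zero_le_power2 mult_nonneg_nonneg)
  qed
  also have "\<dots> <= S A1 (y, z) * S A2 (x, z) * S A3 (x, y)"
   by (intro mult_mono sq k1 k2 k3 fA) auto
  finally show "ennreal (\<bar>?v\<bar> ^ 6) <= S A1 (y, z) * S A2 (x, z) * S A3 (x, y)" .
 qed
 finally have "X^2 <= (NNL x. NNL y. NNL z. S A1 (y, z) * S A2 (x, z) * S A3 (x, y))^2"
  by (intro power_mono) auto
 also have "\<dots> <= (NNL y. NNL z. (S A1 (y, z))^2) * ((NNL x. NNL z. (S A2 (x, z))^2) * (NNL x. NNL y. (S A3 (x, y))^2))"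
  by (rule Loomis_Whitney) (auto simp: S_def)
 also have "\<dots> = (NNL y. NNL z. A1 (y, z)) * ((NNL x. NNL z. A2 (x, z)) * (NNL x. NNL y. A3 (x, y)))"
  unfolding S_def by (simp add: ennreal_sqrt_square fA)
 also have "(NNL y. NNL z. A1 (y, z)) = Q 1"
 proof -
  have "(NNL y. NNL z. A1 (y, z)) = (NNL y. NNL x. NNL z. ennreal (G 1 (vec3of (x, y, z))))"
   unfolding A1_def fst_conv snd_conv by (intro nn_integral_cong lborel_pair.Fubini') measurable
  also have "\<dots> = (NNL x. NNL y. NNL z. ennreal (G 1 (vec3of (x, y, z))))"
   by (rule lborel_pair.Fubini') measurable
  also have "\<dots> = Q 1" unfolding Q_def by (rule nn_integral_vec3[symmetric]) measurable
  finally show ?thesis .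
 qed
 also have "(NNL x. NNL z. A2 (x, z)) = Q 2"
 proof -
  have "(NNL x. NNL z. A2 (x, z)) = (NNL x. NNL y. NNL z. ennreal (G 2 (vec3of (x, y, z))))"
   unfolding A2_def fst_conv snd_conv by (intro nn_integral_cong lborel_pair.Fubini') measurable
  also have "\<dots> = Q 2" unfolding Q_def by (rule nn_integral_vec3[symmetric]) measurable
  finally show ?thesis .
 qed
 also have "(NNL x. NNL y. A3 (x, y)) = Q 3"
  unfolding Q_def A3_def fst_conv snd_conv by (rule nn_integral_vec3[symmetric]) measurable
 finally have X2: "X^2 <= Q 1 * (Q 2 * Q 3)" .
 have Q2: "(Q j)^2 <= 16 * (X * P j)" for j
 proof -
  have "Q j = (NNL x. ennreal (4 * \<bar>f x\<bar> ^ 3) * ennreal \<bar>g j x\<bar>)"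
   unfolding Q_def G_def by (intro nn_integral_cong) (simp add: ennreal_mult mult.assoc flip: ennreal_numeral)
  then have "(Q j)^2 <= (NNL x. (ennreal (4 * \<bar>f x\<bar> ^ 3))^2) * (NNL x. (ennreal \<bar>g j x\<bar>)^2)"
   using Cauchy_Schwarz_nn_integral[of "%x. ennreal (4 * \<bar>f x\<bar> ^ 3)" lborel "%x. ennreal \<bar>g j x\<bar>"] by simp
  also have "(NNL x. (ennreal \<bar>g j x\<bar>)^2) = P j" by (simp add: P_def ennreal_power)
  also have "(NNL x. (ennreal (4 * \<bar>f x\<bar> ^ 3))^2) = (NNL x. 16 * ennreal (\<bar>f x\<bar> ^ 6))"
   by (intro nn_integral_cong) (simp add: ennreal_power power_mult_distrib ennreal_mult flip: power_mult)
  also have "\<dots> = 16 * X" by (simp add: nn_integral_cmult X_def)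
  finally show ?thesis by (simp add: mult.assoc)
 qed
 have Xfin: "X ~= top"
 proof -
  have "IL (%x. \<bar>f x\<bar> ^ 6)"
   by (rule continuous_compact_support_integrable[where R=R]) (use c s in \<open>auto intro!: continuous_intros\<close>)
  then show ?thesis unfolding integrable_iff_bounded X_def by (auto simp: power_abs)
 qed
 have "X <= 4096 * (P 1 * (P 2 * P 3))"
 proof (cases "X = 0")
  case False
  \<comment> \<open>Squaring X^2 <= Q 1 Q 2 Q 3 and inserting the Cauchy-Schwarz bounds gives X^4 <=
    X^3 times the claimed right-hand side; X is finite and nonzero here, so X^3 cancels.\<close>
  have "X ^ 3 * X = (X^2)^2" by (simp add: eval_nat_numeral mult_ac)
  also have "\<dots> <= (Q 1 * (Q 2 * Q 3))^2" by (intro power_mono X2) auto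
  also have "\<dots> = (Q 1)^2 * ((Q 2)^2 * (Q 3)^2)" by (simp add: power_mult_distrib)
  also have "\<dots> <= (16 * (X * P 1)) * ((16 * (X * P 2)) * (16 * (X * P 3)))" by (intro mult_mono Q2) auto
  also have "\<dots> = X ^ 3 * (4096 * (P 1 * (P 2 * P 3)))"
  proof -
   have e: "(a * (X * x)) * ((b * (X * y)) * (d * (X * z))) = X ^ 3 * ((a * (b * d)) * (x * (y * z)))" for a b d x y z :: ennreal
    by (simp add: power3_eq_cube mult_ac)
   have "(16::ennreal) * (16 * 16) = 4096" by (simp flip: ennreal_numeral ennreal_mult)
   then show ?thesis unfolding e by simp
  qed
  finally show ?thesis
   using False Xfin ennreal_mult_le_mult_iff[of "X ^ 3" X "4096 * (P 1 * (P 2 * P 3))"] by (simp add: power_eq_top_ennreal)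
 qed simp
 then show ?thesis by (simp add: X_def P_def)
qed

lemma Cinf_dirderiv:
 fixes f :: "'a::euclidean_space => 'b::euclidean_space"
 assumes f: "Cinf_on UNIV f" and b: "b \<in> Basis"
 obtains g where "dirderiv b f g" "CU g"
proof -
 have "\<forall>c\<in>(Basis::'b set). \<exists>g. dirderiv b (%x. f x <.> c) g & CU g"
 proof
  fix c :: 'b assume "c \<in> Basis"
  then have "Ck (Suc 0) UNIV (%x. f x <.> c)" using f unfolding Cinf_on_def by blast
  from Ck_SucE[OF this] show "\<exists>g. dirderiv b (%x. f x <.> c) g & CU g"
   using b by (metis Ck_continuous)
 qed
 then obtain g where g: "!!c. c \<in> Basis ==> dirderiv b (%x. f x <.> c) (g c)" "!!c. c \<in> Basis ==> CU (g c)"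
  by metis
 have "dirderiv b f (%x. \<Sum>c\<in>Basis. g c x *R c)"
  unfolding dirderiv_def
 proof
  fix x
  have "((%s. \<Sum>c\<in>Basis. (f (x + s *R b) <.> c) *R c) has_vector_derivative (\<Sum>c\<in>Basis. g c x *R c)) (at 0)"
  proof (rule has_vector_derivative_sum)
   fix c :: 'b assume c: "c \<in> Basis"
   show "((%s. (f (x + s *R b) <.> c) *R c) has_vector_derivative g c x *R c) (at 0)"
    using has_vector_derivative_scaleR[of "%s. f (x + s *R b) <.> c" "g c x" 0 UNIV "%_. c" 0] g(1)[OF c]
    by (simp add: dirderiv_def has_real_derivative_iff_has_vector_derivative)
  qed
  then show "((%s. f (x + s *R b)) has_vector_derivative (\<Sum>c\<in>Basis. g c x *R c)) (at 0)"
   by (simp add: euclidean_representation)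
 qed
 moreover have "CU (%x. \<Sum>c\<in>Basis. g c x *R c)" by (intro continuous_intros g)
 ultimately show ?thesis using that by blast
qed

lemma Cinf_continuous:
 fixes f :: "'a::euclidean_space => 'b::euclidean_space"
 assumes f: "Cinf_on UNIV f"
 shows "CU f"
proof -
 have "CU (%x. \<Sum>c\<in>Basis. (f x <.> c) *R c)"
 proof (rule continuous_on_sum, rule continuous_on_scaleR[OF _ continuous_on_const])
  fix c :: 'b assume "c \<in> Basis"
  then have "Ck 0 UNIV (%x. f x <.> c)" using f unfolding Cinf_on_def by blast
  then show "CU (%x. f x <.> c)" by (rule Ck_continuous)
 qed
 then show ?thesis by (simp add: euclidean_representation)
qed

lemma Cinf_pdx:
 fixes f :: "vec3 => 'b::euclidean_space"
 assumes f: "Cinf_on UNIV f"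
 shows "dirderiv (axis j 1) f (pdx j f)" and "CU (pdx j f)"
proof -
 have "axis j 1 \<in> (Basis :: vec3 set)" by (simp add: axis_in_Basis_iff)
 from Cinf_dirderiv[OF f this] obtain g where g: "dirderiv (axis j 1) f g" "CU g" .
 then have "pdx j f = g" using dirderiv_pdx[OF g(1)] by auto
 then show "dirderiv (axis j 1) f (pdx j f)" "CU (pdx j f)" using g by auto
qed

lemma Cc_infE:
 assumes "Cc_inf U f"
 obtains R where "Cinf_on UNIV f" "R > 0" "!!x. norm x > R ==> f x = 0" "!!x. x \<notin> U ==> f x = 0"
proof -
 obtain K where K: "compact K" "K \<subseteq> U" "!!x. x \<notin> K ==> f x = 0" "Cinf_on UNIV f"
  using assms unfolding Cc_inf_def by blast
 obtain R where "R > 0" "\<forall>x\<in>K. norm x <= R" using compact_imp_bounded[OF K(1)] unfolding bounded_pos by blast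
 then show ?thesis using that[of R] K by force
qed

lemma dirderiv_component:
 assumes "dirderiv b f g"
 shows "dirderiv b (%x. f x $ i) (%x. g x $ i)"
 using assms unfolding dirderiv_def
 by (auto intro: bounded_linear.has_vector_derivative[OF bounded_linear_vec_nth])

lemma norm_vec3_power6:
 fixes v :: vec3
 shows "norm v ^ 6 <= 9 * (\<bar>v $ 1\<bar> ^ 6 + \<bar>v $ 2\<bar> ^ 6 + \<bar>v $ 3\<bar> ^ 6)"
proof -
 have cube: "(a + b + c) ^ 3 <= 9 * (a ^ 3 + b ^ 3 + c ^ 3)" if "a >= 0" "b >= 0" "c >= 0" for a b c :: real
 proof -
  \<comment> \<open>The right-hand side of the claim exceeds the left by three times the sum of the
    first three products plus the fourth.\<close>
  have "0 <= (a + b) * (a - b)^2" "0 <= (b + c) * (b - c)^2" "0 <= (a + c) * (a - c)^2"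
    "0 <= (a + b + c) * ((a - b)^2 + (b - c)^2 + (a - c)^2)" using that by auto
  then show ?thesis by (simp add: power2_eq_square power3_eq_cube algebra_simps)
 qed
 have "norm v ^ 6 = ((norm v)^2) ^ 3" by (simp flip: power_mult)
 also have "(norm v)^2 = (v$1)^2 + (v$2)^2 + (v$3)^2"
  unfolding power2_norm_eq_inner by (simp add: inner_vec_def sum_3 power2_eq_square)
 also have "\<dots> ^ 3 <= 9 * (((v$1)^2) ^ 3 + ((v$2)^2) ^ 3 + ((v$3)^2) ^ 3)" by (rule cube) auto
 also have "\<dots> = 9 * (\<bar>v $ 1\<bar> ^ 6 + \<bar>v $ 2\<bar> ^ 6 + \<bar>v $ 3\<bar> ^ 6)" by (simp add: power_even_abs flip: power_mult)
 finally show ?thesis .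
qed

lemma abs_entry_le_norm: "\<bar>(A::real^'n^'m) $ i $ j\<bar> <= norm A"
 by (rule order_trans[OF component_le_norm_cart Finite_Cartesian_Product.norm_nth_le])

text \<open>The scalar inequality for each component. The constant is 110592 = 9 * 3 * 4096, with 9
  from \<open>norm_vec3_power6\<close> and 3 from the number of components.\<close>

lemma Sobolev_Cc_inf:
 fixes ph :: "vec3 => vec3"
 assumes ph: "Cc_inf U ph"
 shows "(NNL x. ennreal (norm (ph x) ^ 6)) <= 110592 * (NNL x. nsq (gradv ph x)) ^ 3"
proof -
 obtain R where c: "Cinf_on UNIV ph" and s: "!!x. norm x > R ==> ph x = 0" using Cc_infE[OF ph] by metis
 have [measurable]: "ph \<in> BM" by (rule borel_measurable_continuous_onI[OF Cinf_continuous[OF c]])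
 define P where "P = (NNL x. nsq (gradv ph x))"
 have comp: "(NNL x. ennreal (\<bar>ph x $ i\<bar> ^ 6)) <= 4096 * P ^ 3" for i
 proof -
  have le: "(NNL x. ennreal ((pdx j ph x $ i)^2)) <= P" for j
   unfolding P_def
  proof (intro nn_integral_mono ennreal_leI)
   fix x
   have "\<bar>pdx j ph x $ i\<bar> <= norm (gradv ph x)" using abs_entry_le_norm[of "gradv ph x" i j] by (simp add: gradv_def)
   then show "(pdx j ph x $ i)^2 <= (norm (gradv ph x))^2" using abs_le_square_iff by fastforce
  qed
  have "(NNL x. ennreal (\<bar>ph x $ i\<bar> ^ 6)) <=
   4096 * ((NNL x. ennreal ((pdx 1 ph x $ i)^2)) * ((NNL x. ennreal ((pdx 2 ph x $ i)^2)) * (NNL x. ennreal ((pdx 3 ph x $ i)^2))))"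
   by (rule Sobolev_aux[where R=R and g="%j x. pdx j ph x $ i"])
    (use s in \<open>auto intro!: dirderiv_component Cinf_pdx[OF c] continuous_intros Cinf_continuous[OF c]\<close>)
  also have "\<dots> <= 4096 * (P * (P * P))" by (intro mult_left_mono mult_mono le) auto
  finally show ?thesis by (simp add: power3_eq_cube mult.assoc)
 qed
 have "(NNL x. ennreal (norm (ph x) ^ 6)) <=
  (NNL x. 9 * (ennreal (\<bar>ph x $ 1\<bar> ^ 6) + ennreal (\<bar>ph x $ 2\<bar> ^ 6) + ennreal (\<bar>ph x $ 3\<bar> ^ 6)))"
 proof (rule nn_integral_mono)
  fix x
  have "ennreal (norm (ph x) ^ 6) <= ennreal (9 * (\<bar>ph x $ 1\<bar> ^ 6 + \<bar>ph x $ 2\<bar> ^ 6 + \<bar>ph x $ 3\<bar> ^ 6))"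
   by (intro ennreal_leI norm_vec3_power6)
  then show "ennreal (norm (ph x) ^ 6) <= 9 * (ennreal (\<bar>ph x $ 1\<bar> ^ 6) + ennreal (\<bar>ph x $ 2\<bar> ^ 6) + ennreal (\<bar>ph x $ 3\<bar> ^ 6))"
   by (simp add: ennreal_mult)
 qed
 also have "\<dots> <= 9 * ((NNL x. ennreal (\<bar>ph x $ 1\<bar> ^ 6)) + (NNL x. ennreal (\<bar>ph x $ 2\<bar> ^ 6)) + (NNL x. ennreal (\<bar>ph x $ 3\<bar> ^ 6)))"
 proof -
  define a where "a i x = ennreal (\<bar>ph x $ i\<bar> ^ 6)" for i x
  have [measurable]: "a i \<in> borel_measurable lborel" for i unfolding a_def by measurable
  show ?thesis unfolding a_def[symmetric] by (simp add: nn_integral_cmult nn_integral_add)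
 qed
 also have "\<dots> <= 9 * (4096 * P ^ 3 + 4096 * P ^ 3 + 4096 * P ^ 3)"
  by (intro mult_left_mono add_mono comp) auto
 also have "\<dots> = 110592 * P ^ 3"
 proof -
  have "(9::ennreal) * (4096 + 4096 + 4096) = 110592" by (simp flip: ennreal_numeral ennreal_mult ennreal_plus)
  then show ?thesis by (metis distrib_right mult.assoc)
 qed
 finally show ?thesis by (simp add: P_def)
qed

lemma norm_diff_power2_le:
 fixes x y z :: "'b::real_normed_vector"
 shows "nsq (x - z) <= 2 * nsq (x - y) + 2 * nsq (z - y)"
proof -
 have "norm (x - z) <= norm (x - y) + norm (z - y)"
  using norm_triangle_ineq4[of "x - y" "z - y"] by simp
 then have "(norm (x - z))^2 <= (norm (x - y) + norm (z - y))^2" by (intro power_mono) auto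
 also have "\<dots> <= 2 * (norm (x - y))^2 + 2 * (norm (z - y))^2"
  using zero_le_power2[of "norm (x - y) - norm (z - y)"] by (simp add: power2_eq_square algebra_simps)
 finally have "nsq (x - z) <= ennreal (2 * (norm (x - y))^2 + 2 * (norm (z - y))^2)" by (rule ennreal_leI)
 then show ?thesis by (simp add: ennreal_mult)
qed

lemma pdx_diff:
 fixes f g :: "vec3 => 'b::euclidean_space"
 assumes "Cinf_on UNIV f" "Cinf_on UNIV g"
 shows "pdx j (%x. f x - g x) = (%x. pdx j f x - pdx j g x)"
proof
 fix x
 have "dirderiv (axis j 1) (%x. f x - g x) (%x. pdx j f x - pdx j g x)"
  using Cinf_pdx(1)[OF assms(1)] Cinf_pdx(1)[OF assms(2)] unfolding dirderiv_def
  by (auto intro!: has_vector_derivative_diff)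
 from dirderiv_pdx[OF this] show "pdx j (%x. f x - g x) x = pdx j f x - pdx j g x" .
qed

lemma Cc_inf_diff:
 fixes f g :: "'a::euclidean_space => 'b::euclidean_space"
 assumes f: "Cc_inf U f" and g: "Cc_inf U g"
 shows "Cc_inf U (%x. f x - g x)"
proof -
 obtain K where K: "compact K" "K \<subseteq> U" "!!x. x \<notin> K ==> f x = 0" "Cinf_on UNIV f"
  using f unfolding Cc_inf_def by blast
 obtain L where L: "compact L" "L \<subseteq> U" "!!x. x \<notin> L ==> g x = 0" "Cinf_on UNIV g"
  using g unfolding Cc_inf_def by blast
 have "Ck k UNIV (%x. (f x - g x) <.> b)" if b: "b \<in> Basis" for k b
 proof -
  have "Ck k UNIV (%x. f x <.> b + (- 1) * (g x <.> b))"
   using K(4) L(4) b unfolding Cinf_on_def by (intro Ck_add Ck_cmult) blast+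
  then show ?thesis by (simp add: inner_diff_left)
 qed
 then have "Cinf_on UNIV (%x. f x - g x)" unfolding Cinf_on_def by auto
 then show ?thesis unfolding Cc_inf_def
  using K L by (intro conjI exI[of _ "K \<union> L"]) auto
qed

lemma Cc_inf_0: "Cc_inf U (%x::'a::euclidean_space. 0::'b::euclidean_space)"
 unfolding Cc_inf_def Cinf_on_def by (auto simp: Ck_const intro: exI[of _ "{}"])

lemma measurable_pdx:
 fixes f :: "vec3 => 'b::euclidean_space"
 assumes "Cinf_on UNIV f" shows "pdx j f \<in> BM"
 by (rule borel_measurable_continuous_onI[OF Cinf_pdx(2)[OF assms]])

lemma continuous_gradv: "Cinf_on UNIV f ==> CU (gradv f)"
 unfolding gradv_def by (intro continuous_on_vec_lambda continuous_on_component Cinf_pdx)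

lemma measurable_gradv: "Cinf_on UNIV f ==> gradv f \<in> BM"
 by (rule borel_measurable_continuous_onI[OF continuous_gradv])

lemma Cc_inf_Cinf: "Cc_inf U f ==> Cinf_on UNIV f"
 by (simp add: Cc_inf_def)

lemma measurable_Cinf:
 fixes f :: "'a::euclidean_space => 'b::euclidean_space"
 shows "Cinf_on UNIV f ==> f \<in> BM"
 by (rule borel_measurable_continuous_onI[OF Cinf_continuous])

text \<open>The limit of the inequality for \<open>ph n\<close> - \<open>ps\<close>: Fatou along an
  almost everywhere convergent subsequence on the left, convergence of the gradients on the right.
  Taking \<open>ps\<close> from the approximating sequence later shows that the approximation is
  also small in L^6.\<close>

lemma Sobolev_H10:
 fixes u :: "vec3 => vec3" and G :: "vec3 => mat3"
 assumes [measurable]: "u \<in> BM" "G \<in> BM"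
  and ph: "!!n. Cc_inf U (ph n)" and ps: "Cc_inf U ps"
  and lim: "(%n. NNL x. ennreal ((norm (ph n x - u x))^2 + (norm (gradv (ph n) x - G x))^2)) ~> 0"
 shows "(NNL x. ennreal (norm (u x - ps x) ^ 6)) <=
  110592 * (2 * (NNL x. nsq (G x - gradv ps x))) ^ 3"
proof -
 note [measurable] = measurable_Cinf[OF Cc_inf_Cinf[OF ph]] measurable_Cinf[OF Cc_inf_Cinf[OF ps]]
  measurable_gradv[OF Cc_inf_Cinf[OF ph]] measurable_gradv[OF Cc_inf_Cinf[OF ps]]
 define e where "e n = (NNL x. ennreal ((norm (ph n x - u x))^2 + (norm (gradv (ph n) x - G x))^2))" for n
 define D where "D = (NNL x. nsq (G x - gradv ps x))"
 have e: "e ~> 0" using lim by (simp add: e_def[abs_def])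
 have "\<exists>s. strict_mono s & (AL x. (%n. (norm (ph (s n) x - u x))^2) ~> 0)"
 proof -
  have e1: "(%n. NNL x. ennreal (norm ((norm (ph n x - u x))^2))) ~> 0"
   by (rule tendsto_sandwich[OF _ _ tendsto_const e]) (auto simp: e_def intro!: nn_integral_mono ennreal_leI always_eventually)
  \<comment> \<open>Finitely many members may be at infinite L^2 distance from u. Dropping them
    leaves integrable functions, as the extraction of a convergent subsequence demands.\<close>
  obtain N where N: "!!n. n >= N ==> (NNL x. ennreal (norm ((norm (ph n x - u x))^2))) < 1"
   using order_tendstoD(2)[OF e1, of 1] by (auto simp: eventually_sequentially)
  have i: "IL (%x. (norm (ph (n + N) x - u x))^2)" for n
   unfolding integrable_iff_bounded using N[of "n + N"] by (auto intro: less_trans)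
  have "(%n. ennreal (LBINT x. norm ((norm (ph (n + N) x - u x))^2))) ~> ennreal 0"
   using LIMSEQ_ignore_initial_segment[OF e1, of N] nn_integral_eq_integral[OF integrable_norm[OF i]] by simp
  then have "(%n. LBINT x. norm ((norm (ph (n + N) x - u x))^2)) ~> 0"
   by (subst (asm) tendsto_ennreal_iff) auto
  from tendsto_L1_AE_subseq[OF i this] obtain r where "strict_mono r" "AL x. (%n. (norm (ph (r n + N) x - u x))^2) ~> 0" by blast
  then show ?thesis by (intro exI[of _ "%n. r n + N"]) (auto simp: strict_mono_def)
 qed
 then obtain s where s: "strict_mono s" "AL x. (%n. (norm (ph (s n) x - u x))^2) ~> 0" by blast
 have es: "(%n. e (s n)) ~> 0" using LIMSEQ_subseq_LIMSEQ[OF e s(1)] by (simp add: o_def)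
 have bd: "(NNL x. ennreal (norm (ph n x - ps x) ^ 6)) <= 110592 * (2 * e n + 2 * D) ^ 3" for n
 proof -
  have "(NNL x. ennreal (norm (ph n x - ps x) ^ 6)) <= 110592 * (NNL x. nsq (gradv (%x. ph n x - ps x) x)) ^ 3"
   by (rule Sobolev_Cc_inf[OF Cc_inf_diff[OF ph ps]])
  also have "(NNL x. nsq (gradv (%x. ph n x - ps x) x)) <=
   (NNL x. 2 * ennreal ((norm (ph n x - u x))^2 + (norm (gradv (ph n) x - G x))^2) + 2 * nsq (G x - gradv ps x))"
  proof (rule nn_integral_mono)
   fix x
   have "gradv (%x. ph n x - ps x) x = gradv (ph n) x - gradv ps x"
    by (simp add: gradv_def pdx_diff[OF Cc_inf_Cinf[OF ph] Cc_inf_Cinf[OF ps]] vec_eq_iff)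
   then have "nsq (gradv (%x. ph n x - ps x) x) <= 2 * nsq (gradv (ph n) x - G x) + 2 * nsq (gradv ps x - G x)"
    by (simp only:) (rule norm_diff_power2_le)
   also have "\<dots> <= 2 * ennreal ((norm (ph n x - u x))^2 + (norm (gradv (ph n) x - G x))^2) + 2 * nsq (G x - gradv ps x)"
    by (intro add_mono mult_left_mono ennreal_leI) (auto simp: norm_minus_commute)
   finally show "nsq (gradv (%x. ph n x - ps x) x) <= \<dots>" .
  qed
  also have "\<dots> = 2 * e n + 2 * D"
   unfolding e_def D_def by (subst nn_integral_add) (auto simp: nn_integral_cmult simp del: ennreal_plus)
  finally show ?thesis by (simp add: mult_left_mono power_mono)
 qed
 have "(NNL x. ennreal (norm (u x - ps x) ^ 6)) = (NNL x. liminf (%n. ennreal (norm (ph (s n) x - ps x) ^ 6)))"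
 proof (rule nn_integral_cong_AE, rule AE_mp[OF s(2)], intro AE_I2 impI)
  fix x assume "(%n. (norm (ph (s n) x - u x))^2) ~> 0"
  then have "(%n. sqrt ((norm (ph (s n) x - u x))^2)) ~> sqrt 0" by (rule tendsto_real_sqrt)
  then have "(%n. norm (ph (s n) x - u x)) ~> 0" by simp
  then have "(%n. ph (s n) x) ~> u x" by (simp add: tendsto_norm_zero_iff LIM_zero_iff)
  then have "(%n. ennreal (norm (ph (s n) x - ps x) ^ 6)) ~> ennreal (norm (u x - ps x) ^ 6)"
   by (intro tendsto_ennrealI tendsto_intros)
  then show "ennreal (norm (u x - ps x) ^ 6) = liminf (%n. ennreal (norm (ph (s n) x - ps x) ^ 6))"
   using lim_imp_Liminf[OF sequentially_bot] by metis
 qed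
 also have "\<dots> <= liminf (%n. NNL x. ennreal (norm (ph (s n) x - ps x) ^ 6))"
  by (rule nn_integral_liminf) measurable
 also have "\<dots> <= liminf (%n. 110592 * (2 * e (s n) + 2 * D) ^ 3)"
  by (intro Liminf_mono always_eventually allI bd)
 also have "\<dots> <= 110592 * (2 * D) ^ 3"
 proof (cases "D = top")
  case False
  have "(%n. 2 * e (s n)) ~> 2 * 0" by (intro ennreal_tendsto_cmult es) simp
  then have "(%n. 2 * e (s n) + 2 * D) ~> 2 * 0 + 2 * D" by (intro tendsto_add tendsto_const)
  then have t: "(%n. 2 * e (s n) + 2 * D) ~> 2 * D" by simp
  have "(%n. (2 * e (s n) + 2 * D) ^ 3) ~> (2 * D) ^ 3"
   unfolding power3_eq_cube using False by (intro tendsto_mult_ennreal t) (auto simp: ennreal_mult_eq_top_iff)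
  then have "(%n. 110592 * (2 * e (s n) + 2 * D) ^ 3) ~> 110592 * (2 * D) ^ 3"
   by (intro ennreal_tendsto_cmult) simp_all
  then show ?thesis using lim_imp_Liminf[OF sequentially_bot] by (metis order_refl)
 qed (simp add: ennreal_mult_eq_top_iff)
 finally show ?thesis by (simp add: D_def)
qed

section \<open>Hoelder inequalities and continuity of translations in time\<close>

lemma weighted_AMGM2:
 fixes x y al \<beta> :: real
 assumes "al > 0" "\<beta> > 0" "al + \<beta> = 1" "x >= 0" "y >= 0"
 shows "x powr al * y powr \<beta> <= al * x + \<beta> * y"
 using assms Youngs_inequality_0[of al \<beta> x y] by (cases "x = 0 \<or> y = 0") auto

lemma weighted_AMGM3:
 fixes x y z al \<beta> gm :: real
 assumes "al > 0" "\<beta> > 0" "gm > 0" "al + \<beta> + gm = 1" "x >= 0" "y >= 0" "z >= 0"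
 shows "x powr al * y powr \<beta> * z powr gm <= al * x + \<beta> * y + gm * z"
proof -
 define w where "w = y powr (\<beta> / (\<beta> + gm)) * z powr (gm / (\<beta> + gm))"
 have bc: "\<beta> + gm > 0" using assms by simp
 have "y powr \<beta> * z powr gm = w powr (\<beta> + gm)"
  using bc by (simp add: w_def powr_mult powr_powr)
 then have "x powr al * y powr \<beta> * z powr gm = x powr al * w powr (\<beta> + gm)" by (simp add: mult.assoc)
 also have "\<dots> <= al * x + (\<beta> + gm) * w" by (rule weighted_AMGM2) (use assms in \<open>auto simp: w_def\<close>)
 also have "w <= \<beta> / (\<beta> + gm) * y + gm / (\<beta> + gm) * z"
  unfolding w_def by (rule weighted_AMGM2) (use assms bc in \<open>auto simp: add_divide_distrib[symmetric]\<close>)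
 also have "(\<beta> + gm) * (\<beta> / (\<beta> + gm) * y + gm / (\<beta> + gm) * z) = \<beta> * y + gm * z"
 proof -
  have "k * (\<beta> / k * y + gm / k * z) = \<beta> * y + gm * z" if "k > 0" for k
   using that by (simp add: distrib_left)
  from this[OF bc] show ?thesis .
 qed
 finally show ?thesis using bc by (simp add: mult_left_mono)
qed

text \<open>After dividing by F, G, H this is weighted AM-GM under the integral. If one of the
  bounds is 0, the corresponding factor vanishes almost everywhere. Upper bounds in place of norms
  avoid a discussion of infinite norms.\<close>

lemma Hoelder3:
 fixes f g h :: "'a => real"
 assumes w: "al > 0" "\<beta> > 0" "gm > 0" "al + \<beta> + gm = 1"
  and [measurable]: "f \<in> borel_measurable M" "g \<in> borel_measurable M" "h \<in> borel_measurable M"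
  and nn: "!!x. f x >= 0" "!!x. g x >= 0" "!!x. h x >= 0" and FGH: "F >= 0" "G >= 0" "H >= 0"
  and le: "(\<integral>\<^sup>+x. ennreal (f x) \<partial>M) <= ennreal F" "(\<integral>\<^sup>+x. ennreal (g x) \<partial>M) <= ennreal G" "(\<integral>\<^sup>+x. ennreal (h x) \<partial>M) <= ennreal H"
 shows "(\<integral>\<^sup>+x. ennreal (f x powr al * g x powr \<beta> * h x powr gm) \<partial>M) <= ennreal (F powr al * G powr \<beta> * H powr gm)"
proof (cases "F = 0 \<or> G = 0 \<or> H = 0")
 case True
 have z: "AE x in M. k x = 0" if "K = 0" "(\<integral>\<^sup>+x. ennreal (k x) \<partial>M) <= ennreal K" "!!x. k x >= 0" "k \<in> borel_measurable M" for k :: "'a => real" and K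
  using that nn_integral_0_iff_AE[of "%x. ennreal (k x)" M] by (simp add: antisym)
 have "AE x in M. f x = 0 \<or> g x = 0 \<or> h x = 0"
  using True
 proof (elim disjE)
  assume "F = 0" from z[OF this le(1) nn(1)] show ?thesis by auto
 next
  assume "G = 0" from z[OF this le(2) nn(2)] show ?thesis by auto
 next
  assume "H = 0" from z[OF this le(3) nn(3)] show ?thesis by auto
 qed
 then have "AE x in M. ennreal (f x powr al * g x powr \<beta> * h x powr gm) = 0" by eventually_elim auto
 then have "(\<integral>\<^sup>+x. ennreal (f x powr al * g x powr \<beta> * h x powr gm) \<partial>M) = 0"
  by (subst nn_integral_0_iff_AE) auto
 then show ?thesis by simp
next
 case False
 then have p: "F > 0" "G > 0" "H > 0" using FGH by auto
 let ?c = "F powr al * G powr \<beta> * H powr gm"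
 have "(\<integral>\<^sup>+x. ennreal (f x powr al * g x powr \<beta> * h x powr gm) \<partial>M) <=
  (\<integral>\<^sup>+x. ennreal ?c * (ennreal (al / F) * ennreal (f x) + ennreal (\<beta> / G) * ennreal (g x) + ennreal (gm / H) * ennreal (h x)) \<partial>M)"
 proof (rule nn_integral_mono)
  fix x
  have "f x powr al * g x powr \<beta> * h x powr gm = ?c * ((f x / F) powr al * (g x / G) powr \<beta> * (h x / H) powr gm)"
   using p nn by (simp add: powr_divide field_simps)
  also have "\<dots> <= ?c * (al * (f x / F) + \<beta> * (g x / G) + gm * (h x / H))"
   using w p nn by (intro mult_left_mono weighted_AMGM3) auto
  finally have "ennreal (f x powr al * g x powr \<beta> * h x powr gm) <= ennreal (?c * (al / F * f x + \<beta> / G * g x + gm / H * h x))"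
   by (intro ennreal_leI) simp
  also have "\<dots> = ennreal ?c * (ennreal (al / F) * ennreal (f x) + ennreal (\<beta> / G) * ennreal (g x) + ennreal (gm / H) * ennreal (h x))"
   using w p nn by (simp add: ennreal_mult'[symmetric] ennreal_mult''[symmetric] flip: ennreal_plus)
  finally show "ennreal (f x powr al * g x powr \<beta> * h x powr gm) <= \<dots>" .
 qed
 also have "\<dots> = ennreal ?c * (ennreal (al / F) * (\<integral>\<^sup>+x. ennreal (f x) \<partial>M) + ennreal (\<beta> / G) * (\<integral>\<^sup>+x. ennreal (g x) \<partial>M) + ennreal (gm / H) * (\<integral>\<^sup>+x. ennreal (h x) \<partial>M))"
  by (simp add: nn_integral_cmult nn_integral_add)
 also have "\<dots> <= ennreal ?c * (ennreal (al / F) * ennreal F + ennreal (\<beta> / G) * ennreal G + ennreal (gm / H) * ennreal H)"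
  by (intro mult_left_mono add_mono le) auto
 also have "\<dots> = ennreal (?c * (al / F * F + \<beta> / G * G + gm / H * H))"
  using w p by (simp add: ennreal_mult'[symmetric] ennreal_mult''[symmetric] flip: ennreal_plus)
 also have "al / F * F + \<beta> / G * G + gm / H * H = 1" using p w by simp
 finally show ?thesis by simp
qed

text \<open>The second factor is split into two equal powers to fit the inequality with three
  factors.\<close>

lemma Hoelder2:
 fixes f g :: "'a => real"
 assumes w: "p > 1" "q > 1" "1 / p + 1 / q = 1"
  and [measurable]: "f \<in> borel_measurable M" "g \<in> borel_measurable M"
  and nn: "!!x. f x >= 0" "!!x. g x >= 0" and FG: "F >= 0" "G >= 0"
  and le: "(\<integral>\<^sup>+x. ennreal (f x powr p) \<partial>M) <= ennreal (F powr p)" "(\<integral>\<^sup>+x. ennreal (g x powr q) \<partial>M) <= ennreal (G powr q)"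
 shows "(\<integral>\<^sup>+x. ennreal (f x * g x) \<partial>M) <= ennreal (F * G)"
proof -
 have "(\<integral>\<^sup>+x. ennreal ((f x powr p) powr (1 / p) * (g x powr q) powr (1 / (2 * q)) * (g x powr q) powr (1 / (2 * q))) \<partial>M)
  <= ennreal ((F powr p) powr (1 / p) * (G powr q) powr (1 / (2 * q)) * (G powr q) powr (1 / (2 * q)))"
  by (rule Hoelder3) (use w nn FG le in auto)
 moreover have "(a powr q) powr (1 / (2 * q)) * (a powr q) powr (1 / (2 * q)) = a" if "a >= 0" for a
  using that w by (simp add: powr_powr flip: powr_add)
 ultimately show ?thesis using w nn FG by (simp add: powr_powr mult.assoc)
qed

text \<open>The functional given by a on nonnegative functions of L^q has norm at most
  \<open>al\<close>. The formulation by duality treats alike the transport term, which is controlled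
  only through an interpolation, and coefficients that lie in an explicit Lebesgue space.\<close>

definition dual_bd :: "real => real => ('a::euclidean_space => real) => bool" where
 "dual_bd q al a \<longleftrightarrow> (\<forall>ph m. ph \<in> BM --> (\<forall>x. 0 <= ph x) --> 0 <= m -->
  (NNL x. ennreal (ph x powr q)) <= ennreal (m powr q) --> (NNL x. ennreal (a x * ph x)) <= ennreal (al * m))"

lemma dual_bdD:
 assumes "dual_bd q al a" "ph \<in> BM" "!!x. 0 <= ph x" "0 <= m"
  "(NNL x. ennreal (ph x powr q)) <= ennreal (m powr q)"
 shows "(NNL x. ennreal (a x * ph x)) <= ennreal (al * m)"
 using assms unfolding dual_bd_def by blast

lemma dual_bd_Lp:
 fixes a :: "'a::euclidean_space => real"
 assumes w: "p > 1" "q > 1" "1 / p + 1 / q = 1" and [measurable]: "a \<in> BM"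
  and nn: "!!x. a x >= 0" and F: "F >= 0" and le: "(NNL x. ennreal (a x powr p)) <= ennreal F"
 shows "dual_bd q (F powr (1 / p)) a"
 unfolding dual_bd_def
proof (intro allI impI)
 fix ph :: "'a => real" and m assume [measurable]: "ph \<in> BM" and "\<forall>x. 0 <= ph x" "0 <= m"
  "(NNL x. ennreal (ph x powr q)) <= ennreal (m powr q)"
 then show "(NNL x. ennreal (a x * ph x)) <= ennreal (F powr (1 / p) * m)"
  using w nn F le by (intro Hoelder2[OF w]) (auto simp: powr_powr)
qed

text \<open>Three-factor Hoelder with weights (r-3)/r, 1/r and 2/r, which sum to 1. The powers of v
  add up to 2 (r-3)/r + 6/r = 2, and \<open>ph\<close> enters in L^r. Here L^2 and L^6 are the
  energy norm and the Sobolev norm of the velocity.\<close>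

lemma interpolation_product:
 fixes v ph :: "'a::euclidean_space => real"
 assumes r: "r > 3" and [measurable]: "v \<in> BM" "ph \<in> BM"
  and nn: "!!x. v x >= 0" "!!x. ph x >= 0" "A >= 0" "B >= 0" "m >= 0"
  and v2: "(NNL x. ennreal ((v x)^2)) <= ennreal A" and v6: "(NNL x. ennreal ((v x) ^ 6)) <= ennreal B"
  and phr: "(NNL x. ennreal (ph x powr r)) <= ennreal (m powr r)"
 shows "(NNL x. ennreal ((v x * ph x)^2)) <= ennreal (A powr ((r - 3) / r) * B powr (1 / r) * m^2)"
proof -
 have "(NNL x. ennreal (((v x)^2) powr ((r - 3) / r) * ((v x) ^ 6) powr (1 / r) * (ph x powr r) powr (2 / r)))
  <= ennreal (A powr ((r - 3) / r) * B powr (1 / r) * (m powr r) powr (2 / r))"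
  by (rule Hoelder3) (use r nn v2 v6 phr in \<open>auto simp: field_simps\<close>)
 moreover have "((v x)^2) powr ((r - 3) / r) * ((v x) ^ 6) powr (1 / r) * (ph x powr r) powr (2 / r) = (v x * ph x)^2" for x
 proof (cases "v x = 0")
  case False
  then have v: "v x > 0" using nn(1)[of x] by simp
  have "((v x)^2) powr ((r - 3) / r) * ((v x) ^ 6) powr (1 / r) = v x powr (2 * ((r - 3) / r)) * v x powr (6 * (1 / r))"
   using v by (simp add: powr_powr flip: powr_numeral)
  also have "\<dots> = v x powr 2" using r by (simp add: field_simps flip: powr_add)
  finally have "((v x)^2) powr ((r - 3) / r) * ((v x) ^ 6) powr (1 / r) = (v x)^2" using v by (simp add: powr_numeral)
  moreover have "(ph x powr r) powr (2 / r) = (ph x)^2" using r nn(2)[of x] by (simp add: powr_powr powr_numeral)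
  ultimately show ?thesis by (simp add: power_mult_distrib)
 qed auto
 moreover have "(m powr r) powr (2 / r) = m^2" using r nn by (simp add: powr_powr powr_numeral)
 ultimately show ?thesis by simp
qed

text \<open>The gradient factor g is paired in L^2 with the product of v and the test function, and
  interpolation controls that product.\<close>

lemma dual_bd_transport:
 fixes v g :: "'a::euclidean_space => real"
 assumes r: "r > 3" and [measurable]: "v \<in> BM" "g \<in> BM"
  and nn: "!!x. v x >= 0" "!!x. g x >= 0" "A >= 0" "B >= 0" "E >= 0"
  and v2: "(NNL x. ennreal ((v x)^2)) <= ennreal A" and v6: "(NNL x. ennreal ((v x) ^ 6)) <= ennreal B"
  and g2: "(NNL x. ennreal ((g x)^2)) <= ennreal E"
 shows "dual_bd r (sqrt E * sqrt (A powr ((r - 3) / r) * B powr (1 / r))) (%x. v x * g x)"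
 unfolding dual_bd_def
proof (intro allI impI)
 fix ph :: "'a => real" and m assume [measurable]: "ph \<in> BM" and ph: "\<forall>x. 0 <= ph x" and m: "0 <= m"
  and le: "(NNL x. ennreal (ph x powr r)) <= ennreal (m powr r)"
 let ?W = "A powr ((r - 3) / r) * B powr (1 / r)"
 have i: "(NNL x. ennreal ((v x * ph x)^2)) <= ennreal (?W * m^2)"
  by (rule interpolation_product[OF r]) (use nn ph m v2 v6 le in auto)
 have p2: "a powr 2 = a^2" if "a >= 0" for a :: real using that by (simp add: powr_numeral)
 have "(NNL x. ennreal (g x * (v x * ph x))) <= ennreal (sqrt E * (sqrt ?W * m))"
  by (rule Hoelder2[of 2 2]) (use g2 i nn ph m in \<open>auto simp: p2 power_mult_distrib\<close>)
 then show "(NNL x. ennreal (v x * g x * ph x)) <= ennreal (sqrt E * sqrt ?W * m)"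
  by (simp add: mult_ac)
qed

lemma Young_weighted:
 fixes x y l p q :: real
 assumes w: "p > 1" "q > 1" "1 / p + 1 / q = 1" and l: "l > 0" and nn: "x >= 0" "y >= 0"
 shows "x * y <= l powr p * x powr p + (1 / l) powr q * y powr q"
proof -
 have "x * y = (l * x) * (1 / l * y)" using l by simp
 also have "\<dots> <= (l * x) powr p / p + (1 / l * y) powr q / q"
  by (rule Youngs_inequality[OF w]) (use l nn in auto)
 also have "\<dots> <= (l * x) powr p + (1 / l * y) powr q"
 proof -
  have "v / k <= v" if "k > 1" "v >= 0" for v k :: real
   using that mult_left_mono[of 1 k v] by (simp add: divide_le_eq)
  then show ?thesis using w by (intro add_mono) auto
 qed
 also have "\<dots> = l powr p * x powr p + (1 / l) powr q * y powr q" using l nn by (simp only: powr_mult)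
 finally show ?thesis .
qed

text \<open>Young's inequality with a free weight: \<open>l\<close> is first chosen to make the part
  with \<open>al\<close> small, and afterwards the part with \<open>ph\<close> is sent to 0 for this
  fixed \<open>l\<close>.\<close>

lemma dual_bd_pairing:
 fixes a :: "'a::euclidean_space => real" and ph :: "'a => real"
 assumes d: "dual_bd q al a" and al: "al >= 0" and q: "q > 0" and w: "p' > 1" "p > 1" "1 / p' + 1 / p = 1" and l: "l > 0"
  and [measurable]: "ph \<in> BM" and nn: "!!x. ph x >= 0"
  and fin: "(NNL x. ennreal (ph x powr q)) < \<infinity>"
 shows "(NNL x. ennreal (a x * ph x)) <= ennreal (l powr p' * al powr p') + ennreal ((1 / l) powr p) * ennreal ((enn2real (NNL x. ennreal (ph x powr q))) powr (p / q))"
proof -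
 define F where "F = enn2real (NNL x. ennreal (ph x powr q))"
 have F: "(NNL x. ennreal (ph x powr q)) = ennreal F" "F >= 0" using fin by (auto simp: F_def)
 have "(NNL x. ennreal (a x * ph x)) <= ennreal (al * F powr (1 / q))"
  by (rule dual_bdD[OF d]) (use F q nn in \<open>auto simp: powr_powr\<close>)
 also have "\<dots> <= ennreal (l powr p' * al powr p' + (1 / l) powr p * (F powr (1 / q)) powr p)"
  by (intro ennreal_leI Young_weighted[OF w l al]) auto
 also have "\<dots> = ennreal (l powr p' * al powr p') + ennreal ((1 / l) powr p) * ennreal (F powr (p / q))"
  by (simp add: powr_powr ennreal_mult)
 finally show ?thesis by (simp add: F_def)
qed

text \<open>The inner integral over a slice may be infinite at exceptional times; such times must
  count as infinite in the mixed norm L^p(L^q), whereas the conversion to reals would turn them into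
  0.\<close>

definition enn_pow :: "ennreal => real => ennreal" where
 "enn_pow x p = (if x = top then top else ennreal (enn2real x powr p))"

lemma measurable_enn_pow[measurable]: "f \<in> borel_measurable M ==> (%x. enn_pow (f x) p) \<in> borel_measurable M"
proof -
 assume [measurable]: "f \<in> borel_measurable M"
 have "f -` {top} \<inter> space M \<in> sets M" by measurable
 then have [measurable]: "Measurable.pred M (%x. f x = top)"
  by (auto simp: pred_def vimage_def Collect_conj_eq Int_commute)
 show "(%x. enn_pow (f x) p) \<in> borel_measurable M" unfolding enn_pow_def by measurable
qed

lemma enn_pow_mono: "p > 0 ==> x <= y ==> enn_pow x p <= enn_pow y p"
 by (auto simp: enn_pow_def top_unique less_top intro!: ennreal_leI powr_mono2 enn2real_mono)

lemma enn_pow_tendsto_0: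
 assumes p: "p > 0" and f: "f ~> 0"
 shows "(%n. enn_pow (f n) p) ~> 0"
proof -
 have ev: "\<forall>\<^sub>F n in sequentially. f n < 1" using order_tendstoD(2)[OF f, of 1] by simp
 have "(%n. enn2real (f n)) ~> enn2real 0" using tendsto_enn2real[of f 0 sequentially] f by simp
 then have "(%n. enn2real (f n) powr p) ~> 0"
  using p tendsto_zero_powrI[of "%n. enn2real (f n)" sequentially "%_. p" p] by simp
 then have "(%n. ennreal (enn2real (f n) powr p)) ~> 0" by (metis ennreal_0 tendsto_ennrealI)
 then show ?thesis
  by (rule Lim_transform_eventually) (use ev in \<open>eventually_elim, auto simp: enn_pow_def\<close>)
qed

lemma dual_bd_pairing':
 fixes a :: "'a::euclidean_space => real" and ph :: "'a => real"
 assumes d: "dual_bd q al a" and al: "al >= 0" and q: "q > 0" and w: "p' > 1" "p > 1" "1 / p' + 1 / p = 1" and l: "l > 0"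
  and [measurable]: "ph \<in> BM" and nn: "!!x. ph x >= 0"
 shows "(NNL x. ennreal (a x * ph x)) <= ennreal (l powr p') * ennreal (al powr p') + ennreal ((1 / l) powr p) * enn_pow (NNL x. ennreal (ph x powr q)) (p / q)"
proof (cases "(NNL x. ennreal (ph x powr q)) = top")
 case True
 then show ?thesis using l by (simp add: enn_pow_def ennreal_mult_top)
next
 case False
 then show ?thesis using dual_bd_pairing[OF d al q w l _ nn]
  by (auto simp: enn_pow_def less_top[symmetric] ennreal_mult)
qed

lemma quasi_pres_translation:
 assumes "A \<in> sets borel"
 shows "quasi_pres 1 A (%x. x + v)"
 using quasi_pres_shift[OF quasi_pres_id[OF assms], of "- v"] by simp

lemma measurable_Pair_borel[measurable (raw)]:
 fixes b :: "real \<times> vec3 => 'b::topological_space"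
 assumes "b \<in> BM"
 shows "(%x. b (t, x)) \<in> BM"
proof -
 have "b \<in> BM2" using assms by (simp add: borel_prod)
 then show ?thesis by measurable
qed

text \<open>The coefficient a stays at time t and only b is moved. Truncate b at height M: the
  remainder is small in the mixed norm by dominated convergence, and the mixed norm does not change
  under shifts in time, so the dual bound controls both its shifted and its unshifted copy. For the
  bounded part, a is truncated at height N: its tail is small in L^1 and multiplies at most 2 M, and
  the rest is continuity of translations in L^1.\<close>

lemma time_translation_continuity:
 fixes a :: "real \<times> vec3 => real" and b :: "real \<times> vec3 => 'b::euclidean_space" and al :: "real => real"
 assumes w: "p' > 1" "p > 1" "1 / p' + 1 / p = 1" and q: "q > 0" and \<Omega>: "bounded \<Omega>" "\<Omega> \<in> sets borel"
  and ma: "a \<in> BM" and mb: "b \<in> BM" and [measurable]: "al \<in> BM"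
  and nn: "!!z. a z >= 0" "!!t. al t >= 0"
  and a0: "!!z. z \<notin> {0<..<T} \<times> \<Omega> ==> a z = 0" and b0: "!!z. z \<notin> {0<..<T} \<times> \<Omega> ==> b z = 0"
  and d: "AL t. dual_bd q (al t) (%x. a (t, x))"
  and ia: "(NNL t. ennreal (al t powr p')) < \<infinity>"
  and ib: "(NNL t. enn_pow (NNL x. ennreal (norm (b (t, x)) powr q)) (p / q)) < \<infinity>"
  and e: "e > 0"
 obtains h where "h > 0" "!!dl. \<bar>dl\<bar> <= h ==>
  (NNL t. NNL x. ennreal (a (t, x) * norm (b (t + dl, x) - b (t, x)))) <= ennreal e"
proof -
 note [measurable] = ma mb
 have [measurable]: "a \<in> BM2" "b \<in> BM2"
  using ma mb by (auto simp: borel_prod)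
 have [measurable]: "\<Omega> \<in> sets borel" by fact
 define Ia where "Ia = enn2real (NNL t. ennreal (al t powr p'))"
 have Ia: "(NNL t. ennreal (al t powr p')) = ennreal Ia" "Ia >= 0" using ia by (auto simp: Ia_def)
 \<comment> \<open>Three contributions of 2 e1 each: the shifted remainder, the unshifted remainder
   and the truncated part.\<close>
 define e1 where "e1 = e / 6"
 have e1: "e1 > 0" using e by (simp add: e1_def)
 \<comment> \<open>Gives l^p' Ia <= e1; the summand 1 covers the case Ia = 0.\<close>
 define l where "l = (e1 / (Ia + 1)) powr (1 / p')"
 have l: "l > 0" using e1 Ia by (simp add: l_def)
 have lp: "l powr p' * Ia <= e1"
 proof -
  have "l powr p' = e1 / (Ia + 1)" using e1 Ia w by (simp add: l_def powr_powr)
  then have "l powr p' * Ia = e1 * (Ia / (Ia + 1))" by simp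
  also have "\<dots> <= e1 * 1" using e1 Ia by (intro mult_left_mono) auto
  finally show ?thesis by simp
 qed
 define L where "L = (1 / l) powr p"
 have L: "L > 0" using l by (simp add: L_def)
 define bM where "bM M z = (if norm (b z) <= real M then b z else 0)" for M :: nat and z
 have [measurable]: "bM M \<in> BM" "bM M \<in> BM2" for M
  unfolding bM_def by measurable
 define \<beta> where "\<beta> M t = (NNL x. ennreal (norm (b (t, x) - bM M (t, x)) powr q))" for M t
 have [measurable]: "\<beta> M \<in> BM" for M unfolding \<beta>_def by measurable
 have \<beta>le: "\<beta> M t <= (NNL x. ennreal (norm (b (t, x)) powr q))" for M t
  unfolding \<beta>_def by (intro nn_integral_mono ennreal_leI powr_mono2) (use q in \<open>auto simp: bM_def\<close>)
 have [measurable]: "(%t. NNL x. ennreal (norm (b (t, x)) powr q)) \<in> BM" by measurable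
 have "AL t. enn_pow (NNL x. ennreal (norm (b (t, x)) powr q)) (p / q) ~= \<infinity>"
  by (rule nn_integral_PInf_AE) (use ib in auto)
 then have fin: "AL t. (NNL x. ennreal (norm (b (t, x)) powr q)) < \<infinity>"
  by eventually_elim (auto simp: enn_pow_def less_top split: if_splits)
 have "(%M. NNL t. enn_pow (\<beta> M t) (p / q)) ~> (NNL (t::real). 0)"
 proof (rule nn_integral_dominated_convergence[OF _ _ _ _ ib])
  show "AL t. enn_pow (\<beta> M t) (p / q) <= enn_pow (NNL x. ennreal (norm (b (t, x)) powr q)) (p / q)" for M
   using w q by (intro AE_I2 enn_pow_mono \<beta>le) auto
  show "AL t. (%M. enn_pow (\<beta> M t) (p / q)) ~> 0"
   using fin
  proof eventually_elim
   case (elim t)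
   have "(%M. \<beta> M t) ~> (NNL (x::vec3). 0)"
    unfolding \<beta>_def
   proof (rule nn_integral_dominated_convergence[OF _ _ _ _ elim])
    show "AL x. ennreal (norm (b (t, x) - bM M (t, x)) powr q) <= ennreal (norm (b (t, x)) powr q)" for M
     by (intro AE_I2 ennreal_leI powr_mono2) (use q in \<open>auto simp: bM_def\<close>)
    show "AL x. (%M. ennreal (norm (b (t, x) - bM M (t, x)) powr q)) ~> 0"
    proof (rule AE_I2)
     fix x
     obtain n0 :: nat where "norm (b (t, x)) <= real n0" by (meson real_arch_simple)
     then have "\<forall>M\<ge>n0. ennreal (norm (b (t, x) - bM M (t, x)) powr q) = 0" by (auto simp: bM_def)
     then have "\<forall>\<^sub>F M in sequentially. ennreal (norm (b (t, x) - bM M (t, x)) powr q) = 0"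
      unfolding eventually_sequentially by blast
     then show "(%M. ennreal (norm (b (t, x) - bM M (t, x)) powr q)) ~> 0" by (rule tendsto_eventually)
    qed
   qed measurable
   then show ?case using w q by (intro enn_pow_tendsto_0) auto
  qed
 qed measurable
 then have "\<forall>\<^sub>F M in sequentially. (NNL t. enn_pow (\<beta> M t) (p / q)) < ennreal (e1 / L)"
  using e1 L by (intro order_tendstoD) auto
 then obtain M where M: "(NNL t. enn_pow (\<beta> M t) (p / q)) < ennreal (e1 / L)"
  by (auto simp: eventually_sequentially)
 have stepA: "(NNL t. NNL x. ennreal (a (t, x) * norm (b (t + dl, x) - bM M (t + dl, x)))) <= ennreal (2 * e1)" for dl
 proof -
  have "(NNL t. NNL x. ennreal (a (t, x) * norm (b (t + dl, x) - bM M (t + dl, x))))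
   <= (NNL t. ennreal (l powr p') * ennreal (al t powr p') + ennreal L * enn_pow (\<beta> M (dl + 1 * t)) (p / q))"
  proof (rule nn_integral_mono_AE, use d in eventually_elim)
   case (elim t)
   show ?case using dual_bd_pairing'[OF elim nn(2) q w l, of "%x. norm (b (t + dl, x) - bM M (t + dl, x))"]
    by (simp add: \<beta>_def L_def add.commute)
  qed
  also have "\<dots> = ennreal (l powr p') * ennreal Ia + ennreal L * (NNL t. enn_pow (\<beta> M (dl + 1 * t)) (p / q))"
   by (subst nn_integral_add) (auto simp: nn_integral_cmult Ia)
  also have "(NNL t. enn_pow (\<beta> M (dl + 1 * t)) (p / q)) = (NNL t. enn_pow (\<beta> M t) (p / q))"
   using nn_integral_real_affine[of "%t. enn_pow (\<beta> M t) (p / q)" 1 dl] by simp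
  also have "ennreal (l powr p') * ennreal Ia + ennreal L * \<dots> <= ennreal e1 + ennreal L * ennreal (e1 / L)"
   using M lp Ia by (intro add_mono mult_left_mono) (auto simp flip: ennreal_mult intro: ennreal_leI)
  also have "\<dots> = ennreal (2 * e1)" using L e1 by (simp flip: ennreal_mult ennreal_plus)
  finally show ?thesis .
 qed
 obtain R where R: "R > 0" "\<forall>x\<in>\<Omega>. norm x <= R" using \<Omega>(1) unfolding bounded_pos by blast
 define V where "V = measure lborel \<Omega>"
 have V: "emeasure lborel \<Omega> = ennreal V" "V >= 0"
  using emeasure_bounded_finite[OF \<Omega>(1)] by (auto simp: V_def emeasure_eq_ennreal_measure)
 \<comment> \<open>Integrability of a comes from testing its dual bound with the indicator of
   \<Omega>, which has finite measure; al <= 1 + al^p' then handles the integral in time.\<close>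
 have ia1: "(NNL t. NNL x. ennreal (a (t, x))) < \<infinity>"
 proof -
  have "(NNL t. NNL x. ennreal (a (t, x))) <= (NNL t. ennreal (V powr (1 / q)) * (ennreal (al t powr p') + indicator {0..T} t))"
  proof (rule nn_integral_mono_AE, use d in eventually_elim)
   case (elim t)
   show ?case
   proof (cases "t \<in> {0..T}")
    case True
    have ind: "(%x. ennreal (indicator \<Omega> x powr q)) = (%x. indicator \<Omega> x)" using q by (auto simp: indicator_def)
    have "(NNL x. ennreal (a (t, x))) = (NNL x. ennreal (a (t, x) * indicator \<Omega> x))"
     using a0 by (intro nn_integral_cong) (auto simp: indicator_def)
    also have "\<dots> <= ennreal (al t * V powr (1 / q))"
     by (rule dual_bdD[OF elim]) (use V q in \<open>auto simp: ind powr_powr\<close>)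
    also have "\<dots> = ennreal (V powr (1 / q)) * ennreal (al t)" using nn by (simp add: ennreal_mult'' mult.commute)
    also have "ennreal (al t) <= ennreal (al t powr p') + indicator {0..T} t"
    proof (cases "al t <= 1")
     case False
     then have "al t powr 1 <= al t powr p'" using w by (intro powr_mono) auto
     then have "ennreal (al t) <= ennreal (al t powr p')" using False by (intro ennreal_leI) simp
     then show ?thesis by (simp add: add_increasing2)
    qed (use True in \<open>simp add: add_increasing\<close>)
    finally show ?thesis by (simp add: mult_left_mono)
   next
    case False
    then show ?thesis using a0 by auto
   qed
  qed
  also have "\<dots> = ennreal (V powr (1 / q)) * (ennreal Ia + emeasure lborel {0..T})"
   by (subst nn_integral_cmult) (auto simp: nn_integral_add Ia)
  also have "\<dots> < \<infinity>" by (simp add: ennreal_mult_less_top emeasure_lborel_Icc_eq)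
  finally show ?thesis .
 qed
 have "(%N. NNL z. ennreal (a z) * indicator {z. a z > real N} z) ~> (NNL (z::real \<times> vec3). 0)"
 proof (rule nn_integral_dominated_convergence[where w="%z. ennreal (a z)"])
  show "(NNL z. ennreal (a z)) < \<infinity>"
   using ia1 by (subst lborel_prod[symmetric], subst lborel.nn_integral_fst[symmetric]) auto
  show "AL z. (%N. ennreal (a z) * indicator {z. a z > real N} z) ~> 0"
  proof (rule AE_I2)
   fix z
   obtain n0 :: nat where "a z <= real n0" by (meson real_arch_simple)
   then have "\<forall>N\<ge>n0. ennreal (a z) * indicator {z. a z > real N} z = 0" by (auto simp: indicator_def)
   then have "\<forall>\<^sub>F N in sequentially. ennreal (a z) * indicator {z. a z > real N} z = 0"
    unfolding eventually_sequentially by blast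
   then show "(%N. ennreal (a z) * indicator {z. a z > real N} z) ~> 0" by (rule tendsto_eventually)
  qed
  show "AL z. ennreal (a z) * indicator {z. a z > real N} z <= ennreal (a z)" for N
   by (auto simp: indicator_def)
 qed measurable
 then have "\<forall>\<^sub>F N in sequentially. (NNL z. ennreal (a z) * indicator {z. a z > real N} z) < ennreal (e1 / (2 * real M + 1))"
  using e1 by (intro order_tendstoD) auto
 then obtain N where N: "(NNL z. ennreal (a z) * indicator {z. a z > real N} z) < ennreal (e1 / (2 * real M + 1))"
  by (auto simp: eventually_sequentially)
 define A where "A = {0..T} \<times> \<Omega>"
 have [measurable]: "A \<in> sets borel" unfolding A_def by (intro borel_Times) auto
 have bA: "bounded A" unfolding A_def using \<Omega> by (intro bounded_Times) auto
 have fM: "(NNL z. ennreal (norm (bM M z) powr 1)) < \<infinity>"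
 proof -
  have "(NNL z. ennreal (norm (bM M z) powr 1)) <= (NNL z. ennreal (real M) * indicator A z)"
   using b0 by (intro nn_integral_mono) (force simp: bM_def A_def indicator_def)
  also have "\<dots> < \<infinity>"
   using emeasure_bounded_finite[OF bA] by (subst nn_integral_cmult_indicator) (auto simp: ennreal_mult_less_top)
  finally show ?thesis .
 qed
 \<comment> \<open>The tolerances e1/(N+1) here and e1/(2M+1) above anticipate the factors N and 2 M
   with which these integrals are multiplied.\<close>
 obtain h where h: "h > 0"
  "!!S. quasi_pres 1 A S ==> (!!x. x \<in> A ==> dist (S x) x <= h) ==>
   (NNL x. indicator A x * ennreal (norm (bM M (S x) - bM M x) powr 1)) <= ennreal (e1 / (real N + 1))"
  by (rule Lp_compose[OF _ _ fM, of A 1 "e1 / (real N + 1)"]) (use bA e1 in \<open>auto\<close>)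
 show ?thesis
 proof (rule that[OF h(1)])
  fix dl assume dl: "\<bar>dl\<bar> <= h"
  have hdl: "(NNL z. indicator A z * ennreal (norm (bM M (z + (dl, 0)) - bM M z))) <= ennreal (e1 / (real N + 1))"
   using h(2)[OF quasi_pres_translation, of "(dl, 0)"] dl by (simp add: dist_norm norm_Pair)
  have "(NNL t. NNL x. ennreal (a (t, x) * norm (bM M (t + dl, x) - bM M (t, x))))
   = (NNL z. ennreal (a z * norm (bM M (z + (dl, 0)) - bM M z)))"
  proof -
   have "(%z. ennreal (a z * norm (bM M (z + (dl, 0)) - bM M z))) \<in> BM" by measurable
   then have m: "(%z. ennreal (a z * norm (bM M (z + (dl, 0)) - bM M z))) \<in> borel_measurable (lborel \<Otimes>\<^sub>M lborel)"
    by (simp add: lborel_prod)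
   show ?thesis by (subst lborel_prod[symmetric], subst lborel.nn_integral_fst[OF m, symmetric]) simp
  qed
  also have "\<dots> <= (NNL z. ennreal (real N) * (indicator A z * ennreal (norm (bM M (z + (dl, 0)) - bM M z)))
    + ennreal (2 * real M) * (ennreal (a z) * indicator {z. a z > real N} z))"
  proof (rule nn_integral_mono)
   fix z
   have n2: "norm (bM M (z + (dl, 0)) - bM M z) <= 2 * real M"
    using norm_triangle_ineq4[of "bM M (z + (dl, 0))" "bM M z"] by (simp add: bM_def split: if_splits)
   show "ennreal (a z * norm (bM M (z + (dl, 0)) - bM M z)) <= ennreal (real N) * (indicator A z * ennreal (norm (bM M (z + (dl, 0)) - bM M z)))
    + ennreal (2 * real M) * (ennreal (a z) * indicator {z. a z > real N} z)"
   proof (cases "a z > real N")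
    case True
    have "ennreal (a z * norm (bM M (z + (dl, 0)) - bM M z)) <= ennreal (2 * real M * a z)"
     using n2 nn(1)[of z] by (intro ennreal_leI) (metis mult.commute mult_left_mono)
    also have "\<dots> = ennreal (2 * real M) * (ennreal (a z) * indicator {z. a z > real N} z)"
     using True nn(1)[of z] by (simp add: ennreal_mult)
    finally show ?thesis by (simp add: add_increasing)
   next
    case False
    show ?thesis
    proof (cases "z \<in> A")
     case True
     have "ennreal (a z * norm (bM M (z + (dl, 0)) - bM M z)) <= ennreal (real N * norm (bM M (z + (dl, 0)) - bM M z))"
      using False by (intro ennreal_leI mult_right_mono) auto
     then show ?thesis using True by (simp add: ennreal_mult add_increasing2)
    next
     case False
     then have "a z = 0" using a0[of z] by (cases z) (auto simp: A_def)
     then show ?thesis by simp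
    qed
   qed
  qed
  also have "\<dots> = ennreal (real N) * (NNL z. indicator A z * ennreal (norm (bM M (z + (dl, 0)) - bM M z)))
    + ennreal (2 * real M) * (NNL z. ennreal (a z) * indicator {z. a z > real N} z)"
   by (subst nn_integral_add) (auto simp: nn_integral_cmult)
  also have "\<dots> <= ennreal (real N) * ennreal (e1 / (real N + 1)) + ennreal (2 * real M) * ennreal (e1 / (2 * real M + 1))"
   using hdl N by (intro add_mono mult_left_mono) auto
  also have "\<dots> = ennreal (real N * (e1 / (real N + 1)) + 2 * real M * (e1 / (2 * real M + 1)))"
   using e1 by (simp flip: ennreal_mult ennreal_plus)
  also have "\<dots> <= ennreal (e1 + e1)"
   using e1 by (intro ennreal_leI add_mono) (auto simp: field_simps)
  finally have stepB: "(NNL t. NNL x. ennreal (a (t, x) * norm (bM M (t + dl, x) - bM M (t, x)))) <= ennreal (2 * e1)"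
   by simp
  have "(NNL t. NNL x. ennreal (a (t, x) * norm (b (t + dl, x) - b (t, x)))) <=
   (NNL t. NNL x. ennreal (a (t, x) * norm (b (t + dl, x) - bM M (t + dl, x)))
     + ennreal (a (t, x) * norm (b (t + 0, x) - bM M (t + 0, x)))
     + ennreal (a (t, x) * norm (bM M (t + dl, x) - bM M (t, x))))"
  proof (intro nn_integral_mono)
   fix t x
   have "norm (b (t + dl, x) - b (t, x)) <= norm (b (t + dl, x) - bM M (t + dl, x)) + norm (b (t, x) - bM M (t, x)) + norm (bM M (t + dl, x) - bM M (t, x))"
    using norm_triangle_ineq[of "b (t + dl, x) - bM M (t + dl, x)" "bM M (t + dl, x) - b (t, x)"]
     norm_triangle_ineq4[of "bM M (t + dl, x) - bM M (t, x)" "b (t, x) - bM M (t, x)"] by simp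
   from mult_left_mono[OF this nn(1)[of "(t, x)"]]
   show "ennreal (a (t, x) * norm (b (t + dl, x) - b (t, x))) <= ennreal (a (t, x) * norm (b (t + dl, x) - bM M (t + dl, x)))
     + ennreal (a (t, x) * norm (b (t + 0, x) - bM M (t + 0, x)))
     + ennreal (a (t, x) * norm (bM M (t + dl, x) - bM M (t, x)))"
    using nn(1)[of "(t, x)"] by (simp add: distrib_left flip: ennreal_plus)
  qed
  also have "\<dots> = (NNL t. NNL x. ennreal (a (t, x) * norm (b (t + dl, x) - bM M (t + dl, x))))
     + (NNL t. NNL x. ennreal (a (t, x) * norm (b (t + 0, x) - bM M (t + 0, x))))
     + (NNL t. NNL x. ennreal (a (t, x) * norm (bM M (t + dl, x) - bM M (t, x))))"
   by (simp add: nn_integral_add)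
  also have "\<dots> <= ennreal (2 * e1) + ennreal (2 * e1) + ennreal (2 * e1)"
   by (intro add_mono stepA stepB)
  also have "\<dots> = ennreal e" using e1 by (simp add: e1_def flip: ennreal_plus)
  finally show "(NNL t. NNL x. ennreal (a (t, x) * norm (b (t + dl, x) - b (t, x)))) <= ennreal e" .
 qed
qed

section \<open>Uniform boundedness in the space of square integrable functions\<close>

lemma integral_Cauchy_Schwarz:
 fixes f g :: "'a => 'b::euclidean_space"
 assumes [measurable]: "f \<in> borel_measurable M" "g \<in> borel_measurable M"
  and f: "integrable M (%x. (norm (f x))^2)" and g: "integrable M (%x. (norm (g x))^2)"
 shows "integrable M (%x. f x <.> g x)" "\<bar>\<integral>x. f x <.> g x \<partial>M\<bar> <= sqrt (\<integral>x. (norm (f x))^2 \<partial>M) * sqrt (\<integral>x. (norm (g x))^2 \<partial>M)"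
proof -
 have ab: "a * b <= a^2 + b^2" for a b :: real
  using zero_le_power2[of "a - b"] zero_le_power2[of a] zero_le_power2[of b] unfolding power2_diff by linarith
 have bd: "norm (f x <.> g x) <= (norm (f x))^2 + (norm (g x))^2" for x
  using Cauchy_Schwarz_ineq2[of "f x" "g x"] ab[of "norm (f x)" "norm (g x)"] by simp
 show i: "integrable M (%x. f x <.> g x)"
  by (rule LB_bound[OF LB_iadd[OF f g]]) (use bd in \<open>auto intro!: AE_I2\<close>)
 have p2: "a powr 2 = a^2" if "a >= 0" for a :: real using that by (simp add: powr_numeral)
 let ?F = "\<integral>x. (norm (f x))^2 \<partial>M" and ?G = "\<integral>x. (norm (g x))^2 \<partial>M"
 have nn: "?F >= 0" "?G >= 0" by auto
 have "(\<integral>\<^sup>+x. ennreal (norm (f x) * norm (g x)) \<partial>M) <= ennreal (sqrt ?F * sqrt ?G)"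
 proof (rule Hoelder2[of 2 2])
  show "(\<integral>\<^sup>+x. ennreal (norm (f x) powr 2) \<partial>M) <= ennreal (sqrt ?F powr 2)"
   using nn nn_integral_eq_integral[OF f] by (simp add: p2)
  show "(\<integral>\<^sup>+x. ennreal (norm (g x) powr 2) \<partial>M) <= ennreal (sqrt ?G powr 2)"
   using nn nn_integral_eq_integral[OF g] by (simp add: p2)
 qed (use nn in auto)
 moreover have "ennreal \<bar>\<integral>x. f x <.> g x \<partial>M\<bar> <= (\<integral>\<^sup>+x. ennreal (norm (f x <.> g x)) \<partial>M)"
  using integral_norm_bound_ennreal[OF i] by simp
 moreover have "(\<integral>\<^sup>+x. ennreal (norm (f x <.> g x)) \<partial>M) <= (\<integral>\<^sup>+x. ennreal (norm (f x) * norm (g x)) \<partial>M)"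
  using Cauchy_Schwarz_ineq2 by (intro nn_integral_mono ennreal_leI) auto
 ultimately have "ennreal \<bar>\<integral>x. f x <.> g x \<partial>M\<bar> <= ennreal (sqrt ?F * sqrt ?G)" by (meson order_trans)
 then show "\<bar>\<integral>x. f x <.> g x \<partial>M\<bar> <= sqrt ?F * sqrt ?G" using nn by (subst (asm) ennreal_le_iff) auto
qed

text \<open>The gliding hump: if the norms were unbounded, a suitably signed series of normalised members with
 geometric weights \<open>3 ^ -n\<close> would pair unboundedly with the family.\<close>

lemma uniform_boundedness_L2:
 fixes f :: "'i => 'a => 'b::euclidean_space"
 assumes f: "!!i. i \<in> I ==> f i \<in> borel_measurable M" "!!i. i \<in> I ==> integrable M (%x. (norm (f i x))^2)"
  and bd: "!!g. g \<in> borel_measurable M ==> integrable M (%x. (norm (g x))^2) ==> \<exists>B. \<forall>i\<in>I. \<bar>\<integral>x. f i x <.> g x \<partial>M\<bar> <= B"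
 shows "\<exists>B. \<forall>i\<in>I. (\<integral>x. (norm (f i x))^2 \<partial>M) <= B"
proof (rule ccontr)
 assume "\<not> ?thesis"
 \<comment> \<open>Squared norms above 16^n mean norms above 4^n, which outgrow the weights
   3^-n.\<close>
 then have "\<forall>n::nat. \<exists>i\<in>I. (\<integral>x. (norm (f i x))^2 \<partial>M) > 16 ^ n" by (metis not_less)
 then obtain j where j: "!!n. j n \<in> I" "!!n::nat. (\<integral>x. (norm (f (j n) x))^2 \<partial>M) > 16 ^ n" by metis
 define F where "F n = f (j n)" for n
 define N where "N n = sqrt (\<integral>x. (norm (F n x))^2 \<partial>M)" for n
 define h where "h n x = ((1/3) ^ n / N n) *R F n x" for n x
 define T where "T n g = (\<integral>x. F n x <.> g x \<partial>M)" for n and g :: "'a => 'b"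
 define L where "L g \<longleftrightarrow> g \<in> borel_measurable M & integrable M (%x. (norm (g x))^2)" for g :: "'a => 'b"
 have N4: "N n >= 4 ^ n" for n
 proof -
  have "sqrt (16 ^ n) <= N n" unfolding N_def F_def using j(2)[of n] by (intro real_sqrt_le_mono) simp
  moreover have "sqrt (16 ^ n) = 4 ^ n"
   by (rule real_sqrt_unique) (auto simp: power_mult_distrib[symmetric] power2_eq_square)
  ultimately show ?thesis by simp
 qed
 have N0: "N n > 0" for n using N4[of n] by (meson less_le_trans zero_less_numeral zero_less_power)
 have LF: "L (F n)" for n using f j(1)[of n] by (auto simp: L_def F_def)
 have Lscale: "L (%x. c *R g x)" if "L g" for c g
  using that by (auto simp: L_def power_mult_distrib)
 have Ladd: "L (%x. g1 x + g2 x)" if "L g1" "L g2" for g1 g2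
 proof -
  have [measurable]: "g1 \<in> borel_measurable M" "g2 \<in> borel_measurable M" using that by (auto simp: L_def)
  have "integrable M (%x. (norm (g1 x + g2 x))^2)"
  proof (rule LB_bound)
   show "integrable M (%x. 2 * (norm (g1 x))^2 + 2 * (norm (g2 x))^2)" using that by (auto simp: L_def)
   show "AE x in M. norm ((norm (g1 x + g2 x))^2) <= norm (2 * (norm (g1 x))^2 + 2 * (norm (g2 x))^2)"
   proof (rule AE_I2)
    fix x
    have "(norm (g1 x + g2 x))^2 <= (norm (g1 x) + norm (g2 x))^2" by (intro power_mono norm_triangle_ineq) auto
    also have "\<dots> <= 2 * (norm (g1 x))^2 + 2 * (norm (g2 x))^2"
     using zero_le_power2[of "norm (g1 x) - norm (g2 x)"] unfolding power2_diff power2_sum by linarith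
    finally show "norm ((norm (g1 x + g2 x))^2) <= norm (2 * (norm (g1 x))^2 + 2 * (norm (g2 x))^2)" by simp
   qed
  qed measurable
  then show ?thesis by (simp add: L_def)
 qed
 have Lh: "L (h n)" for n unfolding h_def by (rule Lscale[OF LF])
 have iT: "integrable M (%x. F n x <.> g x)" if "L g" for n g
  using integral_Cauchy_Schwarz(1)[of "F n" M g] LF[of n] that by (auto simp: L_def)
 have Tbd: "\<bar>T n g\<bar> <= N n * sqrt (\<integral>x. (norm (g x))^2 \<partial>M)" if "L g" for n g
  using integral_Cauchy_Schwarz(2)[of "F n" M g] LF[of n] that by (auto simp: L_def T_def N_def)
 have nh2: "(\<integral>x. (norm (h n x))^2 \<partial>M) = ((1/3) ^ n)^2" for n
 proof -
  have "(N n)^2 = (\<integral>x. (norm (F n x))^2 \<partial>M)" by (simp add: N_def)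
  moreover have "(N n)^2 ~= 0" using N0[of n] by simp
  ultimately show ?thesis by (simp add: h_def power_mult_distrib power_divide)
 qed
 \<comment> \<open>The sign makes the n-th pairing large: the pairings of F n with G n + h n and G n
   - h n differ by 2 * 3^-n N n, so one of them has modulus at least 3^-n N n.\<close>
 define G where "G = rec_nat (%x. 0) (%n g x. g x + (if \<bar>T n (%x. g x + h n x)\<bar> >= (1/3) ^ n * N n then h n x else - h n x))"
 have G0: "G 0 = (%x. 0)" and GS: "G (Suc n) = (%x. G n x + (if \<bar>T n (%x. G n x + h n x)\<bar> >= (1/3) ^ n * N n then h n x else - h n x))" for n
  by (auto simp: G_def)
 have Lmh: "L (%x. - h n x)" for n using Lscale[OF Lh, of "-1"] by simp
 have LG: "L (G n)" for n
 proof (induction n)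
  case (Suc n)
  show ?case
   using Ladd[OF Suc Lh] Ladd[OF Suc Lmh]
   by (cases "\<bar>T n (%x. G n x + h n x)\<bar> >= (1/3) ^ n * N n") (simp_all add: GS)
 qed (simp add: G0 L_def)
 define d where "d n x = G (Suc n) x - G n x" for n x
 have nd: "norm (d n x) = norm (h n x)" for n x by (simp add: d_def GS)
 have Ld: "L (d n)" for n
 proof -
  have "d n = h n \<or> d n = (%x. - h n x)" by (auto simp: d_def GS fun_eq_iff)
  then show ?thesis using Lh Lmh by auto
 qed
 have Gsum: "G n x = (\<Sum>k<n. d k x)" for n x by (induction n) (auto simp: G0 d_def)
 have hump: "\<bar>T n (G (Suc n))\<bar> >= (1/3) ^ n * N n" for n
 proof (cases "\<bar>T n (%x. G n x + h n x)\<bar> >= (1/3) ^ n * N n")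
  case True
  then have "G (Suc n) = (%x. G n x + h n x)" by (simp add: GS)
  then show ?thesis using True by simp
 next
  case False
  then have e: "G (Suc n) = (%x. G n x - h n x)" by (simp add: GS)
  have "T n (%x. G n x + h n x) - T n (%x. G n x - h n x) = 2 * T n (h n)"
   using iT[OF LG, of n n] iT[OF Lh, of n n] by (simp add: T_def inner_add_right inner_diff_right)
  moreover have "T n (h n) = (1/3) ^ n * N n"
  proof -
   have "T n (h n) = ((1/3) ^ n / N n) * (\<integral>x. (norm (F n x))^2 \<partial>M)"
    by (simp add: T_def h_def power2_norm_eq_inner)
   also have "(\<integral>x. (norm (F n x))^2 \<partial>M) = (N n)^2" by (simp add: N_def)
   finally show ?thesis using N0[of n] by (simp add: power2_eq_square)
  qed
  ultimately show ?thesis using False e by auto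
 qed
 \<comment> \<open>The weighted squares have integrals 3^-k. By Cauchy-Schwarz with the weights 3^-k
   their sum Q yields the majorant 3/2 Q for all |G n|^2 at once, and it gives absolute convergence
   of the series almost everywhere.\<close>
 define q where "q k x = 3 ^ k * (norm (h k x))^2" for k x
 have [measurable]: "h k \<in> borel_measurable M" "F k \<in> borel_measurable M" "G k \<in> borel_measurable M" "d k \<in> borel_measurable M" for k
  using Lh LF LG Ld by (auto simp: L_def)
 have mq[measurable]: "q k \<in> borel_measurable M" for k unfolding q_def by measurable
 have iq: "integrable M (q k)" and vq: "(\<integral>x. q k x \<partial>M) = (1/3) ^ k" for k
 proof -
  show "integrable M (q k)" using Lh[of k] by (auto simp: L_def q_def[abs_def])
  show "(\<integral>x. q k x \<partial>M) = (1/3) ^ k"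
  proof -
   have "(3::real) ^ k * ((1/3) ^ k)^2 = (1/3) ^ k" by (simp add: power2_eq_square flip: power_mult_distrib mult.assoc)
   then show ?thesis by (simp add: q_def nh2)
  qed
 qed
 have q0: "q k x >= 0" for k x by (simp add: q_def)
 have s13: "summable (%k. (1/3::real) ^ k)" by (rule summable_geometric) simp
 have "(\<integral>\<^sup>+x. (\<Sum>k. ennreal (q k x)) \<partial>M) = (\<Sum>k. \<integral>\<^sup>+x. ennreal (q k x) \<partial>M)" by (rule nn_integral_suminf) measurable
 also have "\<dots> = (\<Sum>k. ennreal ((1/3) ^ k))" using nn_integral_eq_integral[OF iq] q0 vq by simp
 also have "\<dots> < \<infinity>"
 proof -
  have "(\<Sum>k. ennreal ((1/3) ^ k)) = ennreal (\<Sum>k. (1/3) ^ k)" by (rule suminf_ennreal2[OF _ s13]) simp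
  then show ?thesis by (simp only: infinity_ennreal_def ennreal_less_top)
 qed
 finally have Qfin: "(\<integral>\<^sup>+x. (\<Sum>k. ennreal (q k x)) \<partial>M) < \<infinity>" .
 have "AE x in M. (\<Sum>k. ennreal (q k x)) ~= \<infinity>"
  by (rule nn_integral_PInf_AE) (use Qfin in auto)
 then have sq: "AE x in M. summable (%k. q k x)"
  by eventually_elim (rule summable_suminf_not_top[OF q0], simp)
 define Q where "Q x = (\<Sum>k. q k x)" for x
 have [measurable]: "Q \<in> borel_measurable M" unfolding Q_def by measurable
 have iQ: "integrable M Q"
 proof (rule integrableI_nn_integral_finite[of Q M "enn2real (\<integral>\<^sup>+x. (\<Sum>k. ennreal (q k x)) \<partial>M)"])
  show "AE x in M. 0 <= Q x" using sq by eventually_elim (auto simp: Q_def q0 suminf_nonneg)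
  have "(\<integral>\<^sup>+x. ennreal (Q x) \<partial>M) = (\<integral>\<^sup>+x. (\<Sum>k. ennreal (q k x)) \<partial>M)"
   by (rule nn_integral_cong_AE, use sq in eventually_elim) (simp add: Q_def suminf_ennreal2 q0)
  then show "(\<integral>\<^sup>+x. ennreal (Q x) \<partial>M) = ennreal (enn2real (\<integral>\<^sup>+x. (\<Sum>k. ennreal (q k x)) \<partial>M))" using Qfin by simp
 qed measurable
 have GQ: "AE x in M. \<forall>n. (norm (G n x))^2 <= 3 / 2 * Q x"
  using sq
 proof eventually_elim
  case (elim x)
  show ?case
  proof
   fix n
   have "norm (G n x) <= (\<Sum>k<n. norm (h k x))" unfolding Gsum using norm_sum[of "%k. d k x" "{..<n}"] by (simp add: nd)
   also have "\<dots> = (\<Sum>k<n. sqrt ((1/3) ^ k) * sqrt (q k x))"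
    by (simp add: q_def real_sqrt_mult real_sqrt_divide power_divide real_sqrt_power)
   finally have "(norm (G n x))^2 <= (\<Sum>k<n. sqrt ((1/3) ^ k) * sqrt (q k x))^2" by (intro power_mono) auto
   also have "\<dots> <= (\<Sum>k<n. (sqrt ((1/3) ^ k))^2) * (\<Sum>k<n. (sqrt (q k x))^2)" by (rule Cauchy_Schwarz_ineq_sum)
   also have "\<dots> = (\<Sum>k<n. (1/3) ^ k) * (\<Sum>k<n. q k x)" by (simp add: q0)
   also have "\<dots> <= (3 / 2) * Q x"
   proof (rule mult_mono)
    show "(\<Sum>k<n. (1/3::real) ^ k) <= 3 / 2"
     using sum_le_suminf[OF s13, of "{..<n}"] suminf_geometric[of "1/3::real"] by simp
    show "(\<Sum>k<n. q k x) <= Q x" unfolding Q_def by (rule sum_le_suminf[OF elim]) (auto simp: q0)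
   qed (auto intro!: sum_nonneg simp: q0)
   finally show "(norm (G n x))^2 <= 3 / 2 * Q x" .
  qed
 qed
 define g where "g x = lim (%n. G n x)" for x
 have mg[measurable]: "g \<in> borel_measurable M" unfolding g_def by measurable
 have conv: "AE x in M. (%n. G n x) ~> g x"
  using sq
 proof eventually_elim
  case (elim x)
  have "summable (%k. (1/3) ^ k + q k x)" using s13 elim by (rule summable_add)
  then have "summable (%k. norm (d k x))"
  proof (rule summable_comparison_test'[where N=0])
   fix k :: nat
   have "norm (d k x) = sqrt ((1/3) ^ k) * sqrt (q k x)"
    by (simp add: nd q_def real_sqrt_mult real_sqrt_divide power_divide real_sqrt_power)
   also have "\<dots> <= (sqrt ((1/3) ^ k))^2 + (sqrt (q k x))^2"
    using zero_le_power2[of "sqrt ((1/3) ^ k) - sqrt (q k x)"] zero_le_power2[of "sqrt ((1/3) ^ k)"] zero_le_power2[of "sqrt (q k x)"]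
    unfolding power2_diff by linarith
   also have "\<dots> = (1/3) ^ k + q k x" by (simp add: q0)
   finally show "norm (norm (d k x)) <= (1/3) ^ k + q k x" by simp
  qed
  then have "summable (%k. d k x)" by (rule summable_norm_cancel)
  then have "convergent (%n. G n x)" unfolding Gsum by (simp add: summable_iff_convergent)
  then show ?case unfolding g_def by (rule convergent_LIMSEQ_iff[THEN iffD1])
 qed
 have Lg: "L g"
  unfolding L_def
 proof (intro conjI mg, rule LB_bound)
  show "integrable M (%x. 3 / 2 * Q x)" using iQ by simp
  show "AE x in M. norm ((norm (g x))^2) <= norm (3 / 2 * Q x)"
   using GQ conv
  proof eventually_elim
   case (elim x)
   have "(%n. (norm (G n x))^2) ~> (norm (g x))^2" using elim(2) by (intro tendsto_intros)
   then have "(norm (g x))^2 <= 3 / 2 * Q x" by (rule LIMSEQ_le_const2) (use elim(1) in auto)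
   then show ?case by simp
  qed
 qed measurable
 obtain B where B: "!!i. i \<in> I ==> \<bar>\<integral>x. f i x <.> g x \<partial>M\<bar> <= B" using bd[of g] Lg by (auto simp: L_def)
 have low: "\<bar>T n g\<bar> >= 1 / 2 * (4 / 3) ^ n" for n
 proof -
  have lim: "(%m. T n (G m)) ~> T n g"
   unfolding T_def
  proof (rule integral_dominated_convergence)
   show "integrable M (%x. (norm (F n x))^2 + 3 / 2 * Q x)" using iQ LF[of n] by (auto simp: L_def)
   show "AE x in M. (%m. F n x <.> G m x) ~> F n x <.> g x"
    using conv by eventually_elim (intro tendsto_intros)
   show "AE x in M. norm (F n x <.> G m x) <= (norm (F n x))^2 + 3 / 2 * Q x" for m
    using GQ
   proof eventually_elim
    case (elim x)
    have "norm (F n x <.> G m x) <= norm (F n x) * norm (G m x)" using Cauchy_Schwarz_ineq2[of "F n x" "G m x"] by simp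
    also have "\<dots> <= (norm (F n x))^2 + (norm (G m x))^2"
     using zero_le_power2[of "norm (F n x) - norm (G m x)"] zero_le_power2[of "norm (F n x)"] zero_le_power2[of "norm (G m x)"]
     unfolding power2_diff by linarith
    finally show ?case using elim by (meson add_left_mono order_trans)
   qed
  qed measurable
  \<comment> \<open>All later terms together have weight 3^-(n+1) + 3^-(n+2) + ... = 3^-n / 2, so
    they can undo at most half of the n-th hump.\<close>
  have diff: "\<bar>T n (G (Suc n + m)) - T n (G (Suc n))\<bar> <= N n * (1 / 2 * (1/3) ^ n)" for m
  proof -
   have "T n (G (Suc n + m)) - T n (G (Suc n)) = (\<Sum>k<m. T n (d (Suc n + k)))"
   proof (induction m)
    case (Suc m)
    have "T n (G (Suc n + Suc m)) = T n (G (Suc n + m)) + T n (d (Suc n + m))"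
     using iT[OF LG] iT[OF Ld] by (simp add: T_def d_def inner_diff_right)
    then show ?case using Suc by simp
   qed simp
   also have "\<bar>\<dots>\<bar> <= (\<Sum>k<m. N n * (1/3) ^ (Suc n + k))"
   proof (rule order_trans[OF sum_abs sum_mono])
    fix k
    show "\<bar>T n (d (Suc n + k))\<bar> <= N n * (1/3) ^ (Suc n + k)"
     using Tbd[OF Ld, of n "Suc n + k"] by (simp only: nd nh2) simp
   qed
   also have "\<dots> = N n * (1/3) ^ Suc n * (\<Sum>k<m. (1/3) ^ k)" by (simp add: power_add sum_distrib_left mult.assoc)
   also have "\<dots> <= N n * (1/3) ^ Suc n * (3 / 2)"
    using N0[of n] sum_le_suminf[OF s13, of "{..<m}"] suminf_geometric[of "1/3::real"] by (intro mult_left_mono) auto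
   finally show ?thesis by simp
  qed
  have "(%m. \<bar>T n (G (m + Suc n)) - T n (G (Suc n))\<bar>) ~> \<bar>T n g - T n (G (Suc n))\<bar>"
   by (intro tendsto_intros LIMSEQ_ignore_initial_segment lim)
  then have "\<bar>T n g - T n (G (Suc n))\<bar> <= N n * (1 / 2 * (1/3) ^ n)"
   by (rule LIMSEQ_le_const2) (use diff in \<open>auto simp: add.commute\<close>)
  then have "\<bar>T n g\<bar> >= 1 / 2 * ((1/3) ^ n * N n)"
  proof -
   have "N n * (1 / 2 * (1/3) ^ n) = 1 / 2 * ((1/3) ^ n * N n)" by simp
   then show ?thesis using hump[of n] \<open>\<bar>T n g - T n (G (Suc n))\<bar> <= N n * (1 / 2 * (1/3) ^ n)\<close> by linarith
  qed
  moreover have "(1/3) ^ n * N n >= (1/3) ^ n * 4 ^ n" using N4[of n] by (intro mult_left_mono) auto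
  moreover have "(1/3) ^ n * 4 ^ n = (4/3::real) ^ n" by (simp flip: power_mult_distrib)
  ultimately show ?thesis by linarith
 qed
 have le: "(4 / 3) ^ n <= 2 * B" for n using low[of n] B[OF j(1)[of n]] by (simp add: T_def F_def)
 obtain n where "2 * B < (4 / 3) ^ n" using real_arch_pow[of "4/3" "2 * B"] by auto
 then show False using le[of n] by simp
qed

section \<open>An abstract energy equality\<close>

text \<open>Fubini in the skew coordinates (sg, s - sg): a strip along the diagonal is swept by its
  parallels, each contributing at most e.\<close>

lemma nn_integral_strip:
 fixes W :: "real \<times> real => ennreal"
 assumes [measurable]: "W \<in> BM2" and ab: "a <= b"
  and le: "!!rh. a <= rh ==> rh <= b ==> (NNL sg. W (sg, sg + rh)) <= e"
 shows "(NNL s. NNL sg. (if a <= s - sg & s - sg <= b then W (sg, s) else 0)) <= ennreal (b - a) * e"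
proof -
 have "(NNL s. NNL sg. (if a <= s - sg & s - sg <= b then W (sg, s) else 0))
  = (NNL sg. NNL s. (if a <= s - sg & s - sg <= b then W (sg, s) else 0))"
  by (rule lborel_pair.Fubini') measurable
 also have "\<dots> = (NNL sg. NNL rh. (if a <= rh & rh <= b then W (sg, sg + rh) else 0))"
 proof (rule nn_integral_cong)
  fix sg
  show "(NNL s. (if a <= s - sg & s - sg <= b then W (sg, s) else 0)) = (NNL rh. (if a <= rh & rh <= b then W (sg, sg + rh) else 0))"
   using nn_integral_real_affine[of "%s. (if a <= s - sg & s - sg <= b then W (sg, s) else 0)" 1 sg] by (simp cong: if_cong)
 qed
 also have "\<dots> = (NNL rh. NNL sg. (if a <= rh & rh <= b then W (sg, sg + rh) else 0))"
  by (rule lborel_pair.Fubini') measurable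
 also have "\<dots> <= (NNL rh. e * indicator {a..b} rh)"
  by (rule nn_integral_mono) (use le in \<open>auto simp: indicator_def\<close>)
 also have "\<dots> = ennreal (b - a) * e" using ab by (simp add: nn_integral_cmult_indicator mult.commute)
 finally show ?thesis .
qed

text \<open>Let D h be the L^1 distance of R to its translate by h. Telescoping gives D H <= n D
  (H/n), and D (H/n) <= (H/n) (e/H) for large n, so D H <= e for every e. Thus all translates of R
  agree with R almost everywhere, and Fubini turns this into equality of R s and R \<tau> for almost
  all pairs.\<close>

lemma translation_invariant_ae:
 fixes R :: "real => real"
 assumes [measurable]: "R \<in> BM" and T: "T > 0"
  and small: "!!e. e > 0 ==> \<exists>h0>0. \<forall>h. 0 < h & h <= h0 -->
   (NNL t. (if 0 < t & t < T - h then ennreal \<bar>R (t + h) - R t\<bar> else 0)) <= ennreal (h * e)"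
 shows "AL \<tau>. 0 < \<tau> & \<tau> < T --> (AL s. 0 < s & s < \<tau> --> R s = R \<tau>)"
proof -
 define D where "D h = (NNL t. (if 0 < t & t < T - h then ennreal \<bar>R (t + h) - R t\<bar> else 0))" for h
 have Dn: "D (real n * h) <= of_nat n * D h" if h: "h > 0" for n h
 proof (induction n)
  case (Suc n)
  have "D (real (Suc n) * h) <= (NNL t. (if 0 < t & t < T - real n * h then ennreal \<bar>R (t + real n * h) - R t\<bar> else 0)
    + (if 0 < real n * h + 1 * t & real n * h + 1 * t < T - h then ennreal \<bar>R (real n * h + 1 * t + h) - R (real n * h + 1 * t)\<bar> else 0))"
   unfolding D_def
  proof (rule nn_integral_mono)
   fix t
   show "(if 0 < t & t < T - real (Suc n) * h then ennreal \<bar>R (t + real (Suc n) * h) - R t\<bar> else 0) <=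
    (if 0 < t & t < T - real n * h then ennreal \<bar>R (t + real n * h) - R t\<bar> else 0)
    + (if 0 < real n * h + 1 * t & real n * h + 1 * t < T - h then ennreal \<bar>R (real n * h + 1 * t + h) - R (real n * h + 1 * t)\<bar> else 0)"
   proof (cases "0 < t & t < T - real (Suc n) * h")
    case True
    have c: "0 < t & t < T - real n * h" "0 < real n * h + 1 * t & real n * h + 1 * t < T - h"
    proof -
     have "0 < real n * h + t" using True h by (intro add_nonneg_pos) auto
     then show "0 < t & t < T - real n * h" "0 < real n * h + 1 * t & real n * h + 1 * t < T - h"
      using True h by (auto simp: algebra_simps)
    qed
    have "R (t + real (Suc n) * h) = R (real n * h + 1 * t + h)" "R (t + real n * h) = R (real n * h + 1 * t)"
     by (rule arg_cong[where f=R], simp add: algebra_simps)+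
    then have "\<bar>R (t + real (Suc n) * h) - R t\<bar> <= \<bar>R (t + real n * h) - R t\<bar> + \<bar>R (real n * h + 1 * t + h) - R (real n * h + 1 * t)\<bar>"
     by linarith
    then show ?thesis using True c by (simp flip: ennreal_plus add: ennreal_leI)
   next
    case False
    then show ?thesis unfolding if_not_P[OF False] by simp
   qed
  qed
  also have "\<dots> = D (real n * h) + D h"
   unfolding D_def using nn_integral_real_affine[of "%t. (if 0 < t & t < T - h then ennreal \<bar>R (t + h) - R t\<bar> else 0)" 1 "real n * h"]
   by (subst nn_integral_add) auto
  also have "\<dots> <= of_nat (Suc n) * D h" using Suc by (simp add: distrib_right add.commute add_right_mono)
  finally show ?case .
 next
  case 0
  have "D 0 = (NNL (t::real). 0)" unfolding D_def by (rule nn_integral_cong) simp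
  then show ?case by simp
 qed
 have D0: "D H = 0" if H: "H > 0" for H
 proof -
  have "D H <= 0"
  proof (rule ennreal_le_epsilon)
   fix e :: real assume e: "e > 0"
   obtain h0 where h0: "h0 > 0" "!!h. 0 < h ==> h <= h0 ==> D h <= ennreal (h * (e / H))"
    using small[of "e / H"] e H unfolding D_def by auto
   obtain n :: nat where n: "H / h0 < real n" using reals_Archimedean2 by blast
   then have n0: "real n > 0" using H h0 by (meson divide_pos_pos less_trans)
   have "H / real n <= h0" using n n0 h0 H by (simp add: field_simps)
   then have "D (H / real n) <= ennreal (H / real n * (e / H))" using n0 H by (intro h0) auto
   then have "of_nat n * D (H / real n) <= ennreal (real n) * ennreal (H / real n * (e / H))"
    by (simp add: ennreal_of_nat_eq_real_of_nat mult_left_mono)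
   also have "\<dots> = ennreal e" using n0 H e by (simp flip: ennreal_mult)
   finally have "D (real n * (H / real n)) <= ennreal e" using Dn[of "H / real n" n] n0 H by simp
   then show "D H <= 0 + ennreal e" using n0 by simp
  qed
  then show ?thesis by simp
 qed
 have "(NNL \<tau>. NNL s. (if 0 < s & s < \<tau> & \<tau> < T then ennreal \<bar>R \<tau> - R s\<bar> else 0))
  = (NNL s. NNL \<tau>. (if 0 < s & s < \<tau> & \<tau> < T then ennreal \<bar>R \<tau> - R s\<bar> else 0))"
  by (rule lborel_pair.Fubini') measurable
 also have "\<dots> = (NNL s. NNL h. (if 0 < h & 0 < s & s < T - h then ennreal \<bar>R (s + h) - R s\<bar> else 0))"
 proof (rule nn_integral_cong)
  fix s
  have "(NNL \<tau>. (if 0 < s & s < \<tau> & \<tau> < T then ennreal \<bar>R \<tau> - R s\<bar> else 0)) =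
   (NNL h. (if 0 < s & s < s + 1 * h & s + 1 * h < T then ennreal \<bar>R (s + 1 * h) - R s\<bar> else 0))"
   using nn_integral_real_affine[of "%\<tau>. (if 0 < s & s < \<tau> & \<tau> < T then ennreal \<bar>R \<tau> - R s\<bar> else 0)" 1 s] by simp
  also have "\<dots> = (NNL h. (if 0 < h & 0 < s & s < T - h then ennreal \<bar>R (s + h) - R s\<bar> else 0))"
   by (intro nn_integral_cong) auto
  finally show "(NNL \<tau>. (if 0 < s & s < \<tau> & \<tau> < T then ennreal \<bar>R \<tau> - R s\<bar> else 0)) = \<dots>" .
 qed
 also have "\<dots> = (NNL h. NNL s. (if 0 < h & 0 < s & s < T - h then ennreal \<bar>R (s + h) - R s\<bar> else 0))"
  by (rule lborel_pair.Fubini') measurable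
 also have "\<dots> = (NNL (h::real). 0)"
 proof (rule nn_integral_cong)
  fix h :: real
  show "(NNL s. (if 0 < h & 0 < s & s < T - h then ennreal \<bar>R (s + h) - R s\<bar> else 0)) = 0"
   using D0[of h] by (cases "h > 0") (auto simp: D_def)
 qed
 finally have "(NNL \<tau>. NNL s. (if 0 < s & s < \<tau> & \<tau> < T then ennreal \<bar>R \<tau> - R s\<bar> else 0)) = 0" by simp
 then have "AL \<tau>. (NNL s. (if 0 < s & s < \<tau> & \<tau> < T then ennreal \<bar>R \<tau> - R s\<bar> else 0)) = 0"
  by (subst (asm) nn_integral_0_iff_AE) auto
 then show ?thesis
 proof eventually_elim
  case (elim \<tau>)
  then have "AL s. (if 0 < s & s < \<tau> & \<tau> < T then ennreal \<bar>R \<tau> - R s\<bar> else 0) = 0"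
   by (subst (asm) nn_integral_0_iff_AE) auto
  then have *: "AL s. 0 < \<tau> & \<tau> < T --> 0 < s & s < \<tau> --> R s = R \<tau>"
   by eventually_elim (auto split: if_splits)
  show ?case by (intro impI, use * in eventually_elim) auto
 qed
qed

text \<open>k stands for K on the diagonal, which is a null set of the plane; \<open>TT\<close>
  gives this trace a meaning by asking that K (sg, sg + dl) tends to k in L^1 as the offset dl tends
  to 0. E stands for B on the diagonal, likewise known only for almost every time.\<close>

lemma energy_equality_abstract:
 fixes B :: "real => real => real" and K :: "real \<times> real => real" and E k :: "real => real"
 assumes T: "T > 0" and mK: "K \<in> BM"
  and TT: "!!e. e > 0 ==> \<exists>h>0. \<forall>dl. \<bar>dl\<bar> <= h --> (NNL sg. ennreal \<bar>K (sg, sg + dl) - k sg\<bar>) <= ennreal e"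
  and ik: "IL k"
  and sym: "!!t s. B t s = B s t"
  and eq: "AL s. 0 < s & s < T --> IL (%sg. K (sg, s)) &
   (\<forall>t1 t2. 0 <= t1 & t1 <= t2 & t2 <= T --> B t2 s - B t1 s = (LBINT sg. (if t1 <= sg & sg <= t2 then K (sg, s) else 0)))"
  and cont: "((%s. B 0 s) \<longlongrightarrow> B 0 0) (at_right 0)"
  and E: "E \<in> BM" "AL s. 0 < s & s < T --> E s = B s s"
 shows "AL \<tau>. 0 < \<tau> & \<tau> < T --> E \<tau> = B 0 0 + 2 * (LBINT sg. (if 0 <= sg & sg <= \<tau> then k sg else 0))"
proof -
 have [measurable]: "K \<in> BM2" "K \<in> BM" using mK by (auto simp: borel_prod)
 have [measurable]: "k \<in> BM" "E \<in> BM" using ik E by auto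
 define J where "J t = (LBINT sg. (if 0 <= sg & sg <= t then k sg else 0))" for t
 have [measurable]: "J \<in> BM" unfolding J_def by measurable
 define R where "R t = E t - 2 * J t" for t
 have [measurable]: "R \<in> BM" unfolding R_def by measurable
 define W where "W z = ennreal \<bar>K z - k (fst z)\<bar>" for z
 have [measurable]: "W \<in> BM2" unfolding W_def by measurable
 have ikab: "IL (%sg. if a <= sg & sg <= b then g sg else 0)" if "IL g" for a b :: real and g :: "real => real"
 proof (rule LB_bound[OF that])
  have [measurable]: "g \<in> BM" using that by auto
  show "(%sg. if a <= sg & sg <= b then g sg else 0) \<in> borel_measurable lborel" by measurable
 qed auto
 have Jdiff: "J t2 - J t1 = (LBINT sg. (if t1 <= sg & sg <= t2 then k sg else 0))" if "0 <= t1" "t1 <= t2" for t1 t2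
 proof -
  have "J t2 = (LBINT sg. (if 0 <= sg & sg <= t1 then k sg else 0) + (if t1 <= sg & sg <= t2 then k sg else 0))"
   unfolding J_def
  proof (rule integral_cong_AE)
   show "AL sg. (if 0 <= sg & sg <= t2 then k sg else 0) = (if 0 <= sg & sg <= t1 then k sg else 0) + (if t1 <= sg & sg <= t2 then k sg else 0)"
    using AE_lborel_singleton[of t1] by eventually_elim (use that in auto)
  qed measurable
  also have "\<dots> = J t1 + (LBINT sg. (if t1 <= sg & sg <= t2 then k sg else 0))"
   unfolding J_def by (rule LB_add) (rule ikab[OF ik])+
  finally show ?thesis by simp
 qed
 define good where "good s \<longleftrightarrow> IL (%sg. K (sg, s)) &
   (\<forall>t1 t2. 0 <= t1 & t1 <= t2 & t2 <= T --> B t2 s - B t1 s = (LBINT sg. (if t1 <= sg & sg <= t2 then K (sg, s) else 0))) & E s = B s s" for s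
 have good: "AL s. 0 < s & s < T --> good s"
  using eq E(2) by eventually_elim (auto simp: good_def)
 have Kk: "ennreal \<bar>(LBINT sg. (if t1 <= sg & sg <= t2 then K (sg, s) else 0)) - (LBINT sg. (if t1 <= sg & sg <= t2 then k sg else 0))\<bar>
  <= (NNL sg. (if t1 <= sg & sg <= t2 then W (sg, s) else 0))" if "good s" for s t1 t2
 proof -
  have i: "IL (%sg. K (sg, s))" using that by (simp add: good_def)
  have "(LBINT sg. (if t1 <= sg & sg <= t2 then K (sg, s) else 0)) - (LBINT sg. (if t1 <= sg & sg <= t2 then k sg else 0))
   = (LBINT sg. (if t1 <= sg & sg <= t2 then K (sg, s) else 0) - (if t1 <= sg & sg <= t2 then k sg else 0))"
   by (rule Bochner_Integration.integral_diff[symmetric]) (rule ikab[OF i] ikab[OF ik])+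
  also have "\<dots> = (LBINT sg. (if t1 <= sg & sg <= t2 then K (sg, s) - k sg else 0))"
   by (rule LB_cong) auto
  finally have "ennreal \<bar>(LBINT sg. (if t1 <= sg & sg <= t2 then K (sg, s) else 0)) - (LBINT sg. (if t1 <= sg & sg <= t2 then k sg else 0))\<bar>
   <= (NNL sg. ennreal (norm (if t1 <= sg & sg <= t2 then K (sg, s) - k sg else 0)))"
   using integral_norm_bound_ennreal[OF ikab[OF Bochner_Integration.integrable_diff[OF i ik]], of t1 t2] by simp
  also have "\<dots> = (NNL sg. (if t1 <= sg & sg <= t2 then W (sg, s) else 0))"
   by (rule nn_integral_cong) (auto simp: W_def)
  finally show ?thesis .
 qed
 have shiftAE: "AL t. P (t + h)" if P: "AL t. P t" for P and h :: real
 proof -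
  obtain N where N: "N \<in> null_sets lborel" "!!t. t \<notin> N ==> P t" using AE_E3[OF P] by auto
  have "AL t. t \<notin> N" by (rule AE_not_in[OF N(1)])
  then have "AL t. h + 1 * t \<notin> N"
   using N by (intro AE_borel_affine) (auto simp: pred_def dest: null_setsD2)
  then show ?thesis by eventually_elim (use N in \<open>auto simp: add.commute\<close>)
 qed
 have AE1: "AL \<tau>. 0 < \<tau> & \<tau> < T --> (AL s. 0 < s & s < \<tau> --> R s = R \<tau>)"
 proof (rule translation_invariant_ae[OF _ T])
  fix e :: real assume e: "e > 0"
  obtain h0 where h0: "h0 > 0" "!!dl. \<bar>dl\<bar> <= h0 ==> (NNL sg. W (sg, sg + dl)) <= ennreal (e / 2)"
   using TT[of "e / 2"] e by (auto simp: W_def)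
  show "\<exists>h0>0. \<forall>h. 0 < h & h <= h0 --> (NNL t. (if 0 < t & t < T - h then ennreal \<bar>R (t + h) - R t\<bar> else 0)) <= ennreal (h * e)"
  proof (intro exI[of _ h0] conjI allI impI h0(1))
   fix h assume h: "0 < h & h <= h0"
   define U1 where "U1 s = (NNL sg. (if - h <= s - sg & s - sg <= 0 then W (sg, s) else 0))" for s
   define U2 where "U2 s = (NNL sg. (if 0 <= s - sg & s - sg <= h then W (sg, s) else 0))" for s
   have [measurable]: "U1 \<in> BM" "U2 \<in> BM" unfolding U1_def U2_def by measurable
   have "(NNL t. (if 0 < t & t < T - h then ennreal \<bar>R (t + h) - R t\<bar> else 0)) <= (NNL t. U1 t + U2 (h + 1 * t))"
   proof (rule nn_integral_mono_AE, use good shiftAE[OF good, of h] in eventually_elim)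
    case (elim t)
    show ?case
    proof (cases "0 < t & t < T - h")
     case True
     then have g: "good t" "good (t + h)" using elim h by auto
     \<comment> \<open>B t (t + h) = B (t + h) t is inserted. Both differences move the first
       argument only, with the second frozen at t + h and at t, and each of them produces one
       integral of k.\<close>
     have "E (t + h) - E t = (B (t + h) (t + h) - B t (t + h)) + (B (t + h) t - B t t)"
      using g sym[of t "t + h"] by (simp add: good_def)
     also have "\<dots> = (LBINT sg. (if t <= sg & sg <= t + h then K (sg, t + h) else 0)) + (LBINT sg. (if t <= sg & sg <= t + h then K (sg, t) else 0))"
      using g True h unfolding good_def by force
     finally have "\<bar>R (t + h) - R t\<bar> <= \<bar>(LBINT sg. (if t <= sg & sg <= t + h then K (sg, t) else 0)) - (LBINT sg. (if t <= sg & sg <= t + h then k sg else 0))\<bar>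
      + \<bar>(LBINT sg. (if t <= sg & sg <= t + h then K (sg, t + h) else 0)) - (LBINT sg. (if t <= sg & sg <= t + h then k sg else 0))\<bar>"
      using Jdiff[of t "t + h"] True h unfolding R_def by auto
     then have "ennreal \<bar>R (t + h) - R t\<bar> <= ennreal \<bar>(LBINT sg. (if t <= sg & sg <= t + h then K (sg, t) else 0)) - (LBINT sg. (if t <= sg & sg <= t + h then k sg else 0))\<bar>
      + ennreal \<bar>(LBINT sg. (if t <= sg & sg <= t + h then K (sg, t + h) else 0)) - (LBINT sg. (if t <= sg & sg <= t + h then k sg else 0))\<bar>"
      by (simp flip: ennreal_plus add: ennreal_leI)
     also have "\<dots> <= (NNL sg. (if t <= sg & sg <= t + h then W (sg, t) else 0)) + (NNL sg. (if t <= sg & sg <= t + h then W (sg, t + h) else 0))"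
      by (intro add_mono Kk g)
     also have "\<dots> = U1 t + U2 (h + 1 * t)"
      unfolding U1_def U2_def by (intro arg_cong2[where f="(+)"] nn_integral_cong) (auto simp: add.commute)
     finally show ?thesis using True by simp
    next
     case False
     then show ?thesis unfolding if_not_P[OF False] by simp
    qed
   qed
   also have "\<dots> = (NNL s. U1 s) + (NNL s. U2 s)"
    using nn_integral_real_affine[of U2 1 h] by (subst nn_integral_add) auto
   also have "\<dots> <= ennreal (0 - (- h)) * ennreal (e / 2) + ennreal (h - 0) * ennreal (e / 2)"
    unfolding U1_def U2_def using h by (intro add_mono nn_integral_strip h0) auto
   also have "\<dots> = ennreal (h * e)" using h e by (simp flip: ennreal_mult ennreal_plus)
   finally show "(NNL t. (if 0 < t & t < T - h then ennreal \<bar>R (t + h) - R t\<bar> else 0)) <= ennreal (h * e)" .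
  qed
 qed measurable
 have Jlim: "(J \<longlongrightarrow> 0) (at_right 0)"
  unfolding tendsto_at_iff_sequentially
 proof (intro allI impI)
  fix X :: "nat => real" assume X: "\<forall>i. X i \<in> {0<..} - {0}" "X ~> 0"
  have "(%n. LBINT sg. (if 0 <= sg & sg <= X n then k sg else 0)) ~> (LBINT (sg::real). 0)"
  proof (rule integral_dominated_convergence[where w="%sg. \<bar>k sg\<bar>"])
   show "AL sg. (%n. if 0 <= sg & sg <= X n then k sg else 0) ~> 0"
    using AE_lborel_singleton[of 0]
   proof eventually_elim
    case (elim sg)
    show ?case
    proof (cases "sg < 0")
     case False
     then have "sg > 0" using elim by simp
     then have "\<forall>\<^sub>F n in sequentially. X n < sg" using order_tendstoD(2)[OF X(2)] by simp
     then have "\<forall>\<^sub>F n in sequentially. (if 0 <= sg & sg <= X n then k sg else 0) = 0" by eventually_elim auto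
     then show ?thesis by (rule tendsto_eventually)
    qed simp
   qed
  qed (use ik in auto)
  then show "(J \<circ> X) ~> 0" by (simp add: J_def o_def)
 qed
 from AE1 have "AL \<tau>. 0 < \<tau> & \<tau> < T --> R \<tau> = B 0 0"
 proof eventually_elim
  case (elim \<tau>)
  show ?case
  proof
   assume \<tau>: "0 < \<tau> & \<tau> < T"
   with elim have cst: "AL s. 0 < s & s < \<tau> --> R s = R \<tau>" by simp
   have "\<bar>R \<tau> - B 0 0\<bar> <= 0 + e" if e: "e > 0" for e
   proof -
    define e3 where "e3 = e / 3"
    have e3: "e3 > 0" using e by (simp add: e3_def)
    obtain h0 where h0: "h0 > 0" "!!dl. \<bar>dl\<bar> <= h0 ==> (NNL sg. W (sg, sg + dl)) <= ennreal e3"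
     using TT[OF e3] by (auto simp: W_def)
    have "\<forall>\<^sub>F s in at_right 0. dist (B 0 s) (B 0 0) < e3 & dist (J s) 0 < e3"
     using tendstoD[OF cont e3] tendstoD[OF Jlim e3] by eventually_elim simp
    then obtain b where b: "b > 0" "!!s. 0 < s ==> s < b ==> \<bar>B 0 s - B 0 0\<bar> < e3 & \<bar>J s\<bar> < e3"
     unfolding eventually_at_right_field by (auto simp: dist_real_def)
    define h where "h = min h0 (min b \<tau>)"
    have h: "h > 0" "h <= h0" "h <= b" "h <= \<tau>" using h0 b \<tau> by (auto simp: h_def)
    define U where "U s = (NNL sg. (if 0 <= s - sg & s - sg <= h then W (sg, s) else 0))" for s
    have [measurable]: "U \<in> BM" unfolding U_def by measurable
    \<comment> \<open>R is constant on (0, \<tau>), so its distance to \<open>B 0 0\<close> may be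
      averaged over s in (0, h). This absorbs the exceptional s: 2 e3 comes from the limits of
      \<open>B 0 s\<close> and \<open>J s\<close> at 0, and e3 from the strip.\<close>
    have "ennreal (h * \<bar>R \<tau> - B 0 0\<bar>) = (NNL s. ennreal \<bar>R \<tau> - B 0 0\<bar> * indicator {0<..<h} s)"
     using h by (subst nn_integral_cmult_indicator) (auto simp: ennreal_mult mult.commute)
    also have "\<dots> <= (NNL s. ennreal (2 * e3) * indicator {0<..<h} s + U s)"
    proof (rule nn_integral_mono_AE, use good cst in eventually_elim)
     case (elim s)
     show ?case
     proof (cases "0 < s & s < h")
      case True
      then have g: "good s" and Rs: "R s = R \<tau>" using elim h \<tau> by auto
      have "0 <= s" "s <= T" using True h \<tau> by auto
      then have "B s s - B 0 s = (LBINT sg. (if 0 <= sg & sg <= s then K (sg, s) else 0))"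
       using g unfolding good_def by (elim conjE allE[where x=0] allE[where x=s]) simp
      then have "R s - B 0 0 = (B 0 s - B 0 0) - J s + ((LBINT sg. (if 0 <= sg & sg <= s then K (sg, s) else 0)) - (LBINT sg. (if 0 <= sg & sg <= s then k sg else 0)))"
       using g by (simp add: R_def good_def J_def)
      then have "\<bar>R \<tau> - B 0 0\<bar> <= 2 * e3 + \<bar>(LBINT sg. (if 0 <= sg & sg <= s then K (sg, s) else 0)) - (LBINT sg. (if 0 <= sg & sg <= s then k sg else 0))\<bar>"
       using b(2)[of s] True h unfolding Rs by auto
      then have "ennreal \<bar>R \<tau> - B 0 0\<bar> <= ennreal (2 * e3) + ennreal \<bar>(LBINT sg. (if 0 <= sg & sg <= s then K (sg, s) else 0)) - (LBINT sg. (if 0 <= sg & sg <= s then k sg else 0))\<bar>"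
       using e3 by (simp flip: ennreal_plus add: ennreal_leI)
      also have "\<dots> <= ennreal (2 * e3) + (NNL sg. (if 0 <= sg & sg <= s then W (sg, s) else 0))"
       by (intro add_mono Kk g) auto
      also have "(NNL sg. (if 0 <= sg & sg <= s then W (sg, s) else 0)) <= U s"
       unfolding U_def using True by (intro nn_integral_mono) auto
      finally show ?thesis using True by (simp add: add_left_mono)
     qed simp
    qed
    also have "\<dots> = ennreal (2 * e3) * ennreal h + (NNL s. U s)"
     using h by (subst nn_integral_add) (auto simp: nn_integral_cmult_indicator)
    also have "\<dots> <= ennreal (2 * e3) * ennreal h + ennreal (h - 0) * ennreal e3"
     unfolding U_def using h by (intro add_mono nn_integral_strip h0) auto
    also have "\<dots> = ennreal (h * (3 * e3))" using h e3 by (simp add: algebra_simps flip: ennreal_mult ennreal_plus)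
    finally have "h * \<bar>R \<tau> - B 0 0\<bar> <= h * (3 * e3)" using h e3 by (subst (asm) ennreal_le_iff) auto
    then show ?thesis using h by (simp add: e3_def)
   qed
   then have "\<bar>R \<tau> - B 0 0\<bar> <= 0" by (rule field_le_epsilon)
   then show "R \<tau> = B 0 0" by simp
  qed
 qed
 then show ?thesis by eventually_elim (auto simp: R_def J_def)
qed

section \<open>Pushing the domain into itself\<close>

lemma onorm_matrix_le:
 fixes A :: mat3
 shows "onorm ((*v) A) <= 9 * norm A"
proof -
 have "onorm ((*v) A) <= real CARD(3) * real CARD(3) * norm A"
  by (rule onorm_le_matrix_component) (rule abs_entry_le_norm)
 then show ?thesis by simp
qed

lemma continuous_on_det3: "continuous_on S f ==> continuous_on S (%x. det (f x :: mat3))"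
 unfolding det_def by (intro continuous_intros)

text \<open>Change of variables: the map is injective on \<Omega> with Jacobian at least 1/2, so a
  preimage has at most twice the measure of its image.\<close>

lemma quasi_pres_perturbation:
 fixes V :: "vec3 => vec3" and H :: "vec3 => mat3"
 assumes \<Omega>: "\<Omega> \<in> sets borel" "bounded \<Omega>"
  and dV: "!!x. (V has_derivative (%h. H x *v h)) (at x)" and cH: "CU H"
  and inj: "inj_on (%x. x - d *R V x) \<Omega>"
  and det: "!!x. x \<in> \<Omega> ==> det (mat 1 - d *R H x) >= 1/2"
 shows "quasi_pres 2 \<Omega> (%x. x - d *R V x)"
 unfolding quasi_pres_def
proof (intro conjI ballI)
 have cV: "CU V" using dV by (intro has_derivative_continuous_on) (auto intro: has_derivative_at_withinI)
 let ?S = "%x. x - d *R V x"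
 have cS: "CU ?S" by (intro continuous_intros cV)
 then show mS[measurable]: "?S \<in> BM" by (rule borel_measurable_continuous_onI)
 fix B :: "vec3 set" assume B[measurable]: "B \<in> sets borel"
 define P where "P = {x \<in> \<Omega>. ?S x \<in> B}"
 have P[measurable]: "P \<in> sets borel" unfolding P_def using \<Omega>(1) by measurable
 have bP: "bounded P" by (rule bounded_subset[OF \<Omega>(2)]) (auto simp: P_def)
 have Pl: "P \<in> lmeasurable" using P bP by (intro bounded_set_imp_lmeasurable) auto
 show "emeasure lborel {x \<in> \<Omega>. ?S x \<in> B} <= ennreal 2 * emeasure lborel B"
 proof (cases "emeasure lborel B = top")
  case True then show ?thesis by (simp add: ennreal_mult_top)
 next
  case False
  define J where "J x = \<bar>det (matrix (%h. h - d *R (H x *v h)))\<bar>" for x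
  have Jdet: "J x = \<bar>det (mat 1 - d *R H x)\<bar>" for x
  proof -
   have "(%h. h - d *R (H x *v h)) = (%h. (mat 1 - d *R H x) *v h)"
    by (simp add: fun_eq_iff matrix_vector_mult_diff_rdistrib scaleR_matrix_vector_assoc)
   then show ?thesis unfolding J_def by simp
  qed
  have cJ: "CU J"
   unfolding Jdet by (intro continuous_intros continuous_on_det3 cH)
  have dS: "(?S has_derivative (%h. h - d *R (H x *v h))) (at x within P)" for x
   by (intro derivative_intros has_derivative_at_withinI[OF dV])
  have injP: "inj_on ?S P" by (rule inj_on_subset[OF inj]) (auto simp: P_def)
  have "compact (closure P)" using bP by simp
  then have "bounded (J ` closure P)" by (intro compact_imp_bounded compact_continuous_image continuous_on_subset[OF cJ]) auto
  then obtain M where M: "!!x. x \<in> P ==> norm (J x) <= M"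
   unfolding bounded_iff using closure_subset by (metis image_eqI subsetD)
  have [measurable]: "J \<in> BM" using cJ by (rule borel_measurable_continuous_onI)
  have sJ: "set_integrable lebesgue P J"
   unfolding set_integrable_def
  proof (rule LB_bound[where f="%x. indicator P x *R M"])
   show "integrable lebesgue (%x. indicat_real P x *R M)"
    using Pl by (simp add: lmeasurable_iff_integrable)
   show "(%x. indicat_real P x *R J x) \<in> borel_measurable lebesgue"
    by (rule measurable_completion) measurable
   show "AE x in lebesgue. norm (indicat_real P x *R J x) <= norm (indicat_real P x *R M)"
    using M by (intro AE_I2) (force simp: indicator_def)
  qed
  have iJ: "J integrable_on P" by (rule set_lebesgue_integral_eq_integral(1)[OF sJ])
  have m: "?S ` P \<in> lmeasurable" "measure lebesgue (?S ` P) = integral P J"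
   using measurable_differentiable_image_eq[of P ?S "%x h. h - d *R (H x *v h)"]
    measure_differentiable_image_eq[of P ?S "%x h. h - d *R (H x *v h)"] iJ dS injP Pl
   unfolding J_def[abs_def] by auto
  have "1/2 * measure lebesgue P = 1/2 * integral P (%x. 1)" by (simp only: lmeasure_integral[OF Pl])
  also have "\<dots> = integral P (%x. 1/2 :: real)" by (subst integral_mult_right[symmetric]) simp
  also have "\<dots> <= integral P J"
  proof (rule integral_le)
   show "(%x. 1/2 :: real) integrable_on P" using Pl lmeasurable_iff_integrable_on integrable_on_const by blast
   show "1/2 <= J x" if "x \<in> P" for x using det[of x] that by (auto simp: P_def Jdet)
  qed (rule iJ)
  also have "\<dots> = measure lebesgue (?S ` P)" by (rule m(2)[symmetric])
  also have "\<dots> <= measure lebesgue B"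
  proof (rule measure_mono_fmeasurable)
   show "B \<in> lmeasurable" using False B by (auto simp: fmeasurable_def less_top)
  qed (use m(1) in \<open>auto simp: P_def\<close>)
  finally have le: "measure lborel P <= 2 * measure lborel B" using P B by simp
  have "emeasure lborel P = ennreal (measure lborel P)"
   using emeasure_bounded_finite[OF bP] by (intro emeasure_eq_ennreal_measure) auto
  also have "\<dots> <= ennreal (2 * measure lborel B)" using le by (rule ennreal_leI)
  also have "\<dots> = ennreal 2 * emeasure lborel B"
   using False by (simp add: ennreal_mult emeasure_eq_ennreal_measure)
  finally show ?thesis by (simp add: P_def)
 qed
qed

text \<open>V is the gradient of the defining function \<open>rh\<close>. Where |V| > m, the step -d
  V lowers \<open>rh\<close> by about d |V|^2, which outweighs a perturbation of size c d and the
  quadratic Taylor error. Where |V| <= m, a compact part of the closure away from the boundary,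
  \<open>rh\<close> lies below a negative constant and a short step cannot reach 0.\<close>

lemma C2beta_domain_inward_map:
 assumes dom: "C2beta_domain \<beta> \<Omega>"
 obtains V :: "vec3 => vec3" and H :: "vec3 => mat3" and c d0 G :: real
 where "!!x. (V has_derivative (%h. H x *v h)) (at x)" "CU V" "CU H"
  "c > 0" "d0 > 0" "G > 0" "!!x. x \<in> \<Omega> ==> norm (V x) <= G" "!!x. x \<in> \<Omega> ==> norm (H x) <= G"
  "!!d. 0 < d ==> d <= d0 ==> quasi_pres 2 \<Omega> (%x. x - d *R V x)"
  "!!d x. 0 < d ==> d <= d0 ==> x \<in> \<Omega> ==> cball (x - d *R V x) (c * d) \<subseteq> \<Omega>"
proof -
 from dom obtain rh V H where op: "open \<Omega>" and bd: "bounded \<Omega>" and ne: "\<Omega> ~= {}" and C1: "C1_defining \<Omega> rh V"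
  and dV: "!!x. (V has_derivative (%h. H x *v h)) (at x)" and cH: "CU H"
  unfolding C2beta_domain_def by blast
 have drh: "(rh has_derivative (%h. V x <.> h)) (at x)" for x using C1 by (auto simp: C1_defining_def)
 have cV: "CU V" using C1 by (auto simp: C1_defining_def)
 have \<Omega>eq: "\<Omega> = {x. rh x < 0}" using C1 by (auto simp: C1_defining_def)
 have fr: "!!x. x \<in> frontier \<Omega> ==> V x ~= 0" using C1 by (auto simp: C1_defining_def)
 have crh: "CU rh" using drh by (intro has_derivative_continuous_on) (auto intro: has_derivative_at_withinI)
 have cl: "rh x <= 0" if "x \<in> closure \<Omega>" for x
  using continuous_closed_preimage[of UNIV rh "{..0}"] closure_minimal[of \<Omega> "{x. rh x <= 0}"] that crh
  by (auto simp: \<Omega>eq vimage_def intro: less_imp_le)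
 have cc: "compact (closure \<Omega>)" using bd by simp
 obtain R0 where R0: "R0 > 0" "!!x. x \<in> closure \<Omega> ==> norm x <= R0"
  using compact_imp_bounded[OF cc] unfolding bounded_pos by blast
 define D where "D = cball (0::vec3) (R0 + 1)"
 have "compact (V ` D)" "compact (H ` D)"
  unfolding D_def by (intro compact_continuous_image continuous_on_subset[OF cV] continuous_on_subset[OF cH]; auto)+
 from this[THEN compact_imp_bounded] obtain GV GH where GV: "!!x. x \<in> D ==> norm (V x) <= GV" and GH: "!!x. x \<in> D ==> norm (H x) <= GH"
  unfolding bounded_iff by fastforce
 define G where "G = max 1 (max GV GH)"
 have G: "G > 0" "!!x. x \<in> D ==> norm (V x) <= G" "!!x. x \<in> D ==> norm (H x) <= G"
  using GV GH unfolding G_def by fastforce+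
 define L where "L = 9 * G"
 have L: "L > 0" using G by (simp add: L_def)
 have lip: "norm (V x - V y) <= L * norm (x - y)" if "x \<in> D" "y \<in> D" for x y
 proof (rule differentiable_bound[where S=D and f'="%x h. H x *v h"])
  show "onorm ((*v) (H x)) <= L" if "x \<in> D" for x
   using onorm_matrix_le[of "H x"] G(3)[OF that] by (simp add: L_def)
 qed (use that dV in \<open>auto simp: D_def intro: has_derivative_at_withinI\<close>)
 have clD: "x \<in> closure \<Omega> ==> x \<in> D" for x using R0 by (force simp: D_def)
 have \<Omega>cl: "x \<in> \<Omega> ==> x \<in> closure \<Omega>" for x using closure_subset by blast
 \<comment> \<open>Second-order Taylor bound from the Lipschitz constant L of V. Steps of length at
   most 1 stay in the enlarged ball \<open>D\<close>, on which V and H are bounded by G.\<close>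
 have taylor: "rh (x + w) <= rh x + V x <.> w + L * (norm w)^2" if x: "x \<in> closure \<Omega>" and w: "norm w <= 1" for x w
 proof -
  have seg: "x + t *R w \<in> D" "norm (t *R w) <= norm w" if "t \<in> {0..1}" for t
  proof -
   show *: "norm (t *R w) <= norm w" using that by (auto simp: mult_left_le_one_le)
   then show "x + t *R w \<in> D" using R0(2)[OF x] w norm_triangle_ineq[of x "t *R w"] by (simp add: D_def)
  qed
  have "norm (rh (x + w) - rh x - V x <.> ((x + w) - x)) <= norm ((x + w) - x) * (L * norm w)"
  proof (rule differentiable_bound_linearization[where S="(%t. x + t *R w) ` {0..1}" and f'="%x h. V x <.> h"])
   show "(rh has_derivative (<.>) (V y)) (at y within (%t. x + t *R w) ` {0..1})" for y
    by (rule has_derivative_at_withinI[OF drh])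
   show "x \<in> (%t. x + t *R w) ` {0..1}" by (auto intro!: image_eqI[of _ _ 0])
   fix y assume "y \<in> (%t. x + t *R w) ` {0..1}"
   then obtain t where t: "t \<in> {0..1}" "y = x + t *R w" by auto
   show "onorm ((<.>) (V y) - (<.>) (V x)) <= L * norm w"
   proof (rule onorm_bound)
    show "0 <= L * norm w" using L by simp
    fix h :: vec3
    have "norm (V y - V x) <= L * norm (y - x)" using seg(1)[OF t(1)] t clD[OF x] by (intro lip) auto
    also have "\<dots> <= L * norm w" using seg(2)[OF t(1)] t L by (intro mult_left_mono) auto
    finally have "norm (V y - V x) * norm h <= L * norm w * norm h" by (rule mult_right_mono) simp
    then have "norm (V y <.> h - V x <.> h) <= L * norm w * norm h"
     using Cauchy_Schwarz_ineq2[of "V y - V x" h] by (simp add: inner_diff_left)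
    then show "norm (((<.>) (V y) - (<.>) (V x)) h) <= L * norm w * norm h" by simp
   qed
  qed auto
  then show ?thesis by (simp add: power2_eq_square mult_ac)
 qed
 have "frontier \<Omega> ~= {}"
  using ne bd frontier_eq_empty[of \<Omega>] not_bounded_UNIV by auto
 moreover have cf: "compact (frontier \<Omega>)" using bd by (rule compact_frontier_bounded)
 ultimately obtain x0 where x0: "x0 \<in> frontier \<Omega>" "!!x. x \<in> frontier \<Omega> ==> norm (V x0) <= norm (V x)"
  using continuous_attains_inf[of "frontier \<Omega>" "%x. norm (V x)"] continuous_on_subset[OF cV]
  by (metis continuous_on_norm subset_UNIV)
 define m where "m = norm (V x0) / 2"
 have m: "m > 0" using fr[OF x0(1)] by (simp add: m_def)
 have mf: "norm (V x) > m" if "x \<in> frontier \<Omega>" for x using x0(2)[OF that] m unfolding m_def by linarith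
 define Z where "Z = closure \<Omega> \<inter> {x. norm (V x) <= m}"
 have cZ: "compact Z" unfolding Z_def
  by (intro compact_Int_closed cc closed_Collect_le continuous_intros cV)
 have "\<exists>\<mu>>0. \<forall>x\<in>Z. rh x <= - \<mu>"
 proof (cases "Z = {}")
  case True then show ?thesis by (auto intro: exI[of _ 1])
 next
  case False
  then obtain z where z: "z \<in> Z" "!!x. x \<in> Z ==> rh x <= rh z"
   using continuous_attains_sup[OF cZ False, of rh] continuous_on_subset[OF crh] by auto
  have "z \<in> \<Omega>" using z(1) mf[of z] op by (auto simp: Z_def frontier_def interior_open)
  then have "rh z < 0" by (simp add: \<Omega>eq)
  then show ?thesis using z(2) by (intro exI[of _ "- rh z"]) auto
 qed
 then obtain \<mu> where \<mu>: "\<mu> > 0" "!!x. x \<in> Z ==> rh x <= - \<mu>" by blast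
 \<comment> \<open>With this margin the ball of radius c d costs at most half of the gain d |V|^2
   wherever |V| > m.\<close>
 define c where "c = m / 2"
 have c: "c > 0" using m by (simp add: c_def)
 \<comment> \<open>At d = 0 the determinant is 1; uniform continuity on a compact set provides one
   d1 that keeps it above 1/2 for all x in \<Omega>.\<close>
 have "uniformly_continuous_on ({0..1} \<times> closure \<Omega>) (%z. det (mat 1 - fst z *R H (snd z)))"
  by (intro compact_uniformly_continuous compact_Times cc continuous_on_det3 continuous_intros
    continuous_on_compose2[OF cH]) auto
 then obtain d1 where d1: "d1 > 0" "!!z z'. z \<in> {0..1} \<times> closure \<Omega> ==> z' \<in> {0..1} \<times> closure \<Omega> ==> dist z' z < d1 ==>
   dist (det (mat 1 - fst z' *R H (snd z'))) (det (mat 1 - fst z *R H (snd z))) < 1/2"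
  unfolding uniformly_continuous_on_def by (metis half_gt_zero zero_less_one)
 \<comment> \<open>In turn: the determinant stays above 1/2 (d1 / 2); the total displacement has
   length at most 1 (1 / (G + c)); L d <= 1/9, used for injectivity and for the quadratic term; and
   points with small |V| keep half of their distance \<open>\<mu>\<close> below level 0.\<close>
 define d0 where "d0 = min (min 1 (d1 / 2)) (min (1 / (G + c)) (min (1 / (9 * L)) (\<mu> / (2 * (G + L) * (G + c)))))"
 have d0: "d0 > 0" "d0 <= 1" "d0 < d1" "d0 <= 1 / (G + c)" "d0 <= 1 / (9 * L)" "d0 <= \<mu> / (2 * (G + L) * (G + c))"
  using d1(1) G c L \<mu> by (auto simp: d0_def min_less_iff_disj)
 show ?thesis
 proof (rule that[of V H c d0 G])
  show "norm (V x) <= G" "norm (H x) <= G" if "x \<in> \<Omega>" for x using G clD[OF \<Omega>cl[OF that]] by auto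
  fix d assume d: "0 < d" "d <= d0"
  show "quasi_pres 2 \<Omega> (%x. x - d *R V x)"
  proof (rule quasi_pres_perturbation[OF _ bd dV cH])
   show "\<Omega> \<in> sets borel" using op by simp
   show "inj_on (%x. x - d *R V x) \<Omega>"
   proof (rule inj_onI)
    fix x y assume xy: "x \<in> \<Omega>" "y \<in> \<Omega>" "x - d *R V x = y - d *R V y"
    then have "x - y = d *R (V x - V y)" by (simp add: algebra_simps)
    then have "norm (x - y) = d * norm (V x - V y)" using d by simp
    also have "\<dots> <= d * (L * norm (x - y))" using lip[OF clD[OF \<Omega>cl[OF xy(1)]] clD[OF \<Omega>cl[OF xy(2)]]] d by (intro mult_left_mono) auto
    also have "\<dots> <= (1 / 9) * norm (x - y)"
    proof -
     have "d * L <= 1 / (9 * L) * L" using d d0(5) L by (intro mult_right_mono) auto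
     then have "d * L <= 1 / 9" using L by simp
     from mult_right_mono[OF this, of "norm (x - y)"] show ?thesis by (simp add: mult.assoc)
    qed
    finally show "x = y" by simp
   qed
   fix x assume x: "x \<in> \<Omega>"
   have "dist (det (mat 1 - fst (d, x) *R H (snd (d, x)))) (det (mat 1 - fst (0::real, x) *R H (snd (0::real, x)))) < 1/2"
    by (rule d1(2)) (use d d0 x \<Omega>cl in \<open>auto simp: dist_Pair_Pair\<close>)
   then have "\<bar>det (mat 1 - d *R H x) - 1\<bar> < 1/2" by (simp add: dist_real_def)
   then show "1/2 <= det (mat 1 - d *R H x)" by linarith
  qed
  fix x assume x: "x \<in> \<Omega>"
  note xc = \<Omega>cl[OF x]
  show "cball (x - d *R V x) (c * d) \<subseteq> \<Omega>"
  proof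
   fix y assume "y \<in> cball (x - d *R V x) (c * d)"
   define v where "v = y - (x - d *R V x)"
   have v: "norm v <= c * d" using \<open>y \<in> _\<close> by (simp add: v_def dist_norm norm_minus_commute)
   define w where "w = v - d *R V x"
   have yw: "y = x + w" by (simp add: w_def v_def)
   have nw: "norm w <= d * (norm (V x) + c)"
    using norm_triangle_ineq4[of v "d *R V x"] v d by (simp add: w_def algebra_simps)
   have gx: "norm (V x) <= G" using G clD[OF xc] by auto
   have "d * (norm (V x) + c) <= d * (G + c)" using gx d by (intro mult_left_mono) auto
   also have "d * (G + c) <= 1 / (G + c) * (G + c)" using d d0(4) G c by (intro mult_right_mono) auto
   finally have w1: "norm w <= 1" using nw G c by simp
   have "rh y < 0"
   proof (cases "norm (V x) <= m")
    case True
    then have xZ: "x \<in> Z" using xc by (simp add: Z_def)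
    have "V x <.> w <= G * norm w"
     using Cauchy_Schwarz_ineq2[of "V x" w] mult_right_mono[OF gx, of "norm w"] by auto
    moreover have "L * (norm w)^2 <= L * norm w"
     using w1 L by (intro mult_left_mono) (auto simp: power2_eq_square mult_left_le)
    ultimately have "rh y <= - \<mu> + (G + L) * norm w"
     using taylor[OF xc w1] \<mu>(2)[OF xZ] by (simp add: yw algebra_simps)
    also have "(G + L) * norm w <= (G + L) * (d * (G + c))"
     using nw \<open>d * (norm (V x) + c) <= d * (G + c)\<close> G L by (intro mult_left_mono) auto
    also have "\<dots> <= (G + L) * (\<mu> / (2 * (G + L) * (G + c)) * (G + c))"
     using d d0(6) G L c by (intro mult_left_mono mult_right_mono) auto
    also have "\<dots> = \<mu> / 2"
    proof -
     have "k * (\<mu> / (2 * k * l) * l) = \<mu> / 2" if "k > 0" "l > 0" for k l using that by simp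
     from this[of "G + L" "G + c"] show ?thesis using G(1) L c by linarith
    qed
    finally show ?thesis using \<mu>(1) by simp
   next
    case False
    define g where "g = norm (V x)"
    have g: "g > m" using False by (simp add: g_def)
    have "V x <.> w = V x <.> v - d * g^2" by (simp add: w_def inner_diff_right g_def power2_norm_eq_inner)
    moreover have "V x <.> v <= g * (c * d)"
     using Cauchy_Schwarz_ineq2[of "V x" v] mult_left_mono[OF v, of g] by (auto simp: g_def)
    moreover have "g * (c * d) <= g * (g / 2 * d)" using g m d by (intro mult_left_mono mult_right_mono) (auto simp: c_def)
    \<comment> \<open>The linear term gains d g^2 / 2. Since |w| <= 3/2 d g and L d <= 1/9, the
      quadratic term costs at most d g^2 / 4, so \<open>rh\<close> stays negative.\<close>
    ultimately have 1: "V x <.> w <= - (d * g^2) / 2" by (simp add: power2_eq_square algebra_simps)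
    have "norm w <= d * (g + g / 2)"
     using nw g d by (rule_tac order_trans[OF nw]) (auto simp: c_def g_def intro!: mult_left_mono)
    then have "(norm w)^2 <= (d * (3 / 2 * g))^2" by (intro power_mono) auto
    then have "L * (norm w)^2 <= L * (9 / 4 * (d * g)^2)" using L by (intro mult_left_mono) (auto simp: power_mult_distrib power_divide mult_ac)
    also have "\<dots> = (L * d) * (9 / 4 * (d * g^2))" by (simp add: power2_eq_square mult_ac)
    also have "\<dots> <= (1 / 9) * (9 / 4 * (d * g^2))"
    proof (rule mult_right_mono)
     have "L * d <= L * (1 / (9 * L))" using d d0(5) L by (intro mult_left_mono) auto
     then show "L * d <= 1 / 9" using L by simp
    qed (use d in auto)
    finally have 2: "L * (norm w)^2 <= (d * g^2) / 4" by simp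
    have "d * g^2 > 0" using d g m by simp
    then show ?thesis using taylor[OF xc w1] 1 2 cl[OF xc] by (simp add: yw)
   qed
   then show "y \<in> \<Omega>" by (simp add: \<Omega>eq)
  qed
 qed (use dV cV cH c d0 G in auto)
qed

section \<open>Smooth approximation of Sobolev functions up to the boundary\<close>

text \<open>The increment is taken one coordinate at a time, through \<open>z1\<close> and
  \<open>z2\<close>. On each leg the mean value inequality compares with the partial derivative at
  x, with error e/3 |h|.\<close>

lemma continuous_partials_has_derivative:
 fixes f :: "vec3 => 'b::euclidean_space" and g :: "3 => vec3 => 'b"
 assumes d: "!!j. dirderiv (axis j 1) f (g j)" and c: "!!j. CU (g j)"
 shows "(f has_derivative (%h. \<Sum>j\<in>UNIV. (h $ j) *R g j x)) (at x)"
 unfolding has_derivative_at_alt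
proof (intro conjI allI impI)
 show "bounded_linear (%h. \<Sum>j\<in>UNIV. (h $ j) *R g j x)"
  by (intro bounded_linear_sum bounded_linear_scaleR_left[THEN bounded_linear_compose] bounded_linear_vec_nth)
 fix e :: real assume e: "e > 0"
 have "\<exists>d>0. \<forall>z. dist z x < d --> dist (g j z) (g j x) < e / 3" for j
 proof -
  have "e / 3 > 0" using e by simp
  then show ?thesis using c[of j] unfolding continuous_on_iff by (metis UNIV_I)
 qed
 then obtain dd where dd: "!!j. dd j > 0" "!!j z. dist z x < dd j ==> dist (g j z) (g j x) < e / 3" by metis
 \<comment> \<open>The quarter leaves room for the path: an intermediate point is within 2 |h| of x
   and a leg adds at most |h|, so all points stay within 4 \<open>dm\<close>.\<close>
 define dm where "dm = min (dd 1) (min (dd 2) (dd 3)) / 4"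
 have dm: "dm > 0" "!!j. 4 * dm <= dd j"
  using dd(1) by (auto simp: dm_def) (metis (full_types) exhaust_3 min.cobounded1 min.cobounded2 min.coboundedI2)
 have step: "norm (f (z + t *R axis j 1) - f z - t *R g j x) <= e / 3 * \<bar>t\<bar>"
  if "norm (z - x) + \<bar>t\<bar> < 4 * dm" for z t j
 proof -
  have "norm ((f (z + t *R axis j 1) - t *R g j x) - (f (z + 0 *R axis j 1) - 0 *R g j x)) <= e / 3 * norm (t - 0)"
  proof (rule differentiable_bound[where S="closed_segment 0 t" and f'="%s h. h *R (g j (z + s *R axis j 1) - g j x)"])
   fix s assume s: "s \<in> closed_segment 0 t"
   have "((%s. f (z + s *R axis j 1) - s *R g j x) has_vector_derivative g j (z + s *R axis j 1) - 1 *R g j x) (at s)"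
    by (intro derivative_intros dirderivD[OF d]) (auto intro!: derivative_eq_intros)
   then show "((%s. f (z + s *R axis j 1) - s *R g j x) has_derivative (%h. h *R (g j (z + s *R axis j 1) - g j x))) (at s within closed_segment 0 t)"
    by (simp add: has_vector_derivative_def has_derivative_at_withinI)
   have st: "\<bar>s\<bar> <= \<bar>t\<bar>" using s by (auto simp: closed_segment_eq_real_ivl split: if_splits)
   have "norm (z + s *R axis j 1 - x) <= norm (z - x) + norm (s *R (axis j 1 :: vec3))"
    using norm_triangle_ineq[of "z - x" "s *R axis j 1"] by (simp add: algebra_simps)
   then have "dist (z + s *R axis j 1) x < dd j" using st that dm(2)[of j] by (simp add: dist_norm)
   from dd(2)[OF this] have n: "norm (g j (z + s *R axis j 1) - g j x) <= e / 3" by (simp add: dist_norm)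
   show "onorm (%h. h *R (g j (z + s *R axis j 1) - g j x)) <= e / 3"
   proof (rule onorm_bound)
    show "norm (h *R (g j (z + s *R axis j 1) - g j x)) <= e / 3 * norm h" for h
     using mult_left_mono[OF n, of "\<bar>h\<bar>"] by (simp only: norm_scaleR real_norm_def mult.commute abs_ge_zero)
   qed (use e in simp)
  qed auto
  then show ?thesis by (simp add: algebra_simps)
 qed
 show "\<exists>d>0. \<forall>y. norm (y - x) < d --> norm (f y - f x - (\<Sum>j\<in>UNIV. ((y - x) $ j) *R g j x)) <= e * norm (y - x)"
 proof (intro exI[of _ dm] conjI allI impI dm(1))
  fix y assume y: "norm (y - x) < dm"
  define h where "h = y - x"
  define z1 where "z1 = x + (h $ 1) *R axis 1 1"
  define z2 where "z2 = z1 + (h $ 2) *R axis 2 1"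
  have hj: "\<bar>h $ j\<bar> <= norm h" for j by (rule component_le_norm_cart)
  have nh: "norm h < dm" using y by (simp add: h_def)
  have y3: "y = z2 + (h $ 3) *R axis 3 1"
   by (simp add: vec_eq_iff forall_3 z1_def z2_def h_def axis_def)
  have n1: "norm (z1 - x) <= norm h" using hj[of 1] by (simp add: z1_def)
  have "norm (z2 - x) <= norm (z1 - x) + norm ((h $ 2) *R (axis 2 1 :: vec3))"
   using norm_triangle_ineq[of "z1 - x" "(h $ 2) *R axis 2 1"] by (simp add: z2_def algebra_simps)
  then have n2: "norm (z2 - x) <= 2 * norm h" using n1 hj[of 2] by simp
  have hm: "e / 3 * \<bar>h $ j\<bar> <= e / 3 * norm h" for j using hj[of j] e by (intro mult_left_mono) auto
  have s1: "norm (f z1 - f x - (h $ 1) *R g 1 x) <= e / 3 * norm h"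
   unfolding z1_def by (rule order_trans[OF step hm]) (use hj[of 1] nh in auto)
  have s2: "norm (f z2 - f z1 - (h $ 2) *R g 2 x) <= e / 3 * norm h"
   unfolding z2_def by (rule order_trans[OF step hm]) (use hj[of 2] n1 nh in auto)
  have s3: "norm (f y - f z2 - (h $ 3) *R g 3 x) <= e / 3 * norm h"
   unfolding y3 by (rule order_trans[OF step hm]) (use hj[of 3] n2 nh in auto)
  have "f y - f x - (\<Sum>j\<in>UNIV. (h $ j) *R g j x) = (f z1 - f x - (h $ 1) *R g 1 x) + (f z2 - f z1 - (h $ 2) *R g 2 x) + (f y - f z2 - (h $ 3) *R g 3 x)"
   by (simp add: sum_3)
  also have "norm \<dots> <= e * norm h"
   using norm_triangle_ineq[of "(f z1 - f x - (h $ 1) *R g 1 x) + (f z2 - f z1 - (h $ 2) *R g 2 x)" "f y - f z2 - (h $ 3) *R g 3 x"]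
    norm_triangle_ineq[of "f z1 - f x - (h $ 1) *R g 1 x" "f z2 - f z1 - (h $ 2) *R g 2 x"] s1 s2 s3 by linarith
  finally show "norm (f y - f x - (\<Sum>j\<in>UNIV. ((y - x) $ j) *R g j x)) <= e * norm (y - x)"
   by (simp add: h_def)
 qed
qed

text \<open>The weak gradient, expressed through mollification at those points whose ball fits into
  \<Omega>. Only the countable family of scales 1/(n+1) occurs, so that the property can be obtained
  for almost every time slice with a single null set.\<close>

definition weak_grad :: "vec3 set => (vec3 => 'b::euclidean_space) => (vec3 => 'b^3) => bool" where
 "weak_grad \<Omega> w G \<longleftrightarrow> (\<forall>n y k. cball y (1 / Suc n) \<subseteq> \<Omega> -->
  pdx k (moll (1 / Suc n) w) y = moll (1 / Suc n) (%x. G x $ k) y)"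

text \<open>The regularity that is left after composing a smooth function with the inward map, whose
  derivative is merely continuous. D carries the partial derivatives explicitly so that their limits
  can be named.\<close>

definition C1fun :: "(vec3 => 'b::euclidean_space) => (3 => vec3 => 'b) => bool" where
 "C1fun w D \<longleftrightarrow> CU w & (\<forall>k. dirderiv (axis k 1) w (D k) & CU (D k))"

lemma C1fun_Cinf: "Cinf_on UNIV w ==> C1fun w (%k. pdx k w)"
 unfolding C1fun_def using Cinf_continuous Cinf_pdx by blast

lemma C1fun_compose:
 fixes w :: "vec3 => 'b::euclidean_space" and T :: "vec3 => vec3" and T' :: "vec3 => mat3"
 assumes w: "C1fun w D" and T: "!!x. (T has_derivative (%h. T' x *v h)) (at x)" and cT: "CU T'"
 shows "C1fun (%x. w (T x)) (%k x. \<Sum>j\<in>UNIV. (T' x $ j $ k) *R D j (T x))"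
proof -
 have cT0: "CU T" using T by (intro has_derivative_continuous_on) (auto intro: has_derivative_at_withinI)
 have dw: "(w has_derivative (%h. \<Sum>j\<in>UNIV. (h $ j) *R D j x)) (at x)" for x
  by (rule continuous_partials_has_derivative) (use w in \<open>auto simp: C1fun_def\<close>)
 have "dirderiv (axis k 1) (%x. w (T x)) (%x. \<Sum>j\<in>UNIV. (T' x $ j $ k) *R D j (T x))" for k
  unfolding dirderiv_def
 proof
  fix x
  have line: "((%s. x + s *R axis k 1) has_derivative (%s. s *R (axis k 1 :: vec3))) (at 0)"
   by (auto intro!: derivative_eq_intros)
  have "((%s. T (x + s *R axis k 1)) has_derivative (%s. T' (x + 0 *R axis k 1) *v (s *R axis k 1))) (at 0)"
   by (rule has_derivative_compose[OF line T])
  from has_derivative_compose[OF this dw]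
  have "((%s. w (T (x + s *R axis k 1))) has_derivative (%s. \<Sum>j\<in>UNIV. ((T' x *v (s *R axis k 1)) $ j) *R D j (T x))) (at 0)" by simp
  moreover have "(T' x *v (s *R axis k 1)) $ j = s * T' x $ j $ k" for s j
   by (simp add: matrix_vector_mult_def axis_def if_distrib[of "%u. _ * u"] cong: if_cong)
  ultimately show "((%s. w (T (x + s *R axis k 1))) has_vector_derivative (\<Sum>j\<in>UNIV. (T' x $ j $ k) *R D j (T x))) (at 0)"
   by (simp add: has_vector_derivative_def scaleR_sum_right)
 qed
 moreover have "CU (%x. \<Sum>j\<in>UNIV. (T' x $ j $ k) *R D j (T x))" for k
  using w by (intro continuous_intros cT continuous_on_compose2[OF _ cT0, of UNIV]) (auto simp: C1fun_def)
 moreover have "CU (%x. w (T x))"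
  using w by (intro continuous_on_compose2[OF _ cT0, of UNIV]) (auto simp: C1fun_def)
 ultimately show ?thesis by (auto simp: C1fun_def)
qed

lemma nn_integral_indicator_le:
 "(\<integral>\<^sup>+x. indicator A x * f x \<partial>M) <= (\<integral>\<^sup>+x. f x \<partial>M)" for f :: "'a => ennreal"
 by (intro nn_integral_mono) (auto simp: indicator_def)

lemma moll_bound_L2:
 fixes g :: "vec3 => 'b::euclidean_space"
 assumes [measurable]: "g \<in> BM" "A \<in> sets borel" "T \<in> BM"
  and le: "(NNL x. indicator A x * ennreal (norm (moll k g (T x) - g x) powr 2)) <= 1"
 shows "(NNL x. indicator A x * nsq (moll k g (T x))) <= 2 + 2 * (NNL x. nsq (g x))"
proof -
 have "(NNL x. indicator A x * nsq (moll k g (T x))) <=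
  (NNL x. 2 * (indicator A x * ennreal (norm (moll k g (T x) - g x) powr 2)) + 2 * nsq (g x))"
 proof (rule nn_integral_mono)
  fix x
  show "indicator A x * nsq (moll k g (T x)) <= 2 * (indicator A x * ennreal (norm (moll k g (T x) - g x) powr 2)) + 2 * nsq (g x)"
   using norm_diff_power2_le[of "moll k g (T x)" 0 "g x"] by (cases "x \<in> A") (simp_all add: powr_numeral)
 qed
 also have "\<dots> = 2 * (NNL x. indicator A x * ennreal (norm (moll k g (T x) - g x) powr 2)) + 2 * (NNL x. nsq (g x))"
  by (subst nn_integral_add) (auto simp: nn_integral_cmult)
 also have "\<dots> <= 2 * 1 + 2 * (NNL x. nsq (g x))"
  by (intro add_mono mult_left_mono le) auto
 finally show ?thesis by simp
qed

text \<open>The mollification is evaluated at the inward-shifted point, whose ball lies in \<Omega>,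
  so only interior information on the weak gradient enters. One sequence serves every exponent p for
  which w is in L^p; this matters because the same test functions must converge in L^4, in L^r and,
  for the gradient, in L^2.\<close>

lemma smooth_approximation:
 fixes w :: "vec3 => 'b::euclidean_space" and G :: "vec3 => 'b^3"
 assumes dom: "C2beta_domain \<beta> \<Omega>" and m[measurable]: "w \<in> BM" "G \<in> BM"
  and wg: "weak_grad \<Omega> w G" and iw: "IL w"
  and G2: "(NNL x. nsq (G x)) < \<infinity>"
 obtains W D where "!!n. C1fun (W n) (D n)"
  "!!p. p >= 1 ==> (NNL x. ennreal (norm (w x) powr p)) < \<infinity> ==>
   (%n. NNL x. indicator \<Omega> x * ennreal (norm (W n x - w x) powr p)) ~> 0"
  "!!k. (%n. NNL x. indicator \<Omega> x * nsq (D n k x - G x $ k)) ~> 0"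
proof -
 obtain V H c d0 M where dV: "!!x. (V has_derivative (%h. H x *v h)) (at x)" and cV: "CU V" and cH: "CU H"
  and c: "c > 0" and d0: "d0 > 0" and M: "M > 0" "!!x. x \<in> \<Omega> ==> norm (V x) <= M" "!!x. x \<in> \<Omega> ==> norm (H x) <= M"
  and qp: "!!d. 0 < d ==> d <= d0 ==> quasi_pres 2 \<Omega> (%x. x - d *R V x)"
  and cb: "!!d x. 0 < d ==> d <= d0 ==> x \<in> \<Omega> ==> cball (x - d *R V x) (c * d) \<subseteq> \<Omega>"
  by (rule C2beta_domain_inward_map[OF dom]) blast
 have \<Omega>: "open \<Omega>" "bounded \<Omega>" using dom by (auto simp: C2beta_domain_def)
 have [measurable]: "\<Omega> \<in> sets borel" using \<Omega> by simp
 define kp where "kp n = 1 / Suc n" for n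
 \<comment> \<open>With this step length the margin c * \<open>dl n\<close> of the inward map equals
   the mollification radius \<open>kp n\<close>.\<close>
 define dl where "dl n = kp n / c" for n
 define T where "T n x = x - dl n *R V x" for n x
 define W where "W n x = moll (kp n) w (T n x)" for n x
 define T' where "T' n x = mat 1 - dl n *R H x" for n x
 define D where "D n k x = (\<Sum>j\<in>UNIV. (T' n x $ j $ k) *R pdx j (moll (kp n) w) (T n x))" for n k x
 have kp: "kp n > 0" for n by (simp add: kp_def)
 have dl: "dl n > 0" for n using kp c by (simp add: dl_def)
 have kpl: "kp ~> 0" unfolding kp_def by (rule LIMSEQ_Suc) (rule lim_1_over_n)
 have dll: "dl ~> 0" unfolding dl_def using tendsto_divide[OF kpl tendsto_const[of c]] c by simp
 have cT: "CU (T n)" for n unfolding T_def by (intro continuous_intros cV)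
 have [measurable]: "T n \<in> BM" for n using cT by (rule borel_measurable_continuous_onI)
 have [measurable]: "H \<in> BM" using cH by (rule borel_measurable_continuous_onI)
 have C1: "C1fun (W n) (D n)" for n
  unfolding W_def[abs_def] D_def[abs_def]
 proof (rule C1fun_compose[OF C1fun_Cinf[OF Cinf_moll[OF kp iw]]])
  show "(T n has_derivative (%h. T' n x *v h)) (at x)" for x
  proof -
   have "(T n has_derivative (%h. h - dl n *R (H x *v h))) (at x)"
    unfolding T_def by (intro derivative_intros dV)
   then show ?thesis by (simp add: T'_def matrix_vector_mult_diff_rdistrib scaleR_matrix_vector_assoc)
  qed
  show "CU (T' n)" unfolding T'_def by (intro continuous_intros cH)
 qed
 have ev: "\<forall>\<^sub>F n in sequentially. dl n <= d0"
  using order_tendstoD(2)[OF dll d0] by eventually_elim simp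
 have approx: "(%n. NNL x. indicator \<Omega> x * ennreal (norm (moll (kp n) f (T n x) - f x) powr p)) ~> 0"
  if p: "p >= 1" and [measurable]: "f \<in> BM" and fin: "(NNL x. ennreal (norm (f x) powr p)) < \<infinity>" for p and f :: "vec3 => 'b"
 proof (rule order_tendstoI)
  fix a :: ennreal assume a: "0 < a"
  then obtain e :: real where e: "e > 0" "ennreal e < a" by (metis ennreal_0 ennreal_less_zero_iff dense ennreal_cases not_less_iff_gr_or_eq top.not_eq_extremum less_trans)
  obtain d where d: "d > 0"
   "!!T k. quasi_pres 2 \<Omega> T ==> (!!x. x \<in> \<Omega> ==> dist (T x) x <= d) ==> 0 < k ==> k <= d ==>
    (NNL x. indicator \<Omega> x * ennreal (norm (moll k f (T x) - f x) powr p)) <= ennreal e"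
   by (rule moll_Lp[OF p _ fin _ \<Omega>(2), of 2 e]) (use e in auto)
  have "\<forall>\<^sub>F n in sequentially. kp n < d" using order_tendstoD(2)[OF kpl d(1)] .
  moreover have "\<forall>\<^sub>F n in sequentially. dl n < d / M" using order_tendstoD(2)[OF dll, of "d / M"] d(1) M(1) by simp
  ultimately show "\<forall>\<^sub>F n in sequentially. (NNL x. indicator \<Omega> x * ennreal (norm (moll (kp n) f (T n x) - f x) powr p)) < a"
   using ev
  proof eventually_elim
   case (elim n)
   have "(NNL x. indicator \<Omega> x * ennreal (norm (moll (kp n) f (T n x) - f x) powr p)) <= ennreal e"
   proof (rule d(2))
    show "quasi_pres 2 \<Omega> (T n)" unfolding T_def using qp[OF dl elim(3)] .
    fix x assume "x \<in> \<Omega>"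
    then have "dl n * norm (V x) <= d / M * M" using M(2)[of x] elim(2) dl[of n] d(1) M(1) by (intro mult_mono) auto
    then show "dist (T n x) x <= d" using dl[of n] M(1) by (simp add: T_def dist_norm)
   qed (use kp elim in auto)
   then show ?case using e by simp
  qed
 qed auto
 have G2k: "(NNL x. ennreal (norm (G x $ k) powr 2)) < \<infinity>" for k
 proof -
  have "(NNL x. ennreal (norm (G x $ k) powr 2)) <= (NNL x. nsq (G x))"
   by (intro nn_integral_mono ennreal_leI) (simp add: powr_numeral power_mono Finite_Cartesian_Product.norm_nth_le)
  then show ?thesis using G2 by simp
 qed
 define e where "e n k = (NNL x. indicator \<Omega> x * ennreal (norm (moll (kp n) (%x. G x $ k) (T n x) - G x $ k) powr 2))" for n k
 have el: "(%n. e n k) ~> 0" for k unfolding e_def by (rule approx) (use G2k in auto)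
 define g2 where "g2 k = (NNL x. nsq (G x $ k))" for k
 have g2: "g2 k < \<infinity>" for k using G2k[of k] by (simp add: g2_def powr_numeral)
 have grad: "(%n. NNL x. indicator \<Omega> x * nsq (D n k x - G x $ k)) ~> 0" for k
 proof -
  \<comment> \<open>By the chain rule the derivative of W n differs from the mollified gradient by a
    term with the factor \<open>dl n\<close> times H. Its square is bounded by the second summand:
    the sums 2 + 2 g2 bound the mollified gradients, so it vanishes with
    \<open>dl n\<close>.\<close>
  define B where "B n = 2 * e n k + ennreal (18 * M^2 * (dl n)^2) * (\<Sum>j\<in>UNIV. 2 + 2 * g2 j)" for n
  have "(%n. ennreal (18 * M^2 * (dl n)^2)) ~> ennreal (18 * M^2 * 0^2)"
   by (intro tendsto_ennrealI tendsto_intros dll)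
  moreover have S: "(\<Sum>j\<in>(UNIV::3 set). 2 + 2 * g2 j) ~= top"
   using g2 by (auto simp: ennreal_mult_eq_top_iff less_top)
  ultimately have "(%n. ennreal (18 * M^2 * (dl n)^2) * (\<Sum>j\<in>(UNIV::3 set). 2 + 2 * g2 j)) ~> ennreal (18 * M^2 * 0^2) * (\<Sum>j\<in>(UNIV::3 set). 2 + 2 * g2 j)"
   by (intro tendsto_mult_ennreal tendsto_const) auto
  moreover have "(%n. 2 * e n k) ~> 2 * 0" by (intro ennreal_tendsto_cmult el) simp
  ultimately have "B ~> 2 * 0 + ennreal (18 * M^2 * 0^2) * (\<Sum>j\<in>(UNIV::3 set). 2 + 2 * g2 j)"
   unfolding B_def by (intro tendsto_add)
  then have Bl: "B ~> 0" by simp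
  have e1: "\<forall>\<^sub>F n in sequentially. \<forall>j\<in>(UNIV::3 set). e n j < 1"
   by (intro eventually_ball_finite ballI order_tendstoD(2)[OF el]) auto
  show ?thesis
  proof (rule tendsto_sandwich[OF _ _ tendsto_const Bl])
   show "\<forall>\<^sub>F n in sequentially. (NNL x. indicator \<Omega> x * nsq (D n k x - G x $ k)) <= B n"
    using ev e1
   proof eventually_elim
    case (elim n)
    have Dx: "D n k x = moll (kp n) (%x. G x $ k) (T n x) - dl n *R (\<Sum>j\<in>UNIV. (H x $ j $ k) *R moll (kp n) (%x. G x $ j) (T n x))" if x: "x \<in> \<Omega>" for x
    proof -
     have "cball (T n x) (1 / Suc n) \<subseteq> \<Omega>"
      using cb[OF dl elim(1) x] c by (simp add: T_def dl_def kp_def)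
     then have pm: "pdx j (moll (kp n) w) (T n x) = moll (kp n) (%x. G x $ j) (T n x)" for j
      using wg unfolding weak_grad_def kp_def by blast
     have "D n k x = (\<Sum>j\<in>UNIV. (if j = k then moll (kp n) (%x. G x $ j) (T n x) else 0) - (dl n * H x $ j $ k) *R moll (kp n) (%x. G x $ j) (T n x))"
      unfolding D_def pm T'_def by (intro sum.cong) (auto simp: mat_def scaleR_diff_left)
     then show ?thesis by (simp add: sum_subtractf scaleR_sum_right)
    qed
    have "(NNL x. indicator \<Omega> x * nsq (D n k x - G x $ k)) <=
     (NNL x. 2 * (indicator \<Omega> x * ennreal (norm (moll (kp n) (%x. G x $ k) (T n x) - G x $ k) powr 2))
      + ennreal (18 * M^2 * (dl n)^2) * (\<Sum>j\<in>UNIV. indicator \<Omega> x * nsq (moll (kp n) (%x. G x $ j) (T n x))))"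
    proof (rule nn_integral_mono)
     fix x
     show "indicator \<Omega> x * nsq (D n k x - G x $ k) <= 2 * (indicator \<Omega> x * ennreal (norm (moll (kp n) (%x. G x $ k) (T n x) - G x $ k) powr 2))
      + ennreal (18 * M^2 * (dl n)^2) * (\<Sum>j\<in>UNIV. indicator \<Omega> x * nsq (moll (kp n) (%x. G x $ j) (T n x)))"
     proof (cases "x \<in> \<Omega>")
      case True
      define m where "m j = norm (moll (kp n) (%x. G x $ j) (T n x))" for j
      define S where "S = (\<Sum>j\<in>UNIV. (H x $ j $ k) *R moll (kp n) (%x. G x $ j) (T n x))"
      have "norm S <= (\<Sum>j\<in>UNIV. M * m j)"
       unfolding S_def
      proof (rule order_trans[OF norm_sum sum_mono])
       fix j
       have "\<bar>H x $ j $ k\<bar> <= M" using abs_entry_le_norm[of "H x" j k] M(3)[OF True] by simp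
       then show "norm ((H x $ j $ k) *R moll (kp n) (%x. G x $ j) (T n x)) <= M * m j"
        by (simp add: m_def mult_right_mono)
      qed
      then have "(norm S)^2 <= (\<Sum>j\<in>UNIV. M * m j)^2" by (intro power_mono) auto
      also have "\<dots> <= (\<Sum>j\<in>(UNIV::3 set). M^2) * (\<Sum>j\<in>UNIV. (m j)^2)" by (rule Cauchy_Schwarz_ineq_sum)
      also have "(\<Sum>j\<in>(UNIV::3 set). M^2) = 3 * M^2" by simp
      also have "3 * M^2 * (\<Sum>j\<in>UNIV. (m j)^2) <= 9 * M^2 * (\<Sum>j\<in>UNIV. (m j)^2)"
       by (intro mult_right_mono sum_nonneg) auto
      finally have S2: "(norm S)^2 <= 9 * M^2 * (\<Sum>j\<in>UNIV. (m j)^2)" .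
      have "nsq (D n k x - G x $ k) <= 2 * nsq (D n k x - moll (kp n) (%x. G x $ k) (T n x))
        + 2 * nsq (G x $ k - moll (kp n) (%x. G x $ k) (T n x))"
       by (rule norm_diff_power2_le)
      also have "(norm (D n k x - moll (kp n) (%x. G x $ k) (T n x)))^2 = (dl n)^2 * (norm S)^2"
       unfolding Dx[OF True] S_def[symmetric] by (simp add: power_mult_distrib)
      also have "2 * ennreal ((dl n)^2 * (norm S)^2) <= ennreal (18 * M^2 * (dl n)^2 * (\<Sum>j\<in>UNIV. (m j)^2))"
      proof -
       have "2 * ((dl n)^2 * (norm S)^2) <= 2 * ((dl n)^2 * (9 * M^2 * (\<Sum>j\<in>UNIV. (m j)^2)))"
        by (intro mult_left_mono S2) auto
       then have "ennreal (2 * ((dl n)^2 * (norm S)^2)) <= ennreal (18 * M^2 * (dl n)^2 * (\<Sum>j\<in>UNIV. (m j)^2))"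
        by (intro ennreal_leI) (simp add: mult_ac)
       then show ?thesis by (simp add: ennreal_mult)
      qed
      also have "ennreal (18 * M^2 * (dl n)^2 * (\<Sum>j\<in>UNIV. (m j)^2)) = ennreal (18 * M^2 * (dl n)^2) * (\<Sum>j\<in>UNIV. ennreal ((m j)^2))"
       by (simp add: ennreal_mult sum_nonneg)
      finally show ?thesis using True by (simp add: m_def norm_minus_commute powr_numeral add.commute add_right_mono add_left_mono)
     qed simp
    qed
    also have "\<dots> = 2 * e n k + ennreal (18 * M^2 * (dl n)^2) * (\<Sum>j\<in>UNIV. NNL x. indicator \<Omega> x * nsq (moll (kp n) (%x. G x $ j) (T n x)))"
    proof -
     define P where "P j x = indicator \<Omega> x * nsq (moll (kp n) (%x. G x $ j) (T n x))" for j x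
     define Q where "Q x = indicator \<Omega> x * ennreal (norm (moll (kp n) (%x. G x $ k) (T n x) - G x $ k) powr 2)" for x
     have [measurable]: "P j \<in> BM" "Q \<in> BM" for j unfolding P_def Q_def by measurable
     have "(NNL x. 2 * Q x + ennreal (18 * M^2 * (dl n)^2) * (\<Sum>j\<in>UNIV. P j x)) = 2 * (NNL x. Q x) + ennreal (18 * M^2 * (dl n)^2) * (\<Sum>j\<in>UNIV. NNL x. P j x)"
      by (simp add: nn_integral_add nn_integral_cmult nn_integral_sum)
     then show ?thesis by (simp only: e_def P_def Q_def)
    qed
    also have "\<dots> <= B n"
     unfolding B_def
    proof (intro add_mono mult_left_mono sum_mono)
     fix j
     show "(NNL x. indicator \<Omega> x * nsq (moll (kp n) (%x. G x $ j) (T n x))) <= 2 + 2 * g2 j"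
      unfolding g2_def using elim(2) by (intro moll_bound_L2) (auto simp: e_def intro: less_imp_le)
    qed auto
    finally show "(NNL x. indicator \<Omega> x * nsq (D n k x - G x $ k)) <= B n" .
   qed
  qed auto
 qed
 show ?thesis
 proof (rule that[of W D])
  show "C1fun (W n) (D n)" for n by (rule C1)
  show "(%n. NNL x. indicator \<Omega> x * ennreal (norm (W n x - w x) powr p)) ~> 0"
   if "p >= 1" "(NNL x. ennreal (norm (w x) powr p)) < \<infinity>" for p
   unfolding W_def by (rule approx[OF that(1) _ that(2)]) simp
 qed (rule grad)
qed

section \<open>Limits of pairings\<close>

lemma tendsto_pairing:
 fixes al f :: "'z => 'b::euclidean_space" and g :: "nat => 'z => 'b"
 assumes [measurable]: "al \<in> borel_measurable M" "f \<in> borel_measurable M" "!!n. g n \<in> borel_measurable M"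
  and i: "integrable M (%z. al z <.> f z)"
  and l: "(%n. \<integral>\<^sup>+z. ennreal (norm (al z) * norm (g n z - f z)) \<partial>M) ~> 0"
 shows "(%n. \<integral>z. al z <.> g n z \<partial>M) ~> (\<integral>z. al z <.> f z \<partial>M)"
proof -
 have ev: "\<forall>\<^sub>F n in sequentially. (\<integral>\<^sup>+z. ennreal (norm (al z) * norm (g n z - f z)) \<partial>M) < 1"
  using order_tendstoD(2)[OF l, of 1] by simp
 have bd: "(\<integral>\<^sup>+z. ennreal (norm (al z <.> (g n z - f z))) \<partial>M) <= (\<integral>\<^sup>+z. ennreal (norm (al z) * norm (g n z - f z)) \<partial>M)" for n
  using Cauchy_Schwarz_ineq2 by (intro nn_integral_mono ennreal_leI) auto
 have "(%n. ennreal \<bar>(\<integral>z. al z <.> g n z \<partial>M) - (\<integral>z. al z <.> f z \<partial>M)\<bar>) ~> 0"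
 proof (rule tendsto_sandwich[OF _ _ tendsto_const l])
  show "\<forall>\<^sub>F n in sequentially. ennreal \<bar>(\<integral>z. al z <.> g n z \<partial>M) - (\<integral>z. al z <.> f z \<partial>M)\<bar> <= (\<integral>\<^sup>+z. ennreal (norm (al z) * norm (g n z - f z)) \<partial>M)"
   using ev
  proof eventually_elim
   case (elim n)
   have d: "integrable M (%z. al z <.> (g n z - f z))"
    unfolding integrable_iff_bounded using le_less_trans[OF bd elim] by (auto intro: less_trans)
   have "(\<integral>z. al z <.> g n z \<partial>M) = (\<integral>z. al z <.> (g n z - f z) + al z <.> f z \<partial>M)" by (simp add: inner_diff_right)
   also have "\<dots> = (\<integral>z. al z <.> (g n z - f z) \<partial>M) + (\<integral>z. al z <.> f z \<partial>M)" by (rule LB_add[OF d i])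
   finally have e: "\<bar>(\<integral>z. al z <.> g n z \<partial>M) - (\<integral>z. al z <.> f z \<partial>M)\<bar> = norm (\<integral>z. al z <.> (g n z - f z) \<partial>M)" by simp
   show ?case unfolding e by (rule order_trans[OF integral_norm_bound_ennreal[OF d] bd])
  qed
 qed auto
 then have "(%n. \<bar>(\<integral>z. al z <.> g n z \<partial>M) - (\<integral>z. al z <.> f z \<partial>M)\<bar>) ~> 0"
  unfolding ennreal_0[symmetric] by (subst (asm) tendsto_ennreal_iff) auto
 then show ?thesis using tendsto_rabs_zero_iff LIM_zero_iff by blast
qed

lemma dual_bd_nonneg_finite:
 assumes d: "dual_bd q A a" and q: "q > 0" and [measurable]: "ps \<in> BM" and nn: "!!x. ps x >= 0"
  and le: "(NNL x. ennreal (ps x powr q)) <= ennreal F" and F: "F >= 0"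
 shows "(NNL x. ennreal (a x * ps x)) <= ennreal (A * F powr (1 / q))"
 by (rule dual_bdD[OF d]) (use le q nn F in \<open>auto simp: powr_powr\<close>)

lemma norm_indicator_powr:
 "ennreal (norm (indicator A x *R (f x :: 'b::real_normed_vector)) powr q) = indicator A x * ennreal (norm (f x) powr q)"
 by (auto simp: indicator_def)

text \<open>One statement covers the spatial pairings and, with \<open>z = (t, x)\<close>, the space-time pairings with functions of \<open>x\<close> only.\<close>

lemma pairing_time_limit:
 fixes al :: "real \<times> vec3 => 'b::euclidean_space" and w :: "vec3 => 'b"
 assumes q: "q > 0" and [measurable]: "\<Omega> \<in> sets borel" and ma: "al \<in> BM" and mw: "w \<in> BM" "!!n. W n \<in> BM"
  and [measurable]: "ah \<in> BM" and nn: "!!t. ah t >= 0"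
  and al0: "!!t x. x \<notin> \<Omega> ==> al (t, x) = 0"
  and d: "AL t. dual_bd q (ah t) (%x. norm (al (t, x)))"
  and ia: "(NNL t. ennreal (ah t)) < \<infinity>"
  and fin: "(NNL x. ennreal (norm (w x) powr q)) < \<infinity>"
 shows "IL (%z. al z <.> w (snd z))"
  and "(%n. NNL x. indicator \<Omega> x * ennreal (norm (W n x - w x) powr q)) ~> 0 ==>
   (%n. LBINT z. al z <.> W n (snd z)) ~> (LBINT z. al z <.> w (snd z))"
proof -
 note [measurable] = ma mw
 have [measurable]: "al \<in> BM2" using ma by (simp add: borel_prod)
 have snd_m: "(%z::real \<times> vec3. f (snd z)) \<in> BM" if "f \<in> BM" for f :: "vec3 => 'b"
 proof -
  have [measurable]: "f \<in> BM" by fact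
  have "(%z::real \<times> vec3. f (snd z)) \<in> BM2" by measurable
  then show ?thesis by (simp add: borel_prod)
 qed
 have key: "(NNL z. ennreal (norm (al z) * norm (f (snd z)))) <= ennreal (F powr (1 / q)) * (NNL t. ennreal (ah t))"
  if [measurable]: "f \<in> BM" and F: "F >= 0" "(NNL x. indicator \<Omega> x * ennreal (norm (f x) powr q)) <= ennreal F" for f :: "vec3 => 'b" and F
 proof -
  have "(NNL z. ennreal (norm (al z) * norm (f (snd z)))) = (NNL t. NNL x. ennreal (norm (al (t, x)) * norm (f x)))"
   by (subst lborel_prod[symmetric], subst lborel.nn_integral_fst[symmetric]) auto
  also have "\<dots> <= (NNL t. ennreal (F powr (1 / q)) * ennreal (ah t))"
  proof (rule nn_integral_mono_AE, use d in eventually_elim)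
   case (elim t)
   have "(NNL x. ennreal (norm (al (t, x)) * norm (f x))) = (NNL x. ennreal (norm (al (t, x)) * norm (indicator \<Omega> x *R f x)))"
    using al0[of _ t] by (intro nn_integral_cong) (auto simp: indicator_def)
   also have "\<dots> <= ennreal (ah t * F powr (1 / q))"
    by (rule dual_bd_nonneg_finite[OF elim q]) (use F in \<open>simp_all add: norm_indicator_powr del: norm_scaleR\<close>)
   also have "\<dots> = ennreal (F powr (1 / q)) * ennreal (ah t)" using nn by (simp add: ennreal_mult mult.commute)
   finally show ?case .
  qed
  also have "\<dots> = ennreal (F powr (1 / q)) * (NNL t. ennreal (ah t))" by (rule nn_integral_cmult) simp
  finally show ?thesis .
 qed
 have mws: "(%z::real \<times> vec3. w (snd z)) \<in> BM" "!!n. (%z::real \<times> vec3. W n (snd z)) \<in> BM"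
  using snd_m mw by auto
 note [measurable] = mws
 show i: "IL (%z. al z <.> w (snd z))"
  unfolding integrable_iff_bounded
 proof (intro conjI)
  define F where "F = enn2real (NNL x. ennreal (norm (w x) powr q))"
  have F: "F >= 0" "(NNL x. indicator \<Omega> x * ennreal (norm (w x) powr q)) <= ennreal F"
   using fin order_trans[OF nn_integral_indicator_le[of lborel \<Omega> "%x. ennreal (norm (w x) powr q)"]] by (auto simp: F_def)
  have "(NNL z. ennreal (norm (al z <.> w (snd z)))) <= (NNL z. ennreal (norm (al z) * norm (w (snd z))))"
   using Cauchy_Schwarz_ineq2 by (intro nn_integral_mono ennreal_leI) auto
  also have "\<dots> <= ennreal (F powr (1 / q)) * (NNL t. ennreal (ah t))" by (rule key) (use F in auto)
  also have "\<dots> < \<infinity>" using ia by (simp add: ennreal_mult_less_top)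
  finally show "(NNL z. ennreal (norm (al z <.> w (snd z)))) < \<infinity>" .
 qed measurable
 assume l: "(%n. NNL x. indicator \<Omega> x * ennreal (norm (W n x - w x) powr q)) ~> 0"
 define X where "X n = (NNL x. indicator \<Omega> x * ennreal (norm (W n x - w x) powr q))" for n
 have Xl: "X ~> 0" using l by (simp add: X_def[abs_def])
 show "(%n. LBINT z. al z <.> W n (snd z)) ~> (LBINT z. al z <.> w (snd z))"
 proof (rule tendsto_pairing[OF _ _ _ i])
  have "(%n. ennreal ((enn2real (X n)) powr (1 / q)) * (NNL t. ennreal (ah t))) ~> ennreal 0 * (NNL t. ennreal (ah t))"
  proof (intro tendsto_mult_ennreal tendsto_const tendsto_ennrealI)
   have "(%n. enn2real (X n)) ~> 0" using tendsto_enn2real[of X 0 sequentially] Xl by simp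
   then show "(%n. (enn2real (X n)) powr (1 / q)) ~> 0"
    using q tendsto_zero_powrI[of "%n. enn2real (X n)" sequentially "%_. 1 / q" "1 / q"] by simp
  qed (use ia in auto)
  then have lim: "(%n. ennreal ((enn2real (X n)) powr (1 / q)) * (NNL t. ennreal (ah t))) ~> 0" by simp
  show "(%n. NNL z. ennreal (norm (al z) * norm (W n (snd z) - w (snd z)))) ~> 0"
  proof (rule tendsto_sandwich[OF _ _ tendsto_const lim])
   have "\<forall>\<^sub>F n in sequentially. X n < 1" using order_tendstoD(2)[OF Xl, of 1] by simp
   then show "\<forall>\<^sub>F n in sequentially. (NNL z. ennreal (norm (al z) * norm (W n (snd z) - w (snd z))))
    <= ennreal ((enn2real (X n)) powr (1 / q)) * (NNL t. ennreal (ah t))"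
   proof eventually_elim
    case (elim n)
    then have "X n ~= top" by auto
    then show ?case using key[of "%x. W n x - w x" "enn2real (X n)"] by (simp add: X_def less_top)
   qed
  qed auto
 qed measurable
qed

lemma pairing_space_limit:
 fixes a :: "vec3 => 'b::euclidean_space" and w :: "vec3 => 'b"
 assumes q: "q > 0" and m: "\<Omega> \<in> sets borel" "a \<in> BM" "w \<in> BM" "!!n. W n \<in> BM"
  and a0: "!!x. x \<notin> \<Omega> ==> a x = 0" and d: "dual_bd q A (%x. norm (a x))" and A: "A >= 0"
  and fin: "(NNL x. ennreal (norm (w x) powr q)) < \<infinity>"
 shows "IL (%x. a x <.> w x)"
  and "(%n. NNL x. indicator \<Omega> x * ennreal (norm (W n x - w x) powr q)) ~> 0 ==>
   (%n. LBINT x. a x <.> W n x) ~> (LBINT x. a x <.> w x)"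
proof -
 note [measurable] = m
 have key: "(NNL x. ennreal (norm (a x) * norm (f x))) <= ennreal (A * F powr (1 / q))"
  if [measurable]: "f \<in> BM" and F: "F >= 0" "(NNL x. indicator \<Omega> x * ennreal (norm (f x) powr q)) <= ennreal F" for f :: "vec3 => 'b" and F
 proof -
  have "(NNL x. ennreal (norm (a x) * norm (f x))) = (NNL x. ennreal (norm (a x) * norm (indicator \<Omega> x *R f x)))"
   using a0 by (intro nn_integral_cong) (auto simp: indicator_def)
  also have "\<dots> <= ennreal (A * F powr (1 / q))"
   by (rule dual_bd_nonneg_finite[OF d q]) (use F in \<open>simp_all add: norm_indicator_powr del: norm_scaleR\<close>)
  finally show ?thesis .
 qed
 show i: "IL (%x. a x <.> w x)"
  unfolding integrable_iff_bounded
 proof (intro conjI)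
  define F where "F = enn2real (NNL x. ennreal (norm (w x) powr q))"
  have F: "F >= 0" "(NNL x. indicator \<Omega> x * ennreal (norm (w x) powr q)) <= ennreal F"
   using fin order_trans[OF nn_integral_indicator_le[of lborel \<Omega> "%x. ennreal (norm (w x) powr q)"]] by (auto simp: F_def)
  have "(NNL x. ennreal (norm (a x <.> w x))) <= (NNL x. ennreal (norm (a x) * norm (w x)))"
   using Cauchy_Schwarz_ineq2 by (intro nn_integral_mono ennreal_leI) auto
  also have "\<dots> <= ennreal (A * F powr (1 / q))" by (rule key) (use F in auto)
  finally show "(NNL x. ennreal (norm (a x <.> w x))) < \<infinity>" by (simp add: le_less_trans)
 qed measurable
 assume l: "(%n. NNL x. indicator \<Omega> x * ennreal (norm (W n x - w x) powr q)) ~> 0"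
 define X where "X n = (NNL x. indicator \<Omega> x * ennreal (norm (W n x - w x) powr q))" for n
 have Xl: "X ~> 0" using l by (simp add: X_def[abs_def])
 show "(%n. LBINT x. a x <.> W n x) ~> (LBINT x. a x <.> w x)"
 proof (rule tendsto_pairing[OF _ _ _ i])
  have "(%n. ennreal (A * (enn2real (X n)) powr (1 / q))) ~> ennreal (A * 0)"
  proof (intro tendsto_ennrealI tendsto_intros)
   have "(%n. enn2real (X n)) ~> 0" using tendsto_enn2real[of X 0 sequentially] Xl by simp
   then show "(%n. (enn2real (X n)) powr (1 / q)) ~> 0"
    using q tendsto_zero_powrI[of "%n. enn2real (X n)" sequentially "%_. 1 / q" "1 / q"] by simp
  qed
  then have lim: "(%n. ennreal (A * (enn2real (X n)) powr (1 / q))) ~> 0" by simp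
  show "(%n. NNL z. ennreal (norm (a z) * norm (W n z - w z))) ~> 0"
  proof (rule tendsto_sandwich[OF _ _ tendsto_const lim])
   have "\<forall>\<^sub>F n in sequentially. X n < 1" using order_tendstoD(2)[OF Xl, of 1] by simp
   then show "\<forall>\<^sub>F n in sequentially. (NNL z. ennreal (norm (a z) * norm (W n z - w z))) <= ennreal (A * (enn2real (X n)) powr (1 / q))"
   proof eventually_elim
    case (elim n)
    then have "X n ~= top" by auto
    then show ?case using key[of "%x. W n x - w x" "enn2real (X n)"] by (simp add: X_def less_top)
   qed
  qed auto
 qed measurable
qed

section \<open>Extending weak formulations to less smooth test functions\<close>

lemma continuous_bounded_cball:
 fixes f :: "'a::euclidean_space => 'b::real_normed_vector"
 assumes "CU f"
 obtains M where "!!x. norm x <= R ==> norm (f x) <= M"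
proof -
 have "compact (f ` cball 0 R)" by (intro compact_continuous_image continuous_on_subset[OF assms]) auto
 then have "bounded (f ` cball 0 R)" by (rule compact_imp_bounded)
 then obtain M where "\<forall>y\<in>f ` cball 0 R. norm y <= M" unfolding bounded_iff by blast
 then show ?thesis using that[of M] by auto
qed

lemma moll_continuous_limit:
 fixes f :: "vec3 => 'b::euclidean_space"
 assumes c: "CU f"
 shows "(%n. moll (1 / Suc n) f y) ~> f y"
  and "norm y <= R ==> 0 < k ==> k <= 1 ==> (!!x. norm x <= R + 1 ==> norm (f x) <= M) ==> norm (moll k f y) <= M"
proof -
 have [measurable]: "f \<in> BM" using c by (rule borel_measurable_continuous_onI)
 have nb: "norm (y - k *R z) <= norm y + 1" if "eta z ~= 0" "0 <= k" "k <= 1" for k and z :: vec3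
 proof -
  have "k * norm z <= 1 * 1" using eta_support[OF that(1)] that by (intro mult_mono) auto
  then show ?thesis using norm_triangle_ineq4[of y "k *R z"] that by simp
 qed
 have bd: "norm (eta z *R f (y - k *R z)) <= eta z * M" if "!!x. norm x <= norm y + 1 ==> norm (f x) <= M" "0 <= k" "k <= 1" for k M and z :: vec3
 proof (cases "eta z = 0")
  case False
  then show ?thesis using that(1)[OF nb[OF False that(2,3)]] eta_nonneg[of z] by (simp add: mult_left_mono)
 qed simp
 obtain M0 where M0: "!!x. norm x <= norm y + 1 ==> norm (f x) <= M0"
  using continuous_bounded_cball[OF c, where R="norm y + 1"] by blast
 have "(%n. LBINT z. eta z *R f (y - (1 / Suc n) *R z)) ~> (LBINT z. eta (z::vec3) *R f y)"
 proof (rule integral_dominated_convergence[where w="%z::vec3. eta z * M0"])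
  show "AL z. (%n. eta z *R f (y - (1 / Suc n) *R z)) ~> eta z *R f y"
  proof (rule AE_I2)
   fix z :: vec3
   have "(%n. 1 / real (Suc n)) ~> 0" by (rule LIMSEQ_Suc) (rule lim_1_over_n)
   then have "(%n. y - (1 / Suc n) *R z) ~> y - 0 *R z" by (intro tendsto_intros)
   then have "(%n. f (y - (1 / Suc n) *R z)) ~> f (y - 0 *R z)"
    by (intro continuous_on_tendsto_compose[OF c]) auto
   then show "(%n. eta z *R f (y - (1 / Suc n) *R z)) ~> eta z *R f y" by (intro tendsto_intros) simp
  qed
  show "AL z. norm (eta z *R f (y - (1 / Suc n) *R z)) <= eta z * M0" for n
   by (intro AE_I2 bd M0) auto
  show "IL (%z::vec3. eta z * M0)" using integrable_eta[where 'a=vec3] by simp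
 qed measurable
 then show "(%n. moll (1 / Suc n) f y) ~> f y"
  using integrable_eta[where 'a=vec3] by (simp add: moll_def integral_eta)
 assume y: "norm y <= R" and k: "0 < k" "k <= 1" and M': "!!x. norm x <= R + 1 ==> norm (f x) <= M"
 have "norm (moll k f y) <= (LBINT z. norm (eta z *R f (y - k *R z)))" unfolding moll_def by (rule integral_norm_bound)
 also have "\<dots> <= (LBINT z. eta (z::vec3) * M)"
 proof (rule integral_mono_AE)
  have b: "norm (eta z *R f (y - k *R z)) <= eta z * M" for z by (rule bd) (use y k M' in auto)
  then show "AL z. norm (eta z *R f (y - k *R z)) <= eta z * M" by simp
  show im: "IL (%z::vec3. eta z * M)" using integrable_eta[where 'a=vec3] by simp
  show "IL (%z. norm (eta z *R f (y - k *R z)))"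
  proof (rule LB_bound[OF im])
   show "AL z. norm (norm (eta z *R f (y - k *R z))) <= norm (eta z * M)"
    using b order_trans[OF b abs_ge_self] by (intro AE_I2) (simp del: norm_scaleR)
  qed measurable
 qed
 also have "\<dots> = M" using integrable_eta by (simp add: integral_eta)
 finally show "norm (moll k f y) <= M" .
qed

text \<open>w need not be integrable, so it is cut off outside the ball of radius R + 2. For |y| <=
  R, a difference step of length at most 1 and a mollification radius of at most 1 stay inside that
  ball, and the cut-off leaves no trace.\<close>

lemma pdx_moll_C1:
 fixes w :: "vec3 => 'b::euclidean_space"
 assumes w: "C1fun w D" and y: "norm y <= R" and k: "0 < kp" "kp <= 1"
 shows "pdx k (moll kp (%x. indicator (cball 0 (R + 2)) x *R w x)) y = moll kp (D k) y"
proof -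
 have cw: "CU w" and dw: "dirderiv (axis k 1) w (D k)" and cD: "CU (D k)"
  using w by (auto simp: C1fun_def)
 have [measurable]: "w \<in> BM" "D k \<in> BM" using cw cD by (auto intro: borel_measurable_continuous_onI)
 have shift: "norm (y + s *R axis k 1 - kp *R z) <= R + 2" if "\<bar>s\<bar> <= 1" "eta z ~= 0" for s z
 proof -
  have "kp * norm z <= 1 * 1" using eta_support[OF that(2)] k by (intro mult_mono) auto
  moreover have "norm (y + s *R axis k 1 - kp *R z) <= norm y + norm (s *R (axis k 1 :: vec3)) + norm (kp *R z)"
   by (meson add_right_mono norm_triangle_ineq norm_triangle_ineq4 order_trans)
  ultimately show ?thesis using y that k by simp
 qed
 obtain M where M: "!!x. norm x <= R + 2 ==> norm (D k x) <= M"
  using continuous_bounded_cball[OF cD, where R="R + 2"] by blast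
 have "((%s. LBINT z. eta z *R w (y + s *R axis k 1 - kp *R z)) has_vector_derivative (LBINT z. eta z *R D k (y + 0 *R axis k 1 - kp *R z))) (at 0)"
 proof (rule has_vector_derivative_integral[where h="%z. eta z * M"])
  fix s :: real
  show "IL (%z. eta z *R w (y + s *R axis k 1 - kp *R z))"
  proof (rule continuous_compact_support_integrable[where R=1])
   show "CU (%z. eta z *R w (y + s *R axis k 1 - kp *R z))"
    using Ck_continuous[OF Ck_eta[of 0]] by (intro continuous_intros continuous_on_compose2[OF cw]) auto
   show "norm z > 1 ==> eta z *R w (y + s *R axis k 1 - kp *R z) = 0" for z
    using eta_support[of z] by force
  qed
  fix z
  have "((%s. w ((y - kp *R z) + s *R axis k 1)) has_vector_derivative D k ((y - kp *R z) + s *R axis k 1)) (at s)"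
   by (rule dirderivD[OF dw])
  from has_vector_derivative_scaleR[OF has_vector_derivative_const[of "eta z", THEN has_real_derivative_iff_has_vector_derivative[THEN iffD2]] this]
  show "((%s. eta z *R w (y + s *R axis k 1 - kp *R z)) has_vector_derivative eta z *R D k (y + s *R axis k 1 - kp *R z)) (at s)"
   by (simp add: algebra_simps)
  show "norm (eta z *R D k (y + s *R axis k 1 - kp *R z)) <= eta z * M" if "\<bar>s\<bar> <= 1"
  proof (cases "eta z = 0")
   case False
   then show ?thesis using M[OF shift[OF that False]] eta_nonneg[of z] by (simp add: mult_left_mono)
  qed simp
 next
  show "IL (%z::vec3. eta z * M)" using integrable_eta[where 'a=vec3] by simp
 qed measurable
 moreover have D0: "(LBINT z. eta z *R D k (y + 0 *R axis k 1 - kp *R z)) = moll kp (D k) y" by (simp add: moll_def)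
 ultimately have "((%s. LBINT z. eta z *R w (y + s *R axis k 1 - kp *R z)) has_vector_derivative moll kp (D k) y) (at 0)" by (simp only:)
 then have "((%s. moll kp (%x. indicator (cball 0 (R + 2)) x *R w x) (y + s *R axis k 1)) has_vector_derivative moll kp (D k) y) (at 0)"
 proof (rule has_vector_derivative_transform_within_open[where S="{-1<..<1}"])
  fix s :: real assume s: "s \<in> {-1<..<1}"
  show "(LBINT z. eta z *R w (y + s *R axis k 1 - kp *R z)) = moll kp (%x. indicator (cball 0 (R + 2)) x *R w x) (y + s *R axis k 1)"
   unfolding moll_def
  proof (rule LB_cong[OF refl])
   fix z :: vec3
   show "eta z *R w (y + s *R axis k 1 - kp *R z) = eta z *R indicator (cball 0 (R + 2)) (y + s *R axis k 1 - kp *R z) *R w (y + s *R axis k 1 - kp *R z)"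
    using shift[of s z] s by (cases "eta z = 0") (auto simp: indicator_def)
  qed
 qed (auto simp: moll_def)
 then show ?thesis unfolding pdx_def by (rule vector_derivative_at)
qed

text \<open>The projection p is the identity for integrals over space and \<open>snd\<close> for
  integrals over space-time; in both cases the test function depends on x only.\<close>

lemma moll_pairing_limit:
 fixes b :: "'z::euclidean_space => 'b::euclidean_space" and f :: "vec3 => 'b" and p :: "'z => vec3"
 assumes b: "IL b" and c: "CU f" and U: "!!n y. norm y <= R ==> U n y = moll (1 / Suc n) f y"
  and mU: "!!n. U n \<in> BM" and b0: "!!z. norm (p z) > R ==> b z = 0" and mp: "p \<in> BM"
 shows "(%n. LBINT z. b z <.> U n (p z)) ~> (LBINT z. b z <.> f (p z))"
proof -
 obtain M where M: "!!x. norm x <= R + 1 ==> norm (f x) <= M" using continuous_bounded_cball[OF c, where R="R + 1"] by blast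
 have [measurable]: "f \<in> BM" using c by (rule borel_measurable_continuous_onI)
 note [measurable] = mU mp
 have [measurable]: "b \<in> BM" using b by auto
 show ?thesis
 proof (rule integral_dominated_convergence[where w="%z. norm (b z) * M"])
  show "AL z. (%n. b z <.> U n (p z)) ~> b z <.> f (p z)"
  proof (rule AE_I2)
   fix z
   show "(%n. b z <.> U n (p z)) ~> b z <.> f (p z)"
   proof (cases "norm (p z) <= R")
    case True
    show ?thesis unfolding U[OF True] by (intro tendsto_intros moll_continuous_limit(1)[OF c])
   qed (use b0[of z] in auto)
  qed
  show "AL z. norm (b z <.> U n (p z)) <= norm (b z) * M" for n
  proof (rule AE_I2)
   fix z
   show "norm (b z <.> U n (p z)) <= norm (b z) * M"
   proof (cases "norm (p z) <= R")
    case True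
    have "norm (U n (p z)) <= M" unfolding U[OF True] by (rule moll_continuous_limit(2)[OF c True]) (use M in auto)
    then show ?thesis using Cauchy_Schwarz_ineq2[of "b z" "U n (p z)"] mult_left_mono[of "norm (U n (p z))" M "norm (b z)"] by simp
   qed (use b0[of z] in auto)
  qed
  show "IL (%z. norm (b z) * M)" using b by auto
 qed measurable
qed

text \<open>Here a collects the terms at fixed times, \<open>al\<close> the space-time coefficient
  of w and \<open>gm\<close> that of its gradient. Over \<Omega> the mollifications of w and their
  first derivatives converge pointwise and boundedly, so integrable coefficients allow the passage
  to the limit.\<close>

lemma C1_test_functions:
 fixes a :: "vec3 => 'b::euclidean_space" and al :: "real \<times> vec3 => 'b" and gm :: "3 => real \<times> vec3 => 'b"
 assumes \<Omega>: "bounded \<Omega>" and ia: "IL a" and ial: "IL al" and igm: "!!k. IL (gm k)"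
  and a0: "!!x. x \<notin> \<Omega> ==> a x = 0" and al0: "!!t x. x \<notin> \<Omega> ==> al (t, x) = 0" and gm0: "!!k t x. x \<notin> \<Omega> ==> gm k (t, x) = 0"
  and id: "!!w. Cc_inf UNIV w ==> (LBINT x. a x <.> w x) + (LBINT z. al z <.> w (snd z)) + (\<Sum>k\<in>UNIV. LBINT z. gm k z <.> pdx k w (snd z)) = 0"
  and w: "C1fun w D"
 shows "(LBINT x. a x <.> w x) + (LBINT z. al z <.> w (snd z)) + (\<Sum>k\<in>UNIV. LBINT z. gm k z <.> D k (snd z)) = 0"
proof -
 obtain R where R: "R > 0" "!!x. x \<in> \<Omega> ==> norm x <= R" using \<Omega> unfolding bounded_pos by blast
 have cw: "CU w" and cD: "!!k. CU (D k)" using w by (auto simp: C1fun_def)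
 have [measurable]: "w \<in> BM" "!!k. D k \<in> BM" using cw cD by (auto intro: borel_measurable_continuous_onI)
 define wt where "wt x = indicator (cball 0 (R + 2)) x *R w x" for x
 have iwt: "IL wt" unfolding wt_def[abs_def] by (rule borel_integrable_compact) (auto intro: continuous_on_subset[OF cw])
 define W where "W n = moll (1 / Suc n) wt" for n
 have CW: "Cc_inf UNIV (W n)" for n unfolding W_def by (rule Cc_inf_moll[OF _ iwt, of _ "R + 2"]) (auto simp: wt_def)
 have pW: "pdx k (W n) y = moll (1 / Suc n) (D k) y" if "norm y <= R" for n k y
  unfolding W_def wt_def by (rule pdx_moll_C1[OF w that]) auto
 have Ww: "W n y = moll (1 / Suc n) w y" if y: "norm y <= R" for n y
  unfolding W_def moll_def
 proof (rule LB_cong[OF refl])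
  fix z :: vec3
  show "eta z *R wt (y - (1 / Suc n) *R z) = eta z *R w (y - (1 / Suc n) *R z)"
  proof (cases "eta z = 0")
   case False
   have "1 / Suc n * norm z <= 1 * 1" using eta_support[OF False] by (intro mult_mono) auto
   then have "norm ((1 / Suc n) *R z) <= 1" by simp
   then have "norm (y - (1 / Suc n) *R z) <= R + 2" using norm_triangle_ineq4[of y "(1 / Suc n) *R z"] y by linarith
   then show ?thesis by (simp add: wt_def)
  qed simp
 qed
 note lim = moll_pairing_limit[where R=R]
 have mW: "W n \<in> BM" "pdx k (W n) \<in> BM" for n k
  using measurable_Cinf[OF Cc_inf_Cinf[OF CW]] measurable_pdx[OF Cc_inf_Cinf[OF CW]] by auto
 have msnd: "(snd :: real \<times> vec3 => vec3) \<in> BM" by (intro borel_measurable_continuous_onI continuous_intros)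
 have "(%n. (LBINT x. a x <.> W n x) + (LBINT z. al z <.> W n (snd z)) + (\<Sum>k\<in>UNIV. LBINT z. gm k z <.> pdx k (W n) (snd z)))
  ~> (LBINT x. a x <.> w x) + (LBINT z. al z <.> w (snd z)) + (\<Sum>k\<in>UNIV. LBINT z. gm k z <.> D k (snd z))"
 proof (intro tendsto_add tendsto_sum)
  show "(%n. LBINT x. a x <.> W n x) ~> (LBINT x. a x <.> w x)"
  proof (rule lim[OF ia cw Ww mW(1), where p="%x. x"])
   show "norm z > R ==> a z = 0" for z using a0[of z] R(2)[of z] by force
  qed auto
  show "(%n. LBINT z. al z <.> W n (snd z)) ~> (LBINT z. al z <.> w (snd z))"
  proof (rule lim[OF ial cw Ww mW(1) _ msnd])
   show "norm (snd z) > R ==> al z = 0" for z using al0[of "snd z" "fst z"] R(2)[of "snd z"] by force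
  qed auto
  show "(%n. LBINT z. gm k z <.> pdx k (W n) (snd z)) ~> (LBINT z. gm k z <.> D k (snd z))" for k
  proof (rule lim[OF igm cD pW mW(2) _ msnd])
   show "norm (snd z) > R ==> gm k z = 0" for z using gm0[of "snd z" k "fst z"] R(2)[of "snd z"] by force
  qed auto
 qed
 then have "(%n. 0) ~> (LBINT x. a x <.> w x) + (LBINT z. al z <.> w (snd z)) + (\<Sum>k\<in>UNIV. LBINT z. gm k z <.> D k (snd z))"
  unfolding id[OF CW] .
 from LIMSEQ_unique[OF this tendsto_const] show ?thesis .
qed

section \<open>The transport term\<close>

lemma ennreal_power2_tendsto_0:
 fixes X :: "nat => ennreal"
 assumes "(%n. (X n)^2) ~> 0"
 shows "X ~> 0"
proof (rule order_tendstoI)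
 fix a :: ennreal assume a: "0 < a"
 define e where "e = min a 1"
 have e: "0 < e" "e <= a" using a by (auto simp: e_def)
 then have "0 < e^2" by (simp add: zero_less_iff_neq_zero)
 then have "\<forall>\<^sub>F n in sequentially. (X n)^2 < e^2" by (rule order_tendstoD(2)[OF assms])
 then show "\<forall>\<^sub>F n in sequentially. X n < a"
 proof eventually_elim
  case (elim n)
  have "X n < e"
  proof (rule ccontr)
   assume "\<not> X n < e"
   then have "e^2 <= (X n)^2" by (intro power_mono) auto
   then show False using elim by simp
  qed
  then show ?case using e by simp
 qed
qed auto

lemma L2_times_small:
 fixes g :: "'a::euclidean_space => real" and ps :: "nat => 'a => real"
 assumes [measurable]: "g \<in> BM" "!!n. ps n \<in> BM"
  and nn: "!!x. g x >= 0" "!!n x. ps n x >= 0"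
  and g: "(NNL x. ennreal ((g x)^2)) < \<infinity>" and l: "(%n. NNL x. ennreal ((ps n x)^2)) ~> 0"
 shows "(%n. NNL x. ennreal (g x * ps n x)) ~> 0"
proof (rule ennreal_power2_tendsto_0)
 have le: "(NNL x. ennreal (g x * ps n x))^2 <= (NNL x. ennreal ((g x)^2)) * (NNL x. ennreal ((ps n x)^2))" for n
 proof -
  have "(NNL x. ennreal (g x) * ennreal (ps n x))^2 <= (NNL x. (ennreal (g x))^2) * (NNL x. (ennreal (ps n x))^2)"
   by (rule Cauchy_Schwarz_nn_integral) auto
  then show ?thesis using nn by (simp add: ennreal_mult ennreal_power)
 qed
 have "(%n. (NNL x. ennreal ((g x)^2)) * (NNL x. ennreal ((ps n x)^2))) ~> (NNL x. ennreal ((g x)^2)) * 0"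
  by (intro ennreal_tendsto_cmult l) (use g in auto)
 then have u: "(%n. (NNL x. ennreal ((g x)^2)) * (NNL x. ennreal ((ps n x)^2))) ~> 0" by simp
 show "(%n. (NNL x. ennreal (g x * ps n x))^2) ~> 0"
  by (rule tendsto_sandwich[OF _ _ tendsto_const u]) (use le in auto)
qed

lemma L2_product_limit:
 fixes f g :: "'a::euclidean_space => 'b::euclidean_space" and fn gn :: "nat => 'a => 'b" and h :: "'a => real"
 assumes [measurable]: "f \<in> BM" "g \<in> BM" "!!n. fn n \<in> BM" "!!n. gn n \<in> BM"
   "h \<in> BM" "A \<in> sets borel"
  and h: "!!x. \<bar>h x\<bar> <= B" "!!x. x \<notin> A ==> h x = 0"
  and f: "(NNL x. nsq (f x)) < \<infinity>" and g: "(NNL x. nsq (g x)) < \<infinity>"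
 shows "IL (%x. h x * (f x <.> g x))"
  and "(%n. NNL x. indicator A x * nsq (fn n x - f x)) ~> 0 ==>
   (%n. NNL x. indicator A x * nsq (gn n x - g x)) ~> 0 ==>
   (%n. LBINT x. h x * (fn n x <.> gn n x)) ~> (LBINT x. h x * (f x <.> g x))"
proof -
 have B: "B >= 0" using h(1)[of undefined] abs_ge_zero order_trans by blast
 have ab: "a * b <= a^2 + b^2" for a b :: real
  using zero_le_power2[of "a - b"] zero_le_power2[of a] zero_le_power2[of b] unfolding power2_diff by linarith
 have intf: "IL (%x. (norm (f x))^2)" "IL (%x. (norm (g x))^2)"
  unfolding integrable_iff_bounded using f g by auto
 show i: "IL (%x. h x * (f x <.> g x))"
 proof (rule LB_bound)
  show "IL (%x. B * ((norm (f x))^2 + (norm (g x))^2))" using intf by auto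
  show "AL x. norm (h x * (f x <.> g x)) <= norm (B * ((norm (f x))^2 + (norm (g x))^2))"
  proof (rule AE_I2)
   fix x
   have "\<bar>f x <.> g x\<bar> <= (norm (f x))^2 + (norm (g x))^2" using Cauchy_Schwarz_ineq2 ab order_trans by blast
   then have "\<bar>h x\<bar> * \<bar>f x <.> g x\<bar> <= B * ((norm (f x))^2 + (norm (g x))^2)" using h(1)[of x] B by (intro mult_mono) auto
   then show "norm (h x * (f x <.> g x)) <= norm (B * ((norm (f x))^2 + (norm (g x))^2))" using B by (simp add: abs_mult)
  qed
 qed measurable
 assume lf: "(%n. NNL x. indicator A x * nsq (fn n x - f x)) ~> 0"
  and lg: "(%n. NNL x. indicator A x * nsq (gn n x - g x)) ~> 0"
 define F where "F n x = indicator A x * norm (fn n x - f x)" for n x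
 define G where "G n x = indicator A x * norm (gn n x - g x)" for n x
 have [measurable]: "F n \<in> BM" "G n \<in> BM" for n unfolding F_def G_def by measurable
 have nn: "F n x >= 0" "G n x >= 0" for n x by (auto simp: F_def G_def)
 have "(%x. ennreal ((F n x)^2)) = (%x. indicator A x * nsq (fn n x - f x))"
  "(%x. ennreal ((G n x)^2)) = (%x. indicator A x * nsq (gn n x - g x))" for n
  by (auto simp: F_def G_def indicator_def)
 then have lF: "(%n. NNL x. ennreal ((F n x)^2)) ~> 0" and lG: "(%n. NNL x. ennreal ((G n x)^2)) ~> 0"
  using lf lg by simp_all
 have t1: "(%n. NNL x. ennreal (norm (g x) * F n x)) ~> 0" by (rule L2_times_small) (use nn g lF in auto)
 have t2: "(%n. NNL x. ennreal (norm (f x) * G n x)) ~> 0" by (rule L2_times_small) (use nn f lG in auto)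
 define U where "U n = ennreal B * ((NNL x. ennreal ((F n x)^2)) + (NNL x. ennreal ((G n x)^2))
   + (NNL x. ennreal (norm (g x) * F n x)) + (NNL x. ennreal (norm (f x) * G n x)))" for n
 have "U ~> ennreal B * (0 + 0 + 0 + 0)" unfolding U_def by (intro ennreal_tendsto_cmult tendsto_add lF lG t1 t2) simp
 then have Ul: "U ~> 0" by simp
 have "(%n. LBINT x. (1::real) <.> (h x * (fn n x <.> gn n x))) ~> (LBINT x. 1 <.> (h x * (f x <.> g x)))"
 proof (rule tendsto_pairing)
  show "IL (%x. (1::real) <.> (h x * (f x <.> g x)))" using i by simp
  show "(%n. NNL x. ennreal (norm (1::real) * norm (h x * (fn n x <.> gn n x) - h x * (f x <.> g x)))) ~> 0"
  proof (rule tendsto_sandwich[OF _ _ tendsto_const Ul])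
   show "\<forall>\<^sub>F n in sequentially. (NNL x. ennreal (norm (1::real) * norm (h x * (fn n x <.> gn n x) - h x * (f x <.> g x)))) <= U n"
   proof (rule always_eventually, rule allI)
    fix n
    have "(NNL x. ennreal (norm (1::real) * norm (h x * (fn n x <.> gn n x) - h x * (f x <.> g x)))) <=
     (NNL x. ennreal B * (ennreal ((F n x)^2) + ennreal ((G n x)^2) + ennreal (norm (g x) * F n x) + ennreal (norm (f x) * G n x)))"
    proof (rule nn_integral_mono)
     fix x
     show "ennreal (norm (1::real) * norm (h x * (fn n x <.> gn n x) - h x * (f x <.> g x))) <=
      ennreal B * (ennreal ((F n x)^2) + ennreal ((G n x)^2) + ennreal (norm (g x) * F n x) + ennreal (norm (f x) * G n x))"
     proof (cases "x \<in> A")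
      case True
      have FG: "F n x = norm (fn n x - f x)" "G n x = norm (gn n x - g x)" using True by (auto simp: F_def G_def)
      have "fn n x <.> gn n x - f x <.> g x = (fn n x - f x) <.> (gn n x - g x) + (fn n x - f x) <.> g x + f x <.> (gn n x - g x)"
       by (simp add: inner_diff_left inner_diff_right)
      then have "\<bar>fn n x <.> gn n x - f x <.> g x\<bar> <= F n x * G n x + norm (g x) * F n x + norm (f x) * G n x"
       using Cauchy_Schwarz_ineq2[of "fn n x - f x" "gn n x - g x"] Cauchy_Schwarz_ineq2[of "fn n x - f x" "g x"]
        Cauchy_Schwarz_ineq2[of "f x" "gn n x - g x"] unfolding FG by (simp add: mult.commute)
      also have "\<dots> <= (F n x)^2 + (G n x)^2 + norm (g x) * F n x + norm (f x) * G n x" using ab[of "F n x" "G n x"] by simp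
      finally have "\<bar>h x\<bar> * \<bar>fn n x <.> gn n x - f x <.> g x\<bar> <= B * ((F n x)^2 + (G n x)^2 + norm (g x) * F n x + norm (f x) * G n x)"
       using h(1)[of x] B by (intro mult_mono) auto
      then have "ennreal (norm (h x * (fn n x <.> gn n x) - h x * (f x <.> g x))) <= ennreal (B * ((F n x)^2 + (G n x)^2 + norm (g x) * F n x + norm (f x) * G n x))"
       by (intro ennreal_leI) (simp add: abs_mult flip: right_diff_distrib)
      then show ?thesis using B nn[where n=n and x=x] by (simp add: ennreal_mult)
     qed (use h(2) in auto)
    qed
    also have "\<dots> = U n" unfolding U_def by (simp add: nn_integral_cmult nn_integral_add)
    finally show "(NNL x. ennreal (norm (1::real) * norm (h x * (fn n x <.> gn n x) - h x * (f x <.> g x)))) <= U n" .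
   qed
  qed auto
 qed measurable
 then show "(%n. LBINT x. h x * (fn n x <.> gn n x)) ~> (LBINT x. h x * (f x <.> g x))" by simp
qed

lemma moll_tendsto_L2:
 fixes f :: "'a::euclidean_space => 'b::euclidean_space"
 assumes [measurable]: "f \<in> BM" and fin: "(NNL x. nsq (f x)) < \<infinity>"
  and A: "A \<in> sets borel" "bounded A"
 shows "(%n. NNL x. indicator A x * nsq (moll (1 / Suc n) f x - f x)) ~> 0"
proof (rule order_tendstoI)
 fix a :: ennreal assume a: "0 < a"
 then obtain e :: real where e: "e > 0" "ennreal e < a" by (metis ennreal_0 ennreal_less_zero_iff dense ennreal_cases not_less_iff_gr_or_eq top.not_eq_extremum less_trans)
 have p2: "norm v powr 2 = (norm v)^2" for v :: 'b by (simp add: powr_numeral)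
 have fin': "(NNL x. ennreal (norm (f x) powr 2)) < \<infinity>" using fin by (simp add: p2)
 obtain d where d: "d > 0"
  "!!T k. quasi_pres 1 A T ==> (!!x. x \<in> A ==> dist (T x) x <= d) ==> 0 < k ==> k <= d ==>
   (NNL x. indicator A x * ennreal (norm (moll k f (T x) - f x) powr 2)) <= ennreal e"
  by (rule moll_Lp[OF _ _ fin' A, of 1 e]) (use e in auto)
 have "(%n. 1 / real (Suc n)) ~> 0" by (rule LIMSEQ_Suc) (rule lim_1_over_n)
 from order_tendstoD(2)[OF this d(1)] show "\<forall>\<^sub>F n in sequentially. (NNL x. indicator A x * nsq (moll (1 / Suc n) f x - f x)) < a"
 proof eventually_elim
  case (elim n)
  have "(NNL x. indicator A x * nsq (moll (1 / Suc n) f x - f x)) <= ennreal e"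
   using d(2)[OF quasi_pres_id[OF A(1)], of "1 / Suc n"] elim d(1) by (simp add: p2)
  then show ?case using e by simp
 qed
qed auto

text \<open>For smooth c this is the divergence theorem for the field \<open>ph\<close> |c|^2.
  Mollifying c keeps the identity, and on the support of \<open>ph\<close> the gradient of the
  mollification is the mollified weak gradient, so every term converges.\<close>

lemma transport_step:
 fixes c :: "vec3 => 'b::euclidean_space" and G :: "vec3 => 'b^3" and ph :: "vec3 => vec3"
 assumes \<Omega>: "open \<Omega>" "bounded \<Omega>" and ph: "Cc_inf \<Omega> ph"
  and m[measurable]: "c \<in> BM" "G \<in> BM" and ic: "IL c"
  and c2: "(NNL x. nsq (c x)) < \<infinity>" and G2: "(NNL x. nsq (G x)) < \<infinity>"
  and wg: "weak_grad \<Omega> c G"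
 shows "IL (%x. (\<Sum>k\<in>UNIV. ph x $ k *R G x $ k) <.> c x)"
  "2 * (LBINT x. (\<Sum>k\<in>UNIV. ph x $ k *R G x $ k) <.> c x) = - (LBINT x. trace (gradv ph x) * (norm (c x))^2)"
proof -
 obtain K where K: "compact K" "K \<subseteq> \<Omega>" "!!x. x \<notin> K ==> ph x = 0" and Cph: "Cinf_on UNIV ph"
  using ph unfolding Cc_inf_def by blast
 obtain R where R: "R > 0" "!!x. norm x > R ==> ph x = 0" using Cc_infE[OF ph] by metis
 have [measurable]: "\<Omega> \<in> sets borel" using \<Omega> by simp
 have cph: "CU ph" by (rule Cinf_continuous[OF Cph])
 have cp: "CU (pdx k ph)" "dirderiv (axis k 1) ph (pdx k ph)" for k using Cinf_pdx[OF Cph] by auto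
 have [measurable]: "ph \<in> BM" "!!k. pdx k ph \<in> BM" "gradv ph \<in> BM"
  using measurable_Cinf[OF Cph] measurable_pdx[OF Cph] measurable_gradv[OF Cph] by auto
 have K0: "x \<notin> K ==> pdx k ph x = 0" for x k
 proof -
  assume x: "x \<notin> K"
  have "((%s. ph (x + s *R axis k 1)) has_vector_derivative 0) (at 0)"
  proof (rule has_vector_derivative_transform_within_open[where S="(%s. x + s *R axis k 1) -` (- K)" and f="%_. 0"])
   show "open ((%s. x + s *R axis k 1) -` (- K))"
    by (intro open_vimage continuous_intros) (use compact_imp_closed[OF K(1)] in auto)
  qed (use x K in auto)
  then show ?thesis unfolding pdx_def by (rule vector_derivative_at)
 qed
 obtain B1 where B1: "B1 > 0" "!!x. norm (ph x) <= B1" using continuous_compact_support_bounded[OF cph R(2)] by metis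
 have hk: "\<bar>ph x $ k\<bar> <= B1" for x k using component_le_norm_cart[of "ph x" k] B1(2)[of x] by linarith
 have ctr: "CU (%x. trace (gradv ph x))"
  unfolding trace_def gradv_def using cp by (auto intro!: continuous_intros)
 have tr0: "x \<notin> K ==> trace (gradv ph x) = 0" for x using K0 by (simp add: trace_def gradv_def)
 obtain B2 where B2: "!!x. norm (trace (gradv ph x)) <= B2"
 proof -
  have "norm x > R ==> trace (gradv ph x) = 0" for x
   using dirderiv_support[OF cp(2) R(2)] by (simp add: trace_def gradv_def)
  from continuous_compact_support_bounded[OF ctr this] show ?thesis using that by blast
 qed
 define cn where "cn n = moll (1 / Suc n) c" for n
 have Ccn: "Cinf_on UNIV (cn n)" for n unfolding cn_def by (rule Cinf_moll[OF _ ic]) simp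
 have [measurable]: "cn n \<in> BM" for n using measurable_Cinf[OF Ccn] .
 have Gk2: "(NNL x. nsq (G x $ k)) < \<infinity>" for k
 proof -
  have "(NNL x. nsq (G x $ k)) <= (NNL x. nsq (G x))"
   by (intro nn_integral_mono ennreal_leI) (simp add: power_mono Finite_Cartesian_Product.norm_nth_le)
  then show ?thesis using G2 by simp
 qed
 \<comment> \<open>Each coordinate derivative of \<open>ph\<close> |cn|^2 integrates to 0 because
   \<open>ph\<close> has compact support; summation over the coordinates produces the
   divergence.\<close>
 have zero: "(LBINT x. trace (gradv ph x) * (cn n x <.> cn n x)) + 2 * (\<Sum>k\<in>UNIV. LBINT x. ph x $ k * (pdx k (cn n) x <.> cn n x)) = 0" for n
 proof -
  have ccn: "CU (cn n)" and cpn: "!!k. CU (pdx k (cn n))" and dpn: "!!k. dirderiv (axis k 1) (cn n) (pdx k (cn n))"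
   using Cinf_continuous[OF Ccn] Cinf_pdx[OF Ccn] by auto
  have i1: "IL (%x. pdx k ph x $ k * (cn n x <.> cn n x))" for k
   by (rule continuous_compact_support_integrable[where R=R])
    (use dirderiv_support[OF cp(2) R(2)] cp ccn in \<open>auto intro!: continuous_intros\<close>)
  have i2: "IL (%x. 2 * (ph x $ k * (pdx k (cn n) x <.> cn n x)))" for k
   by (rule continuous_compact_support_integrable[where R=R])
    (use R(2) cph ccn cpn in \<open>auto intro!: continuous_intros\<close>)
  have "(LBINT x. pdx k ph x $ k * (cn n x <.> cn n x) + 2 * (ph x $ k * (pdx k (cn n) x <.> cn n x))) = 0" for k
  proof (rule integral_dirderiv_eq_0[where f="%x. ph x $ k * (cn n x <.> cn n x)" and b="axis k 1" and R=R])
   show "dirderiv (axis k 1) (%x. ph x $ k * (cn n x <.> cn n x)) (%x. pdx k ph x $ k * (cn n x <.> cn n x) + 2 * (ph x $ k * (pdx k (cn n) x <.> cn n x)))"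
    unfolding dirderiv_def
   proof
    fix x
    let ?l = "%s. x + s *R (axis k 1 :: vec3)"
    have d1: "((%s. ph (?l s) $ k) has_vector_derivative pdx k ph x $ k) (at 0)"
     using dirderiv_component[OF cp(2), of k k] by (auto simp: dirderiv_def)
    have d2: "((%s. cn n (?l s)) has_vector_derivative pdx k (cn n) x) (at 0)" using dpn by (auto simp: dirderiv_def)
    have d3: "((%s. cn n (?l s) <.> cn n (?l s)) has_vector_derivative cn n x <.> pdx k (cn n) x + pdx k (cn n) x <.> cn n x) (at 0)"
     using bounded_bilinear.has_vector_derivative[OF bounded_bilinear_inner d2 d2] by simp
    have "((%s. ph (?l s) $ k * (cn n (?l s) <.> cn n (?l s))) has_vector_derivative ph x $ k * (cn n x <.> pdx k (cn n) x + pdx k (cn n) x <.> cn n x) + pdx k ph x $ k * (cn n x <.> cn n x)) (at 0)"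
     using has_vector_derivative_mult[OF d1 d3] by simp
    then show "((%s. ph (?l s) $ k * (cn n (?l s) <.> cn n (?l s))) has_vector_derivative pdx k ph x $ k * (cn n x <.> cn n x) + 2 * (ph x $ k * (pdx k (cn n) x <.> cn n x))) (at 0)"
     by (simp add: inner_commute algebra_simps)
   qed
  qed (use R(2) cph ccn cpn cp in \<open>auto intro!: continuous_intros\<close>)
  then have s: "(LBINT x. pdx k ph x $ k * (cn n x <.> cn n x)) + (LBINT x. 2 * (ph x $ k * (pdx k (cn n) x <.> cn n x))) = 0" for k
   using LB_add[OF i1 i2] by simp
  have "(LBINT x. trace (gradv ph x) * (cn n x <.> cn n x)) = (LBINT x. (\<Sum>k\<in>UNIV. pdx k ph x $ k * (cn n x <.> cn n x)))"
   by (simp add: trace_def gradv_def sum_distrib_right)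
  also have "\<dots> = (\<Sum>k\<in>UNIV. LBINT x. pdx k ph x $ k * (cn n x <.> cn n x))" by (rule LB_sum[OF i1])
  finally have "(LBINT x. trace (gradv ph x) * (cn n x <.> cn n x)) + 2 * (\<Sum>k\<in>UNIV. LBINT x. ph x $ k * (pdx k (cn n) x <.> cn n x))
   = (\<Sum>k\<in>UNIV. (LBINT x. pdx k ph x $ k * (cn n x <.> cn n x)) + (LBINT x. 2 * (ph x $ k * (pdx k (cn n) x <.> cn n x))))"
   by (simp add: sum.distrib sum_distrib_left)
  then show ?thesis using s by simp
 qed
 have lc: "(%n. NNL x. indicator \<Omega> x * nsq (cn n x - c x)) ~> 0"
  unfolding cn_def by (rule moll_tendsto_L2) (use c2 \<Omega> in auto)
 have lG: "(%n. NNL x. indicator \<Omega> x * nsq (moll (1 / Suc n) (%x. G x $ k) x - G x $ k)) ~> 0" for k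
  by (rule moll_tendsto_L2) (use Gk2 \<Omega> in auto)
 have l1: "(%n. LBINT x. trace (gradv ph x) * (cn n x <.> cn n x)) ~> (LBINT x. trace (gradv ph x) * (c x <.> c x))"
  by (rule L2_product_limit(2)[where A=\<Omega> and B=B2]) (use B2 tr0 K lc c2 in \<open>auto simp: trace_def\<close>)
 have ph\<Omega>: "ph x = 0" if "x \<notin> \<Omega>" for x using K(2,3) that by blast
 have l2: "(%n. LBINT x. ph x $ k * (moll (1 / Suc n) (%x. G x $ k) x <.> cn n x)) ~> (LBINT x. ph x $ k * (G x $ k <.> c x))" for k
  by (rule L2_product_limit(2)[where A=\<Omega> and B=B1, OF _ _ _ _ _ _ _ _ _ _ lG lc]) (use hk ph\<Omega> c2 Gk2 in auto)
 have ik: "IL (%x. ph x $ k * (G x $ k <.> c x))" for k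
  by (rule L2_product_limit(1)[where A=\<Omega> and B=B1 and fn="%n x. 0" and gn="%n x. 0"]) (use hk ph\<Omega> c2 Gk2 in auto)
 \<comment> \<open>Once 1/(n+1) is below this distance, balls around all points of K lie in \<Omega>
   and \<open>weak_grad\<close> applies on K.\<close>
 obtain e where e: "e > 0" "(\<Union>x\<in>K. cball x e) \<subseteq> \<Omega>"
  using compact_subset_open_imp_cball_epsilon_subset[OF K(1) \<Omega>(1) K(2)] .
 have pk: "\<forall>\<^sub>F n in sequentially. \<forall>k. (LBINT x. ph x $ k * (pdx k (cn n) x <.> cn n x)) = (LBINT x. ph x $ k * (moll (1 / Suc n) (%x. G x $ k) x <.> cn n x))"
 proof -
  have "(%n. 1 / real (Suc n)) ~> 0" by (rule LIMSEQ_Suc) (rule lim_1_over_n)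
  from order_tendstoD(2)[OF this e(1)] show ?thesis
  proof eventually_elim
   case (elim n)
   show ?case
   proof (intro allI LB_cong[OF refl])
    fix k x
    show "ph x $ k * (pdx k (cn n) x <.> cn n x) = ph x $ k * (moll (1 / Suc n) (%x. G x $ k) x <.> cn n x)"
    proof (cases "x \<in> K")
     case True
     have "cball x (1 / Suc n) \<subseteq> cball x e" using elim by (intro subset_cball less_imp_le)
     then have "cball x (1 / Suc n) \<subseteq> \<Omega>" using e(2) True by (meson UN_subset_iff order_trans)
     then show ?thesis using wg unfolding weak_grad_def cn_def by simp
    qed (use K in simp)
   qed
  qed
 qed
 have "(%n. (LBINT x. trace (gradv ph x) * (cn n x <.> cn n x)) + 2 * (\<Sum>k\<in>UNIV. LBINT x. ph x $ k * (moll (1 / Suc n) (%x. G x $ k) x <.> cn n x)))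
  ~> (LBINT x. trace (gradv ph x) * (c x <.> c x)) + 2 * (\<Sum>k\<in>UNIV. LBINT x. ph x $ k * (G x $ k <.> c x))"
  by (intro tendsto_intros l1 l2)
 moreover have "(%n. (LBINT x. trace (gradv ph x) * (cn n x <.> cn n x)) + 2 * (\<Sum>k\<in>UNIV. LBINT x. ph x $ k * (moll (1 / Suc n) (%x. G x $ k) x <.> cn n x))) ~> 0"
 proof (rule tendsto_eventually, use pk in eventually_elim)
  case (elim n)
  show ?case using zero[of n] elim by (simp del: of_nat_Suc)
 qed
 ultimately have z: "(LBINT x. trace (gradv ph x) * (c x <.> c x)) + 2 * (\<Sum>k\<in>UNIV. LBINT x. ph x $ k * (G x $ k <.> c x)) = 0"
  using LIMSEQ_unique by blast
 have eq: "(%x. (\<Sum>k\<in>UNIV. ph x $ k *R G x $ k) <.> c x) = (%x. \<Sum>k\<in>UNIV. ph x $ k * (G x $ k <.> c x))"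
  by (simp add: inner_sum_left)
 show "IL (%x. (\<Sum>k\<in>UNIV. ph x $ k *R G x $ k) <.> c x)"
  unfolding eq by (rule LB_isum[OF ik])
 have "(LBINT x. (\<Sum>k\<in>UNIV. ph x $ k *R G x $ k) <.> c x) = (\<Sum>k\<in>UNIV. LBINT x. ph x $ k * (G x $ k <.> c x))"
  unfolding eq by (rule LB_sum[OF ik])
 then show "2 * (LBINT x. (\<Sum>k\<in>UNIV. ph x $ k *R G x $ k) <.> c x) = - (LBINT x. trace (gradv ph x) * (norm (c x))^2)"
  using z by (simp add: power2_norm_eq_inner)
qed

lemma norm_transport_le:
 fixes v :: vec3 and G :: "'b::euclidean_space^3"
 shows "norm (\<Sum>k\<in>UNIV. v $ k *R G $ k) <= norm v * norm G"
proof -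
 have "norm (\<Sum>k\<in>UNIV. v $ k *R G $ k) <= (\<Sum>k\<in>UNIV. \<bar>v $ k\<bar> * norm (G $ k))"
  by (rule order_trans[OF norm_sum]) simp
 also have "\<dots> <= norm v * norm G"
  using L2_set_mult_ineq[of "%k. v $ k" "%k. norm (G $ k)" UNIV] by (simp add: norm_vec_def L2_set_def)
 finally show ?thesis .
qed

text \<open>The integral runs over all of space: it is meant for v and Gv extended by 0 outside
  \<Omega>, where the approximating functions and their gradients vanish as well.\<close>

definition H10_approx :: "vec3 set => (nat => vec3 => vec3) => (vec3 => vec3) => (vec3 => mat3) => bool" where
 "H10_approx \<Omega> ph v Gv \<longleftrightarrow> (\<forall>n. Cc_inf \<Omega> (ph n)) &
  (%n. NNL x. ennreal ((norm (ph n x - v x))^2 + (norm (gradv (ph n) x - Gv x))^2)) ~> 0"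

lemma gradv_0: "gradv (%x. 0) = (%x. 0)"
 by (simp add: gradv_def pdx_def fun_eq_iff vec_eq_iff)

text \<open>With \<open>ps\<close> = 0 it bounds the transport coefficient itself, with
  \<open>ps\<close> = ph n it shows that approximating v changes the term little. The constant
  884736 = 8 * 110592 arises from cubing the factor 2 in \<open>Sobolev_H10\<close>.\<close>

lemma transport_dual_bd_diff:
 fixes G :: "vec3 => 'b::euclidean_space^3"
 assumes r: "r > 3" and m[measurable]: "v \<in> BM" "Gv \<in> BM" "G \<in> BM"
  and ap: "H10_approx \<Omega> ph v Gv" and ps: "Cc_inf \<Omega> ps" and nn: "A >= 0" "D >= 0" "E >= 0"
  and A: "(NNL x. nsq (v x - ps x)) <= ennreal A"
  and D: "(NNL x. nsq (Gv x - gradv ps x)) <= ennreal D"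
  and E: "(NNL x. nsq (G x)) <= ennreal E"
 shows "dual_bd r (sqrt E * sqrt (A powr ((r - 3) / r) * (884736 * D ^ 3) powr (1 / r))) (%x. norm (v x - ps x) * norm (G x))"
proof (rule dual_bd_transport[OF r])
 have [measurable]: "ps \<in> BM" by (rule measurable_Cinf[OF Cc_inf_Cinf[OF ps]])
 show "(%x. norm (v x - ps x)) \<in> BM" "(%x. norm (G x)) \<in> BM" by measurable
 have "(NNL x. ennreal (norm (v x - ps x) ^ 6)) <= 110592 * (2 * (NNL x. nsq (Gv x - gradv ps x))) ^ 3"
  by (rule Sobolev_H10[OF m(1,2) _ ps, where ph=ph]) (use ap in \<open>auto simp: H10_approx_def\<close>)
 also have "\<dots> <= 110592 * (2 * ennreal D) ^ 3" by (intro mult_left_mono power_mono D) auto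
 also have "\<dots> = ennreal (884736 * D ^ 3)"
 proof -
  have "110592 * (2 * ennreal D) ^ 3 = ennreal 110592 * (ennreal 2 * ennreal D) ^ 3" by (simp only: ennreal_numeral)
  also have "\<dots> = ennreal (110592 * (2 * D) ^ 3)" using nn(2) by (simp only: ennreal_mult[symmetric] ennreal_power mult_nonneg_nonneg zero_le_numeral zero_le_power)
  also have "110592 * (2 * D) ^ 3 = 884736 * D ^ 3" by (simp add: power_mult_distrib)
  finally show ?thesis .
 qed
 finally show "(NNL x. ennreal (norm (v x - ps x) ^ 6)) <= ennreal (884736 * D ^ 3)" .
qed (use nn A E in auto)

lemma transport_dual_bd:
 fixes G :: "vec3 => 'b::euclidean_space^3"
 assumes r: "r > 3" and m[measurable]: "v \<in> BM" "Gv \<in> BM" "G \<in> BM"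
  and ap: "H10_approx \<Omega> ph v Gv" and nn: "A >= 0" "D >= 0" "E >= 0"
  and A: "(NNL x. nsq (v x)) <= ennreal A"
  and D: "(NNL x. nsq (Gv x)) <= ennreal D"
  and E: "(NNL x. nsq (G x)) <= ennreal E"
 shows "dual_bd r (sqrt E * sqrt (A powr ((r - 3) / r) * (884736 * D ^ 3) powr (1 / r))) (%x. norm (v x) * norm (G x))"
 using transport_dual_bd_diff[OF r m ap Cc_inf_0 nn] A D E by (simp add: gradv_0)

lemma dual_bd_mono:
 assumes "dual_bd q al a" "!!x. b x <= a x"
 shows "dual_bd q al b"
 unfolding dual_bd_def
proof (intro allI impI)
 fix ph :: "'a => real" and m assume *: "ph \<in> BM" "\<forall>x. 0 <= ph x" "0 <= m"
  "(NNL x. ennreal (ph x powr q)) <= ennreal (m powr q)"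
 have "(NNL x. ennreal (b x * ph x)) <= (NNL x. ennreal (a x * ph x))"
  using * assms(2) by (intro nn_integral_mono ennreal_leI mult_right_mono) auto
 also have "\<dots> <= ennreal (al * m)" by (rule dual_bdD[OF assms(1)]) (use * in auto)
 finally show "(NNL x. ennreal (b x * ph x)) <= ennreal (al * m)" .
qed

text \<open>The approximations of v are not divergence free; their divergence is merely small in
  L^2. It is multiplied by |c|^2, which therefore has to lie in L^2, and this is where c in L^4
  enters. The transport integral itself converges because v - ph n is small in the dual norm that
  pairs with c in L^r.\<close>

lemma transport_zero:
 fixes c :: "vec3 => 'b::euclidean_space" and G :: "vec3 => 'b^3" and v :: "vec3 => vec3"
 assumes r: "r > 3" and \<Omega>: "open \<Omega>" "bounded \<Omega>"
  and m[measurable]: "v \<in> BM" "Gv \<in> BM" "G \<in> BM" "c \<in> BM"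
  and ap: "H10_approx \<Omega> ph v Gv" and tr: "AL x. trace (Gv x) = 0"
  and v2: "(NNL x. nsq (v x)) < \<infinity>" and Gv2: "(NNL x. nsq (Gv x)) < \<infinity>"
  and ic: "IL c" and c2: "(NNL x. nsq (c x)) < \<infinity>"
  and c4: "(NNL x. ennreal ((norm (c x)) ^ 4)) < \<infinity>"
  and cr: "(NNL x. ennreal ((norm (c x)) powr r)) < \<infinity>" and G2: "(NNL x. nsq (G x)) < \<infinity>"
  and wg: "weak_grad \<Omega> c G"
 shows "(LBINT x. (\<Sum>k\<in>UNIV. v x $ k *R G x $ k) <.> c x) = 0"
proof -
 have ph: "Cc_inf \<Omega> (ph n)" for n using ap by (simp add: H10_approx_def)
 note [measurable] = measurable_Cinf[OF Cc_inf_Cinf[OF ph]] measurable_gradv[OF Cc_inf_Cinf[OF ph]]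
 define e where "e n = (NNL x. ennreal ((norm (ph n x - v x))^2 + (norm (gradv (ph n) x - Gv x))^2))" for n
 have e: "e ~> 0" using ap by (simp add: H10_approx_def e_def[abs_def])
 have ev: "\<forall>\<^sub>F n in sequentially. e n < 1" using order_tendstoD(2)[OF e, of 1] by simp
 define E where "E = enn2real (NNL x. nsq (G x))"
 define M where "M = enn2real (NNL x. ennreal ((norm (c x)) powr r))"
 have E: "E >= 0" "(NNL x. nsq (G x)) <= ennreal E" using G2 by (auto simp: E_def)
 have M: "M >= 0" "(NNL x. ennreal ((norm (c x)) powr r)) <= ennreal M" using cr by (auto simp: M_def)
 define \<epsilon> where "\<epsilon> n = enn2real (e n)" for n
 have \<epsilon>l: "\<epsilon> ~> 0" unfolding \<epsilon>_def using tendsto_enn2real[of e 0 sequentially] e by simp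
 define U where "U n = sqrt E * sqrt (\<epsilon> n powr ((r - 3) / r) * (884736 * \<epsilon> n ^ 3) powr (1 / r)) * M powr (1 / r)" for n
 have "(%n. \<epsilon> n powr ((r - 3) / r)) ~> 0"
  using r \<epsilon>l tendsto_zero_powrI[of \<epsilon> sequentially "%_. (r - 3) / r" "(r - 3) / r"] by (simp add: \<epsilon>_def)
 moreover have "(%n. 884736 * \<epsilon> n ^ 3) ~> 884736 * 0 ^ 3" by (intro tendsto_intros \<epsilon>l)
 then have "(%n. (884736 * \<epsilon> n ^ 3) powr (1 / r)) ~> 0"
  using r tendsto_zero_powrI[of "%n. 884736 * \<epsilon> n ^ 3" sequentially "%_. 1 / r" "1 / r"] by (simp add: \<epsilon>_def)
 ultimately have "U ~> sqrt E * sqrt (0 * 0) * M powr (1 / r)" unfolding U_def by (intro tendsto_intros)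
 then have Ul: "(%n. ennreal (U n)) ~> 0" by (metis ennreal_0 mult_zero_left mult_zero_right real_sqrt_zero tendsto_ennrealI)
 have diff: "(%n. NNL x. ennreal (norm (ph n x - v x) * norm (G x) * norm (c x))) ~> 0"
 proof (rule tendsto_sandwich[OF _ _ tendsto_const Ul])
  show "\<forall>\<^sub>F n in sequentially. (NNL x. ennreal (norm (ph n x - v x) * norm (G x) * norm (c x))) <= ennreal (U n)"
   using ev
  proof eventually_elim
   case (elim n)
   have en: "e n = ennreal (\<epsilon> n)" "\<epsilon> n >= 0" using order_less_trans[OF elim ennreal_one_less_top] by (auto simp: \<epsilon>_def)
   have a: "(NNL x. nsq (v x - ph n x)) <= ennreal (\<epsilon> n)"
    unfolding en(1)[symmetric] e_def by (intro nn_integral_mono ennreal_leI) (simp add: norm_minus_commute)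
   have b: "(NNL x. nsq (Gv x - gradv (ph n) x)) <= ennreal (\<epsilon> n)"
    unfolding en(1)[symmetric] e_def by (intro nn_integral_mono ennreal_leI) (simp add: norm_minus_commute)
   have "dual_bd r (sqrt E * sqrt (\<epsilon> n powr ((r - 3) / r) * (884736 * \<epsilon> n ^ 3) powr (1 / r))) (%x. norm (v x - ph n x) * norm (G x))"
    by (rule transport_dual_bd_diff[OF r m(1,2,3) ap ph en(2) en(2) E(1) a b E(2)])
   from dual_bd_nonneg_finite[OF this _ _ _ M(2,1)] show ?case using r by (simp add: U_def norm_minus_commute mult.assoc)
  qed
 qed auto
 define Vc where "Vc u x = (\<Sum>k\<in>UNIV. u x $ k *R G x $ k) <.> c x" for u :: "vec3 => vec3" and x
 have mV[measurable]: "Vc u \<in> BM" if [measurable]: "u \<in> BM" for u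
  unfolding Vc_def by measurable
 have Vbd: "norm (Vc u x) <= norm (u x) * norm (G x) * norm (c x)" for u x
  unfolding Vc_def using Cauchy_Schwarz_ineq2[of "\<Sum>k\<in>UNIV. u x $ k *R G x $ k" "c x"]
   mult_right_mono[OF norm_transport_le[of "u x" "G x"], of "norm (c x)"] by simp
 have Vdiff: "norm (Vc u x - Vc u' x) <= norm (u x - u' x) * norm (G x) * norm (c x)" for u u' x
  using Vbd[of "%x. u x - u' x" x] by (simp add: Vc_def inner_diff_left scaleR_diff_left sum_subtractf)
 have iv: "IL (Vc v)"
  unfolding integrable_iff_bounded
 proof (intro conjI)
  define A where "A = enn2real (NNL x. nsq (v x))"
  define D where "D = enn2real (NNL x. nsq (Gv x))"
  have A: "A >= 0" "(NNL x. nsq (v x)) <= ennreal A" using v2 by (auto simp: A_def)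
  have D: "D >= 0" "(NNL x. nsq (Gv x)) <= ennreal D" using Gv2 by (auto simp: D_def)
  have "(NNL x. ennreal (norm (Vc v x))) <= (NNL x. ennreal (norm (v x) * norm (G x) * norm (c x)))"
   by (intro nn_integral_mono ennreal_leI Vbd)
  also have "\<dots> <= ennreal (sqrt E * sqrt (A powr ((r - 3) / r) * (884736 * D ^ 3) powr (1 / r)) * M powr (1 / r))"
   by (rule dual_bd_nonneg_finite[OF transport_dual_bd[OF r m(1,2,3) ap A(1) D(1) E(1) A(2) D(2) E(2)]]) (use r M in auto)
  finally show "(NNL x. ennreal (norm (Vc v x))) < \<infinity>" by (simp add: le_less_trans)
 qed measurable
 have "(%n. LBINT x. (1::real) <.> Vc (ph n) x) ~> (LBINT x. 1 <.> Vc v x)"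
 proof (rule tendsto_pairing)
  show "(%n. NNL x. ennreal (norm (1::real) * norm (Vc (ph n) x - Vc v x))) ~> 0"
   by (rule tendsto_sandwich[OF _ _ tendsto_const diff]) (use Vdiff in \<open>auto intro!: always_eventually nn_integral_mono ennreal_leI\<close>)
 qed (use iv in auto)
 then have l1: "(%n. 2 * (LBINT x. Vc (ph n) x)) ~> 2 * (LBINT x. Vc v x)" by (intro tendsto_intros) simp
 have trb: "\<bar>trace N\<bar> <= 3 * norm N" for N :: mat3
  unfolding trace_def by (rule order_trans[OF sum_abs]) (use sum_bounded_above[of UNIV "%i. \<bar>N $ i $ i\<bar>" "norm N"] abs_entry_le_norm in auto)
 have [measurable]: "(%x. trace (N x)) \<in> BM" if [measurable]: "N \<in> BM" for N :: "vec3 => mat3"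
  unfolding trace_def by measurable
 have z0: "AL x. (norm (c x))^2 <.> trace (Gv x) = 0" using tr by eventually_elim simp
 have "(%n. LBINT x. (norm (c x))^2 <.> trace (gradv (ph n) x)) ~> (LBINT x. (norm (c x))^2 <.> trace (Gv x))"
 proof (rule tendsto_pairing)
  show "IL (%x. (norm (c x))^2 <.> trace (Gv x))"
   using integrable_cong_AE[of "%x. (norm (c x))^2 <.> trace (Gv x)" lborel "%x. 0", OF _ _ z0] by simp
  have "(%n. NNL x. ennreal ((norm (c x))^2 * norm (gradv (ph n) x - Gv x))) ~> 0"
  proof (rule L2_times_small)
   show "(NNL x. ennreal (((norm (c x))^2)^2)) < \<infinity>" using c4 by simp
   show "(%n. NNL x. nsq (gradv (ph n) x - Gv x)) ~> 0"
    by (rule tendsto_sandwich[OF _ _ tendsto_const e]) (auto intro!: always_eventually nn_integral_mono ennreal_leI simp: e_def)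
  qed auto
  then have "(%n. ennreal 3 * (NNL x. ennreal ((norm (c x))^2 * norm (gradv (ph n) x - Gv x)))) ~> ennreal 3 * 0"
   by (intro ennreal_tendsto_cmult) auto
  then have u: "(%n. ennreal 3 * (NNL x. ennreal ((norm (c x))^2 * norm (gradv (ph n) x - Gv x)))) ~> 0" by simp
  show "(%n. NNL x. ennreal (norm ((norm (c x))^2) * norm (trace (gradv (ph n) x) - trace (Gv x)))) ~> 0"
  proof (rule tendsto_sandwich[OF _ _ tendsto_const u])
   show "\<forall>\<^sub>F n in sequentially. (NNL x. ennreal (norm ((norm (c x))^2) * norm (trace (gradv (ph n) x) - trace (Gv x))))
    <= ennreal 3 * (NNL x. ennreal ((norm (c x))^2 * norm (gradv (ph n) x - Gv x)))"
   proof (rule always_eventually, rule allI)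
    fix n
    have "(NNL x. ennreal (norm ((norm (c x))^2) * norm (trace (gradv (ph n) x) - trace (Gv x))))
     <= (NNL x. ennreal 3 * ennreal ((norm (c x))^2 * norm (gradv (ph n) x - Gv x)))"
    proof (rule nn_integral_mono)
     fix x
     have "(norm (c x))^2 * \<bar>trace (gradv (ph n) x - Gv x)\<bar> <= (norm (c x))^2 * (3 * norm (gradv (ph n) x - Gv x))"
      by (intro mult_left_mono trb) auto
     then have "ennreal (norm ((norm (c x))^2) * norm (trace (gradv (ph n) x) - trace (Gv x))) <= ennreal (3 * ((norm (c x))^2 * norm (gradv (ph n) x - Gv x)))"
      by (intro ennreal_leI) (simp add: trace_sub)
     then show "ennreal (norm ((norm (c x))^2) * norm (trace (gradv (ph n) x) - trace (Gv x))) <= ennreal 3 * ennreal ((norm (c x))^2 * norm (gradv (ph n) x - Gv x))"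
      by (simp only: ennreal_mult zero_le_numeral mult_nonneg_nonneg zero_le_power2 norm_ge_zero)
    qed
    also have "\<dots> = ennreal 3 * (NNL x. ennreal ((norm (c x))^2 * norm (gradv (ph n) x - Gv x)))" by (rule nn_integral_cmult) measurable
    finally show "(NNL x. ennreal (norm ((norm (c x))^2) * norm (trace (gradv (ph n) x) - trace (Gv x)))) <= \<dots>" .
   qed
  qed auto
 qed measurable
 also have "(LBINT x. (norm (c x))^2 <.> trace (Gv x)) = 0"
  using integral_cong_AE[of "%x. (norm (c x))^2 <.> trace (Gv x)" lborel "%x. 0", OF _ _ z0] by simp
 finally have l2: "(%n. - (LBINT x. trace (gradv (ph n) x) * (norm (c x))^2)) ~> - 0"
  by (intro tendsto_intros) (simp add: mult.commute)
 have "2 * (LBINT x. Vc (ph n) x) = - (LBINT x. trace (gradv (ph n) x) * (norm (c x))^2)" for n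
  unfolding Vc_def by (rule transport_step(2)[OF \<Omega> ph m(4,3) ic c2 G2 wg])
 then have "2 * (LBINT x. Vc v x) = - 0" using LIMSEQ_unique[OF l1] l2 by simp
 then show ?thesis by (simp add: Vc_def)
qed

section \<open>Weak formulations in time\<close>

lemma continuous_antiderivative:
 fixes f :: "real => real"
 assumes c: "CU f" and z: "!!t. t < a ==> f t = 0"
 obtains F where "!!t. (F has_real_derivative f t) (at t)" "!!s t. s <= t ==> F t - F s = (LBINT x. indicator {s..t} x *R f x)" "!!t. t <= a ==> F t = 0"
proof -
 have "\<exists>F. \<forall>x::real. -\<infinity> < ereal x --> ereal x < \<infinity> --> (F has_vector_derivative f x) (at x)"
  by (rule einterval_antiderivative) (use c in \<open>auto simp: continuous_on_eq_continuous_at\<close>)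
 then obtain F0 where F0: "!!x. (F0 has_vector_derivative f x) (at x)" by auto
 define F where "F t = F0 t - F0 a" for t
 have F: "(F has_vector_derivative f x) (at x)" for x unfolding F_def using F0[of x] by (auto intro!: derivative_eq_intros)
 have ftc: "F t - F s = (LBINT x. indicator {s..t} x *R f x)" if "s <= t" for s t
  by (rule integral_FTC_Icc[OF that, symmetric]) (use F c in \<open>auto intro: has_vector_derivative_at_within continuous_on_subset\<close>)
 have "F t = 0" if "t <= a" for t
 proof -
  have "F a - F t = (LBINT (x::real). 0)" unfolding ftc[OF that]
  proof (rule integral_cong_AE)
   show "AL x. indicator {t..a} x *R f x = 0"
    using AE_lborel_singleton[of a] by eventually_elim (use z in \<open>auto simp: indicator_def\<close>)
   show "(%x. indicator {t..a} x *R f x) \<in> borel_measurable lborel"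
    using borel_measurable_continuous_onI[OF c] by measurable
  qed simp
  then show ?thesis by (simp add: F_def)
 qed
 then show ?thesis using that[of F] F ftc by (auto simp: has_real_derivative_iff_has_vector_derivative)
qed

text \<open>The du Bois-Reymond argument with an initial value. A given \<open>kp\<close> with
  support in (0,T) is made the derivative of an admissible test function on (0,T) by subtracting its
  integral times a bump at negative times. The primitive then has compact support and the value
  minus the integral of \<open>kp\<close> at t = 0, which is how the initial datum q0 enters. So q +
  P - q0 is orthogonal to every \<open>kp\<close>.\<close>

lemma weak_time_derivative:
 fixes q b :: "real => real"
 assumes T: "T > 0" and cq: "continuous_on {0..T} q" and ib: "IL b" and b0: "!!t. t \<notin> {0<..<T} ==> b t = 0"
  and weak: "!!th th'. Cc_inf {..<T} th ==> (!!t. (th has_real_derivative th' t) (at t)) ==> CU th' ==>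
   - (LBINT t. indicator {0<..<T} t * (q t * th' t)) + (LBINT t. b t * th t) = q0 * th 0"
  and t: "0 <= t" "t <= T"
 shows "q t = q0 - (LBINT s. (if 0 <= s & s <= t then b s else 0))"
proof -
 have [measurable]: "b \<in> BM" using ib by auto
 define P where "P t = (LBINT s. (if 0 <= s & s <= t then b s else 0))" for t
 have [measurable]: "P \<in> BM" unfolding P_def by measurable
 have P_b: "(LBINT s. (if s <= t then b s else 0)) = P t" for t
  unfolding P_def by (rule LB_cong) (use b0 in auto)
 have cP: "continuous_on {0..T} P"
  unfolding continuous_on_sequentially
 proof (intro allI ballI impI)
  fix X :: "nat => real" and t assume X: "(\<forall>n. X n \<in> {0..T}) & X ~> t"
  have "(%n. LBINT s. (if 0 <= s & s <= X n then b s else 0)) ~> (LBINT s. (if 0 <= s & s <= t then b s else 0))"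
  proof (rule integral_dominated_convergence[where w="%s. \<bar>b s\<bar>"])
   show "AL s. (%n. if 0 <= s & s <= X n then b s else 0) ~> (if 0 <= s & s <= t then b s else 0)"
    using AE_lborel_singleton[of t]
   proof eventually_elim
    case (elim s)
    have "\<forall>\<^sub>F n in sequentially. (s <= X n) = (s <= t)"
    proof (cases "s < t")
     case True
     then have "\<forall>\<^sub>F n in sequentially. s < X n" using X by (intro order_tendstoD) auto
     then show ?thesis by eventually_elim (use True in auto)
    next
     case False
     then have "t < s" using elim by auto
     then have "\<forall>\<^sub>F n in sequentially. X n < s" using X by (intro order_tendstoD) auto
     then show ?thesis by eventually_elim (use \<open>t < s\<close> in auto)
    qed
    then have "\<forall>\<^sub>F n in sequentially. (if 0 <= s & s <= X n then b s else 0) = (if 0 <= s & s <= t then b s else 0)"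
     by eventually_elim auto
    then show ?case by (rule tendsto_eventually)
   qed
  qed (use ib in auto)
  then show "(P \<circ> X) ~> P t" by (simp add: P_def o_def)
 qed
 define v where "v t = indicator {0..T} t * (q t + P t - q0)" for t
 have cv: "continuous_on {0..T} (%t. q t + P t - q0)" by (intro continuous_intros cq cP)
 have iv: "IL v"
  using borel_integrable_compact[OF compact_Icc cv] by (simp add: v_def[abs_def])
 have "AL t. t \<in> {0<..<T} --> v t = 0"
 proof (rule fundamental_lemma_variations[OF iv])
  fix kp :: "real => real" assume kp: "Cc_inf {0<..<T} kp"
  obtain K where K: "compact K" "K \<subseteq> {0<..<T}" "!!x. x \<notin> K ==> kp x = 0" "Cinf_on UNIV kp" using kp unfolding Cc_inf_def by blast
  have K0: "t \<notin> {0<..<T} ==> kp t = 0" for t using K(2,3) by blast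
  then have K0': "\<not> 0 <= t ==> kp t = 0" "\<not> t <= T ==> kp t = 0" for t by auto
  have Ckkp: "Ck k UNIV kp" for k using K(4) unfolding Cinf_on_def by auto
  have ckp: "CU kp" using Ck_continuous[OF Ckkp[of 0]] .
  have ikp: "IL kp"
   by (rule continuous_compact_support_integrable[OF ckp, of T]) (use K(2,3) in force)
  have [measurable]: "kp \<in> BM" using ikp by auto
  define I where "I = (LBINT t. kp t)"
  \<comment> \<open>A bump of mass one with support in (-3/2, -1/2): it lies before time 0, where
    neither q nor b is seen.\<close>
  define \<beta> where "\<beta> t = ker (1/2) (t + 1)" for t :: real
  have Ck\<beta>: "Ck k UNIV \<beta>" for k
   using Ck_affine[OF Ck_ker, of k "1/2" "1::real" 1] by (simp add: \<beta>_def[abs_def] add.commute)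
  have \<beta>s: "\<beta> t = 0" if "\<not> (- 3/2 < t & t < - 1/2)" for t
   using ker_support[of "1/2" "t + 1"] that by (force simp: \<beta>_def)
  have c\<beta>: "CU \<beta>" using Ck_continuous[OF Ck\<beta>[of 0]] .
  have i\<beta>: "IL \<beta>" by (rule continuous_compact_support_integrable[OF c\<beta>, of 2]) (auto intro!: \<beta>s)
  have int\<beta>: "(LBINT t. \<beta> t) = 1"
  proof -
   have "(LBINT t. \<beta> t) = (LBINT x. ker (1/2) (x::real) *R (1::real))"
    using lborel_integral_real_affine[of 1 "%x. ker (1/2) x" 1, symmetric] by (simp add: \<beta>_def add.commute)
   also have "\<dots> = (LBINT x. ker (1/2) (0 - x :: real) *R (1::real))"
    using lborel_integral_real_affine[of "-1" "%x. ker (1/2) x" 0] by simp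
   also have "\<dots> = moll (1/2) (%x. 1::real) (0::real)" by (rule moll_eq[symmetric]) auto
   finally show ?thesis by (simp add: moll_def integral_eta)
  qed
  define th' where "th' t = kp t + (- I) * \<beta> t" for t
  have Ckth': "Ck k UNIV th'" for k unfolding th'_def[abs_def] by (intro Ck_add Ck_cmult Ckkp Ck\<beta>)
  have cth': "CU th'" using Ck_continuous[OF Ckth'[of 0]] .
  have ith': "IL th'" unfolding th'_def[abs_def] by (intro LB_iadd integrable_mult_right ikp i\<beta>)
  have intth': "(LBINT t. th' t) = 0"
   unfolding th'_def using ikp i\<beta> int\<beta> by (simp add: I_def)
  have th'low: "th' t = 0" if "t < - 2" for t using that K0[of t] \<beta>s[of t] by (simp add: th'_def)
  \<comment> \<open>A time strictly before T after which \<open>kp\<close> vanishes, so that the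
    primitive has compact support in the half-line below T. The support of \<open>kp\<close> may be
    empty, hence the case split.\<close>
  obtain bb where bb: "bb < T" "bb > 0" "!!x. x \<in> K ==> x <= bb"
  proof (cases "K = {}")
   case True then show ?thesis using that[of "T / 2"] T by auto
  next
   case False
   from compact_attains_sup[OF K(1) this] obtain s where "s \<in> K" "\<forall>x\<in>K. x <= s" by blast
   then show ?thesis using that[of s] K(2) by auto
  qed
  have th'high: "th' t = 0" if "t > bb" for t using that K(3)[of t] bb \<beta>s[of t] by (force simp: th'_def)
  obtain th where th: "!!t. (th has_real_derivative th' t) (at t)" "!!s t. s <= t ==> th t - th s = (LBINT x. indicator {s..t} x *R th' x)" "!!t. t <= -2 ==> th t = 0"
   using continuous_antiderivative[OF cth' th'low] by blast
  have thhigh: "th t = 0" if "t >= bb" for t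
  proof -
   have "th t - th (- 3) = (LBINT x. indicator {-3..t} x *R th' x)" using that bb by (intro th(2)) auto
   also have "\<dots> = (LBINT x. th' x)"
   proof (rule LB_cong[OF refl])
    fix x
    show "indicator {-3..t} x *R th' x = th' x"
     using th'low[of x] th'high[of x] that by (cases "x < -2"; cases "x > bb") (auto simp: indicator_def)
   qed
   finally show ?thesis using intth' th(3)[of "-3"] by simp
  qed
  have cth: "CU th" using th(1) by (auto intro!: DERIV_continuous continuous_at_imp_continuous_on)
  have dd: "dirderiv 1 th th'"
   unfolding dirderiv_def
  proof
   fix t
   have "((%s. th (s + t)) has_real_derivative th' t) (at 0)" using DERIV_shift[of th "th' t" 0 t] th(1)[of t] by simp
   then show "((%s. th (t + s *R 1)) has_vector_derivative th' t) (at 0)"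
    by (simp add: has_real_derivative_iff_has_vector_derivative add.commute)
  qed
  have Ckth: "Ck k UNIV th" for k
  proof (cases k)
   case 0 then show ?thesis using cth by simp
  next
   case (Suc m)
   show ?thesis unfolding Suc by (rule Ck_SucI[where g="%_. th'"]) (use cth dd Ckth' in auto)
  qed
  have Ccth: "Cc_inf {..<T} th"
   unfolding Cc_inf_def Cinf_on_def
  proof (intro conjI exI[of _ "{-2..bb}"] ballI allI impI)
   show "th x = 0" if "x \<notin> {-2..bb}" for x using that th(3)[of x] thhigh[of x] by force
  qed (use Ckth bb in auto)
  have w: "- (LBINT t. indicator {0<..<T} t * (q t * th' t)) + (LBINT t. b t * th t) = q0 * th 0"
   by (rule weak[OF Ccth th(1) cth'])
  have th'kp: "th' t = kp t" if "t > 0" for t using \<beta>s[of t] that by (simp add: th'_def)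
  have w1: "(LBINT t. indicator {0<..<T} t * (q t * th' t)) = (LBINT t. indicator {0..T} t * (q t * kp t))"
   by (rule LB_cong) (use th'kp K0 in \<open>auto simp: indicator_def\<close>)
  have tht: "th t = - (LBINT s. (if t <= s & s <= T then kp s else 0))" if "t >= 0" "t <= T" for t
  proof -
   have "th T - th t = (LBINT x. indicator {t..T} x *R th' x)" by (rule th(2)[OF that(2)])
   also have "\<dots> = (LBINT s. (if t <= s & s <= T then kp s else 0))"
   proof (rule integral_cong_AE)
    show "AL x. indicator {t..T} x *R th' x = (if t <= x & x <= T then kp x else 0)"
     using AE_lborel_singleton[of 0] by eventually_elim (use that th'kp in \<open>auto simp: indicator_def\<close>)
    have [measurable]: "th' \<in> BM" using cth' by (rule borel_measurable_continuous_onI)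
    show "(%x. indicator {t..T} x *R th' x) \<in> borel_measurable lborel" by measurable
   qed measurable
   finally show ?thesis using thhigh[of T] bb by simp
  qed
  have w2: "th 0 = - I"
  proof -
   have "(LBINT s. (if 0 <= s & s <= T then kp s else 0)) = I"
    unfolding I_def by (rule LB_cong) (use K0 in auto)
   then show ?thesis using tht[of 0] T by simp
  qed
  \<comment> \<open>Integration by parts in disguise: th is minus the integral of \<open>kp\<close>
    from t onwards, and exchanging the order of integration moves the primitive from
    \<open>kp\<close> to b.\<close>
  have "(LBINT t. b t * th t) = (LBINT t. - (LBINT s. (if t <= s then b t * kp s else 0)))"
  proof (rule LB_cong[OF refl])
   fix t
   show "b t * th t = - (LBINT s. (if t <= s then b t * kp s else 0))"
   proof (cases "t \<in> {0<..<T}")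
    case True
    have "(LBINT s. (if t <= s then b t * kp s else 0)) = (LBINT s. b t * (if t <= s & s <= T then kp s else 0))"
     by (rule LB_cong) (use K0 in auto)
    then show ?thesis using tht[of t] True by simp
   qed (use b0 in \<open>simp cong: if_cong\<close>)
  qed
  also have "\<dots> = - (LBINT t. LBINT s. (if t <= s then b t * kp s else 0))" by simp
  also have "(LBINT t. LBINT s. (if t <= s then b t * kp s else 0)) = (LBINT s. LBINT t. (if t <= s then b t * kp s else 0))"
  proof (rule lborel_pair.Fubini_integral[symmetric])
   have i: "integrable (lborel \<Otimes>\<^sub>M lborel) (%(t, s). b t * kp s)"
    by (rule lborel_pair.Fubini_integrable) (use ib ikp in \<open>auto simp: abs_mult\<close>)
   show "integrable (lborel \<Otimes>\<^sub>M lborel) (%(t, s). if t <= s then b t * kp s else 0)"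
    by (rule LB_bound[OF i]) auto
  qed
  also have "\<dots> = (LBINT s. kp s * P s)"
  proof (rule LB_cong[OF refl])
   fix s
   have "(LBINT t. (if t <= s then b t * kp s else 0)) = (LBINT t. kp s * (if t <= s then b t else 0))"
    by (rule LB_cong) auto
   then show "(LBINT t. (if t <= s then b t * kp s else 0)) = kp s * P s" by (simp add: P_b)
  qed
  finally have w3: "(LBINT t. b t * th t) = - (LBINT s. kp s * P s)" .
  have iq: "IL (%t. indicator {0..T} t * (q t * kp t))"
   using borel_integrable_compact[OF compact_Icc, of 0 T "%t. q t * kp t"] cq continuous_on_subset[OF ckp] by (auto intro!: continuous_intros)
  have iP: "IL (%t. indicator {0..T} t * (P t * kp t))"
   using borel_integrable_compact[OF compact_Icc, of 0 T "%t. P t * kp t"] cP continuous_on_subset[OF ckp] by (auto intro!: continuous_intros)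
  have "(LBINT t. kp t * v t) = (LBINT t. indicator {0..T} t * (q t * kp t) + indicator {0..T} t * (P t * kp t) - q0 * kp t)"
   by (rule LB_cong) (use K0' in \<open>auto simp: v_def indicator_def algebra_simps\<close>)
  also have "\<dots> = (LBINT t. indicator {0..T} t * (q t * kp t)) + (LBINT t. indicator {0..T} t * (P t * kp t)) - q0 * I"
   using iq iP ikp by (simp add: I_def)
  also have "(LBINT t. indicator {0..T} t * (P t * kp t)) = (LBINT s. kp s * P s)"
   by (rule LB_cong) (use K0' in \<open>auto simp: indicator_def\<close>)
  finally show "(LBINT t. kp t * v t) = 0" using w w1 w2 w3 by simp
 qed
 then have ae: "AE t in lebesgue. t \<in> {0<..<T} --> v t = 0" by (rule AE_completion)
 \<comment> \<open>Clamping the time to [0,T] makes a function that is continuous on the whole line;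
   vanishing almost everywhere on (0,T), it vanishes at every point of [0,T], the end points
   included.\<close>
 define h where "h t = q (max 0 (min T t)) + P (max 0 (min T t)) - q0" for t
 have "CU h"
  unfolding h_def using T by (intro continuous_on_compose2[OF cv, of UNIV "%t. max 0 (min T t)"] continuous_intros) auto
 then have cl: "closed {t. h t = 0}" by (intro closed_Collect_eq) auto
 have "{0<..<T} \<subseteq> {t. h t = 0}"
 proof
  fix x assume x: "x \<in> {0<..<T}"
  have "AE t\<in>{0<..<T} in lebesgue. t \<in> {t. h t = 0}"
   using ae by eventually_elim (auto simp: v_def h_def min_def max_def)
  from mem_closed_if_AE_lebesgue_open[OF _ cl this x] show "x \<in> {t. h t = 0}" by simp
 qed
 from closure_minimal[OF this cl] T have "{0..T} \<subseteq> {t. h t = 0}" by simp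
 then have "h t = 0" using t by auto
 then have "q t + P t - q0 = 0" using t by (simp add: h_def min_def max_def split: if_splits)
 then show ?thesis by (simp add: P_def)
qed

lemma nn_integral_slices:
 fixes f :: "'a::euclidean_space \<times> 'b::euclidean_space => ennreal"
 assumes f: "f \<in> BM"
 shows "(NNL z. f z) = (NNL t. NNL x. f (t, x))"
  and "(%t. NNL x. f (t, x)) \<in> BM"
  and "(NNL z. f z) < \<infinity> ==> AL t. (NNL x. f (t, x)) < \<infinity>"
proof -
 have [measurable]: "f \<in> BM2" using f by (simp add: borel_prod)
 show e: "(NNL z. f z) = (NNL t. NNL x. f (t, x))"
  by (subst lborel_prod[symmetric], subst lborel.nn_integral_fst[symmetric]) auto
 show m: "(%t. NNL x. f (t, x)) \<in> BM" by measurable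
 show "AL t. (NNL x. f (t, x)) < \<infinity>" if "(NNL z. f z) < \<infinity>"
  using nn_integral_PInf_AE[of "%t. NNL x. f (t, x)" lborel] m that unfolding e by (auto simp: less_top)
qed

lemma integral_slices:
 fixes f :: "'a::euclidean_space \<times> 'b::euclidean_space => 'c::euclidean_space"
 assumes f: "IL f"
 shows "(LBINT z. f z) = (LBINT t. LBINT x. f (t, x))"
  and "IL (%t. LBINT x. f (t, x))"
  and "AL t. IL (%x. f (t, x))"
proof -
 have i: "integrable (lborel \<Otimes>\<^sub>M lborel) f" using f by (simp add: lborel_prod)
 show "(LBINT z. f z) = (LBINT t. LBINT x. f (t, x))"
  using lborel_pair.integral_fst'[OF i] by (simp add: lborel_prod)
 show "IL (%t. LBINT x. f (t, x))" by (rule lborel_pair.integrable_fst'[OF i])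
 show "AL t. IL (%x. f (t, x))" by (rule lborel_pair.AE_integrable_fst'[OF i])
qed

lemma integrable_Lp_bounded_support:
 fixes f :: "'a::euclidean_space => 'b::euclidean_space"
 assumes [measurable]: "f \<in> BM" "A \<in> sets borel" and A: "emeasure lborel A < \<infinity>" and p: "p >= 1"
  and f0: "!!x. x \<notin> A ==> f x = 0" and fin: "(NNL x. ennreal (norm (f x) powr p)) < \<infinity>"
 shows "IL f"
 unfolding integrable_iff_bounded
proof
 have "norm (f x) <= indicator A x + norm (f x) powr p" for x
 proof (cases "norm (f x) <= 1")
  case True
  have "norm (f x) <= indicator A x" using f0[of x] True by (auto simp: indicator_def)
  then show ?thesis using powr_ge_zero[of "norm (f x)" p] by linarith
 next
  case False
  then have "norm (f x) powr 1 <= norm (f x) powr p" using p by (intro powr_mono) auto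
  then show ?thesis using False by (simp add: indicator_def)
 qed
 then have "(NNL x. ennreal (norm (f x))) <= (NNL x. indicator A x + ennreal (norm (f x) powr p))"
  by (intro nn_integral_mono) (auto simp: ennreal_plus[symmetric] ennreal_indicator[symmetric] simp del: ennreal_plus intro!: ennreal_leI)
 also have "\<dots> = emeasure lborel A + (NNL x. ennreal (norm (f x) powr p))" by (subst nn_integral_add) auto
 also have "\<dots> < \<infinity>" using A fin by (simp add: less_top)
 finally show "(NNL x. ennreal (norm (f x))) < \<infinity>" .
qed measurable

text \<open>All that the abstract energy equality needs from one term of the density: measurability,
  integrability on the diagonal, L^1 continuity in the offset, and, for almost every frozen time s,
  the passage from smooth test functions to the slice b (s, -). The coefficient is taken in L^p' in
  time with values in the dual of L^q, the slice family in L^p(L^q).\<close>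

lemma pairing_package:
 fixes al b :: "real \<times> vec3 => 'b::euclidean_space"
 assumes w: "p' > 1" "p > 1" "1 / p' + 1 / p = 1" and q: "q > 0" and \<Omega>: "bounded \<Omega>" "\<Omega> \<in> sets borel"
  and ma: "al \<in> BM" and mb: "b \<in> BM" and [measurable]: "ah \<in> BM"
  and nn: "!!t. ah t >= 0" and ah0: "!!t. t \<notin> {0<..<T} ==> ah t = 0"
  and a0: "!!z. z \<notin> {0<..<T} \<times> \<Omega> ==> al z = 0" and b0: "!!z. z \<notin> {0<..<T} \<times> \<Omega> ==> b z = 0"
  and d: "AL t. dual_bd q (ah t) (%x. norm (al (t, x)))"
  and ia: "(NNL t. ennreal (ah t powr p')) < \<infinity>"
  and ib: "(NNL t. enn_pow (NNL x. ennreal (norm (b (t, x)) powr q)) (p / q)) < \<infinity>"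
 defines "K \<equiv> %z. LBINT x. al (fst z, x) <.> b (snd z, x)"
 shows "K \<in> BM" (is ?m)
  and "IL (%z. al z <.> b z)" (is ?i)
  and "e > 0 ==> \<exists>h>0. \<forall>dl. \<bar>dl\<bar> <= h --> (NNL sg. ennreal \<bar>K (sg, sg + dl) - K (sg, sg)\<bar>) <= ennreal e"
  and "AL s. IL (%sg. K (sg, s)) & (\<forall>t1 t2 W. (\<forall>n. W n \<in> BM) -->
   (%n. NNL x. indicator \<Omega> x * ennreal (norm (W n x - b (s, x)) powr q)) ~> 0 -->
   (%n. LBINT z. (if t1 <= fst z & fst z <= t2 then al z else 0) <.> W n (snd z))
    ~> (LBINT sg. (if t1 <= sg & sg <= t2 then K (sg, s) else 0)))" (is ?l)
proof -
 note [measurable] = ma mb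
 have [measurable]: "al \<in> BM2" "b \<in> BM2" "\<Omega> \<in> sets borel"
  using ma mb \<Omega> by (auto simp: borel_prod)
 have "K \<in> BM2" unfolding K_def by measurable
 then show ?m by (simp add: borel_prod)
 define Bq where "Bq t = (NNL x. ennreal (norm (b (t, x)) powr q))" for t
 have [measurable]: "Bq \<in> BM" unfolding Bq_def by measurable
 have Bfin: "AL t. Bq (t + dl) < \<infinity>" for dl
 proof -
  have "(NNL t. enn_pow (Bq (dl + 1 * t)) (p / q)) = (NNL t. enn_pow (Bq t) (p / q))"
   using nn_integral_real_affine[of "%t. enn_pow (Bq t) (p / q)" 1 dl] by simp
  then have "(NNL t. enn_pow (Bq (t + dl)) (p / q)) ~= \<infinity>" using ib by (simp add: Bq_def add.commute)
  then have "AL t. enn_pow (Bq (t + dl)) (p / q) ~= \<infinity>" by (intro nn_integral_PInf_AE) auto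
  then show ?thesis by eventually_elim (auto simp: enn_pow_def less_top split: if_splits)
 qed
 have iah: "(NNL t. ennreal (ah t)) < \<infinity>"
 proof -
  have "IL ah"
   by (rule integrable_Lp_bounded_support[where A="{0<..<T}" and p=p']) (use w nn ah0 ia in \<open>auto intro: emeasure_bounded_finite[simplified]\<close>)
  then show ?thesis using nn by (simp add: integrable_iff_bounded)
 qed
 have alx: "al (t, x) = 0" if "x \<notin> \<Omega>" for t x using a0 that by simp
 have bb: "AL t. (NNL x. ennreal (norm (al (t, x) <.> b (t, x)))) <= ennreal (ah t powr p') + enn_pow (Bq t) (p / q)"
  using d Bfin[of 0]
 proof eventually_elim
  case (elim t)
  define B where "B = enn2real (Bq t)"
  have B: "Bq t = ennreal B" "B >= 0" using elim by (auto simp: B_def)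
  have "(NNL x. ennreal (norm (al (t, x) <.> b (t, x)))) <= (NNL x. ennreal (norm (al (t, x)) * norm (b (t, x))))"
   using Cauchy_Schwarz_ineq2 by (intro nn_integral_mono ennreal_leI) auto
  also have "\<dots> <= ennreal (ah t * B powr (1 / q))"
  proof (rule dual_bd_nonneg_finite[OF elim(1) q _ _ _ B(2)])
   show "(NNL x. ennreal (norm (b (t, x)) powr q)) <= ennreal B" using B(1) by (simp only: Bq_def)
  qed auto
  also have "\<dots> <= ennreal (ah t powr p' + B powr (p / q))"
   using Young_weighted[OF w zero_less_one nn, of "B powr (1 / q)" t] by (intro ennreal_leI) (simp add: powr_powr)
  also have "\<dots> = ennreal (ah t powr p') + enn_pow (Bq t) (p / q)" using B(2) unfolding B(1) by (simp add: enn_pow_def)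
  finally show ?case .
 qed
 show ?i unfolding integrable_iff_bounded
 proof
  have "(NNL z. ennreal (norm (al z <.> b z))) = (NNL t. NNL x. ennreal (norm (al (t, x) <.> b (t, x))))"
   by (rule nn_integral_slices) measurable
  also have "\<dots> <= (NNL t. ennreal (ah t powr p') + enn_pow (Bq t) (p / q))" by (rule nn_integral_mono_AE[OF bb])
  also have "\<dots> = (NNL t. ennreal (ah t powr p')) + (NNL t. enn_pow (Bq t) (p / q))" by (rule nn_integral_add) auto
  also have "\<dots> < \<infinity>" using ia ib by (simp add: Bq_def less_top)
  finally show "(NNL z. ennreal (norm (al z <.> b z))) < \<infinity>" .
 qed measurable
 show "\<exists>h>0. \<forall>dl. \<bar>dl\<bar> <= h --> (NNL sg. ennreal \<bar>K (sg, sg + dl) - K (sg, sg)\<bar>) <= ennreal e" if e: "e > 0"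
 proof -
  obtain h where h: "h > 0" "!!dl. \<bar>dl\<bar> <= h ==>
   (NNL t. NNL x. ennreal (norm (al (t, x)) * norm (b (t + dl, x) - b (t, x)))) <= ennreal e"
   by (rule time_translation_continuity[OF w q \<Omega> _ mb, where a="%z. norm (al z)" and al=ah and T=T and e=e])
    (use nn a0 b0 d ia ib e in auto)
  have "(NNL sg. ennreal \<bar>K (sg, sg + dl) - K (sg, sg)\<bar>) <= ennreal e" if "\<bar>dl\<bar> <= h" for dl
  proof (rule order_trans[OF nn_integral_mono_AE h(2)[OF that]])
   show "AL t. ennreal \<bar>K (t, t + dl) - K (t, t)\<bar> <= (NNL x. ennreal (norm (al (t, x)) * norm (b (t + dl, x) - b (t, x))))"
    using d Bfin[of 0] Bfin[of dl]
   proof eventually_elim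
    case (elim t)
    have i: "IL (%x. al (t, x) <.> b (s, x))" if "Bq s < \<infinity>" for s
     by (rule pairing_space_limit(1)[where \<Omega>=\<Omega> and q=q and A="ah t" and W="%n x. 0"]) (use q alx elim nn that in \<open>auto simp: Bq_def\<close>)
    have i1: "IL (%x. al (t, x) <.> b (t, x))" and i2: "IL (%x. al (t, x) <.> b (t + dl, x))"
     using elim i by auto
    have "K (t, t + dl) - K (t, t) = (LBINT x. al (t, x) <.> b (t + dl, x) - al (t, x) <.> b (t, x))"
     using i1 i2 by (simp add: K_def)
    also have "ennreal (norm \<dots>) <= (NNL x. ennreal (norm (al (t, x) <.> b (t + dl, x) - al (t, x) <.> b (t, x))))"
     by (rule integral_norm_bound_ennreal) (intro Bochner_Integration.integrable_diff i1 i2)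
    also have "\<dots> <= (NNL x. ennreal (norm (al (t, x)) * norm (b (t + dl, x) - b (t, x))))"
     unfolding inner_diff_right[symmetric] using Cauchy_Schwarz_ineq2 by (intro nn_integral_mono ennreal_leI) auto
    finally show ?case by simp
   qed
  qed
  then show ?thesis using h(1) by blast
 qed
 show ?l using Bfin[of 0]
 proof eventually_elim
  case (elim s)
  \<comment> \<open>Restricting the coefficient to the times in [t1,t2] can only decrease its
    modulus, so the dual bounds carry over.\<close>
  define gm where "gm t1 t2 z = (if t1 <= fst z & fst z <= t2 then al z else 0)" for t1 t2 :: real and z :: "real \<times> vec3"
  have "gm t1 t2 \<in> BM2" for t1 t2 unfolding gm_def by measurable
  then have mgm: "gm t1 t2 \<in> BM" for t1 t2 by (simp add: borel_prod)
  have dgm: "AL t. dual_bd q (ah t) (%x. norm (gm t1 t2 (t, x)))" for t1 t2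
   using d by eventually_elim (erule dual_bd_mono, simp add: gm_def)
  have mbs: "(%x. b (s, x)) \<in> BM" by measurable
  have fin: "(NNL x. ennreal (norm (b (s, x)) powr q)) < \<infinity>" using elim by (simp add: Bq_def)
  have i1: "IL (%z. al z <.> b (s, snd z))"
   by (rule pairing_time_limit(1)[OF q \<Omega>(2) ma mbs mbs, where ah=ah]) (use nn alx d iah fin in auto)
  have Ki: "IL (%sg. K (sg, s))" using integral_slices(2)[OF i1] by (simp add: K_def)
  have "(%n. LBINT z. gm t1 t2 z <.> W n (snd z)) ~> (LBINT sg. (if t1 <= sg & sg <= t2 then K (sg, s) else 0))"
   if W: "!!n. W n \<in> BM" "(%n. NNL x. indicator \<Omega> x * ennreal (norm (W n x - b (s, x)) powr q)) ~> 0"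
   for t1 t2 W
  proof -
   have gm0: "gm t1 t2 (t, x) = 0" if "x \<notin> \<Omega>" for t x using alx that by (simp add: gm_def)
   have i2: "IL (%z. gm t1 t2 z <.> b (s, snd z))"
    by (rule pairing_time_limit(1)[OF q \<Omega>(2) mgm mbs mbs _ nn gm0 dgm iah fin]) auto
   have "(LBINT z. gm t1 t2 z <.> b (s, snd z)) = (LBINT sg. (if t1 <= sg & sg <= t2 then K (sg, s) else 0))"
    unfolding integral_slices(1)[OF i2] by (rule LB_cong) (auto simp: gm_def K_def)
   moreover have "(%n. LBINT z. gm t1 t2 z <.> W n (snd z)) ~> (LBINT z. gm t1 t2 z <.> b (s, snd z))"
    by (rule pairing_time_limit(2)[OF q \<Omega>(2) mgm mbs W(1) _ nn gm0 dgm iah fin W(2)]) auto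
   ultimately show ?thesis by simp
  qed
  then show ?case using Ki by (auto simp: gm_def)
 qed
qed

text \<open>Plain conjugate exponents in space-time are the case q = p of the mixed setting, with
  the L^p' norm of a slice as its dual bound.\<close>

lemma Lp_pair_bounds:
 fixes al :: "real \<times> vec3 => 'b::euclidean_space" and b :: "real \<times> vec3 => 'c::euclidean_space"
 assumes w: "p' > 1" "p > 1" "1 / p' + 1 / p = 1" and m: "al \<in> BM" "b \<in> BM"
  and a0: "!!z. z \<notin> {0<..<T} \<times> \<Omega> ==> al z = 0"
  and ia: "(NNL z. ennreal (norm (al z) powr p')) < \<infinity>" and ib: "(NNL z. ennreal (norm (b z) powr p)) < \<infinity>"
 defines "ah \<equiv> %t. enn2real (NNL x. ennreal (norm (al (t, x)) powr p')) powr (1 / p')"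
 shows "ah \<in> BM" "!!t. ah t >= 0" "!!t. t \<notin> {0<..<T} ==> ah t = 0"
  "AL t. dual_bd p (ah t) (%x. norm (al (t, x)))"
  "(NNL t. ennreal (ah t powr p')) < \<infinity>"
  "(NNL t. enn_pow (NNL x. ennreal (norm (b (t, x)) powr p)) (p / p)) < \<infinity>"
proof -
 note [measurable] = m
 have [measurable]: "al \<in> BM2" "b \<in> BM2" using m by (auto simp: borel_prod)
 show "ah \<in> BM" unfolding ah_def by measurable
 show "ah t >= 0" for t by (simp add: ah_def)
 show "ah t = 0" if "t \<notin> {0<..<T}" for t
 proof -
  have "al (t, x) = 0" for x using a0 that by auto
  then show ?thesis using w by (simp add: ah_def)
 qed
 have f: "AL t. (NNL x. ennreal (norm (al (t, x)) powr p')) < \<infinity>"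
  using nn_integral_slices(3)[OF _ ia] by simp
 then show "AL t. dual_bd p (ah t) (%x. norm (al (t, x)))"
  by eventually_elim (unfold ah_def, rule dual_bd_Lp[OF w], auto)
 have "(NNL t. ennreal (ah t powr p')) <= (NNL t. NNL x. ennreal (norm (al (t, x)) powr p'))"
  using f by (intro nn_integral_mono_AE, eventually_elim) (use w in \<open>simp add: ah_def powr_powr\<close>)
 also have "\<dots> = (NNL z. ennreal (norm (al z) powr p'))" by (rule nn_integral_slices(1)[symmetric]) simp
 finally show "(NNL t. ennreal (ah t powr p')) < \<infinity>" using ia by simp
 have "(NNL t. enn_pow (NNL x. ennreal (norm (b (t, x)) powr p)) (p / p)) <= (NNL t. NNL x. ennreal (norm (b (t, x)) powr p))"
  by (intro nn_integral_mono) (use w in \<open>auto simp: enn_pow_def less_top\<close>)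
 also have "\<dots> = (NNL z. ennreal (norm (b z) powr p))" by (rule nn_integral_slices(1)[symmetric]) simp
 finally show "(NNL t. enn_pow (NNL x. ennreal (norm (b (t, x)) powr p)) (p / p)) < \<infinity>" using ib by simp
qed

lemma vec_L2_tendsto_0:
 fixes D :: "nat => 3 => vec3 => 'b::euclidean_space" and G :: "vec3 => 'b^3"
 assumes [measurable]: "A \<in> sets borel" "!!n k. D n k \<in> BM" "G \<in> BM"
  and l: "!!k. (%n. NNL x. indicator A x * nsq (D n k x - G x $ k)) ~> 0"
 shows "(%n. NNL x. indicator A x * ennreal (norm ((\<chi> k. D n k x) - G x) powr 2)) ~> 0"
proof -
 have e: "ennreal (norm v powr 2) = (\<Sum>k\<in>UNIV. nsq (v $ k))" for v :: "'b^3"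
  by (simp add: norm_vec_def L2_set_def sum_nonneg)
 have "(NNL x. indicator A x * ennreal (norm ((\<chi> k. D n k x) - G x) powr 2))
  = (\<Sum>k\<in>UNIV. NNL x. indicator A x * nsq (D n k x - G x $ k))" for n
  unfolding e sum_distrib_left by (subst nn_integral_sum) auto
 moreover have "(%n. \<Sum>k\<in>(UNIV::3 set). NNL x. indicator A x * nsq (D n k x - G x $ k)) ~> (\<Sum>k\<in>(UNIV::3 set). 0)"
  by (intro tendsto_sum l)
 ultimately show ?thesis by simp
qed

section \<open>The equation for C in Borel form and its energy identity\<close>

lemma integrable_inner_bounded:
 fixes f g :: "'z => 'b::euclidean_space"
 assumes f: "integrable M f" and [measurable]: "g \<in> borel_measurable M" and B: "!!z. f z ~= 0 ==> norm (g z) <= B"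
 shows "integrable M (%z. f z <.> g z)"
proof (rule LB_bound[where f="%z. B * norm (f z)"])
 show "integrable M (%z. B * norm (f z))" using f by simp
 have [measurable]: "f \<in> borel_measurable M" using f by auto
 show "(%z. f z <.> g z) \<in> borel_measurable M" by measurable
 have "norm (f z <.> g z) <= norm (B * norm (f z))" for z
 proof (cases "f z = 0")
  case False
  have "\<bar>f z <.> g z\<bar> <= norm (f z) * norm (g z)" by (rule Cauchy_Schwarz_ineq2)
  also have "\<dots> <= norm (f z) * B" by (rule mult_left_mono[OF B[OF False]]) simp
  finally have "\<bar>f z <.> g z\<bar> <= norm (f z) * B" .
  moreover have "0 <= B" using B[OF False] norm_ge_zero[of "g z"] by linarith
  ultimately show ?thesis by (simp add: mult.commute)
 qed simp
 then show "AE z in M. norm (f z <.> g z) <= norm (B * norm (f z))" by simp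
qed

text \<open>The function w may grow at infinity; what counts is its bound over the bounded set that
  carries \<open>al\<close>.\<close>

lemma integrable_inner_continuous:
 fixes al :: "real \<times> vec3 => 'b::euclidean_space"
 assumes \<Omega>: "bounded \<Omega>" and ia: "IL al" and z: "!!t x. x \<notin> \<Omega> ==> al (t, x) = 0" and w: "CU w"
 shows "IL (%z. al z <.> w (snd z))"
proof -
 obtain R where R: "!!x. x \<in> \<Omega> ==> norm x <= R" using \<Omega> unfolding bounded_iff by blast
 obtain M where M: "!!x. norm x <= R ==> norm (w x) <= M" using continuous_bounded_cball[OF w] by blast
 show ?thesis
 proof (rule integrable_inner_bounded[OF ia, where B=M])
  have "CU (%z::real \<times> vec3. w (snd z))" by (intro continuous_on_compose2[OF w] continuous_intros) auto
  then show "(%z::real \<times> vec3. w (snd z)) \<in> borel_measurable lborel" by (simp add: borel_measurable_continuous_onI)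
  show "norm (w (snd z)) <= M" if "al z ~= 0" for z using that z[of "snd z" "fst z"] R M by force
 qed
qed

text \<open>All space-time fields are Borel and vanish off the cylinder, so Fubini can be used on
  the whole space without cut-offs. F gathers every term except transport and diffusion,
  \<open>ls\<close> is the Serrin condition, and \<open>cw\<close> is the weakly continuous
  representative of C, which has a value at each single time.\<close>

locale regular_data =
 fixes \<beta> :: real and \<Omega> :: "vec3 set" and T \<epsilon> s r A :: real and u :: "real \<times> vec3 => vec3" and Gu C F :: "real \<times> vec3 => mat3"
  and GC :: "real \<times> vec3 => mat3^3" and cw :: "real => vec3 => mat3"
 assumes dom: "C2beta_domain \<beta> \<Omega>" and T: "T > 0" and r: "r > 3" and s: "s > 2" and rs: "2 / s + 3 / r <= 1"
  and mu: "u \<in> BM" and mGu: "Gu \<in> BM" and mC: "C \<in> BM"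
  and mF: "F \<in> BM" and mGC: "GC \<in> BM"
  and u0: "!!z. z \<notin> {0<..<T} \<times> \<Omega> ==> u z = 0" and Gu0: "!!z. z \<notin> {0<..<T} \<times> \<Omega> ==> Gu z = 0"
  and C0: "!!z. z \<notin> {0<..<T} \<times> \<Omega> ==> C z = 0"
  and F0: "!!z. z \<notin> {0<..<T} \<times> \<Omega> ==> F z = 0" and GC0: "!!z. z \<notin> {0<..<T} \<times> \<Omega> ==> GC z = 0"
  and A: "A >= 0" "AL t. 0 < t & t < T --> (NNL x. nsq (u (t, x))) <= ennreal A"
  and u2: "(NNL z. nsq (u z)) < \<infinity>" and Gu2: "(NNL z. nsq (Gu z)) < \<infinity>"
  and GC2: "(NNL z. nsq (GC z)) < \<infinity>" and C4: "(NNL z. ennreal (norm (C z) powr 4)) < \<infinity>"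
  and F43: "(NNL z. ennreal (norm (F z) powr (4/3))) < \<infinity>"
  and ls: "(NNL t. enn_pow (NNL x. ennreal (norm (C (t, x)) powr r)) (s / r)) < \<infinity>"
  and ap: "AL t. 0 < t & t < T --> (\<exists>ph. H10_approx \<Omega> ph (%x. u (t, x)) (%x. Gu (t, x)))"
  and tr: "AL t. 0 < t & t < T --> (AL x. trace (Gu (t, x)) = 0)"
  and wg: "AL t. 0 < t & t < T --> weak_grad \<Omega> (%x. C (t, x)) (%x. GC (t, x))"
  and mcw: "!!t. 0 <= t ==> t <= T ==> cw t \<in> BM" and cw0: "!!t x. x \<notin> \<Omega> ==> cw t x = 0"
  and cw2: "!!t. 0 <= t ==> t <= T ==> (NNL x. nsq (cw t x)) < \<infinity>"
  and cwc: "!!g. g \<in> BM ==> (NNL x. nsq (g x)) < \<infinity> ==> continuous_on {0..T} (%t. LBINT x. cw t x <.> g x)"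
  and cwC: "AL t. 0 < t & t < T --> (AL x. cw t x = C (t, x))"
begin

lemma \<Omega>: "open \<Omega>" "bounded \<Omega>" "\<Omega> \<in> sets borel"
 using dom by (auto simp: C2beta_domain_def)

lemmas m[measurable] = mu mGu mC mF mGC \<Omega>(3)

lemma mp[measurable]: "u \<in> BM2" "Gu \<in> BM2" "C \<in> BM2"
 "F \<in> BM2" "GC \<in> BM2"
 using m by (auto simp: borel_prod)

definition tp :: "real \<times> vec3 => mat3" where
 "tp z = (\<Sum>k\<in>UNIV. u z $ k *R GC z $ k)"

lemma mtp[measurable]: "tp \<in> BM" "tp \<in> BM2"
 unfolding tp_def by measurable

lemma tp0: "z \<notin> {0<..<T} \<times> \<Omega> ==> tp z = 0"
 by (simp add: tp_def u0)

lemma finite_cylinder: "emeasure lborel ({0<..<T} \<times> \<Omega>) < \<infinity>" "{0<..<T} \<times> \<Omega> \<in> sets borel"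
proof -
 show "emeasure lborel ({0<..<T} \<times> \<Omega>) < \<infinity>" using \<Omega> by (intro emeasure_bounded_finite bounded_Times) auto
 show "{0<..<T} \<times> \<Omega> \<in> sets borel" using \<Omega> by (intro borel_open open_Times) auto
qed

lemma int_F: "IL F"
 by (rule integrable_Lp_bounded_support[where p="4/3" and A="{0<..<T} \<times> \<Omega>"]) (use finite_cylinder F0 F43 in auto)

lemma int_GC: "IL GC"
 by (rule integrable_Lp_bounded_support[where p=2 and A="{0<..<T} \<times> \<Omega>"]) (use finite_cylinder GC0 GC2 in auto)

lemma int_tp: "IL tp"
 unfolding integrable_iff_bounded
proof
 have "norm (tp z) <= (norm (u z))^2 + (norm (GC z))^2" for z
  using norm_transport_le[of "u z" "GC z"] sum_squares_bound[of "norm (u z)" "norm (GC z)"] mult_nonneg_nonneg[OF norm_ge_zero[of "u z"] norm_ge_zero[of "GC z"]]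
  unfolding tp_def mult.assoc by linarith
 then have "(NNL z. ennreal (norm (tp z))) <= (NNL z. nsq (u z) + nsq (GC z))"
  by (intro nn_integral_mono) (simp add: ennreal_plus[symmetric] ennreal_leI del: ennreal_plus)
 also have "\<dots> = (NNL z. nsq (u z)) + (NNL z. nsq (GC z))" by (rule nn_integral_add) auto
 also have "\<dots> < \<infinity>" using u2 GC2 by (simp add: less_top)
 finally show "(NNL z. ennreal (norm (tp z))) < \<infinity>" .
qed measurable

definition Et where "Et t = (NNL x. nsq (GC (t, x)))"
definition Dt where "Dt t = (NNL x. nsq (Gu (t, x)))"

text \<open>The bound of \<open>transport_dual_bd\<close> at time t, with the time-independent A in
  place of the squared L^2 norm of the velocity.\<close>

definition ah where
 "ah t = sqrt (enn2real (Et t)) * sqrt (A powr ((r - 3) / r) * (884736 * enn2real (Dt t) ^ 3) powr (1 / r))"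

lemma mEt[measurable]: "Et \<in> BM" "Dt \<in> BM"
 unfolding Et_def[abs_def] Dt_def[abs_def] by measurable

lemma mah[measurable]: "ah \<in> BM"
 unfolding ah_def[abs_def] by measurable

lemma ah_nonneg: "ah t >= 0"
 by (simp add: ah_def)

lemma ah0:
 assumes "t \<notin> {0<..<T}" shows "ah t = 0"
proof -
 have "GC (t, x) = 0" for x using assms GC0 by auto
 then show ?thesis by (simp add: ah_def Et_def)
qed

lemma slices_finite: "AL t. Et t < \<infinity> & Dt t < \<infinity>"
 using nn_integral_slices(3)[OF _ GC2] nn_integral_slices(3)[OF _ Gu2] by (simp add: Et_def Dt_def)

lemma dual_bd_tp: "AL t. dual_bd r (ah t) (%x. norm (tp (t, x)))"
 using slices_finite A(2) ap
proof eventually_elim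
 case (elim t)
 show ?case
 proof (cases "0 < t & t < T")
  case True
  then obtain ph where ph: "H10_approx \<Omega> ph (%x. u (t, x)) (%x. Gu (t, x))" using elim by blast
  have "dual_bd r (ah t) (%x. norm (u (t, x)) * norm (GC (t, x)))"
   unfolding ah_def by (rule transport_dual_bd[OF r _ _ _ ph A(1)]) (use elim True in \<open>auto simp: Et_def Dt_def\<close>)
  then show ?thesis by (rule dual_bd_mono) (simp add: tp_def norm_transport_le)
 next
  case False
  then have "tp (t, x) = 0" for x by (intro tp0) auto
  then show ?thesis using ah0[of t] False by (simp add: dual_bd_def)
 qed
qed

text \<open>The exponent conjugate to s.\<close>

definition ss where "ss = s / (s - 1)"

lemma ss: "ss > 1" "1 / ss + 1 / s = 1"
 using s by (simp_all add: ss_def field_simps)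

text \<open>The place where 2/s + 3/r <= 1 acts. With M = 1 + |grad C|^2 + |grad u|^2 (spatial
  integrals at time t), \<open>ah\<close> is at most a constant times M^(1/2 + 3/(2r)). The
  condition says that the \<open>ss\<close>-th power of this has exponent at most 1, and since M >=
  1 the exponent may be raised to 1.\<close>

lemma ah_power_bound:
 obtains c where "c >= 0" "!!t. ah t powr ss <= c * (1 + enn2real (Et t) + enn2real (Dt t))"
proof -
 define c1 where "c1 = A powr ((r - 3) / r) * 884736 powr (1 / r)"
 have c1: "c1 >= 0" by (simp add: c1_def)
 have ex: "(1 / 2 + 3 / (2 * r)) * ss <= 1"
 proof -
  have "(2 / s + 3 / r) * s <= 1 * s" by (rule mult_right_mono[OF rs]) (use s in simp)
  then have "2 + 3 / r * s <= s" using s by (simp add: distrib_right)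
  then have "(1 / 2 + 3 / (2 * r)) * s <= s - 1" by (simp add: distrib_right)
  then show ?thesis using s by (simp add: ss_def pos_divide_le_eq)
 qed
 have "ah t powr ss <= sqrt c1 powr ss * (1 + enn2real (Et t) + enn2real (Dt t))" for t
 proof -
  define M where "M = 1 + enn2real (Et t) + enn2real (Dt t)"
  have M: "M >= 1" "enn2real (Et t) <= M" "enn2real (Dt t) <= M" by (auto simp: M_def)
  have "(884736 * enn2real (Dt t) ^ 3) powr (1 / r) <= (884736 * M ^ 3) powr (1 / r)"
   using M r by (intro powr_mono2 mult_left_mono power_mono) auto
  also have "\<dots> = 884736 powr (1 / r) * M powr (3 / r)"
   using M by (simp add: powr_mult powr_powr flip: powr_numeral)
  finally have "A powr ((r - 3) / r) * (884736 * enn2real (Dt t) ^ 3) powr (1 / r) <= c1 * M powr (3 / r)"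
   by (simp add: c1_def mult.assoc mult_left_mono)
  then have "ah t <= sqrt M * sqrt (c1 * M powr (3 / r))"
   unfolding ah_def using M by (intro mult_mono[OF real_sqrt_le_mono[OF M(2)] real_sqrt_le_mono]) auto
  also have "\<dots> = sqrt c1 * (M powr (1/2) * (M powr (3 / r)) powr (1/2))"
   using M by (simp add: real_sqrt_mult powr_half_sqrt)
  also have "\<dots> = sqrt c1 * M powr (1 / 2 + 3 / (2 * r))" by (simp add: powr_powr powr_add mult.commute)
  finally have "ah t powr ss <= (sqrt c1 * M powr (1 / 2 + 3 / (2 * r))) powr ss"
   using ss ah_nonneg by (intro powr_mono2) auto
  also have "\<dots> = sqrt c1 powr ss * M powr ((1 / 2 + 3 / (2 * r)) * ss)" using c1 by (simp add: powr_mult powr_powr)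
  also have "M powr ((1 / 2 + 3 / (2 * r)) * ss) <= M powr 1" by (rule powr_mono[OF ex M(1)])
  finally show ?thesis using M c1 by (simp add: M_def mult_left_mono)
 qed
 then show ?thesis using that[of "sqrt c1 powr ss"] by simp
qed

lemma ah_fin: "(NNL t. ennreal (ah t powr ss)) < \<infinity>"
proof -
 obtain c where c: "c >= 0" "!!t. ah t powr ss <= c * (1 + enn2real (Et t) + enn2real (Dt t))" using ah_power_bound by blast
 have le: "ennreal (enn2real x) <= x" for x by (cases x) auto
 have "ennreal (ah t powr ss) <= ennreal c * (indicator {0<..<T} t + (Et t + Dt t))" for t
 proof (cases "t \<in> {0<..<T}")
  case True
  have "ennreal (ah t powr ss) <= ennreal c * (1 + (ennreal (enn2real (Et t)) + ennreal (enn2real (Dt t))))"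
   using c by (simp add: ennreal_leI add.assoc ennreal_plus[symmetric] ennreal_mult[symmetric] ennreal_1[symmetric] del: ennreal_plus ennreal_1)
  also have "\<dots> <= ennreal c * (1 + (Et t + Dt t))" by (intro mult_left_mono add_mono le order_refl) auto
  finally show ?thesis using True by simp
 qed (use ah0[of t] ss in simp)
 then have "(NNL t. ennreal (ah t powr ss)) <= (NNL t. ennreal c * (indicator {0<..<T} t + (Et t + Dt t)))"
  by (intro nn_integral_mono) auto
 also have "\<dots> = ennreal c * (emeasure lborel {0<..<T} + ((NNL t. Et t) + (NNL t. Dt t)))"
  by (subst nn_integral_cmult, measurable, subst nn_integral_add, measurable, subst nn_integral_add) auto
 also have "(NNL t. Et t) = (NNL z. nsq (GC z))" unfolding Et_def by (rule nn_integral_slices(1)[symmetric]) simp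
 also have "(NNL t. Dt t) = (NNL z. nsq (Gu z))" unfolding Dt_def by (rule nn_integral_slices(1)[symmetric]) simp
 also have "ennreal c * (emeasure lborel {0<..<T} + ((NNL z. nsq (GC z)) + (NNL z. nsq (Gu z)))) < \<infinity>"
  using GC2 Gu2 T by (auto simp: ennreal_mult_less_top less_top)
 finally show ?thesis .
qed

text \<open>The integrand of the equation tested with a function of x alone, all terms except the
  time derivative brought to the left-hand side.\<close>

definition bw where
 "bw w z = (tp z - F z) <.> w (snd z) + \<epsilon> * (\<Sum>k\<in>UNIV. GC z $ k <.> pdx k w (snd z))"

lemma int_bw:
 assumes w: "Cc_inf UNIV w"
 shows "IL (bw w)"
 unfolding bw_def[abs_def]
proof (intro LB_iadd integrable_mult_right LB_isum integrable_inner_continuous[OF \<Omega>(2)])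
 have W: "Cinf_on UNIV w" using w by (rule Cc_inf_Cinf)
 show "IL (%z. tp z - F z)" using int_tp int_F by auto
 show "CU w" by (rule Cinf_continuous[OF W])
 show "IL (%z. GC z $ k)" for k
  by (rule LB_bound[OF int_GC]) (auto simp: Finite_Cartesian_Product.norm_nth_le)
 show "CU (pdx k w)" for k by (rule Cinf_pdx(2)[OF W])
qed (auto simp: tp0 F0 GC0)

end

text \<open>Separated test functions th(t) w(x) are enough. The spatial factor ranges over functions
  on the whole space that need not vanish on the boundary of \<Omega>, which is how the Neumann
  condition is encoded; th may be nonzero at time 0, which brings in the initial value.\<close>

locale regular_solution = regular_data +
 assumes weak: "!!th th' w. Cc_inf {..<T} th ==> (!!t. (th has_real_derivative th' t) (at t)) ==> CU th' ==> Cc_inf UNIV w ==>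
   - (LBINT t. indicator {0<..<T} t * ((LBINT x. cw t x <.> w x) * th' t)) + (LBINT t. (LBINT x. bw w (t, x)) * th t)
   = (LBINT x. cw 0 x <.> w x) * th 0"
begin

lemma time_identity:
 assumes w: "Cc_inf UNIV w" and t: "0 <= t1" "t1 <= t2" "t2 <= T"
 shows "(LBINT x. (cw t2 x - cw t1 x) <.> w x) + (LBINT z. (if t1 <= fst z & fst z <= t2 then bw w z else 0)) = 0"
proof -
 define b where "b t = (LBINT x. bw w (t, x))" for t
 have ib: "IL b" unfolding b_def[abs_def] by (rule integral_slices(2)[OF int_bw[OF w]])
 have b0: "b t = 0" if "t \<notin> {0<..<T}" for t
 proof -
  have "tp (t, x) = 0" "F (t, x) = 0" "GC (t, x) = 0" for x using that tp0 F0 GC0 by auto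
  then show ?thesis by (simp add: b_def bw_def)
 qed
 have W: "Cinf_on UNIV w" using w by (rule Cc_inf_Cinf)
 obtain R where R: "!!x. norm x > R ==> w x = 0" using w by (rule Cc_infE) blast
 have cwn: "CU w" by (rule Cinf_continuous[OF W])
 have [measurable]: "w \<in> BM" by (rule measurable_Cinf[OF W])
 have w2: "(NNL x. nsq (w x)) < \<infinity>"
 proof -
  have "IL (%x. (norm (w x))^2)"
   by (rule continuous_compact_support_integrable[where R=R]) (use R cwn in \<open>auto intro!: continuous_intros\<close>)
  then show ?thesis by (simp add: integrable_iff_bounded)
 qed
 have q: "(LBINT x. cw t x <.> w x) = (LBINT x. cw 0 x <.> w x) - (LBINT s. (if 0 <= s & s <= t then b s else 0))" if "0 <= t" "t <= T" for t
 proof (rule weak_time_derivative[OF T _ ib b0 _ that])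
  show "continuous_on {0..T} (%t. LBINT x. cw t x <.> w x)" by (rule cwc[OF _ w2]) simp
  show "- (LBINT t. indicator {0<..<T} t * ((LBINT x. cw t x <.> w x) * th' t)) + (LBINT t. b t * th t) = (LBINT x. cw 0 x <.> w x) * th 0"
   if "Cc_inf {..<T} th" "!!t. (th has_real_derivative th' t) (at t)" "CU th'" for th th'
   using weak[OF that w] by (simp add: b_def)
 qed
 have icw: "IL (%x. cw t x <.> w x)" if "0 <= t" "t <= T" for t
  using L2_product_limit(1)[of "cw t" w "%n x. 0" "%n x. 0" "%x. 1" UNIV 1] mcw[OF that] cw2[OF that] w2 by simp
 have ii: "IL (%s. if p <= s & s <= q then b s else 0)" for p q
 proof (rule LB_bound[OF ib])
  have [measurable]: "b \<in> BM" using ib by auto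
  show "(%s. if p <= s & s <= q then b s else 0) \<in> borel_measurable lborel" by measurable
 qed auto
 have "(LBINT x. (cw t2 x - cw t1 x) <.> w x) = (LBINT x. cw t2 x <.> w x) - (LBINT x. cw t1 x <.> w x)"
  unfolding inner_diff_left using icw t by (intro Bochner_Integration.integral_diff) auto
 also have "\<dots> = - ((LBINT s. (if 0 <= s & s <= t2 then b s else 0)) - (LBINT s. (if 0 <= s & s <= t1 then b s else 0)))"
  using q[of t1] q[of t2] t by simp
 also have "(LBINT s. (if 0 <= s & s <= t2 then b s else 0)) - (LBINT s. (if 0 <= s & s <= t1 then b s else 0))
  = (LBINT s. (if 0 <= s & s <= t2 then b s else 0) - (if 0 <= s & s <= t1 then b s else 0))"
  by (rule Bochner_Integration.integral_diff[symmetric]) (rule ii)+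
 also have "\<dots> = (LBINT s. (if t1 <= s & s <= t2 then b s else 0))"
 proof (rule integral_cong_AE)
  show "AL s. (if 0 <= s & s <= t2 then b s else 0) - (if 0 <= s & s <= t1 then b s else 0) = (if t1 <= s & s <= t2 then b s else 0)"
   using AE_lborel_singleton[of t1] by eventually_elim (use t in auto)
 qed (use ii in auto)
 also have "\<dots> = (LBINT z. (if t1 <= fst z & fst z <= t2 then bw w z else 0))"
 proof -
  have [measurable]: "bw w \<in> BM" using int_bw[OF w] by auto
  then have [measurable]: "bw w \<in> BM2" by (simp add: borel_prod)
  have "(%z. if t1 <= fst z & fst z <= t2 then bw w z else 0) \<in> BM2" by measurable
  then have mm: "(%z. if t1 <= fst z & fst z <= t2 then bw w z else 0) \<in> borel_measurable lborel" by (simp add: borel_prod)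
  have "IL (%z. if t1 <= fst z & fst z <= t2 then bw w z else 0)"
   by (rule LB_bound[OF int_bw[OF w] mm]) auto
  from integral_slices(1)[OF this] show ?thesis
   by (auto simp: b_def intro!: LB_cong)
 qed
 finally show ?thesis by simp
qed

end

lemma integrable_mult_inner_L2:
 fixes f g :: "'a::euclidean_space => 'b::euclidean_space"
 assumes "f \<in> BM" "g \<in> BM"
  "(NNL x. nsq (f x)) < \<infinity>" "(NNL x. nsq (g x)) < \<infinity>"
 shows "IL (%x. f x <.> g x)"
 using L2_product_limit(1)[of f g "%n x. 0" "%n x. 0" "%x. 1" UNIV 1] assms by simp

context regular_solution
begin

abbreviation cyl where "cyl \<equiv> {0<..<T} \<times> \<Omega>"

definition K where
 "K z = (LBINT x. - tp (fst z, x) <.> C (snd z, x)) + (LBINT x. F (fst z, x) <.> C (snd z, x))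
  + (LBINT x. (- \<epsilon>) *R GC (fst z, x) <.> GC (snd z, x))"

lemma transport_hyps:
 "s > 1" "r > 0" "(%z. - tp z) \<in> BM" "!!z. z \<notin> cyl ==> - tp z = 0"
 "AL t. dual_bd r (ah t) (%x. norm (- tp (t, x)))"
 using s r dual_bd_tp tp0 by auto

text \<open>Each of the three terms has its own exponents (p', p, q): transport (s', s, r) here,
  stress (4/3, 4, 4) in \<open>fpk\<close> and diffusion (2, 2, 2) in \<open>gpk\<close>.\<close>

lemmas tpk = pairing_package[where T=T, OF ss(1) transport_hyps(1) ss(2) transport_hyps(2) \<Omega>(2,3) transport_hyps(3) mC mah ah_nonneg ah0
 transport_hyps(4) C0 transport_hyps(5) ah_fin ls, simplified implies_True_equals triv_forall_equality True_implies_equals not_False_eq_True]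

lemma four: "(4/3::real) > 1" "(4::real) > 1" "1 / (4/3) + 1 / 4 = (1::real)" "(4::real) > 0" by auto

lemmas Fb = Lp_pair_bounds[where T=T and \<Omega>=\<Omega>, OF four(1-3) mF mC F0 F43 C4, simplified implies_True_equals triv_forall_equality True_implies_equals not_False_eq_True]
lemmas fpk = pairing_package[where T=T, OF four \<Omega>(2,3) mF mC Fb(1) Fb(2) Fb(3) F0 C0 Fb(4) Fb(5) Fb(6), simplified implies_True_equals triv_forall_equality True_implies_equals not_False_eq_True]

lemma two: "(2::real) > 1" "1 / 2 + 1 / 2 = (1::real)" "(2::real) > 0" by auto

lemma grad_hyps: "(%z. (- \<epsilon>) *R GC z) \<in> BM" "!!z. z \<notin> cyl ==> (- \<epsilon>) *R GC z = 0"
 "(NNL z. ennreal (norm ((- \<epsilon>) *R GC z) powr 2)) < \<infinity>" "(NNL z. ennreal (norm (GC z) powr 2)) < \<infinity>"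
proof -
 show g: "(NNL z. ennreal (norm (GC z) powr 2)) < \<infinity>" using GC2 by simp
 have "(NNL z. ennreal (norm ((- \<epsilon>) *R GC z) powr 2)) = (NNL z. ennreal (\<epsilon>^2) * ennreal (norm (GC z) powr 2))"
  by (intro nn_integral_cong) (simp add: power_mult_distrib ennreal_mult)
 also have "\<dots> = ennreal (\<epsilon>^2) * (NNL z. ennreal (norm (GC z) powr 2))" by (rule nn_integral_cmult) simp
 finally show "(NNL z. ennreal (norm ((- \<epsilon>) *R GC z) powr 2)) < \<infinity>" using g by (simp add: ennreal_mult_less_top)
qed (auto simp: GC0)

lemmas Gb = Lp_pair_bounds[where T=T and \<Omega>=\<Omega>, OF two(1) two(1) two(2) grad_hyps(1) mGC grad_hyps(2) grad_hyps(3) grad_hyps(4), simplified implies_True_equals triv_forall_equality True_implies_equals not_False_eq_True]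
lemmas gpk = pairing_package[where T=T, OF two(1) two(1) two(2) two(3) \<Omega>(2,3) grad_hyps(1) mGC Gb(1) Gb(2) Gb(3) grad_hyps(2) GC0 Gb(4) Gb(5) Gb(6), simplified implies_True_equals triv_forall_equality True_implies_equals not_False_eq_True]

lemma measurable_K: "K \<in> BM"
 unfolding K_def[abs_def] by (intro borel_measurable_add tpk(1) fpk(1) gpk(1))

lemma C_slices: "AL \<tau>. (NNL x. ennreal (norm (C (\<tau>, x)) powr 4)) < \<infinity> & (NNL x. ennreal (norm (C (\<tau>, x)) powr r)) < \<infinity>"
proof -
 have a: "AL \<tau>. (NNL x. ennreal (norm (C (\<tau>, x)) powr 4)) < \<infinity>"
  by (rule nn_integral_slices(3)[OF _ C4]) measurable
 have "AL \<tau>. enn_pow (NNL x. ennreal (norm (C (\<tau>, x)) powr r)) (s / r) ~= \<infinity>"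
  by (intro nn_integral_PInf_AE) (use ls in auto)
 then show ?thesis using a by eventually_elim (auto simp: enn_pow_def less_top split: if_splits)
qed

lemma integrable_slice:
 assumes "(NNL x. ennreal (norm (C (\<tau>, x)) powr 4)) < \<infinity>"
 shows "IL (%x. C (\<tau>, x))"
 by (rule integrable_Lp_bounded_support[where A=\<Omega> and p=4]) (use assms \<Omega> C0 emeasure_bounded_finite in auto)

lemma int_cw:
 assumes "0 <= t" "t <= T"
 shows "IL (cw t)"
 by (rule integrable_Lp_bounded_support[where A=\<Omega> and p=2]) (use assms mcw cw2 \<Omega> cw0 emeasure_bounded_finite in auto)

text \<open>The slice at time \<tau> is reached by one sequence of C^1 functions: the time increment
  converges by L^2, transport by L^r, stress by L^4, and diffusion by L^2 convergence of the
  gradients. The exceptional \<tau> do not depend on t1 and t2.\<close>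

lemma slice_identity:
 "AL \<tau>. 0 < \<tau> & \<tau> < T --> IL (%sg. K (sg, \<tau>)) &
  (\<forall>t1 t2. 0 <= t1 & t1 <= t2 & t2 <= T -->
   (LBINT x. cw t2 x <.> cw \<tau> x) - (LBINT x. cw t1 x <.> cw \<tau> x) = (LBINT sg. (if t1 <= sg & sg <= t2 then K (sg, \<tau>) else 0)))"
 using tpk(4) fpk(4) gpk(4) C_slices slices_finite wg cwC
proof eventually_elim
 case (elim \<tau>)
 define Kt where "Kt = (%sg. LBINT x. - tp (sg, x) <.> C (\<tau>, x))"
 define Kf where "Kf = (%sg. LBINT x. F (sg, x) <.> C (\<tau>, x))"
 define Kg where "Kg = (%sg. LBINT x. (- \<epsilon>) *R GC (sg, x) <.> GC (\<tau>, x))"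
 have Ki: "IL Kt" "IL Kf" "IL Kg"
  using conjunct1[OF elim(1)] conjunct1[OF elim(2)] conjunct1[OF elim(3)] by (simp_all add: Kt_def Kf_def Kg_def)
 have Keq: "K (sg, \<tau>) = Kt sg + Kf sg + Kg sg" for sg by (simp only: K_def Kt_def Kf_def Kg_def fst_conv snd_conv)
 have ci: "IL (%sg. if a <= sg & sg <= b then f sg else 0)" if "IL f" for a b :: real and f :: "real => real"
 proof (rule LB_bound[OF that])
  have [measurable]: "f \<in> BM" using that by auto
  show "(%sg. if a <= sg & sg <= b then f sg else 0) \<in> borel_measurable lborel" by measurable
 qed auto
 show ?case
 proof (intro impI conjI allI)
  show "IL (%sg. K (sg, \<tau>))" unfolding Keq using Ki by auto
  fix t1 t2 assume \<tau>: "0 < \<tau> & \<tau> < T" and t: "0 <= t1 & t1 <= t2 & t2 <= T"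
  have t1: "0 <= t1" "t1 <= T" and t2: "0 <= t2" "t2 <= T" and \<tau>': "0 <= \<tau>" "\<tau> <= T" using t \<tau> by auto
  note [measurable] = mcw[OF t1] mcw[OF t2] mcw[OF \<tau>']
  have ae: "AL x. cw \<tau> x = C (\<tau>, x)" using elim \<tau> by blast
  have mCt: "(%x. C (\<tau>, x)) \<in> BM" "(%x. GC (\<tau>, x)) \<in> BM" by measurable
  have C2: "(NNL x. ennreal (norm (C (\<tau>, x)) powr 2)) < \<infinity>"
  proof -
   have "(NNL x. ennreal (norm (C (\<tau>, x)) powr 2)) = (NNL x. nsq (cw \<tau> x))"
    by (intro nn_integral_cong_AE) (use ae in eventually_elim, simp)
   then show ?thesis using cw2[OF \<tau>'] by simp
  qed
  obtain W D where W: "!!n. C1fun (W n) (D n)"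
   and Wp: "!!p. p >= 1 ==> (NNL x. ennreal (norm (C (\<tau>, x)) powr p)) < \<infinity> ==>
    (%n. NNL x. indicator \<Omega> x * ennreal (norm (W n x - C (\<tau>, x)) powr p)) ~> 0"
   and Dp: "!!k. (%n. NNL x. indicator \<Omega> x * nsq (D n k x - GC (\<tau>, x) $ k)) ~> 0"
   by (rule smooth_approximation[OF dom mCt _ integrable_slice[of \<tau>]]) (use elim \<tau> in \<open>auto simp: Et_def\<close>)
  have cW: "CU (W n)" and cD: "CU (D n k)" for n k using W[of n] by (auto simp: C1fun_def)
  have [measurable]: "W n \<in> BM" "D n k \<in> BM" for n k
   using cW cD by (auto intro: borel_measurable_continuous_onI)
  define V where "V n x = (\<chi> k. D n k x)" for n x
  have cV: "CU (V n)" for n unfolding V_def by (intro continuous_on_vec_lambda cD)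
  have [measurable]: "V n \<in> BM" for n using cV by (auto intro: borel_measurable_continuous_onI)
  have Vp: "(%n. NNL x. indicator \<Omega> x * ennreal (norm (V n x - GC (\<tau>, x)) powr 2)) ~> 0"
   unfolding V_def by (rule vec_L2_tendsto_0) (use Dp in auto)
  define c where "c x = cw t2 x - cw t1 x" for x
  have ic: "IL c" unfolding c_def using int_cw t1 t2 by auto
  have [measurable]: "c \<in> BM" using ic by auto
  have c0: "c x = 0" if "x \<notin> \<Omega>" for x using cw0 that by (simp add: c_def)
  have c2: "(NNL x. ennreal (norm (c x) powr 2)) < \<infinity>"
  proof -
   have "(NNL x. ennreal (norm (c x) powr 2)) <= (NNL x. ennreal 2 * (nsq (cw t2 x) + nsq (cw t1 x)))"
   proof (intro nn_integral_mono)
    fix x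
    show "ennreal (norm (c x) powr 2) <= ennreal 2 * (nsq (cw t2 x) + nsq (cw t1 x))"
     using norm_diff_power2_le[of "cw t2 x" "cw t1 x" 0] by (simp add: c_def distrib_left)
   qed
   also have "\<dots> = ennreal 2 * ((NNL x. nsq (cw t2 x)) + (NNL x. nsq (cw t1 x)))"
    by (subst nn_integral_cmult, measurable, subst nn_integral_add) auto
   also have "\<dots> < \<infinity>" using cw2[OF t1] cw2[OF t2] by (simp add: ennreal_mult_less_top less_top)
   finally show ?thesis .
  qed
  define I where "I = (%z::real \<times> vec3. t1 <= fst z & fst z <= t2)"
  have rI: "IL (%z. if I z then f z else 0)" if i: "IL f" for f :: "real \<times> vec3 => 'x::euclidean_space"
  proof (rule LB_bound[OF i])
   have [measurable]: "f \<in> BM2" using i by (simp add: borel_prod)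
   have "(%z. if I z then f z else 0) \<in> BM2" unfolding I_def by measurable
   then show "(%z. if I z then f z else 0) \<in> borel_measurable lborel" by (simp add: borel_prod)
  qed auto
  have iGk: "IL (%z. GC z $ k)" for k
   by (rule LB_bound[OF int_GC]) (auto simp: Finite_Cartesian_Product.norm_nth_le)
  have id: "(LBINT x. c x <.> W n x) + (LBINT z. (if I z then tp z - F z else 0) <.> W n (snd z))
   + (\<Sum>k\<in>UNIV. LBINT z. (if I z then \<epsilon> *R GC z $ k else 0) <.> D n k (snd z)) = 0" for n
  proof (rule C1_test_functions[OF \<Omega>(2) ic _ _ c0 _ _ _ W])
   show iA: "IL (%z. if I z then tp z - F z else 0)" using int_tp int_F by (intro rI) auto
   show iB: "IL (%z. if I z then \<epsilon> *R GC z $ k else 0)" for k using iGk[of k] by (intro rI) auto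
   fix w :: "vec3 => mat3" assume w: "Cc_inf UNIV w"
   have W: "Cinf_on UNIV w" using w by (rule Cc_inf_Cinf)
   have "(LBINT z. (if t1 <= fst z & fst z <= t2 then bw w z else 0))
    = (LBINT z. (if I z then tp z - F z else 0) <.> w (snd z) + (\<Sum>k\<in>UNIV. (if I z then \<epsilon> *R GC z $ k else 0) <.> pdx k w (snd z)))"
    by (rule LB_cong) (auto simp: I_def bw_def sum_distrib_left)
   also have "\<dots> = (LBINT z. (if I z then tp z - F z else 0) <.> w (snd z)) + (\<Sum>k\<in>UNIV. LBINT z. (if I z then \<epsilon> *R GC z $ k else 0) <.> pdx k w (snd z))"
   proof -
    have jA: "IL (%z. (if I z then tp z - F z else 0) <.> w (snd z))"
     by (rule integrable_inner_continuous[OF \<Omega>(2) iA _ Cinf_continuous[OF W]]) (auto simp: tp0 F0)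
    have jB: "IL (%z. (if I z then \<epsilon> *R GC z $ k else 0) <.> pdx k w (snd z))" for k
     by (rule integrable_inner_continuous[OF \<Omega>(2) iB _ Cinf_pdx(2)[OF W]]) (auto simp: GC0)
    show ?thesis
     by (subst LB_add[OF jA LB_isum[OF jB]], subst LB_sum[OF jB]) (rule refl)
   qed
   finally show "(LBINT x. c x <.> w x) + (LBINT z. (if I z then tp z - F z else 0) <.> w (snd z))
    + (\<Sum>k\<in>UNIV. LBINT z. (if I z then \<epsilon> *R GC z $ k else 0) <.> pdx k w (snd z)) = 0"
    using time_identity[OF w, of t1 t2] t by (simp add: c_def)
  qed (auto simp: tp0 F0 GC0)
  have j1: "IL (%z. (if I z then - tp z else 0) <.> W n (snd z))" for n
   by (rule integrable_inner_continuous[OF \<Omega>(2) rI _ cW]) (use int_tp tp0 in auto)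
  have j2: "IL (%z. (if I z then F z else 0) <.> W n (snd z))" for n
   by (rule integrable_inner_continuous[OF \<Omega>(2) rI _ cW]) (use int_F F0 in auto)
  have j3: "IL (%z. (if I z then \<epsilon> *R GC z $ k else 0) <.> D n k (snd z))" for n k
   by (rule integrable_inner_continuous[OF \<Omega>(2) rI _ cD]) (use iGk GC0 in auto)
  have idn: "(LBINT x. c x <.> W n x) = (LBINT z. (if I z then - tp z else 0) <.> W n (snd z)) + (LBINT z. (if I z then F z else 0) <.> W n (snd z))
   + (LBINT z. (if I z then (- \<epsilon>) *R GC z else 0) <.> V n (snd z))" for n
  proof -
   have "(LBINT z. (if I z then tp z - F z else 0) <.> W n (snd z)) = (LBINT z. - ((if I z then - tp z else 0) <.> W n (snd z) + (if I z then F z else 0) <.> W n (snd z)))"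
    by (rule LB_cong) (auto simp: algebra_simps)
   then have a: "(LBINT z. (if I z then tp z - F z else 0) <.> W n (snd z)) = - ((LBINT z. (if I z then - tp z else 0) <.> W n (snd z)) + (LBINT z. (if I z then F z else 0) <.> W n (snd z)))"
    by (simp only: Bochner_Integration.integral_minus LB_add[OF j1 j2])
   have "(LBINT z. (if I z then (- \<epsilon>) *R GC z else 0) <.> V n (snd z)) = (LBINT z. - (\<Sum>k\<in>UNIV. (if I z then \<epsilon> *R GC z $ k else 0) <.> D n k (snd z)))"
    by (rule LB_cong) (auto simp: V_def inner_vec_def sum_negf)
   then have "(LBINT z. (if I z then (- \<epsilon>) *R GC z else 0) <.> V n (snd z)) = - (\<Sum>k\<in>UNIV. LBINT z. (if I z then \<epsilon> *R GC z $ k else 0) <.> D n k (snd z))"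
    by (simp only: Bochner_Integration.integral_minus LB_sum[OF j3])
   then show ?thesis using a id[of n] by linarith
  qed
  have l0: "(%n. LBINT x. c x <.> W n x) ~> (LBINT x. c x <.> C (\<tau>, x))"
  proof (rule pairing_space_limit(2)[where q=2 and \<Omega>=\<Omega>])
   show "dual_bd 2 (enn2real (NNL x. ennreal (norm (c x) powr 2)) powr (1 / 2)) (%x. norm (c x))"
    by (rule dual_bd_Lp) (use c2 in auto)
  qed (use C2 c0 Wp[OF _ C2] \<Omega> in auto)
  have l1: "(%n. LBINT z. (if I z then - tp z else 0) <.> W n (snd z)) ~> (LBINT sg. (if t1 <= sg & sg <= t2 then Kt sg else 0))"
   unfolding I_def Kt_def by (rule conjunct2[OF elim(1), rule_format, unfolded fst_conv snd_conv, OF _ Wp]) (use r elim(4) in auto)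
  have l2: "(%n. LBINT z. (if I z then F z else 0) <.> W n (snd z)) ~> (LBINT sg. (if t1 <= sg & sg <= t2 then Kf sg else 0))"
   unfolding I_def Kf_def by (rule conjunct2[OF elim(2), rule_format, unfolded fst_conv snd_conv, OF _ Wp]) (use elim(4) in auto)
  have l3: "(%n. LBINT z. (if I z then (- \<epsilon>) *R GC z else 0) <.> V n (snd z)) ~> (LBINT sg. (if t1 <= sg & sg <= t2 then Kg sg else 0))"
   unfolding I_def Kg_def by (rule conjunct2[OF elim(3), rule_format, unfolded fst_conv snd_conv, OF _ Vp]) measurable
  have "(LBINT x. c x <.> C (\<tau>, x)) = (LBINT sg. (if t1 <= sg & sg <= t2 then Kt sg else 0))
   + (LBINT sg. (if t1 <= sg & sg <= t2 then Kf sg else 0)) + (LBINT sg. (if t1 <= sg & sg <= t2 then Kg sg else 0))"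
   by (rule LIMSEQ_unique[OF l0]) (unfold idn, intro tendsto_add l1 l2 l3)
  also have "\<dots> = (LBINT sg. (if t1 <= sg & sg <= t2 then Kt sg else 0) + (if t1 <= sg & sg <= t2 then Kf sg else 0) + (if t1 <= sg & sg <= t2 then Kg sg else 0))"
   using ci[OF Ki(1)] ci[OF Ki(2)] ci[OF Ki(3)] by simp
  also have "\<dots> = (LBINT sg. (if t1 <= sg & sg <= t2 then K (sg, \<tau>) else 0))"
   by (rule LB_cong) (auto simp: Keq)
  also have "(LBINT x. c x <.> C (\<tau>, x)) = (LBINT x. c x <.> cw \<tau> x)"
   by (rule integral_cong_AE, measurable) (use ae in eventually_elim, simp)
  also have "\<dots> = (LBINT x. cw t2 x <.> cw \<tau> x) - (LBINT x. cw t1 x <.> cw \<tau> x)"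
   unfolding c_def inner_diff_left
   by (intro Bochner_Integration.integral_diff integrable_mult_inner_L2 mcw cw2 t1 t2 \<tau>')
  finally show "(LBINT x. cw t2 x <.> cw \<tau> x) - (LBINT x. cw t1 x <.> cw \<tau> x) = (LBINT sg. (if t1 <= sg & sg <= t2 then K (sg, \<tau>) else 0))" .
 qed
qed

theorem energy_identity:
 shows "IL (%z. F z <.> C z)" "IL (%z. (norm (GC z))^2)"
  and "AL \<tau>. 0 < \<tau> & \<tau> < T --> (LBINT x. (norm (cw \<tau> x))^2)
   = (LBINT x. (norm (cw 0 x))^2) + 2 * (LBINT z. (if 0 <= fst z & fst z <= \<tau> then F z <.> C z - \<epsilon> * (norm (GC z))^2 else 0))"
proof -
 show iF: "IL (%z. F z <.> C z)" by (rule fpk(2))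
 show iG: "IL (%z. (norm (GC z))^2)" using GC2 by (simp add: integrable_iff_bounded)
 define KT where "KT = (%z. LBINT x. - tp (fst z, x) <.> C (snd z, x))"
 define KF where "KF = (%z. LBINT x. F (fst z, x) <.> C (snd z, x))"
 define KG where "KG = (%z. LBINT x. (- \<epsilon>) *R GC (fst z, x) <.> GC (snd z, x))"
 have Keq: "K z = KT z + KF z + KG z" for z by (simp only: K_def KT_def KF_def KG_def)
 have [measurable]: "KT \<in> BM" "KF \<in> BM" "KG \<in> BM"
  unfolding KT_def KF_def KG_def by (rule tpk(1) fpk(1) gpk(1))+
 then have [measurable]: "KT \<in> BM2" "KF \<in> BM2" "KG \<in> BM2"
  by (simp_all add: borel_prod)
 have iKT: "IL (%sg. KT (sg, sg))" using integral_slices(2)[OF tpk(2)] by (simp add: KT_def)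
 have iKF: "IL (%sg. KF (sg, sg))" using integral_slices(2)[OF fpk(2)] by (simp add: KF_def)
 have iKG: "IL (%sg. KG (sg, sg))" using integral_slices(2)[OF gpk(2)] by (simp add: KG_def)
 have ae: "AL \<tau>. 0 < \<tau> & \<tau> < T --> (LBINT x. (norm (C (\<tau>, x)))^2) = (LBINT x. (norm (cw \<tau> x))^2)"
  using cwC
 proof eventually_elim
  case (elim \<tau>)
  have "(LBINT x. (norm (C (\<tau>, x)))^2) = (LBINT x. (norm (cw \<tau> x))^2)" if "0 < \<tau>" "\<tau> < T"
  proof (rule integral_cong_AE)
   show "(%x. (norm (cw \<tau> x))^2) \<in> borel_measurable lborel" using mcw[of \<tau>] that by simp
   have "AL x. cw \<tau> x = C (\<tau>, x)" using elim that by blast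
   then show "AL x. (norm (C (\<tau>, x)))^2 = (norm (cw \<tau> x))^2" by eventually_elim simp
  qed measurable
  then show ?case by blast
 qed
 \<comment> \<open>The energy is expressed by the jointly Borel function C, for which measurability
   in \<tau> is clear, while B is built from \<open>cw\<close>, which carries the weak
   continuity.\<close>
 have main: "AL \<tau>. 0 < \<tau> & \<tau> < T --> (LBINT x. (norm (C (\<tau>, x)))^2)
  = (LBINT x. cw 0 x <.> cw 0 x) + 2 * (LBINT sg. (if 0 <= sg & sg <= \<tau> then K (sg, sg) else 0))"
 proof (rule energy_equality_abstract[OF T measurable_K, where B="%t s. LBINT x. cw t x <.> cw s x"])
  fix e :: real assume "e > 0"
  then have e: "e / 3 > 0" by simp
  obtain h1 where h1: "h1 > 0" "!!dl. \<bar>dl\<bar> <= h1 ==> (NNL sg. ennreal \<bar>KT (sg, sg + dl) - KT (sg, sg)\<bar>) <= ennreal (e / 3)"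
   using tpk(3)[OF e] unfolding KT_def by blast
  obtain h2 where h2: "h2 > 0" "!!dl. \<bar>dl\<bar> <= h2 ==> (NNL sg. ennreal \<bar>KF (sg, sg + dl) - KF (sg, sg)\<bar>) <= ennreal (e / 3)"
   using fpk(3)[OF e] unfolding KF_def by blast
  obtain h3 where h3: "h3 > 0" "!!dl. \<bar>dl\<bar> <= h3 ==> (NNL sg. ennreal \<bar>KG (sg, sg + dl) - KG (sg, sg)\<bar>) <= ennreal (e / 3)"
   using gpk(3)[OF e] unfolding KG_def by blast
  have "(NNL sg. ennreal \<bar>K (sg, sg + dl) - K (sg, sg)\<bar>) <= ennreal e" if dl: "\<bar>dl\<bar> <= min h1 (min h2 h3)" for dl
  proof -
   have "(NNL sg. ennreal \<bar>K (sg, sg + dl) - K (sg, sg)\<bar>)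
    <= (NNL sg. ennreal \<bar>KT (sg, sg + dl) - KT (sg, sg)\<bar> + (ennreal \<bar>KF (sg, sg + dl) - KF (sg, sg)\<bar> + ennreal \<bar>KG (sg, sg + dl) - KG (sg, sg)\<bar>))"
    by (intro nn_integral_mono) (simp add: Keq ennreal_plus[symmetric] ennreal_leI del: ennreal_plus)
   also have "\<dots> = (NNL sg. ennreal \<bar>KT (sg, sg + dl) - KT (sg, sg)\<bar>) + ((NNL sg. ennreal \<bar>KF (sg, sg + dl) - KF (sg, sg)\<bar>)
    + (NNL sg. ennreal \<bar>KG (sg, sg + dl) - KG (sg, sg)\<bar>))"
    by (subst nn_integral_add, measurable, subst nn_integral_add) auto
   also have "\<dots> <= ennreal (e / 3) + (ennreal (e / 3) + ennreal (e / 3))"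
    using dl by (intro add_mono h1(2) h2(2) h3(2)) auto
   also have "\<dots> = ennreal e" using \<open>e > 0\<close> by (simp add: ennreal_plus[symmetric] del: ennreal_plus)
   finally show ?thesis .
  qed
  then show "\<exists>h>0. \<forall>dl. \<bar>dl\<bar> <= h --> (NNL sg. ennreal \<bar>K (sg, sg + dl) - K (sg, sg)\<bar>) <= ennreal e"
   using h1(1) h2(1) h3(1) by (intro exI[of _ "min h1 (min h2 h3)"]) auto
 next
  show "IL (%sg. K (sg, sg))" unfolding Keq by (intro LB_iadd iKT iKF iKG)
  show "(LBINT x. cw t x <.> cw s x) = (LBINT x. cw s x <.> cw t x)" for t s by (simp add: inner_commute)
  \<comment> \<open>Only the weak continuity of \<open>cw\<close>, tested with the fixed function
    \<open>cw 0\<close>, enters at the initial time.\<close>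
  show "((%s. LBINT x. cw 0 x <.> cw s x) \<longlongrightarrow> (LBINT x. cw 0 x <.> cw 0 x)) (at_right 0)"
  proof -
   have "continuous_on {0..T} (%t. LBINT x. cw t x <.> cw 0 x)" using cwc[OF mcw cw2, of 0] T by simp
   then have "((%t. LBINT x. cw t x <.> cw 0 x) \<longlongrightarrow> (LBINT x. cw 0 x <.> cw 0 x)) (at 0 within {0..T})"
    using T by (simp add: continuous_on_def)
   then show ?thesis using T by (simp add: at_within_Icc_at_right inner_commute)
  qed
  show "(%\<tau>. LBINT x. (norm (C (\<tau>, x)))^2) \<in> BM" by measurable
  show "AL s. 0 < s & s < T --> (LBINT x. (norm (C (s, x)))^2) = (LBINT x. cw s x <.> cw s x)"
   using ae by (simp add: power2_norm_eq_inner)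
 qed (rule slice_identity)
 have KT0: "AL sg. KT (sg, sg) = 0"
  using ap tr wg A(2) slices_finite C_slices cwC
 proof eventually_elim
  case (elim sg)
  show ?case
  proof (cases "0 < sg & sg < T")
   case True
   obtain ph where ph: "H10_approx \<Omega> ph (%x. u (sg, x)) (%x. Gu (sg, x))" using elim True by blast
   have c2: "(NNL x. nsq (C (sg, x))) < \<infinity>"
   proof -
    have ae: "AL x. cw sg x = C (sg, x)" using elim True by blast
    have "(NNL x. nsq (C (sg, x))) = (NNL x. nsq (cw sg x))"
     by (intro nn_integral_cong_AE) (use ae in eventually_elim, simp)
    then show ?thesis using cw2[of sg] True by simp
   qed
   have u2': "(NNL x. nsq (u (sg, x))) < \<infinity>" using elim(4) True by (auto intro: le_less_trans)
   have "(LBINT x. (\<Sum>k\<in>UNIV. u (sg, x) $ k *R GC (sg, x) $ k) <.> C (sg, x)) = 0"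
    by (rule transport_zero[OF r \<Omega>(1,2) _ _ _ _ ph _ u2' _ integrable_slice c2])
     (use elim True in \<open>auto simp: Et_def Dt_def\<close>)
   then show ?thesis by (simp add: KT_def tp_def)
  next
   case False
   then have "tp (sg, x) = 0" for x by (intro tp0) auto
   then show ?thesis by (simp add: KT_def)
  qed
 qed
 have conv: "(LBINT sg. (if 0 <= sg & sg <= \<tau> then K (sg, sg) else 0))
  = (LBINT z. (if 0 <= fst z & fst z <= \<tau> then F z <.> C z - \<epsilon> * (norm (GC z))^2 else 0))" for \<tau>
 proof -
  define f where "f z = F z <.> C z - \<epsilon> * (norm (GC z))^2" for z
  have if0: "IL f" unfolding f_def[abs_def] using iF iG by auto
  have [measurable]: "f \<in> BM2" using if0 by (simp add: borel_prod)
  have i: "IL (%z. if 0 <= fst z & fst z <= \<tau> then f z else 0)"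
  proof (rule LB_bound[OF if0])
   have "(%z. if 0 <= fst z & fst z <= \<tau> then f z else 0) \<in> BM2" by measurable
   then show "(%z. if 0 <= fst z & fst z <= \<tau> then f z else 0) \<in> borel_measurable lborel" by (simp add: borel_prod)
  qed auto
  have k: "AL sg. K (sg, sg) = (LBINT x. f (sg, x))"
   using KT0 integral_slices(3)[OF iF] integral_slices(3)[OF iG]
  proof eventually_elim
   case (elim sg)
   then show ?case by (simp add: Keq KF_def KG_def f_def power2_norm_eq_inner)
  qed
  have [measurable]: "K \<in> BM2" using measurable_K by (simp add: borel_prod)
  have "(LBINT sg. (if 0 <= sg & sg <= \<tau> then K (sg, sg) else 0)) = (LBINT sg. (if 0 <= sg & sg <= \<tau> then (LBINT x. f (sg, x)) else 0))"
   by (rule integral_cong_AE, measurable) (use k in eventually_elim, simp)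
  also have "\<dots> = (LBINT z. (if 0 <= fst z & fst z <= \<tau> then f z else 0))"
   unfolding integral_slices(1)[OF i] by (rule LB_cong) auto
  finally show ?thesis unfolding f_def .
 qed
 show "AL \<tau>. 0 < \<tau> & \<tau> < T --> (LBINT x. (norm (cw \<tau> x))^2)
   = (LBINT x. (norm (cw 0 x))^2) + 2 * (LBINT z. (if 0 <= fst z & fst z <= \<tau> then F z <.> C z - \<epsilon> * (norm (GC z))^2 else 0))"
  using main ae by eventually_elim (simp add: conv power2_norm_eq_inner)
qed

end

section \<open>Borel versions of Lebesgue measurable data\<close>

lemma measurable_AE_eq_lebesgue:
 fixes f g :: "'a::euclidean_space => 'b::topological_space"
 assumes g: "g \<in> BM" and ae: "AL x. f x = g x"
 shows "f \<in> borel_measurable lebesgue"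
proof (rule measurableI)
 fix B :: "'b set" assume B: "B \<in> sets borel"
 have n: "AL x. \<not> (f x \<in> B & f x ~= g x)" "AL x. \<not> (f x ~= g x)" using ae by auto
 have 1: "{x. f x \<in> B & f x ~= g x} \<in> sets lebesgue" "{x. f x ~= g x} \<in> sets lebesgue"
  using sets_completion_AE[OF n(1)] sets_completion_AE[OF n(2)] by (auto simp: pred_def)
 have 2: "g -` B \<in> sets lebesgue" using measurable_sets[OF g B] by (auto intro: sets_completionI_sets)
 have "f -` B \<inter> space lebesgue = (g -` B - {x. f x ~= g x}) \<union> {x. f x \<in> B & f x ~= g x}" by auto
 also have "\<dots> \<in> sets lebesgue" using 1 2 by auto
 finally show "f -` B \<inter> space lebesgue \<in> sets lebesgue" .
qed auto

lemma lebesgue_integral_AE_eq: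
 fixes f g :: "'a::euclidean_space => 'b::euclidean_space"
 assumes g: "g \<in> BM" and ae: "AL x. f x = g x"
 shows "(\<integral>x. f x \<partial>lebesgue) = (LBINT x. g x)" and "integrable lebesgue f \<longleftrightarrow> IL g"
proof -
 have m: "f \<in> borel_measurable lebesgue" "g \<in> borel_measurable lebesgue"
  using measurable_AE_eq_lebesgue[OF g ae] measurable_completion[of g lborel borel] g by auto
 have ae': "AE x in lebesgue. f x = g x" by (rule AE_completion[OF ae])
 have "(\<integral>x. f x \<partial>lebesgue) = (\<integral>x. g x \<partial>lebesgue)" by (rule integral_cong_AE[OF m ae'])
 then show "(\<integral>x. f x \<partial>lebesgue) = (LBINT x. g x)" using integral_completion[of g lborel] g by simp
 have "integrable lebesgue f \<longleftrightarrow> integrable lebesgue g" by (rule integrable_cong_AE[OF m ae'])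
 then show "integrable lebesgue f \<longleftrightarrow> IL g" using integrable_completion[of g lborel] g by simp
qed

text \<open>Extension by 0 outside S turns integrals over S against Lebesgue measure into integrals
  over the whole space against Borel measure, where the product structure and Fubini are
  available.\<close>

definition borel_version :: "'a::euclidean_space set => ('a => 'b::euclidean_space) => ('a => 'b) => bool" where
 "borel_version S f g \<longleftrightarrow> g \<in> BM & (\<forall>z. z \<notin> S --> g z = 0) & (AL z. z \<in> S --> f z = g z)"

lemma borel_version_exists:
 fixes f :: "'a::euclidean_space => 'b::euclidean_space"
 assumes S: "S \<in> sets borel" and f: "f \<in> borel_measurable (lebesgue_on S)"
 obtains g where "borel_version S f g"
proof -
 have m: "(%x. indicator S x *R f x) \<in> borel_measurable lebesgue"
  using f S by (subst (asm) borel_measurable_restrict_space_iff) (auto intro: sets_completionI_sets)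
 have "\<exists>g. g \<in> BM & (AL x. (indicator S x *R f x) <.> b = g x)" for b
 proof -
  have "(%x. (indicator S x *R f x) <.> b) \<in> borel_measurable lebesgue" using m by (intro borel_measurable_inner) auto
  from completion_ex_borel_measurable_real[OF this] show ?thesis by auto
 qed
 then obtain h where h: "!!b. h b \<in> BM" "!!b. AL x. (indicator S x *R f x) <.> b = h b x" by metis
 define g where "g x = indicator S x *R (\<Sum>b\<in>Basis. h b x *R b)" for x
 have "AL x. \<forall>b\<in>Basis. (indicator S x *R f x) <.> b = h b x" using h(2) by (intro AE_finite_allI) auto
 then have "AL z. z \<in> S --> f z = g z"
  by eventually_elim (auto simp: g_def indicator_def intro!: euclidean_eqI[where 'a='b])
 moreover have [measurable]: "h b \<in> BM" for b by (rule h(1))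
 have "g \<in> BM" using S unfolding g_def by measurable
 ultimately have "borel_version S f g" by (auto simp: borel_version_def g_def)
 then show ?thesis using that by blast
qed

lemma set_lebesgue_integral_borel:
 fixes h g :: "'a::euclidean_space => 'b::euclidean_space"
 assumes "g \<in> BM" "!!z. z \<notin> S ==> g z = 0" "AL z. z \<in> S --> h z = g z"
 shows "(LINT z:S|lebesgue. h z) = (LBINT z. g z)"
 unfolding set_lebesgue_integral_def
proof (rule lebesgue_integral_AE_eq(1)[OF assms(1)])
 show "AL z. indicator S z *R h z = g z" using assms(3) by eventually_elim (use assms(2) in \<open>auto simp: indicator_def\<close>)
qed

lemma nn_integral_lebesgue_on_borel:
 assumes S: "S \<in> sets borel" and "AL z. z \<in> S --> h z = g z" "!!z. z \<notin> S ==> g z = 0"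
 shows "(\<integral>\<^sup>+z. h z \<partial>lebesgue_on S) = (NNL z. g z)"
proof -
 have "(\<integral>\<^sup>+z. h z \<partial>lebesgue_on S) = (NNL z. h z * indicator S z)"
  using S by (subst nn_integral_restrict_space) (auto intro: sets_completionI_sets simp: nn_integral_completion)
 also have "\<dots> = (NNL z. g z)"
  by (rule nn_integral_cong_AE) (use assms(2) in eventually_elim, use assms(3) in \<open>auto simp: indicator_def\<close>)
 finally show ?thesis .
qed

lemma AE_lebesgue_on_borel:
 assumes S: "S \<in> sets borel" and "AE z in lebesgue_on S. P z"
 shows "AL z. z \<in> S --> P z"
 using assms by (subst (asm) AE_restrict_space_iff) (auto intro: sets_completionI_sets simp: AE_completion_iff)

lemma borel_version_Lp:
 fixes f g :: "'a::euclidean_space => 'b::euclidean_space"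
 assumes S: "S \<in> sets borel" and g: "borel_version S f g" and p: "p > 0" and f: "Lp_on S p f"
 shows "(NNL z. ennreal (norm (g z) powr p)) < \<infinity>"
proof -
 have "(\<integral>\<^sup>+z. ennreal (norm (f z) powr p) \<partial>lebesgue_on S) = (NNL z. ennreal (norm (g z) powr p))"
 proof (rule nn_integral_lebesgue_on_borel[OF S])
  show "AL z. z \<in> S --> ennreal (norm (f z) powr p) = ennreal (norm (g z) powr p)"
   using g unfolding borel_version_def by auto
 qed (use g p in \<open>auto simp: borel_version_def\<close>)
 then show ?thesis using f by (simp add: Lp_on_def integrable_iff_bounded)
qed

lemma Lp_on_borel:
 fixes g :: "'a::euclidean_space => 'b::euclidean_space"
 assumes S: "S \<in> sets borel" and g: "g \<in> BM" and fin: "(NNL z. ennreal (norm (g z) powr p)) < \<infinity>"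
 shows "Lp_on S p g"
 unfolding Lp_on_def
proof
 show "g \<in> borel_measurable (lebesgue_on S)" using g by (intro measurable_restrict_space1 measurable_completion) simp
 have "IL (%z. norm (g z) powr p)" using g fin by (simp add: integrable_iff_bounded)
 then have "integrable lebesgue (%z. norm (g z) powr p)" using integrable_completion[of "%z. norm (g z) powr p" lborel] g by simp
 then have "integrable lebesgue (%z. indicator S z *R (norm (g z) powr p))"
  using S by (intro integrable_mult_indicator) (auto intro: sets_completionI_sets)
 then show "integrable (lebesgue_on S) (%z. norm (g z) powr p)"
  using S by (subst integrable_restrict_space) (auto intro: sets_completionI_sets)
qed

text \<open>The versions are chosen for each time separately, so that weak continuity holds at every
  t. Joint measurability in (t, x) is supplied by the version of the field on the cylinder
  instead.\<close>

lemma Cw_L2_version: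
 fixes f :: "real => vec3 => 'b::euclidean_space"
 assumes S: "\<Omega> \<in> sets borel" and f: "Cw_L2 \<Omega> T f"
 obtains w where "!!t. 0 <= t ==> t <= T ==> borel_version \<Omega> (f t) (w t)" "!!t x. x \<notin> \<Omega> ==> w t x = 0"
  "!!t. 0 <= t ==> t <= T ==> (NNL x. nsq (w t x)) < \<infinity>"
  "!!g. g \<in> BM ==> (NNL x. nsq (g x)) < \<infinity> ==> continuous_on {0..T} (%t. LBINT x. w t x <.> g x)"
proof -
 have Lp: "Lp_on \<Omega> 2 (f t)" if "t \<in> {0..T}" for t using f that by (simp add: Cw_L2_def)
 have "\<exists>g. borel_version \<Omega> (f t) g" if "t \<in> {0..T}" for t
  using borel_version_exists[OF S, of "f t"] Lp[OF that] unfolding Lp_on_def by blast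
 then obtain v where v: "!!t. t \<in> {0..T} ==> borel_version \<Omega> (f t) (v t)" by metis
 define w where "w t x = indicator \<Omega> x *R v t x" for t x
 have wv: "w t = v t" if "t \<in> {0..T}" for t using v[OF that] by (auto simp: w_def borel_version_def indicator_def fun_eq_iff)
 show ?thesis
 proof (rule that[of w])
  show "borel_version \<Omega> (f t) (w t)" if "0 <= t" "t <= T" for t using v[of t] wv[of t] that by simp
  show "w t x = 0" if "x \<notin> \<Omega>" for t x using that by (simp add: w_def)
  show "(NNL x. nsq (w t x)) < \<infinity>" if "0 <= t" "t <= T" for t
   using borel_version_Lp[OF S v _ Lp, of t] wv[of t] that by simp
  show "continuous_on {0..T} (%t. LBINT x. w t x <.> g x)"
   if [measurable]: "g \<in> BM" and g2: "(NNL x. nsq (g x)) < \<infinity>" for g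
  proof -
   have "continuous_on {0..T} (%t. LINT x:\<Omega>|lebesgue. f t x <.> g x)"
    using f Lp_on_borel[OF S that(1), of 2] g2 by (simp add: Cw_L2_def)
   moreover have "(LINT x:\<Omega>|lebesgue. f t x <.> g x) = (LBINT x. w t x <.> g x)" if "t \<in> {0..T}" for t
   proof (rule set_lebesgue_integral_borel)
    have [measurable]: "w t \<in> BM" using v[OF that] wv[OF that] by (simp add: borel_version_def)
    show "(%x. w t x <.> g x) \<in> BM" by measurable
    show "AL x. x \<in> \<Omega> --> f t x <.> g x = w t x <.> g x"
     using v[OF that] unfolding wv[OF that] borel_version_def by auto
   qed (simp add: w_def)
   ultimately show ?thesis by (rule continuous_on_eq)
  qed
 qed
qed

lemma AE_slices:
 fixes P :: "'a::euclidean_space \<times> 'b::euclidean_space => bool"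
 assumes "AL z. P z"
 shows "AL t. AL x. P (t, x)"
 by (rule lborel_pair.AE_pair) (unfold lborel_prod, rule assms)

lemma Cinf_on_component:
 fixes f :: "'a::euclidean_space => real"
 shows "(!!k. Ck k UNIV f) ==> Cinf_on UNIV f"
 by (simp add: Cinf_on_def)

lemma testfn_product:
 fixes w :: "vec3 => 'b::euclidean_space"
 assumes th: "Cc_inf I th" and w: "Cc_inf U w"
 shows "testfn (I \<times> U) (%t x. th t *R w x)"
proof -
 obtain K where K: "compact K" "K \<subseteq> I" "!!t. t \<notin> K ==> th t = 0" using th unfolding Cc_inf_def by blast
 obtain L where L: "compact L" "L \<subseteq> U" "!!x. x \<notin> L ==> w x = 0" using w unfolding Cc_inf_def by blast
 have cth: "Ck k UNIV th" for k using th by (simp add: Cc_inf_def Cinf_on_def)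
 have cw: "Ck k UNIV (%x. w x <.> b)" if "b \<in> Basis" for k b using w that by (simp add: Cc_inf_def Cinf_on_def)
 have "Ck k UNIV (%z. (case z of (t, x) => th t *R w x) <.> b)" if "b \<in> Basis" for k b
  using Ck_mult[OF Ck_fst[OF cth[of k]] Ck_snd[OF cw[OF that, of k]]] by (simp add: case_prod_beta)
 moreover have "compact (K \<times> L)" "K \<times> L \<subseteq> I \<times> U" using K L by (auto intro: compact_Times)
 moreover have "(case z of (t, x) => th t *R w x) = 0" if "z \<notin> K \<times> L" for z using that K(3) L(3) by (auto simp: case_prod_beta mem_Times_iff)
 ultimately show ?thesis unfolding testfn_def Cc_inf_def Cinf_on_def by blast
qed

lemma pdx_ker: "dirderiv (axis k 1) (ker kp) (pdx k (ker kp :: vec3 => real))" "CU (pdx k (ker kp :: vec3 => real))"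
 using Cinf_pdx[of "ker kp :: vec3 => real" k] Cinf_on_component[OF Ck_ker] by auto

lemma pdx_ker_reflect: "pdx k (%x. ker kp (y - x)) x = - pdx k (ker kp) (y - x :: vec3)"
proof -
 have "((%s. ker kp ((y - x) + s *R (axis k 1 :: vec3))) has_vector_derivative pdx k (ker kp) (y - x)) (at 0)"
  using pdx_ker(1)[of k kp] by (simp add: dirderiv_def)
 moreover have "(uminus has_vector_derivative - 1) (at (0::real))"
  by (auto intro!: derivative_eq_intros simp: has_real_derivative_iff_has_vector_derivative[symmetric])
 ultimately have "(((%s. ker kp ((y - x) + s *R (axis k 1 :: vec3))) \<circ> uminus) has_vector_derivative - 1 *R pdx k (ker kp) (y - x)) (at 0)"
  by (intro vector_diff_chain_at) simp_all
 then show ?thesis unfolding pdx_def[of k "%x. ker kp (y - x)"] by (intro vector_derivative_at) (simp add: o_def algebra_simps)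
qed

text \<open>Testing with th(t) times a mollifier kernel centred at y yields the slice identity for
  almost every t, with a null set depending on y and on the scale. Countably many y and scales share
  one null set, and continuity in y reaches the remaining centres.\<close>

lemma weak_grad_slices:
 fixes C :: "real \<times> vec3 => mat3" and G :: "real \<times> vec3 => mat3^3"
 assumes \<Omega>: "open \<Omega>" and iC: "IL C" and iG: "IL G"
  and wd: "!!i j k th. testfn ({0<..<T} \<times> \<Omega>) th ==>
   (LBINT z. C z $ i $ j * pdx k (th (fst z)) (snd z)) = - (LBINT z. G z $ k $ i $ j * th (fst z) (snd z))"
 shows "AL t. 0 < t & t < T --> weak_grad \<Omega> (%x. C (t, x)) (%x. G (t, x))"
proof -
 have iGk: "IL (%z. G z $ k)" for k
  by (rule LB_bound[OF iG]) (use iG in \<open>auto simp: Finite_Cartesian_Product.norm_nth_le\<close>)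
 \<comment> \<open>The defect of the identity in kernel form, with the derivative already placed on
   the kernel. Being a difference of convolutions it is continuous in y for every fixed good time
   t.\<close>
 define V where "V kp k y t = (LBINT x. pdx k (ker kp) (y - x) *R C (t, x)) - (LBINT x. ker kp (y - x) *R G (t, x) $ k)" for kp k y t
 have bnd: "\<exists>M. \<forall>x. norm (f (y - x)) <= M" if c: "CU f" and s: "!!x. norm x > R ==> f x = 0" for f :: "vec3 => real" and R y
 proof -
  obtain M where M: "!!x. norm x <= R ==> norm (f x) <= M" using continuous_bounded_cball[OF c] by blast
  have "norm (f x) <= max M 0" for x using M[of x] s[of x] by (cases "norm x <= R") (auto simp: max_def)
  then show ?thesis by blast
 qed
 have conv_int: "IL (%z. f (y - snd z) *R H z)"
  if c: "CU f" and s: "!!x. norm x > R ==> f x = 0" and H: "IL H"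
  for f :: "vec3 => real" and R y and H :: "real \<times> vec3 => mat3"
 proof -
  obtain M where M: "!!x. norm (f (y - x)) <= M" using bnd[OF c s] by blast
  have M0: "M >= 0" using M[of 0] norm_ge_zero order_trans by blast
  have [measurable]: "H \<in> BM" using H by auto
  have "CU (%z::real \<times> vec3. f (y - snd z))" by (intro continuous_on_compose2[OF c] continuous_intros) auto
  then have [measurable]: "(%z::real \<times> vec3. f (y - snd z)) \<in> BM" by (rule borel_measurable_continuous_onI)
  show ?thesis
  proof (rule LB_bound[where f="%z. M *R norm (H z)"])
   show "AL z. norm (f (y - snd z) *R H z) <= norm (M *R norm (H z))"
    using M M0 by (auto intro!: mult_right_mono)
  qed (use H in auto)
 qed
 have ks: "ker kp x = 0" if "norm x > kp" "kp > 0" for kp and x :: vec3 using ker_support[OF that(2), of x] that by force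
 have pks: "pdx k (ker kp) x = 0" if "norm x > kp" "kp > 0" for kp k and x :: vec3
  by (rule dirderiv_support[OF pdx_ker(1) ks[OF _ that(2)] that(1)])
 have V0: "AL t. t \<in> {0<..<T} --> V kp k y t = 0" if kp: "kp > 0" and y: "cball y kp \<subseteq> \<Omega>" for kp k y
 proof -
  have j1: "IL (%z. pdx k (ker kp) (y - snd z) *R C z)"
   by (rule conv_int[OF pdx_ker(2) pks[OF _ kp] iC])
  have j2: "IL (%z. ker kp (y - snd z) *R G z $ k)"
   by (rule conv_int[OF continuous_ker ks[OF _ kp] iGk])
  define v where "v z = pdx k (ker kp) (y - snd z) *R C z - ker kp (y - snd z) *R G z $ k" for z
  have iv: "IL v" unfolding v_def[abs_def] using j1 j2 by auto
  have Vv: "AL t. V kp k y t = (LBINT x. v (t, x))"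
   using integral_slices(3)[OF j1] integral_slices(3)[OF j2] by eventually_elim (simp add: V_def v_def)
  have "AL t. t \<in> {0<..<T} --> (LBINT x. v (t, x)) $ i $ j = 0" for i j
  proof (rule fundamental_lemma_variations)
   have bl: "bounded_linear (%A::mat3. A $ i $ j)"
    by (intro bounded_linear_compose[OF bounded_linear_vec_nth bounded_linear_vec_nth])
   show "IL (%t. (LBINT x. v (t, x)) $ i $ j)"
    by (rule integrable_bounded_linear[OF bl integral_slices(2)[OF iv]])
   fix th :: "real => real" assume th: "Cc_inf {0<..<T} th"
   have cth: "CU th" using Cinf_continuous[OF Cc_inf_Cinf[OF th]] .
   obtain R where R: "!!t. norm t > R ==> th t = 0" using th by (rule Cc_infE) blast
   obtain M where M: "!!t. norm t <= R ==> norm (th t) <= M" using continuous_bounded_cball[OF cth] by blast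
   have M': "\<bar>th t\<bar> <= max M 0" for t using M[of t] R[of t] by (cases "\<bar>t\<bar> <= R") (auto simp: max_def)
   have "CU (%z::real \<times> vec3. th (fst z))" by (intro continuous_on_compose2[OF cth] continuous_intros) auto
   then have [measurable]: "(%z::real \<times> vec3. th (fst z)) \<in> BM" by (rule borel_measurable_continuous_onI)
   have ith: "IL (%z. th (fst z) * H z $ i $ j)" if H: "IL H" for H :: "real \<times> vec3 => mat3"
    using integrable_inner_bounded[OF integrable_bounded_linear[OF bl H], of "%z. th (fst z)" "max M 0"] M' by (simp add: mult.commute)
   have "testfn ({0<..<T} \<times> \<Omega>) (%t x. th t *R ker kp (y - x))" by (rule testfn_product[OF th Cc_inf_ker[OF kp y]])
   from wd[OF this, of i j k]
   have e: "(LBINT z. C z $ i $ j * pdx k (%x. th (fst z) *R ker kp (y - x)) (snd z)) = - (LBINT z. G z $ k $ i $ j * (th (fst z) *R ker kp (y - snd z)))" .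
   have pd: "pdx k (%x. c *R ker kp (y - x)) x = - (c * pdx k (ker kp) (y - x))" for c x
   proof -
    have "((%s. ker kp (y - (x + s *R (axis k 1 :: vec3)))) has_vector_derivative - pdx k (ker kp) (y - x)) (at 0)"
     using Cinf_pdx(1)[OF Cc_inf_Cinf[OF Cc_inf_ker[OF kp y]], of k] unfolding dirderiv_def pdx_ker_reflect[symmetric] by blast
    from has_vector_derivative_scaleR[OF DERIV_const[of c] this] show ?thesis unfolding pdx_def[of k "%x. c *R ker kp (y - x)"]
     by (intro vector_derivative_at) simp
   qed
   have "(LBINT t. th t * (LBINT x. v (t, x)) $ i $ j) = (LBINT t. LBINT x. th (fst (t, x)) * v (t, x) $ i $ j)"
   proof (rule integral_cong_AE)
    show "AL t. th t * (LBINT x. v (t, x)) $ i $ j = (LBINT x. th (fst (t, x)) * v (t, x) $ i $ j)"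
     using integral_slices(3)[OF iv] by eventually_elim (simp add: integral_bounded_linear[OF bl, symmetric])
    show "(%t. LBINT x. th (fst (t, x)) * v (t, x) $ i $ j) \<in> borel_measurable lborel" using integral_slices(2)[OF ith[OF iv]] by auto
    have "(%t. (LBINT x. v (t, x)) $ i $ j) \<in> borel_measurable lborel"
     using integrable_bounded_linear[OF bl integral_slices(2)[OF iv]] by auto
    then show "(%t. th t * (LBINT x. v (t, x)) $ i $ j) \<in> borel_measurable lborel"
     using borel_measurable_continuous_onI[OF cth] by (intro borel_measurable_times) auto
   qed
   also have "\<dots> = (LBINT z. th (fst z) * v z $ i $ j)" by (rule integral_slices(1)[OF ith[OF iv], symmetric])
   also have "\<dots> = (LBINT z. th (fst z) * (pdx k (ker kp) (y - snd z) *R C z) $ i $ j - th (fst z) * (ker kp (y - snd z) *R G z $ k) $ i $ j)"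
    by (simp add: v_def right_diff_distrib)
   also have "\<dots> = (LBINT z. th (fst z) * (pdx k (ker kp) (y - snd z) *R C z) $ i $ j) - (LBINT z. th (fst z) * (ker kp (y - snd z) *R G z $ k) $ i $ j)"
    by (rule Bochner_Integration.integral_diff[OF ith[OF j1] ith[OF j2]])
   also have "\<dots> = - (LBINT z. C z $ i $ j * pdx k (%x. th (fst z) *R ker kp (y - x)) (snd z)) - (LBINT z. G z $ k $ i $ j * (th (fst z) *R ker kp (y - snd z)))"
    unfolding pd by (simp add: mult_ac)
   also have "\<dots> = 0" using e by simp
   finally show "(LBINT t. th t * (LBINT x. v (t, x)) $ i $ j) = 0" .
  qed
  then have "AL t. \<forall>i j. t \<in> {0<..<T} --> (LBINT x. v (t, x)) $ i $ j = 0" unfolding AE_all_countable by blast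
  with Vv show ?thesis by eventually_elim (auto simp: vec_eq_iff)
 qed
 \<comment> \<open>A countable dense set of centres. If the defect were nonzero at some y, it would
   be nonzero at a point of Q so close to y that its ball still lies in \<Omega>.\<close>
 obtain Q :: "vec3 set" where Q: "countable Q" "!!U. open U ==> U ~= {} ==> \<exists>q\<in>Q. q \<in> U" using countable_dense_setE by blast
 have "AL t. \<forall>n k. \<forall>y\<in>Q. cball y (1 / Suc n) \<subseteq> \<Omega> --> t \<in> {0<..<T} --> V (1 / Suc n) k y t = 0"
  unfolding AE_all_countable AE_ball_countable[OF Q(1)] using V0 by (auto simp del: of_nat_Suc)
 then show ?thesis using integral_slices(3)[OF iC] integral_slices(3)[OF iGk[of 1]] integral_slices(3)[OF iG]
 proof eventually_elim
  case (elim t)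
  have iCt: "IL (%x. C (t, x))" by fact
  have iGt: "IL (%x. G (t, x) $ k)" for k
   by (rule integrable_bounded_linear[OF bounded_linear_vec_nth elim(4)])
  show ?case unfolding weak_grad_def
  proof (intro impI allI)
   fix n y k assume t: "0 < t & t < T" and y: "cball y (1 / real (Suc n)) \<subseteq> \<Omega>"
   define kp where "kp = 1 / real (Suc n)"
   have kp: "kp > 0" by (simp add: kp_def)
   have cV: "CU (%y. V kp k y t)"
    unfolding V_def by (intro continuous_on_diff continuous_conv[OF iCt pdx_ker(2) pks[OF _ kp]] continuous_conv[OF iGt continuous_ker ks[OF _ kp]])
   have "V kp k y t = 0"
   proof (rule ccontr)
    assume ne: "V kp k y t ~= 0"
    obtain e where e: "e > 0" "(\<Union>x\<in>cball y kp. cball x e) \<subseteq> \<Omega>"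
     using compact_subset_open_imp_cball_epsilon_subset[OF compact_cball \<Omega> y[folded kp_def]] .
    have o: "open ({y. V kp k y t ~= 0} \<inter> ball y e)" by (intro open_Int open_Collect_neq cV continuous_intros) auto
    have "y \<in> {y. V kp k y t ~= 0} \<inter> ball y e" using ne e by simp
    then have n: "{y. V kp k y t ~= 0} \<inter> ball y e ~= {}" by blast
    obtain q where q: "q \<in> Q" "V kp k q t ~= 0" "dist y q < e" using Q(2)[OF o n] by auto
    have "cball q kp \<subseteq> \<Omega>"
    proof
     fix z assume z: "z \<in> cball q kp"
     have "z \<in> cball (z - (q - y)) e" using q(3) by (simp add: dist_norm norm_minus_commute)
     moreover have "z - (q - y) \<in> cball y kp" using z by (simp add: dist_norm algebra_simps)
     ultimately show "z \<in> \<Omega>" using e(2) by blast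
    qed
    then show False using elim(1) q t unfolding kp_def by auto
   qed
   have [measurable]: "(%x. C (t, x)) \<in> BM" "(%x. G (t, x) $ k) \<in> BM" using iCt iGt by auto
   have "pdx k (moll kp (%x. C (t, x))) y = (LBINT x. pdx k (ker kp) (y - x) *R C (t, x))"
   proof (rule dirderiv_pdx)
    have "moll kp (%x. C (t, x)) = (%y. LBINT x. ker kp (y - x) *R C (t, x))" by (intro ext moll_eq kp) measurable
    then show "dirderiv (axis k 1) (moll kp (%x. C (t, x))) (%y. LBINT x. pdx k (ker kp) (y - x) *R C (t, x))"
     using dirderiv_conv[OF iCt continuous_ker pdx_ker(1) pdx_ker(2) ks[OF _ kp]] by simp
   qed
   also have "\<dots> = (LBINT x. ker kp (y - x) *R G (t, x) $ k)" using \<open>V kp k y t = 0\<close> by (simp add: V_def)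
   also have "\<dots> = moll kp (%x. G (t, x) $ k) y" by (rule moll_eq[symmetric, OF kp]) measurable
   finally show "pdx k (moll (1 / real (Suc n)) (%x. C (t, x))) y = moll (1 / real (Suc n)) (%x. G (t, x) $ k) y" by (simp only: kp_def)
  qed
 qed
qed

section \<open>Growth of the stress\<close>

lemma norm_mat3_le:
 assumes "!!i j. \<bar>(M::mat3) $ i $ j\<bar> <= b" shows "norm M <= 9 * b"
proof -
 have "norm M <= (\<Sum>i\<in>UNIV. norm (M $ i))" unfolding norm_vec_def by (rule L2_set_le_sum) simp
 also have "\<dots> <= (\<Sum>i\<in>(UNIV::3 set). \<Sum>j\<in>(UNIV::3 set). b)"
  by (intro sum_mono order_trans[OF norm_le_l1_cart] assms)
 finally show ?thesis by simp
qed

lemma norm_mat3_mult_le: "norm (A ** B :: mat3) <= 27 * (norm A * norm (B :: mat3))"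
proof -
 have "\<bar>(A ** B) $ i $ j\<bar> <= 3 * (norm A * norm B)" for i j
 proof -
  have "\<bar>(A ** B) $ i $ j\<bar> <= (\<Sum>k\<in>UNIV. \<bar>A $ i $ k * B $ k $ j\<bar>)" unfolding matrix_matrix_mult_def by simp
  also have "\<dots> <= (\<Sum>k\<in>(UNIV::3 set). norm A * norm B)"
   unfolding abs_mult by (intro sum_mono mult_mono abs_entry_le_norm) auto
  finally show ?thesis by simp
 qed
 from norm_mat3_le[OF this] show ?thesis by simp
qed

lemma abs_trace_le: "\<bar>trace (A::mat3)\<bar> <= 3 * norm A"
 unfolding trace_def by (rule order_trans[OF sum_abs]) (use sum_bounded_above[of UNIV "%i. \<bar>A $ i $ i\<bar>" "norm A"] abs_entry_le_norm in auto)

text \<open>The right-hand side of the equation for C without the diffusion term, as a function of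
  the velocity gradient and of C.\<close>

definition stress :: "real => mat3 => mat3 => mat3" where
 "stress a G C = G ** C + C ** transpose G + Phi a (trace C) *R mat 1 - chi a (trace C) *R C"

text \<open>Measure everything by Y with Y^4 = 1 + |G|^2 + |C|^4: then |C| <= Y and |G| <= Y^2, and
  each term is at most a multiple of Y^3, whose power 4/3 is Y^4. So G in L^2 and C in L^4 put the
  stress into L^(4/3). The terms add up to (306 + 12 a) Y^3, which is rounded up.\<close>

lemma stress_bound:
 assumes a: "a >= 0"
 shows "norm (stress a G C) powr (4/3) <= (400 + 400 * a) powr (4/3) * (1 + (norm G)^2 + norm C powr 4)"
proof -
 define X where "X = 1 + (norm G)^2 + norm C powr 4"
 define Y where "Y = X powr (1/4)"
 have X: "X >= 1" by (simp add: X_def)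
 have Y: "Y >= 1" unfolding Y_def using X by (simp add: ge_one_powr_ge_zero)
 have Y4: "Y powr 4 = X" using X by (simp add: Y_def powr_powr del: powr_numeral)
 have C: "norm C <= Y"
 proof -
  have "norm C = (norm C powr 4) powr (1/4)" by (simp add: powr_powr del: powr_numeral)
  also have "\<dots> <= Y" unfolding Y_def by (rule powr_mono2) (auto simp: X_def)
  finally show ?thesis .
 qed
 have G: "norm G <= Y^2"
 proof (rule power2_le_imp_le)
  have "(Y^2)^2 = Y powr 4" using Y by simp
  then show "(norm G)^2 <= (Y^2)^2" using Y4 by (simp add: X_def)
 qed simp
 have GC: "norm G * norm C <= Y ^ 3"
  using mult_mono[OF G C] Y by (simp add: power2_eq_square power3_eq_cube)
 have "norm (transpose G) <= 9 * norm G" by (rule norm_mat3_le) (simp add: transpose_def abs_entry_le_norm)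
 then have CG: "norm C * norm (transpose G) <= 9 * Y ^ 3"
  using mult_left_mono[of "norm (transpose G)" "9 * norm G" "norm C"] GC by (simp add: mult_ac)
 have I: "norm (mat 1 :: mat3) <= 9" using norm_mat3_le[of "mat 1" 1] by (simp add: mat_def)
 have t: "\<bar>trace C\<bar> <= 3 * Y" using abs_trace_le[of C] C by simp
 have Y13: "Y <= Y ^ 3" "1 <= Y ^ 3" "Y^2 <= Y ^ 3" using Y by (auto intro: self_le_power power_increasing one_le_power)
 have aY: "a * 1 <= a * Y ^ 3" "a * Y^2 <= a * Y ^ 3" using mult_left_mono[OF Y13(2) a] mult_left_mono[OF Y13(3) a] by auto
 have P: "norm (Phi a (trace C) *R (mat 1 :: mat3)) <= (3 + a) * Y ^ 3 * 9"
 proof -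
  have "\<bar>Phi a (trace C)\<bar> <= 3 * Y + a" using t a by (simp add: Phi_def)
  also have "\<dots> <= (3 + a) * Y ^ 3" using Y13 aY by (simp add: distrib_right)
  finally show ?thesis using I mult_mono[of "\<bar>Phi a (trace C)\<bar>" "(3 + a) * Y ^ 3" "norm (mat 1 :: mat3)" 9] a Y by simp
 qed
 have Ch: "norm (chi a (trace C) *R C) <= (9 + 3 * a) * Y ^ 3"
 proof -
  have "(trace C)^2 <= (3 * Y)^2" using power_mono[OF t, of 2] by simp
  moreover have "a * \<bar>trace C\<bar> <= a * (3 * Y)" using t a by (intro mult_left_mono) auto
  moreover have "a * Y <= a * Y^2" using a Y by (intro mult_left_mono self_le_power) auto
  ultimately have "chi a (trace C) <= (9 + 3 * a) * Y^2" by (simp add: chi_def power_mult_distrib algebra_simps)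
  moreover have "chi a (trace C) >= 0" using a by (simp add: chi_def)
  ultimately show ?thesis using mult_mono[of "chi a (trace C)" "(9 + 3 * a) * Y^2" "norm C" Y] C a Y
   by (simp add: power2_eq_square power3_eq_cube mult_ac)
 qed
 have "norm (stress a G C) <= norm (G ** C) + norm (C ** transpose G) + norm (Phi a (trace C) *R (mat 1 :: mat3)) + norm (chi a (trace C) *R C)"
  unfolding stress_def by (rule order_trans[OF norm_triangle_ineq4]) (intro add_right_mono order_trans[OF norm_triangle_ineq] norm_triangle_ineq)
 also have "\<dots> <= 27 * Y ^ 3 + 27 * (9 * Y ^ 3) + (3 + a) * Y ^ 3 * 9 + (9 + 3 * a) * Y ^ 3"
  using norm_mat3_mult_le[of G C] norm_mat3_mult_le[of C "transpose G"] GC CG P Ch by linarith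
 also have "\<dots> <= (306 + 12 * a) * Y ^ 3" by (simp add: algebra_simps)
 also have "\<dots> <= (400 + 400 * a) * Y ^ 3" using a Y by (intro mult_right_mono) auto
 finally have "norm (stress a G C) powr (4/3) <= ((400 + 400 * a) * Y ^ 3) powr (4/3)" by (rule powr_mono2[rotated 2]) auto
 also have "\<dots> = (400 + 400 * a) powr (4/3) * (Y powr 3) powr (4/3)" using a Y by (simp add: powr_mult)
 also have "(Y powr 3) powr (4/3) = X" unfolding powr_powr using Y4 by simp
 finally show ?thesis unfolding X_def .
qed

lemma stress_inner:
 "stress a G C <.> C = (G ** C + C ** transpose G) <.> C + ((trace C)^2 + a * trace C) - ((trace C)^2 * (norm C)^2 + a * \<bar>trace C\<bar> * (norm C)^2)"
proof -
 have "(mat 1 :: mat3) <.> C = trace C"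
  by (simp add: inner_vec_def mat_def trace_def sum.delta if_distrib[of "%c. c * _"] cong: if_cong)
 then show ?thesis
  by (simp add: stress_def inner_diff_left inner_add_left Phi_def chi_def power2_norm_eq_inner[symmetric] algebra_simps power2_eq_square)
qed

section \<open>Transfer of the given weak solution to Borel versions\<close>

lemma borel_versionD:
 assumes "borel_version S f g"
 shows "g \<in> BM" "!!z. z \<notin> S ==> g z = 0" "AL z. z \<in> S --> f z = g z"
 using assms by (auto simp: borel_version_def)

lemma AE_fst_neq: "AL z. fst (z :: real \<times> vec3) ~= c"
proof -
 have "AE z in lborel \<Otimes>\<^sub>M lborel. fst (z :: real \<times> vec3) ~= c"
 proof (rule lborel_pair.AE_pair_measure)
  show "AL t. AL x. fst (t, x :: vec3) ~= c" using AE_lborel_singleton[of c] by eventually_elim simp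
 qed measurable
 then show ?thesis unfolding lborel_prod .
qed

lemma H10_approx_exists:
 assumes \<Omega>: "\<Omega> \<in> sets borel" and f: "H10 \<Omega> f G" and v: "AL x. x \<in> \<Omega> --> f x = v x & G x = Gv x" and z: "!!x. x \<notin> \<Omega> ==> v x = 0 & Gv x = 0"
 shows "\<exists>ph. H10_approx \<Omega> ph v Gv"
proof -
 obtain ph where ph: "!!n. Cc_inf \<Omega> (ph n)"
  and l: "(%n. \<integral>\<^sup>+x. ennreal ((norm (ph n x - f x))^2 + (norm (gradv (ph n) x - G x))^2) \<partial>lebesgue_on \<Omega>) ~> 0"
  using f unfolding H10_def by blast
 have "(\<integral>\<^sup>+x. ennreal ((norm (ph n x - f x))^2 + (norm (gradv (ph n) x - G x))^2) \<partial>lebesgue_on \<Omega>)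
  = (NNL x. ennreal ((norm (ph n x - v x))^2 + (norm (gradv (ph n) x - Gv x))^2))" for n
 proof (rule nn_integral_lebesgue_on_borel[OF \<Omega>])
  show "AL x. x \<in> \<Omega> --> ennreal ((norm (ph n x - f x))^2 + (norm (gradv (ph n) x - G x))^2) = ennreal ((norm (ph n x - v x))^2 + (norm (gradv (ph n) x - Gv x))^2)"
   using v by eventually_elim auto
  fix x assume x: "x \<notin> \<Omega>"
  obtain K where K: "compact K" "K \<subseteq> \<Omega>" "!!x. x \<notin> K ==> ph n x = 0" using ph[of n] unfolding Cc_inf_def by blast
  have "pdx j (ph n) x = 0" for j
  proof -
   have op: "open ((%s. x + s *R (axis j 1 :: vec3)) -` (- K))"
    using K(1) by (intro open_vimage open_Compl compact_imp_closed continuous_intros) auto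
   have "((%s. ph n (x + s *R axis j 1)) has_vector_derivative 0) (at 0)"
    by (rule has_vector_derivative_transform_within_open[of "%_. 0", OF _ op]) (use K x in auto)
   then show ?thesis unfolding pdx_def by (rule vector_derivative_at)
  qed
  then have "gradv (ph n) x = 0" by (simp add: gradv_def vec_eq_iff)
  moreover have "ph n x = 0" using K x by blast
  ultimately show "ennreal ((norm (ph n x - v x))^2 + (norm (gradv (ph n) x - Gv x))^2) = 0" using z[OF x] by simp
 qed
 then show ?thesis using ph l unfolding H10_approx_def by auto
qed

lemma LsLr_borel_version:
 fixes f :: "real => vec3 => mat3" and g :: "real \<times> vec3 => mat3"
 assumes \<Omega>: "\<Omega> \<in> sets borel" and f: "LsLr \<Omega> T s r f" and g: "borel_version ({0<..<T} \<times> \<Omega>) (%(t, x). f t x) g" and p: "s > 0" "r > 0"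
 shows "(NNL t. enn_pow (NNL x. ennreal (norm (g (t, x)) powr r)) (s / r)) < \<infinity>"
proof -
 note [measurable] = borel_versionD(1)[OF g]
 have g0: "g (t, x) = 0" if "t \<notin> {0<..<T} \<or> x \<notin> \<Omega>" for t x using borel_versionD(2)[OF g] that by auto
 define h where "h t = (LINT x:\<Omega>|lebesgue. norm (f t x) powr r) powr (s / r)" for t
 have ih: "integrable (lebesgue_on {0<..<T}) h" using f by (simp add: LsLr_def h_def[abs_def])
 have i: "AL t. t \<in> {0<..<T} --> integrable (lebesgue_on \<Omega>) (%x. norm (f t x) powr r)"
  using f by (intro AE_lebesgue_on_borel) (auto simp: LsLr_def)
 have ae: "AL t. AL x. t \<in> {0<..<T} --> x \<in> \<Omega> --> f t x = g (t, x)"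
  using AE_slices[OF borel_versionD(3)[OF g]]
 proof eventually_elim
  case (elim t) then show ?case by eventually_elim auto
 qed
 have m: "(%x. g (t, x)) \<in> BM" for t
 proof -
  have [measurable]: "g \<in> BM2" using borel_versionD(1)[OF g] by (simp add: borel_prod)
  show ?thesis by measurable
 qed
 have "(\<integral>\<^sup>+t. ennreal \<bar>h t\<bar> \<partial>lebesgue_on {0<..<T}) = (NNL t. enn_pow (NNL x. ennreal (norm (g (t, x)) powr r)) (s / r))"
 proof (rule nn_integral_lebesgue_on_borel)
  show "AL t. t \<in> {0<..<T} --> ennreal \<bar>h t\<bar> = enn_pow (NNL x. ennreal (norm (g (t, x)) powr r)) (s / r)"
   using i ae
  proof eventually_elim
   case (elim t)
   show ?case
   proof
    assume t: "t \<in> {0<..<T}"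
    have mt: "(%x. norm (g (t, x)) powr r) \<in> BM" using m[of t] by measurable
    have gx: "AL x. x \<in> \<Omega> --> norm (f t x) powr r = norm (g (t, x)) powr r" using elim(2) by eventually_elim (use t in auto)
    have e: "AL x. indicator \<Omega> x *R (norm (f t x) powr r) = norm (g (t, x)) powr r"
     using gx by eventually_elim (use g0 p in \<open>auto simp: indicator_def\<close>)
    have "integrable lebesgue (%x. indicator \<Omega> x *R (norm (f t x) powr r))"
     using elim(1) t \<Omega> by (subst (asm) integrable_restrict_space) (auto intro: sets_completionI_sets)
    then have ig: "IL (%x. norm (g (t, x)) powr r)" using lebesgue_integral_AE_eq(2)[OF mt e] by simp
    have "(LINT x:\<Omega>|lebesgue. norm (f t x) powr r) = (LBINT x. norm (g (t, x)) powr r)"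
     by (rule set_lebesgue_integral_borel[OF mt _ gx]) (use g0 p in auto)
    moreover have "(NNL x. ennreal (norm (g (t, x)) powr r)) = ennreal (LBINT x. norm (g (t, x)) powr r)"
     by (rule nn_integral_eq_integral[OF ig]) simp
    ultimately show "ennreal \<bar>h t\<bar> = enn_pow (NNL x. ennreal (norm (g (t, x)) powr r)) (s / r)"
     by (simp add: h_def enn_pow_def)
   qed
  qed
  show "enn_pow (NNL x. ennreal (norm (g (t, x)) powr r)) (s / r) = 0" if "t \<notin> {0<..<T}" for t
   using g0 that p by (simp add: enn_pow_def)
 qed auto
 then show ?thesis using ih by (simp add: integrable_iff_bounded)
qed

text \<open>On the compact interval [0,T] weak continuity bounds each single pairing; uniform
  boundedness turns this into one bound for all norms. It places the velocity in L^\<infinity>(0,T;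
  L^2).\<close>

lemma Cw_L2_bounded:
 fixes w :: "real => vec3 => vec3"
 assumes m: "!!t. 0 <= t ==> t <= T ==> w t \<in> BM" and w2: "!!t. 0 <= t ==> t <= T ==> (NNL x. nsq (w t x)) < \<infinity>"
  and c: "!!g. g \<in> BM ==> (NNL x. nsq (g x)) < \<infinity> ==> continuous_on {0..T} (%t. LBINT x. w t x <.> g x)"
 obtains A where "A >= 0" "!!t. 0 <= t ==> t <= T ==> (NNL x. nsq (w t x)) <= ennreal A"
proof -
 have i: "IL (%x. (norm (w t x))^2)" if "t \<in> {0..T}" for t
  using m[of t] w2[of t] that by (simp add: integrable_iff_bounded)
 have "\<exists>B. \<forall>t\<in>{0..T}. (LBINT x. (norm (w t x))^2) <= B"
 proof (rule uniform_boundedness_L2[OF _ i])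
  show "w t \<in> borel_measurable lborel" if "t \<in> {0..T}" for t using m that by simp
  fix g :: "vec3 => vec3" assume g: "g \<in> borel_measurable lborel" "IL (%x. (norm (g x))^2)"
  have "continuous_on {0..T} (%t. LBINT x. w t x <.> g x)" by (rule c) (use g in \<open>auto simp: integrable_iff_bounded\<close>)
  then have "bounded ((%t. LBINT x. w t x <.> g x) ` {0..T})" by (intro compact_imp_bounded compact_continuous_image compact_Icc)
  then show "\<exists>B. \<forall>t\<in>{0..T}. \<bar>\<integral>x. w t x <.> g x \<partial>lborel\<bar> <= B" by (simp add: bounded_iff)
 qed
 then obtain B where B: "!!t. t \<in> {0..T} ==> (LBINT x. (norm (w t x))^2) <= B" by blast
 have "(NNL x. nsq (w t x)) <= ennreal (max B 0)" if "0 <= t" "t <= T" for t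
  using nn_integral_eq_integral[OF i[of t]] B[of t] that by (auto simp: max_def intro!: ennreal_leI intro: order_trans)
 then show ?thesis using that[of "max B 0"] by simp
qed


theorem mainTheorem4:
  fixes \<Omega> :: "vec3 set" and \<beta> T \<eta> \<epsilon> a s r :: real
    and u0 :: "vec3 \<Rightarrow> vec3" and C0 :: "vec3 \<Rightarrow> mat3"
    and u :: "real \<Rightarrow> vec3 \<Rightarrow> vec3" and C :: "real \<Rightarrow> vec3 \<Rightarrow> mat3"
    and Gu :: "real \<Rightarrow> vec3 \<Rightarrow> mat3" and GC :: "real \<Rightarrow> vec3 \<Rightarrow> mat3^3"
  assumes "0 < \<beta>" "\<beta> < 1" "C2beta_domain \<beta> \<Omega>"
    and "T > 0" "\<eta> > 0" "\<epsilon> > 0" "a \<ge> 0"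
    and "peterlin_weak_solution \<Omega> T \<eta> \<epsilon> a u0 C0 u C Gu GC"
    and "\<forall>i j. (\<lambda>x. C0 x $ i $ j) \<in> W_half_43_n \<Omega>"
    and "LsLr \<Omega> T s r C"
    and "2 / s + 3 / r \<le> 1" "2 < s" "3 < r"
  shows "AE \<tau> in lborel. \<tau> \<in> {0<..T} \<longrightarrow>
    (LINT x:\<Omega>|lebesgue. (1/2) * (norm (C \<tau> x))\<^sup>2)
    + (LINT z:{0<..<\<tau>} \<times> \<Omega>|lebesgue. (case z of (t,x) \<Rightarrow>
         \<epsilon> * (norm (GC t x))\<^sup>2 + (trace (C t x))\<^sup>2 * (norm (C t x))\<^sup>2
         + a * \<bar>trace (C t x)\<bar> * (norm (C t x))\<^sup>2))
    = (LINT x:\<Omega>|lebesgue. (1/2) * (norm (C0 x))\<^sup>2)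
    + (LINT z:{0<..<\<tau>} \<times> \<Omega>|lebesgue. (case z of (t,x) \<Rightarrow>
         (trace (C t x))\<^sup>2 + a * trace (C t x)))
    + (LINT z:{0<..<\<tau>} \<times> \<Omega>|lebesgue. (case z of (t,x) \<Rightarrow>
         (Gu t x ** C t x + C t x ** transpose (Gu t x)) \<bullet> C t x))"
proof -
 note dom = assms(3) and T = assms(4) and a = assms(7) and sol = assms(8)[unfolded peterlin_weak_solution_def] and Ls = assms(10)
 have r: "r > 3" and s: "s > 2" by fact+
 define Q where "Q = {0<..<T} \<times> \<Omega>"
 have OQ: "OmT \<Omega> T = Q" by (simp add: OmT_def Q_def)
 have \<Omega>: "open \<Omega>" "bounded \<Omega>" "\<Omega> \<in> sets borel" using dom by (auto simp: C2beta_domain_def)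
 have Qb: "Q \<in> sets borel" "emeasure lborel Q < \<infinity>"
 proof -
  show "Q \<in> sets borel" unfolding Q_def using \<Omega> by (intro borel_open open_Times) auto
  show "emeasure lborel Q < \<infinity>" unfolding Q_def using \<Omega> by (intro emeasure_bounded_finite bounded_Times) auto
 qed
 have Lp: "Lp_on Q 2 (%(t, x). u t x)" "Lp_on Q 2 (%(t, x). Gu t x)" "Lp_on Q 2 (%(t, x). C t x)" "Lp_on Q 2 (%(t, x). GC t x)" "Lp_on Q 4 (%(t, x). C t x)"
  and Cw: "Cw_L2 \<Omega> T u" "Cw_L2 \<Omega> T C" and H10: "AE t in lebesgue_on {0<..<T}. H10 \<Omega> (u t) (Gu t)"
  and tr0: "AE z in lebesgue_on Q. trace (Gu (fst z) (snd z)) = 0" and init: "AE x in lebesgue_on \<Omega>. C 0 x = C0 x"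
  and wdC: "!!i j k. weak_dx \<Omega> T (%t x. C t x $ i $ j) (%t x. GC t x $ k $ i $ j) k"
  using sol unfolding OQ by blast+
 have weq: "(LINT z:Q|lebesgue. (case z of (t,x) => - (C t x <.> dt ps t x) + ((\<Sum>k\<in>UNIV. u t x $ k *R GC t x $ k) <.> ps t x)
      - (stress a (Gu t x) (C t x) <.> ps t x) + \<epsilon> * (GC t x <.> gradm (ps t) x))) = (LINT x:\<Omega>|lebesgue. C0 x <.> ps 0 x)"
  if "testfn ({..<T} \<times> UNIV) ps" for ps
  using sol that unfolding OQ stress_def by blast
 \<comment> \<open>Two kinds of versions are kept: one per field on the cylinder, for Fubini, and
   the time-wise versions \<open>uw\<close> and \<open>cw\<close>, for the values at a single time.
   Both agree almost everywhere in space for almost every time.\<close>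
 obtain u' where u': "borel_version Q (%(t, x). u t x) u'" by (rule borel_version_exists[OF Qb(1)]) (use Lp(1) in \<open>auto simp: Lp_on_def\<close>)
 obtain G' where G': "borel_version Q (%(t, x). Gu t x) G'" by (rule borel_version_exists[OF Qb(1)]) (use Lp(2) in \<open>auto simp: Lp_on_def\<close>)
 obtain C' where C': "borel_version Q (%(t, x). C t x) C'" by (rule borel_version_exists[OF Qb(1)]) (use Lp(3) in \<open>auto simp: Lp_on_def\<close>)
 obtain D' where D': "borel_version Q (%(t, x). GC t x) D'" by (rule borel_version_exists[OF Qb(1)]) (use Lp(4) in \<open>auto simp: Lp_on_def\<close>)
 obtain uw where uw: "!!t. 0 <= t ==> t <= T ==> borel_version \<Omega> (u t) (uw t)" "!!t x. x \<notin> \<Omega> ==> uw t x = 0"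
  "!!t. 0 <= t ==> t <= T ==> (NNL x. nsq (uw t x)) < \<infinity>"
  "!!g. g \<in> BM ==> (NNL x. nsq (g x)) < \<infinity> ==> continuous_on {0..T} (%t. LBINT x. uw t x <.> g x)"
  using Cw_L2_version[OF \<Omega>(3) Cw(1)] by blast
 obtain cw where cw: "!!t. 0 <= t ==> t <= T ==> borel_version \<Omega> (C t) (cw t)" "!!t x. x \<notin> \<Omega> ==> cw t x = 0"
  "!!t. 0 <= t ==> t <= T ==> (NNL x. nsq (cw t x)) < \<infinity>"
  "!!g. g \<in> BM ==> (NNL x. nsq (g x)) < \<infinity> ==> continuous_on {0..T} (%t. LBINT x. cw t x <.> g x)"
  using Cw_L2_version[OF \<Omega>(3) Cw(2)] by blast
 have muw: "uw t \<in> BM" and mcw: "cw t \<in> BM" if "0 <= t" "t <= T" for t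
  using borel_versionD(1)[OF uw(1)[OF that]] borel_versionD(1)[OF cw(1)[OF that]] by auto
 note [measurable] = borel_versionD(1)[OF u'] borel_versionD(1)[OF G'] borel_versionD(1)[OF C'] borel_versionD(1)[OF D'] Qb(1)
 have mp[measurable]: "u' \<in> BM2" "G' \<in> BM2" "C' \<in> BM2" "D' \<in> BM2"
  by (simp_all add: borel_prod)
 note z0 = borel_versionD(2)[OF u'] borel_versionD(2)[OF G'] borel_versionD(2)[OF C'] borel_versionD(2)[OF D']
 have tm[measurable]: "(%x. trace (N x)) \<in> borel_measurable M" if [measurable]: "N \<in> borel_measurable M" for N :: "real \<times> vec3 => mat3" and M
  unfolding trace_def by measurable
 have mm[measurable]: "(%x. N x ** N' x) \<in> BM" if "N \<in> BM" "N' \<in> BM" for N N' :: "real \<times> vec3 => mat3"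
 proof (rule borel_measurable_continuous_Pair[OF that])
  show "CU (%x. fst x ** (snd x :: mat3) :: mat3)"
   unfolding matrix_matrix_mult_def by (intro continuous_intros)
 qed
 have mt[measurable]: "(%x. transpose (N x)) \<in> BM" if N: "N \<in> BM" for N :: "real \<times> vec3 => mat3"
 proof -
  have "CU (%A::mat3. transpose A)" unfolding transpose_def by (intro continuous_intros)
  from measurable_compose[OF N borel_measurable_continuous_onI[OF this]] show ?thesis .
 qed
 have aeQ: "AL z. z \<in> Q --> u (fst z) (snd z) = u' z & Gu (fst z) (snd z) = G' z & C (fst z) (snd z) = C' z & GC (fst z) (snd z) = D' z"
  using borel_versionD(3)[OF u'] borel_versionD(3)[OF G'] borel_versionD(3)[OF C'] borel_versionD(3)[OF D'] by eventually_elim (auto simp: case_prod_beta)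
 have aes: "AL t. AL x. (t, x) \<in> Q --> u t x = u' (t, x) & Gu t x = G' (t, x) & C t x = C' (t, x) & GC t x = D' (t, x)"
  using AE_slices[OF aeQ] by simp
 \<comment> \<open>Cut off explicitly, because \<open>stress\<close> at (0, 0) is a times the
   identity matrix and does not vanish off the cylinder by itself.\<close>
 define F where "F z = (if z \<in> Q then stress a (G' z) (C' z) else 0)" for z
 have mF: "F \<in> BM"
  unfolding F_def[abs_def] stress_def Phi_def chi_def by measurable
 have fin: "(NNL z. nsq (u' z)) < \<infinity>" "(NNL z. nsq (G' z)) < \<infinity>"
  "(NNL z. nsq (D' z)) < \<infinity>" "(NNL z. ennreal (norm (C' z) powr 4)) < \<infinity>"
  using borel_version_Lp[OF Qb(1) u' _ Lp(1)] borel_version_Lp[OF Qb(1) G' _ Lp(2)] borel_version_Lp[OF Qb(1) D' _ Lp(4)] borel_version_Lp[OF Qb(1) C' _ Lp(5)] by simp_all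
 have F43: "(NNL z. ennreal (norm (F z) powr (4/3))) < \<infinity>"
 proof -
  define c where "c = (400 + 400 * a) powr (4/3)"
  have "ennreal (norm (F z) powr (4/3)) <= ennreal c * (indicator Q z + (nsq (G' z) + ennreal (norm (C' z) powr 4)))" for z
  proof (cases "z \<in> Q")
   case True
   have "ennreal (norm (F z) powr (4/3)) <= ennreal (c * (1 + (norm (G' z))^2 + norm (C' z) powr 4))"
    using stress_bound[OF a, of "G' z" "C' z"] True by (intro ennreal_leI) (simp add: F_def c_def)
   also have "\<dots> = ennreal c * (ennreal 1 + (nsq (G' z) + ennreal (norm (C' z) powr 4)))"
    by (subst ennreal_plus[symmetric], simp, simp, subst ennreal_plus[symmetric], simp, simp, subst ennreal_mult[symmetric]) (auto simp: c_def add.assoc)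
   finally show ?thesis using True by simp
  qed (simp add: F_def)
  then have "(NNL z. ennreal (norm (F z) powr (4/3))) <= (NNL z. ennreal c * (indicator Q z + (nsq (G' z) + ennreal (norm (C' z) powr 4))))"
   by (intro nn_integral_mono) auto
  also have "\<dots> = ennreal c * (emeasure lborel Q + ((NNL z. nsq (G' z)) + (NNL z. ennreal (norm (C' z) powr 4))))"
   by (subst nn_integral_cmult, measurable, subst nn_integral_add, measurable, subst nn_integral_add) auto
  also have "\<dots> < \<infinity>" using fin Qb(2) by (auto simp: ennreal_mult_less_top less_top)
  finally show ?thesis .
 qed
 obtain A where A: "A >= 0" "!!t. 0 <= t ==> t <= T ==> (NNL x. nsq (uw t x)) <= ennreal A"
  by (rule Cw_L2_bounded[OF muw uw(3,4)]) auto
 have Ab: "AL t. 0 < t & t < T --> (NNL x. nsq (u' (t, x))) <= ennreal A"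
  using aes
 proof eventually_elim
  case (elim t)
  show ?case
  proof
   assume t: "0 < t & t < T"
   have "AL x. x \<in> \<Omega> --> u t x = uw t x" by (rule borel_versionD(3)[OF uw(1)]) (use t in auto)
   with elim have e: "AL x. nsq (u' (t, x)) = nsq (uw t x)"
   proof eventually_elim
    case (elim x)
    show ?case
    proof (cases "x \<in> \<Omega>")
     case True then show ?thesis using elim t by (simp add: Q_def)
    next
     case False then show ?thesis using z0(1)[of "(t, x)"] uw(2)[of x t] by (simp add: Q_def)
    qed
   qed
   show "(NNL x. nsq (u' (t, x))) <= ennreal A" unfolding nn_integral_cong_AE[OF e] using A(2)[of t] t by simp
  qed
 qed
 have H10': "AL t. t \<in> {0<..<T} --> H10 \<Omega> (u t) (Gu t)" by (rule AE_lebesgue_on_borel[OF _ H10]) simp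
 have ap: "AL t. 0 < t & t < T --> (\<exists>ph. H10_approx \<Omega> ph (%x. u' (t, x)) (%x. G' (t, x)))"
  using H10' aes
 proof eventually_elim
  case (elim t)
  show ?case
  proof
   assume t: "0 < t & t < T"
   show "\<exists>ph. H10_approx \<Omega> ph (%x. u' (t, x)) (%x. G' (t, x))"
   proof (rule H10_approx_exists[OF \<Omega>(3)])
    show "H10 \<Omega> (u t) (Gu t)" using elim(1) t by simp
    show "AL x. x \<in> \<Omega> --> u t x = u' (t, x) & Gu t x = G' (t, x)" using elim(2) by eventually_elim (use t in \<open>auto simp: Q_def\<close>)
   qed (auto simp: Q_def intro!: z0)
  qed
 qed
 have "AL z. trace (G' z) = 0"
  using AE_lebesgue_on_borel[OF Qb(1) tr0] aeQ
 proof eventually_elim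
  case (elim z) then show ?case using z0(2)[of z] by (cases "z \<in> Q") (auto simp: trace_def)
 qed
 from AE_slices[OF this] have tr: "AL t. 0 < t & t < T --> (AL x. trace (G' (t, x)) = 0)" by eventually_elim simp
 have iC: "IL C'" by (rule integrable_Lp_bounded_support[where A=Q and p=4]) (use fin Qb z0 in auto)
 have iD: "IL D'" by (rule integrable_Lp_bounded_support[where A=Q and p=2]) (use fin Qb z0 in auto)
 have wg: "AL t. 0 < t & t < T --> weak_grad \<Omega> (%x. C' (t, x)) (%x. D' (t, x))"
 proof (rule weak_grad_slices[OF \<Omega>(1) iC iD])
  fix i j k :: 3 and th :: "real => vec3 => real" assume tf: "testfn ({0<..<T} \<times> \<Omega>) th"
  have Ci: "Cinf_on UNIV (%(t, x). th t x)" using tf by (simp add: testfn_def Cc_inf_def)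
  obtain g where g: "dirderiv (0, axis k 1) (%(t, x). th t x) g" "CU g"
   by (rule Cinf_dirderiv[OF Ci, of "(0, axis k 1)"]) (auto simp: Basis_prod_def axis_in_Basis_iff)
  have pg: "pdx k (th (fst z)) (snd z) = g z" for z
  proof -
   have "((%s. th (fst z) (snd z + s *R axis k 1)) has_vector_derivative g z) (at 0)"
    using g(1)[unfolded dirderiv_def, rule_format, of z] by (simp add: case_prod_beta)
   then show ?thesis unfolding pdx_def by (rule vector_derivative_at)
  qed
  have [measurable]: "g \<in> BM" using g(2) by (rule borel_measurable_continuous_onI)
  have "(%z. th (fst z) (snd z)) \<in> BM" using measurable_Cinf[OF Ci] by (simp add: case_prod_beta')
  note [measurable] = this
  have "(LINT z:Q|lebesgue. (case z of (t,x) => C t x $ i $ j * pdx k (th t) x)) = (LBINT z. C' z $ i $ j * pdx k (th (fst z)) (snd z))"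
   by (rule set_lebesgue_integral_borel) (use z0 in \<open>auto simp: pg case_prod_beta intro!: eventually_mono[OF aeQ]\<close>)
  moreover have "(LINT z:Q|lebesgue. (case z of (t,x) => GC t x $ k $ i $ j * th t x)) = (LBINT z. D' z $ k $ i $ j * th (fst z) (snd z))"
   by (rule set_lebesgue_integral_borel) (use z0 in \<open>auto simp: case_prod_beta intro!: eventually_mono[OF aeQ]\<close>)
  ultimately show "(LBINT z. C' z $ i $ j * pdx k (th (fst z)) (snd z)) = - (LBINT z. D' z $ k $ i $ j * th (fst z) (snd z))"
   using wdC[of i j k] tf unfolding weak_dx_def OQ Q_def by auto
 qed
 have cwC: "AL t. 0 < t & t < T --> (AL x. cw t x = C' (t, x))"
  using aes
 proof eventually_elim
  case (elim t)
  show ?case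
  proof
   assume t: "0 < t & t < T"
   have "AL x. x \<in> \<Omega> --> C t x = cw t x" by (rule borel_versionD(3)[OF cw(1)]) (use t in auto)
   with elim show "AL x. cw t x = C' (t, x)"
   proof eventually_elim
    case (elim x)
    show ?case
    proof (cases "x \<in> \<Omega>")
     case True then show ?thesis using elim t by (simp add: Q_def)
    next
     case False then show ?thesis using z0(3)[of "(t, x)"] cw(2)[of x t] by (simp add: Q_def)
    qed
   qed
  qed
 qed
 have ls: "(NNL t. enn_pow (NNL x. ennreal (norm (C' (t, x)) powr r)) (s / r)) < \<infinity>"
  by (rule LsLr_borel_version[OF \<Omega>(3) Ls C'[unfolded Q_def]]) (use r s in auto)
 interpret D: regular_data \<beta> \<Omega> T \<epsilon> s r A u' G' C' F D' cw
  by unfold_locales (fact dom T r s assms(11) borel_versionD(1)[OF u'] borel_versionD(1)[OF G'] borel_versionD(1)[OF C'] mF borel_versionD(1)[OF D'] A(1) Ab fin F43 ls ap tr wg mcw cw(2-4) cwC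
   | (insert z0, simp add: Q_def F_def; fail))+
 interpret R: regular_solution \<beta> \<Omega> T \<epsilon> s r A u' G' C' F D' cw
 proof unfold_locales
  fix th th' :: "real => real" and w :: "vec3 => mat3"
  assume th: "Cc_inf {..<T} th" and d: "!!t. (th has_real_derivative th' t) (at t)" and c: "CU th'" and w: "Cc_inf UNIV w"
  have W: "Cinf_on UNIV w" using w by (rule Cc_inf_Cinf)
  obtain L where L: "!!x. norm x > L ==> w x = 0" using w by (rule Cc_infE) blast
  have cwn: "CU w" by (rule Cinf_continuous[OF W])
  have cth: "CU th" by (rule Cinf_continuous[OF Cc_inf_Cinf[OF th]])
  have [measurable]: "w \<in> BM" "th \<in> BM" "th' \<in> BM"
   using cwn cth c by (auto intro: borel_measurable_continuous_onI)
  have "(%z::real \<times> vec3. w (snd z)) \<in> BM2" "(%z::real \<times> vec3. th (fst z)) \<in> BM2" "(%z::real \<times> vec3. th' (fst z)) \<in> BM2" by measurable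
  then have [measurable]: "(%z::real \<times> vec3. w (snd z)) \<in> BM" "(%z::real \<times> vec3. th (fst z)) \<in> BM" "(%z::real \<times> vec3. th' (fst z)) \<in> BM"
   by (simp_all add: borel_prod)
  have dtps: "dt (%t x. th t *R w x) t x = th' t *R w x" for t x
   unfolding dt_def using has_vector_derivative_scaleR[OF d has_vector_derivative_const[of "w x"]] by (intro vector_derivative_at) simp
  have gps: "gradm (%x. th t *R w x) x = (\<chi> k. th t *R pdx k w x)" for t x
  proof -
   have "pdx k (%x. th t *R w x) x = th t *R pdx k w x" for k
   proof -
    have "((%s. w (x + s *R axis k 1)) has_vector_derivative pdx k w x) (at 0)" using Cinf_pdx(1)[OF W, of k] by (simp add: dirderiv_def)
    from has_vector_derivative_scaleR[OF DERIV_const[of "th t"] this] show ?thesis unfolding pdx_def[of k "%x. th t *R w x"]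
     by (intro vector_derivative_at) simp
   qed
   then show ?thesis by (simp add: gradm_def)
  qed
  \<comment> \<open>Bounds on [-T, T] suffice for th and its derivative, since they are multiplied
    by fields that vanish off the cylinder.\<close>
  obtain M where M: "!!t. norm t <= T ==> norm (th' t) <= M" using continuous_bounded_cball[OF c] by blast
  obtain N where N: "!!t. norm t <= T ==> norm (th t) <= N" using continuous_bounded_cball[OF cth] by blast
  have i1: "IL (%z. (C' z <.> w (snd z)) * th' (fst z))"
  proof -
   have "IL (%z. C' z <.> w (snd z))" by (rule integrable_inner_continuous[OF \<Omega>(2) iC _ cwn]) (auto simp: Q_def intro!: z0)
   moreover have "norm (th' (fst z)) <= M" if "C' z <.> w (snd z) ~= 0" for z
   proof -
    have "z \<in> Q" by (rule ccontr) (use that z0(3)[of z] in simp)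
    then show ?thesis by (intro M) (auto simp: Q_def)
   qed
   ultimately show ?thesis using integrable_inner_bounded[of lborel "%z. C' z <.> w (snd z)" "%z. th' (fst z)" M] by simp
  qed
  have i2: "IL (%z. D.bw w z * th (fst z))"
  proof -
   have b0: "D.bw w z = 0" if "z \<notin> Q" for z using that by (simp add: D.bw_def D.tp0 D.F0 D.GC0 Q_def)
   have "norm (th (fst z)) <= N" if "D.bw w z ~= 0" for z
   proof -
    have "z \<in> Q" by (rule ccontr) (use that b0[of z] in simp)
    then show ?thesis by (intro N) (auto simp: Q_def)
   qed
   then show ?thesis using integrable_inner_bounded[OF D.int_bw[OF w], of "%z. th (fst z)" N] by simp
  qed
  define H where "H z = - ((C' z <.> w (snd z)) * th' (fst z)) + D.bw w z * th (fst z)" for z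
  have "(LINT z:Q|lebesgue. (case z of (t,x) => - (C t x <.> dt (%t x. th t *R w x) t x) + ((\<Sum>k\<in>UNIV. u t x $ k *R GC t x $ k) <.> (th t *R w x))
      - (stress a (Gu t x) (C t x) <.> (th t *R w x)) + \<epsilon> * (GC t x <.> gradm (%x. th t *R w x) x))) = (LBINT z. H z)"
  proof (rule set_lebesgue_integral_borel)
   have "IL H" unfolding H_def[abs_def] using i1 i2 by auto
   then show "H \<in> BM" by auto
   show "H z = 0" if "z \<notin> Q" for z using that z0 by (simp add: H_def D.bw_def D.tp0 D.F0 D.GC0 Q_def)
   show "AL z. z \<in> Q --> (case z of (t,x) => - (C t x <.> dt (%t x. th t *R w x) t x) + ((\<Sum>k\<in>UNIV. u t x $ k *R GC t x $ k) <.> (th t *R w x))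
      - (stress a (Gu t x) (C t x) <.> (th t *R w x)) + \<epsilon> * (GC t x <.> gradm (%x. th t *R w x) x)) = H z"
    using aeQ
   proof eventually_elim
    case (elim z)
    have "v <.> (\<chi> k. c *R pdx k w x) = c * (\<Sum>k\<in>UNIV. v $ k <.> pdx k w x)" for v :: "mat3^3" and c x
     by (simp add: inner_vec_def[of v] sum_distrib_left)
    note v = this
    show ?case
    proof
     assume z: "z \<in> Q"
     have e: "u (fst z) (snd z) = u' z" "Gu (fst z) (snd z) = G' z" "C (fst z) (snd z) = C' z" "GC (fst z) (snd z) = D' z" using elim z by auto
     have tp: "(\<Sum>k\<in>UNIV. u' z $ k *R D' z $ k) = D.tp z" by (simp only: D.tp_def)
     have "(case z of (t,x) => - (C t x <.> dt (%t x. th t *R w x) t x) + ((\<Sum>k\<in>UNIV. u t x $ k *R GC t x $ k) <.> (th t *R w x))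
      - (stress a (Gu t x) (C t x) <.> (th t *R w x)) + \<epsilon> * (GC t x <.> gradm (%x. th t *R w x) x))
      = - (th' (fst z) * (C' z <.> w (snd z))) + th (fst z) * (D.tp z <.> w (snd z)) - th (fst z) * (F z <.> w (snd z))
       + \<epsilon> * (th (fst z) * (\<Sum>k\<in>UNIV. D' z $ k <.> pdx k w (snd z)))"
      unfolding case_prod_beta e dtps gps tp v inner_scaleR_right using z by (simp only: F_def if_True)
     then show "(case z of (t,x) => - (C t x <.> dt (%t x. th t *R w x) t x) + ((\<Sum>k\<in>UNIV. u t x $ k *R GC t x $ k) <.> (th t *R w x))
      - (stress a (Gu t x) (C t x) <.> (th t *R w x)) + \<epsilon> * (GC t x <.> gradm (%x. th t *R w x) x)) = H z"
      by (simp only: H_def D.bw_def inner_diff_left distrib_right left_diff_distrib) (simp only: mult_ac diff_conv_add_uminus add_ac)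
    qed
   qed
  qed
  moreover have "(LINT x:\<Omega>|lebesgue. C0 x <.> (th 0 *R w x)) = (LBINT x. cw 0 x <.> (th 0 *R w x))"
  proof (rule set_lebesgue_integral_borel)
   have [measurable]: "cw 0 \<in> BM" using mcw T by simp
   show "(%x. cw 0 x <.> (th 0 *R w x)) \<in> BM" by measurable
   show "AL x. x \<in> \<Omega> --> C0 x <.> (th 0 *R w x) = cw 0 x <.> (th 0 *R w x)"
    using AE_lebesgue_on_borel[OF \<Omega>(3) init] borel_versionD(3)[OF cw(1)[of 0]] T by (auto elim!: eventually_elim2)
  qed (simp add: cw(2))
  ultimately have e: "(LBINT z. H z) = (LBINT x. cw 0 x <.> w x) * th 0"
   using weq[OF testfn_product[OF th w]] by (simp add: mult.commute)
  have "(LBINT z. H z) = - (LBINT z. (C' z <.> w (snd z)) * th' (fst z)) + (LBINT z. D.bw w z * th (fst z))"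
   unfolding H_def using i1 i2 by simp
  also have "(LBINT z. D.bw w z * th (fst z)) = (LBINT t. (LBINT x. D.bw w (t, x)) * th t)"
   using integral_slices(1)[OF i2] by simp
  also have "(LBINT z. (C' z <.> w (snd z)) * th' (fst z)) = (LBINT t. (LBINT x. C' (t, x) <.> w x) * th' t)"
   using integral_slices(1)[OF i1] by simp
  also have "\<dots> = (LBINT t. indicator {0<..<T} t * ((LBINT x. cw t x <.> w x) * th' t))"
  proof (rule integral_cong_AE)
   show "(%t. (LBINT x. C' (t, x) <.> w x) * th' t) \<in> borel_measurable lborel" by measurable
   have "IL (%x. (norm (w x))^2)"
    by (rule continuous_compact_support_integrable[where R=L]) (use L cwn in \<open>auto intro!: continuous_intros\<close>)
   then have "continuous_on {0..T} (%t. LBINT x. cw t x <.> w x)" by (intro cw(4)) (auto simp: integrable_iff_bounded)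
   then have "continuous_on {0<..<T} (%t. LBINT x. cw t x <.> w x)" by (rule continuous_on_subset) auto
   from continuous_on_mult[OF this continuous_on_subset[OF c subset_UNIV]]
   have "continuous_on {0<..<T} (%t. (LBINT x. cw t x <.> w x) * th' t)" .
   from borel_measurable_continuous_on_indicator[OF _ this]
   show "(%t. indicator {0<..<T} t * ((LBINT x. cw t x <.> w x) * th' t)) \<in> borel_measurable lborel" by simp
   show "AL t. (LBINT x. C' (t, x) <.> w x) * th' t = indicator {0<..<T} t * ((LBINT x. cw t x <.> w x) * th' t)"
    using cwC
   proof eventually_elim
    case (elim t)
    show ?case
    proof (cases "0 < t & t < T")
     case True
     have [measurable]: "cw t \<in> BM" using mcw True by simp
     have ct: "AL x. cw t x = C' (t, x)" using elim True by blast
     have "(LBINT x. C' (t, x) <.> w x) = (LBINT x. cw t x <.> w x)"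
      by (rule integral_cong_AE, measurable) (use ct in eventually_elim, simp)
     then show ?thesis using True by simp
    next
     case False
     then have "C' (t, x) = 0" for x using z0(3)[of "(t, x)"] by (auto simp: Q_def)
     then show ?thesis using False by simp
    qed
   qed
  qed
  finally show "- (LBINT t. indicator {0<..<T} t * ((LBINT x. cw t x <.> w x) * th' t)) + (LBINT t. (LBINT x. D.bw w (t, x)) * th t)
   = (LBINT x. cw 0 x <.> w x) * th 0" using e by simp
 qed
 define p1 where "p1 z = \<epsilon> * (norm (D' z))^2 + (trace (C' z))^2 * (norm (C' z))^2 + a * \<bar>trace (C' z)\<bar> * (norm (C' z))^2" for z
 define p2 where "p2 z = (trace (C' z))^2 + a * trace (C' z)" for z
 define p3 where "p3 z = (G' z ** C' z + C' z ** transpose (G' z)) <.> C' z" for z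
 have FC: "F z <.> C' z - \<epsilon> * (norm (D' z))^2 = p3 z + p2 z - p1 z" for z
 proof (cases "z \<in> Q")
  case True then show ?thesis by (simp add: F_def stress_inner p1_def p2_def p3_def)
 next
  case False then show ?thesis using z0 by (simp add: F_def p1_def p2_def p3_def trace_def)
 qed
 have iN: "IL (%z. indicator Q z + norm (C' z) powr 4)"
 proof (rule LB_iadd)
  show "IL (indicator Q :: real \<times> vec3 => real)" using Qb by (simp add: integrable_real_indicator)
  show "IL (%z. norm (C' z) powr 4)" using fin(4) by (simp add: integrable_iff_bounded)
 qed
 have bnd: "IL h" if "h \<in> BM" "!!z. z \<in> Q ==> \<bar>h z\<bar> <= K * (1 + norm (C' z) powr 4)" "!!z. z \<notin> Q ==> h z = 0"
  for h :: "real \<times> vec3 => real" and K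
 proof (rule LB_bound[where f="%z. K * (indicator Q z + norm (C' z) powr 4)"])
  show "AL z. norm (h z) <= norm (K * (indicator Q z + norm (C' z) powr 4))"
  proof (intro always_eventually allI)
   fix z show "norm (h z) <= norm (K * (indicator Q z + norm (C' z) powr 4))"
    using that(2)[of z] that(3)[of z] by (cases "z \<in> Q") auto
  qed
 qed (use iN that(1) in auto)
 have pw: "n ^ k <= 1 + n powr 4" if "n >= 0" "k <= 4" for n :: real and k :: nat
 proof (cases "n <= 1")
  case True
  have "n ^ k <= 1" by (rule power_le_one[OF that(1) True])
  then show ?thesis using powr_ge_zero[of n 4] by linarith
 next
  case False
  then have "n ^ k <= n ^ 4" using that by (intro power_increasing) auto
  then show ?thesis using that by simp
 qed
 have tb: "(trace (C' z))^2 <= 9 * (norm (C' z))^2" for z using power_mono[OF abs_trace_le[of "C' z"], of 2] by (simp add: power_mult_distrib)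
 have j2: "IL p2"
 proof (rule bnd[where K="9 + 3 * a"])
  show "p2 \<in> BM" unfolding p2_def[abs_def] by measurable
  show "\<bar>p2 z\<bar> <= (9 + 3 * a) * (1 + norm (C' z) powr 4)" for z
  proof -
   have "\<bar>p2 z\<bar> <= (trace (C' z))^2 + a * \<bar>trace (C' z)\<bar>" unfolding p2_def using a by (intro order_trans[OF abs_triangle_ineq]) (simp add: abs_mult)
   also have "\<dots> <= 9 * (norm (C' z))^2 + a * (3 * norm (C' z) ^ 1)" using tb abs_trace_le a by (intro add_mono mult_left_mono) auto
   also have "\<dots> <= 9 * (1 + norm (C' z) powr 4) + a * (3 * (1 + norm (C' z) powr 4))" using a by (intro add_mono mult_left_mono pw) auto
   finally show ?thesis by (simp add: algebra_simps)
  qed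
  show "p2 z = 0" if "z \<notin> Q" for z using z0(3)[OF that] by (simp add: p2_def trace_def)
 qed
 have j1: "IL p1"
 proof -
  have "IL (%z. (trace (C' z))^2 * (norm (C' z))^2 + a * \<bar>trace (C' z)\<bar> * (norm (C' z))^2)"
  proof (rule bnd[where K="9 + 3 * a"])
   show "\<bar>(trace (C' z))^2 * (norm (C' z))^2 + a * \<bar>trace (C' z)\<bar> * (norm (C' z))^2\<bar> <= (9 + 3 * a) * (1 + norm (C' z) powr 4)" for z
   proof -
    have "(trace (C' z))^2 * (norm (C' z))^2 + a * \<bar>trace (C' z)\<bar> * (norm (C' z))^2 <= 9 * (norm (C' z))^2 * (norm (C' z))^2 + a * (3 * norm (C' z)) * (norm (C' z))^2"
     using tb abs_trace_le a by (intro add_mono mult_right_mono mult_left_mono) auto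
    also have "\<dots> = 9 * norm (C' z) ^ 4 + 3 * a * norm (C' z) ^ 3" by (simp add: power2_eq_square power3_eq_cube power4_eq_xxxx)
    also have "\<dots> <= 9 * (1 + norm (C' z) powr 4) + 3 * a * (1 + norm (C' z) powr 4)" using a by (intro add_mono mult_left_mono pw) auto
    finally show ?thesis using a by (simp add: distrib_right)
   qed
   show "(trace (C' z))^2 * (norm (C' z))^2 + a * \<bar>trace (C' z)\<bar> * (norm (C' z))^2 = 0" if "z \<notin> Q" for z using z0(3)[OF that] by simp
  qed measurable
  from LB_iadd[OF integrable_mult_right[OF R.energy_identity(2), of \<epsilon>] this] show ?thesis
   unfolding p1_def[abs_def] add.assoc by simp
 qed
 \<comment> \<open>Integrability of the stretching term is read off from \<open>FC\<close>, in which
   all the other terms are already integrable.\<close>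
 have j3: "IL p3"
 proof -
  have "p3 = (%z. F z <.> C' z - \<epsilon> * (norm (D' z))^2 - p2 z + p1 z)" using FC by (auto simp: fun_eq_iff)
  then show ?thesis using R.energy_identity(1,2) j1 j2 by simp
 qed
 define J where "J \<tau> h = (LBINT z. (if z \<in> {0<..<\<tau>} \<times> \<Omega> then h z else 0))" for \<tau> and h :: "real \<times> vec3 => real"
 have Sb: "{0<..<\<tau>} \<times> \<Omega> \<in> sets borel" for \<tau> :: real using \<Omega> by (intro borel_open open_Times) auto
 have Ji: "IL (%z. if z \<in> {0<..<\<tau>} \<times> \<Omega> then h z else 0)" if h: "IL h" for \<tau> and h :: "real \<times> vec3 => real"
 proof -
  have "(%z. if z \<in> {0<..<\<tau>} \<times> \<Omega> then h z else 0) = (%z. indicator ({0<..<\<tau>} \<times> \<Omega>) z *R h z)" by (auto simp: indicator_def fun_eq_iff)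
  then show ?thesis using integrable_mult_indicator[OF _ h, of "{0<..<\<tau>} \<times> \<Omega>"] Sb[of \<tau>] by simp
 qed
 have Jc: "(LINT z:{0<..<\<tau>} \<times> \<Omega>|lebesgue. (case z of (t, x) => f t x)) = J \<tau> h"
  if h: "IL h" and "\<tau> <= T" and "AL z. z \<in> Q --> f (fst z) (snd z) = h z" for \<tau> f and h :: "real \<times> vec3 => real"
  unfolding J_def
 proof (rule set_lebesgue_integral_borel)
  show "(%z. if z \<in> {0<..<\<tau>} \<times> \<Omega> then h z else 0) \<in> BM" using Ji[OF h, of \<tau>] by auto
  show "AL z. z \<in> {0<..<\<tau>} \<times> \<Omega> --> (case z of (t, x) => f t x) = (if z \<in> {0<..<\<tau>} \<times> \<Omega> then h z else 0)"
   using that(3) by eventually_elim (use that(2) in \<open>auto simp: Q_def\<close>)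
 qed simp
 have c0: "(LINT x:\<Omega>|lebesgue. (1/2) * (norm (C0 x))^2) = 1/2 * (LBINT x. (norm (cw 0 x))^2)"
 proof -
  have [measurable]: "cw 0 \<in> BM" using mcw T by simp
  have "(LINT x:\<Omega>|lebesgue. (1/2) * (norm (C0 x))^2) = (LBINT x. (1/2) * (norm (cw 0 x))^2)"
  proof (rule set_lebesgue_integral_borel)
   show "AL x. x \<in> \<Omega> --> 1 / 2 * (norm (C0 x))^2 = 1 / 2 * (norm (cw 0 x))^2"
    using AE_lebesgue_on_borel[OF \<Omega>(3) init] borel_versionD(3)[OF cw(1)[of 0]] T by (auto elim!: eventually_elim2)
  qed (auto simp: cw(2))
  then show ?thesis by simp
 qed
 show ?thesis
  using R.energy_identity(3) AE_lborel_singleton[of T]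
 proof eventually_elim
  case (elim \<tau>)
  show ?case
  proof
   assume "\<tau> \<in> {0<..T}"
   \<comment> \<open>The time T itself is discarded as a null set, because the energy identity
     concerns times strictly before T.\<close>
   then have \<tau>: "0 < \<tau>" "\<tau> < T" using elim(2) by auto
   have [measurable]: "cw \<tau> \<in> BM" using mcw \<tau> by simp
   have ct: "(LINT x:\<Omega>|lebesgue. (1/2) * (norm (C \<tau> x))^2) = 1/2 * (LBINT x. (norm (cw \<tau> x))^2)"
   proof -
    have "(LINT x:\<Omega>|lebesgue. (1/2) * (norm (C \<tau> x))^2) = (LBINT x. (1/2) * (norm (cw \<tau> x))^2)"
    proof (rule set_lebesgue_integral_borel)
     show "AL x. x \<in> \<Omega> --> 1 / 2 * (norm (C \<tau> x))^2 = 1 / 2 * (norm (cw \<tau> x))^2"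
      using borel_versionD(3)[OF cw(1)[of \<tau>]] \<tau> by (auto elim!: eventually_mono)
    qed (auto simp: cw(2))
    then show ?thesis by simp
   qed
   have "(LBINT z. (if 0 <= fst z & fst z <= \<tau> then F z <.> C' z - \<epsilon> * (norm (D' z))^2 else 0)) = J \<tau> (%z. p3 z + p2 z - p1 z)"
    unfolding J_def FC
   proof (rule integral_cong_AE)
    \<comment> \<open>The closed interval [0, \<tau>] of the identity and the open one of the claim
      differ by the slice at \<tau>, a null set, and by the slice at 0, where all fields
      vanish.\<close>
    show "AL z. (if 0 <= fst z & fst z <= \<tau> then p3 z + p2 z - p1 z else 0) = (if z \<in> {0<..<\<tau>} \<times> \<Omega> then p3 z + p2 z - p1 z else 0)"
     using AE_fst_neq[of \<tau>]
    proof eventually_elim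
     case (elim z)
     show ?case
     proof (cases "z \<in> Q")
      case True then show ?thesis using elim \<tau> by (auto simp: Q_def)
     next
      case False
      have "p3 z + p2 z - p1 z = 0" using z0[OF False] unfolding FC[symmetric] by simp
      then show ?thesis by simp
     qed
    qed
    have [measurable]: "p1 \<in> BM2" "p2 \<in> BM2" "p3 \<in> BM2"
     using j1 j2 j3 by (auto simp: borel_prod)
    have "(%z. if 0 <= fst z & fst z <= \<tau> then p3 z + p2 z - p1 z else 0) \<in> BM2" by measurable
    then show "(%z. if 0 <= fst z & fst z <= \<tau> then p3 z + p2 z - p1 z else 0) \<in> borel_measurable lborel" by (simp add: borel_prod)
    show "(%z. if z \<in> {0<..<\<tau>} \<times> \<Omega> then p3 z + p2 z - p1 z else 0) \<in> borel_measurable lborel"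
     using Ji[of "%z. p3 z + p2 z - p1 z" \<tau>] j1 j2 j3 by auto
   qed
   also have "\<dots> = (LBINT z. (if z \<in> {0<..<\<tau>} \<times> \<Omega> then p3 z else 0) + (if z \<in> {0<..<\<tau>} \<times> \<Omega> then p2 z else 0) - (if z \<in> {0<..<\<tau>} \<times> \<Omega> then p1 z else 0))"
    unfolding J_def by (rule LB_cong) auto
   also have "\<dots> = J \<tau> p3 + J \<tau> p2 - J \<tau> p1"
    unfolding J_def using Ji[OF j1, of \<tau>] Ji[OF j2, of \<tau>] Ji[OF j3, of \<tau>] by simp
   finally have E: "(LBINT x. (norm (cw \<tau> x))^2) = (LBINT x. (norm (cw 0 x))^2) + 2 * (J \<tau> p3 + J \<tau> p2 - J \<tau> p1)"
    using elim(1) \<tau> by simp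
   have 1: "(LINT z:{0<..<\<tau>} \<times> \<Omega>|lebesgue. (case z of (t,x) => \<epsilon> * (norm (GC t x))^2 + (trace (C t x))^2 * (norm (C t x))^2 + a * \<bar>trace (C t x)\<bar> * (norm (C t x))^2)) = J \<tau> p1"
    by (rule Jc[OF j1]) (use \<tau> in \<open>auto simp: p1_def intro!: eventually_mono[OF aeQ]\<close>)
   have 2: "(LINT z:{0<..<\<tau>} \<times> \<Omega>|lebesgue. (case z of (t,x) => (trace (C t x))^2 + a * trace (C t x))) = J \<tau> p2"
    by (rule Jc[OF j2]) (use \<tau> in \<open>auto simp: p2_def intro!: eventually_mono[OF aeQ]\<close>)
   have 3: "(LINT z:{0<..<\<tau>} \<times> \<Omega>|lebesgue. (case z of (t,x) => (Gu t x ** C t x + C t x ** transpose (Gu t x)) <.> C t x)) = J \<tau> p3"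
    by (rule Jc[OF j3]) (use \<tau> in \<open>auto simp: p3_def intro!: eventually_mono[OF aeQ]\<close>)
   show "(LINT x:\<Omega>|lebesgue. (1/2) * (norm (C \<tau> x))^2)
  + (LINT z:{0<..<\<tau>} \<times> \<Omega>|lebesgue. (case z of (t,x) =>
    \<epsilon> * (norm (GC t x))^2 + (trace (C t x))^2 * (norm (C t x))^2
    + a * \<bar>trace (C t x)\<bar> * (norm (C t x))^2))
  = (LINT x:\<Omega>|lebesgue. (1/2) * (norm (C0 x))^2)
  + (LINT z:{0<..<\<tau>} \<times> \<Omega>|lebesgue. (case z of (t,x) =>
    (trace (C t x))^2 + a * trace (C t x)))
  + (LINT z:{0<..<\<tau>} \<times> \<Omega>|lebesgue. (case z of (t,x) =>
    (Gu t x ** C t x + C t x ** transpose (Gu t x)) <.> C t x))"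
    unfolding c0 ct 1 2 3 E by (simp add: field_simps)
  qed
 qed
qed

end
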